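(* Let $n\ge 1$ and let $Q(v)=\tfrac12 v^{\mathsf T}Av$ be a quadratic form on $\mathbb{R}^n$ of signature $(n-1,1)$, integer-valued on $\mathbb{Z}^n$, where $A$ is an even symmetric $n\times n$ matrix (integer entries, even diagonal), and let $B(u,v)=u^{\mathsf T}Av$. Let $f:\mathbb{R}^n\to\mathbb{C}$ be a homogeneous polynomial of degree $d$ and let $c_1,c_2\in\mathcal{C}_Q$. Then for all $\gamma=\begin{pmatrix}a&b\\ c&d'\end{pmatrix}\in\Gamma_0(N)$, \[\widetilde\Theta^{c_1,c_2}[f]\Bigl(\frac{a\tau+b}{c\tau+d'}\Bigr)=\chi(\gamma)\,(c\tau+d')^{n/2+d}\,\widetilde\Theta^{c_1,c_2}[f](\tau),\] i.e. $\widetilde\Theta^{c_1,c_2}[f]$ transforms as a modular form of weight $n/2+d$ and character $\chi$ on $\Gamma_0(N)$.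
   Context: Fix $c_0\in\mathbb{R}^n$ with $Q(c_0)<0$ and set $\mathcal{C}_Q=\{c\in\mathbb{R}^n: Q(c)=-1,\ B(c,c_0)<0\}$. Let $E(z)=2\int_0^z e^{-\pi u^2}\,du$ and $E^{(k)}$ its $k$-th derivative. Let $\Delta=\bigl(\frac{\partial}{\partial v}\bigr)^{\mathsf T}A^{-1}\frac{\partial}{\partial v}$, $e^{-\Delta/8\pi}=\sum_{k\ge0}\frac{(-1)^k}{(8\pi)^k k!}\Delta^k$ (a finite sum on polynomials), $\partial_c=\sum_i c_i\frac{\partial}{\partial v_i}$, $\widehat f=e^{-\Delta/8\pi}f$, and \[p^c[f](v)=\sum_{k=0}^d\frac{(-1)^k}{(4\pi)^k k!}E^{(k)}(B(c,v))\,\partial_c^k\widehat f(v).\] For $\tau$ in the upper half-plane, $y=\operatorname{Im}\tau$, $q=e^{2\pi i\tau}$, \[\widetilde\Theta^{c_1,c_2}[f](\tau)=y^{-d/2}\sum_{\ell\in\mathbb{Z}^n}\bigl\{p^{c_1}[f](\ell y^{1/2})-p^{c_2}[f](\ell y^{1/2})\bigr\}q^{Q(\ell)}.\] $N$ is the level of $A$: the smallest $N\in\mathbb{N}$ with $NA^{-1}$ even. For $\gamma=\begin{pmatrix}a&b\\ c&d'\end{pmatrix}\in\Gamma_0(N)$, $\chi(\gamma)=\bigl(\frac{D}{d'}\bigr)v(\gamma)$ (Kronecker symbol), where for $n$ even $D=(-1)^{n/2}\det A$, $v(\gamma)=1$, and for $n$ odd $D=2\det A$, $v(\gamma)=\bigl(\frac{c}{d'}\bigr)\bigl(\frac{-4}{d'}\bigr)^{-n/2}$.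 Powers $(c\tau+d')^{n/2+d}$ use the principal branch. *)

theory Defs
  imports "HOL-Analysis.Analysis" "HOL-Number_Theory.Residues"
begin

section \<open>Quadratic forms\<close>

abbreviation rmat :: "int^'n^'m \<Rightarrow> real^'n^'m" where
  "rmat \<equiv> map_matrix real_of_int"

definition rvec :: "int^'n \<Rightarrow> real^'n" where
  "rvec l = (\<chi> i. real_of_int (l $ i))"

definition even_symmetric :: "int^'n^'n \<Rightarrow> bool" where
  "even_symmetric A \<longleftrightarrow> transpose A = A \<and> (\<forall>i. even (A $ i $ i))"

definition bil :: "int^'n^'n \<Rightarrow> real^'n \<Rightarrow> real^'n \<Rightarrow> real" where
  "bil A u v = u \<bullet> (rmat A *v v)"

definition qf :: "int^'n^'n \<Rightarrow> real^'n \<Rightarrow> real" where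
  "qf A v = (1/2) * (v \<bullet> (rmat A *v v))"

text \<open>The signature counts the positive and the negative coefficients of the form in a
  diagonalising basis (the columns of \<open>P\<close>); the counts do not depend on the basis.\<close>

definition has_signature :: "real^'n^'n \<Rightarrow> nat \<Rightarrow> nat \<Rightarrow> bool" where
  "has_signature M r s \<longleftrightarrow>
     (\<exists>(P :: real^'n^'n) (e :: 'n \<Rightarrow> real). invertible P \<and>
        transpose P ** M ** P = (\<chi> i j. if i = j then e i else 0) \<and>
        card {i. e i > 0} = r \<and> card {i. e i < 0} = s)"

lemma qf_rvec_Ints:
  fixes A :: "int^'n^'n" and l :: "int^'n"
  assumes "even_symmetric A"
  shows "qf A (rvec l) \<in> \<int>"
proof -
  define g where "g i j = l$i * (A$i$j * l$j)" for i j
  have sym: "g i j = g j i" for i j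
    using assms unfolding even_symmetric_def g_def transpose_def
    by (metis mult.left_commute mult.commute vec_lambda_beta)
  have ev: "even (g i i)" for i using assms by (simp add: even_symmetric_def g_def)
  have "finite S \<Longrightarrow> even (\<Sum>i\<in>S. \<Sum>j\<in>S. g i j)" for S
  proof (induction S rule: finite_induct)
    case (insert x S)
    have "(\<Sum>i\<in>S. g i x) = (\<Sum>i\<in>S. g x i)" using sym by simp
    then have "(\<Sum>i\<in>insert x S. \<Sum>j\<in>insert x S. g i j) =
       g x x + 2 * (\<Sum>i\<in>S. g x i) + (\<Sum>i\<in>S. \<Sum>j\<in>S. g i j)"
      using insert by (simp add: sum.distrib)
    then show ?case using insert ev by simp
  qed simp
  then obtain k where k: "(\<Sum>i\<in>UNIV. \<Sum>j\<in>UNIV. g i j) = 2 * k" by (auto elim: evenE)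
  have "qf A (rvec l) = (1/2) * real_of_int (\<Sum>i\<in>UNIV. \<Sum>j\<in>UNIV. g i j)"
    by (simp add: qf_def rvec_def inner_vec_def matrix_vector_mult_def g_def sum_distrib_left)
  then show ?thesis unfolding k by simp
qed

definition cone_sheet :: "int^'n^'n \<Rightarrow> real^'n \<Rightarrow> (real^'n) set" where
  "cone_sheet A c0 = {c. qf A c = -1 \<and> bil A c c0 < 0}"

section \<open>Polynomials and differential operators\<close>

definition homogeneous_polynomial :: "nat \<Rightarrow> (real^'n \<Rightarrow> complex) \<Rightarrow> bool" where
  "homogeneous_polynomial d f \<longleftrightarrow>
     (\<exists>a :: ('n \<Rightarrow> nat) \<Rightarrow> complex. \<forall>v.
        f v = (\<Sum>\<alpha> | (\<Sum>i\<in>UNIV. \<alpha> i) = d. a \<alpha> * (\<Prod>i\<in>UNIV. complex_of_real (v $ i) ^ \<alpha> i)))"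

definition pderiv_at :: "'n \<Rightarrow> (real^'n \<Rightarrow> complex) \<Rightarrow> real^'n \<Rightarrow> complex" where
  "pderiv_at i f v = vector_derivative (\<lambda>t. f (v + t *\<^sub>R axis i 1)) (at 0)"

definition dir_deriv :: "real^'n \<Rightarrow> (real^'n \<Rightarrow> complex) \<Rightarrow> real^'n \<Rightarrow> complex" where
  "dir_deriv c f v = (\<Sum>i\<in>UNIV. complex_of_real (c $ i) * pderiv_at i f v)"

definition laplace :: "int^'n^'n \<Rightarrow> (real^'n \<Rightarrow> complex) \<Rightarrow> real^'n \<Rightarrow> complex" where
  "laplace A f v = (\<Sum>i\<in>UNIV. \<Sum>j\<in>UNIV.
     complex_of_real (matrix_inv (rmat A) $ i $ j) * pderiv_at i (pderiv_at j f) v)"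

text \<open>On polynomials all but finitely many terms of this series vanish.\<close>

definition heat :: "int^'n^'n \<Rightarrow> (real^'n \<Rightarrow> complex) \<Rightarrow> real^'n \<Rightarrow> complex" where
  "heat A f v = (\<Sum>k. complex_of_real ((-1) ^ k / ((8 * pi) ^ k * fact k)) * (laplace A ^^ k) f v)"

section \<open>The theta function\<close>

text \<open>The interval integral is oriented, so \<open>err\<close> is odd.\<close>

definition err :: "real \<Rightarrow> real" where
  "err z = 2 * (LBINT u=0..ereal z. exp (- pi * u\<^sup>2))"

definition p_fun :: "int^'n^'n \<Rightarrow> nat \<Rightarrow> real^'n \<Rightarrow> (real^'n \<Rightarrow> complex) \<Rightarrow> real^'n \<Rightarrow> complex" where
  "p_fun A d c f v = (\<Sum>k=0..d.
     complex_of_real ((-1) ^ k / ((4 * pi) ^ k * fact k) * (deriv ^^ k) err (bil A c v)) *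
     (dir_deriv c ^^ k) (heat A f) v)"

definition theta ::
  "int^'n^'n \<Rightarrow> nat \<Rightarrow> real^'n \<Rightarrow> real^'n \<Rightarrow> (real^'n \<Rightarrow> complex) \<Rightarrow> complex \<Rightarrow> complex" where
  "theta A d c1 c2 f \<tau> =
     complex_of_real (Im \<tau> powr (- (real d / 2))) *
     (\<Sum>\<^sub>\<infinity>l\<in>UNIV.
        (p_fun A d c1 f (sqrt (Im \<tau>) *\<^sub>R rvec l) - p_fun A d c2 f (sqrt (Im \<tau>) *\<^sub>R rvec l)) *
        exp (2 * complex_of_real pi * \<i> * \<tau> * complex_of_real (qf A (rvec l))))"

section \<open>Level, congruence subgroup and character\<close>

definition level :: "int^'n^'n \<Rightarrow> nat" where
  "level A = (LEAST N. N > 0 \<and>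
     (\<exists>M. even_symmetric M \<and> real N *\<^sub>R matrix_inv (rmat A) = rmat M))"

definition Gamma0 :: "nat \<Rightarrow> (int^2^2) set" where
  "Gamma0 N = {\<gamma>. det \<gamma> = 1 \<and> int N dvd \<gamma> $ 2 $ 1}"

definition aut_factor :: "int^2^2 \<Rightarrow> complex \<Rightarrow> complex" where
  "aut_factor \<gamma> \<tau> = of_int (\<gamma> $ 2 $ 1) * \<tau> + of_int (\<gamma> $ 2 $ 2)"

definition moebius_act :: "int^2^2 \<Rightarrow> complex \<Rightarrow> complex" where
  "moebius_act \<gamma> \<tau> =
     (of_int (\<gamma> $ 1 $ 1) * \<tau> + of_int (\<gamma> $ 1 $ 2)) / aut_factor \<gamma> \<tau>"

text \<open>The Kronecker symbol extends the Legendre symbol multiplicatively in the lower argument,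
  with its own values at \<open>2\<close>, \<open>-1\<close> and \<open>0\<close>.\<close>

definition kronecker_prime :: "int \<Rightarrow> int \<Rightarrow> int" where
  "kronecker_prime a p =
     (if p = 2 then (if even a then 0 else if a mod 8 = 1 \<or> a mod 8 = 7 then 1 else -1)
      else Legendre a p)"

definition kronecker :: "int \<Rightarrow> int \<Rightarrow> int" where
  "kronecker a m =
     (if m = 0 then (if \<bar>a\<bar> = 1 then 1 else 0)
      else (if m < 0 \<and> a < 0 then -1 else 1) *
           (\<Prod>p\<in>prime_factors m. kronecker_prime a p ^ multiplicity p m))"

definition chi_D :: "int^'n^'n \<Rightarrow> int" where
  "chi_D A = (if even CARD('n) then (-1) ^ (CARD('n) div 2) * det A else 2 * det A)"

text \<open>In odd dimension the power of \<open>(-4/d)\<close> is taken on the principal branch, so that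
  \<open>(-1)\<close> raised to \<open>1/2\<close> is \<open>\<i>\<close>.\<close>

definition chi_v :: "int^'n^'n \<Rightarrow> int^2^2 \<Rightarrow> complex" where
  "chi_v A \<gamma> =
     (if even CARD('n) then 1
      else of_int (kronecker (\<gamma> $ 2 $ 1) (\<gamma> $ 2 $ 2)) *
           complex_of_int (kronecker (-4) (\<gamma> $ 2 $ 2)) powr (- (of_nat CARD('n) / 2)))"

definition chi :: "int^'n^'n \<Rightarrow> int^2^2 \<Rightarrow> complex" where
  "chi A \<gamma> = of_int (kronecker (chi_D A) (\<gamma> $ 2 $ 2)) * chi_v A \<gamma>"

end

theory Submission
  imports Defs "HOL-Probability.Probability" "HOL-Complex_Analysis.Complex_Analysis"
    "HOL-Number_Theory.Number_Theory" "HOL-Real_Asymp.Real_Asymp"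
begin

text \<open>Write \<open>f\<close> as a sum of powers \<open>(w \<bullet> v) ^ d\<close> of linear forms. For one such power, \<open>p\<^sup>c[f](v)\<close> is
  the \<open>d\<close>-th derivative at \<open>s = 0\<close> of \<open>E(B(c,v) - s (w \<bullet> c)/4\<pi>) exp(s (w \<bullet> v) - s\<^sup>2 W/8\<pi>)\<close> with
  \<open>W = w \<bullet> A\<^sup>-\<^sup>1 w\<close>. Join \<open>c\<^sub>1\<close> to \<open>c\<^sub>2\<close> by the hyperbolic geodesic \<open>c(t)\<close>. The derivative in \<open>t\<close> of
  this generating function is Gaussian: up to a constant it is the derivative at \<open>r = 0\<close> of a term of
  a Siegel theta series for the majorant of \<open>Q\<close> determined by \<open>c(t)\<close>, with elliptic variable linear
  in \<open>(s, r)\<close>. The modularity of such theta series on \<open>\<Gamma>\<^sub>0(N)\<close> follows from Poisson summation over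
  the residue classes modulo the lower row of \<open>\<gamma>\<close> and the evaluation of the resulting quadratic Gauss
  sums as \<open>\<chi>(\<gamma>)\<close>. It scales \<open>(s, r)\<close> by \<open>c\<tau> + d\<close>, so the \<open>d\<close>-th derivative in \<open>s\<close> contributes the
  factor \<open>(c\<tau> + d)\<^sup>d\<close>; integration over \<open>t\<close> recovers \<open>p\<^bsup>c\<^sub>1\<^esup> - p\<^bsup>c\<^sub>2\<^esup>\<close>.\<close>

text \<open>For a single c the series over l is not summable, as |q^Q(l)| grows on the cone Q < 0;
  only the difference of the two converges. Differentiating along the geodesic replaces the error
  function by a Gaussian governed by the majorant Q + B(c,.)^2/2, whose decay is uniform on compact
  parts of the geodesic; this justifies exchanging the lattice sum with the t-integral and with the
  derivatives in s and r. The weight adds up as follows, with j = c tau + d. A theta series of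
  signature (n-1,1) carries j^((n-1)/2) times the conjugate of j^(1/2), that is j^(n/2) |j|/j. The
  r-derivative contributes j and the factor sqrt(Im tau) of the t-derivative contributes 1/|j|, so
  j^(n/2) is left. The elliptic variable is arranged to vanish in the negative direction, so it is
  scaled by j and never by its conjugate. The term s^2 W/8 pi encodes the heat operator; together
  with the square produced by the error function it absorbs the exponential factor of the theta law.
  The sign of the scalar Gauss sums, and quadratic reciprocity with it, is drawn from the
  one-dimensional theta series.\<close>

unbundle no fps_syntax

section \<open>Gaussian integrals with complex parameters\<close>

lemma holomorphic_on_parametric_integral:
  fixes f :: "complex \<Rightarrow> 'a \<Rightarrow> complex"
  assumes S: "open S"
    and hol: "\<And>y. (\<lambda>z. f z y) holomorphic_on S"
    and meas: "\<And>z. z \<in> S \<Longrightarrow> f z \<in> borel_measurable M"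
    and dom: "\<And>z. z \<in> S \<Longrightarrow> \<exists>r>0. \<exists>g. cball z r \<subseteq> S \<and> integrable M g \<and>
                (\<forall>w\<in>cball z r. \<forall>y. norm (f w y) \<le> g y)"
  shows "(\<lambda>z. \<integral>y. f z y \<partial>M) holomorphic_on S"
proof -
  have "\<exists>D. ((\<lambda>z. \<integral>y. f z y \<partial>M) has_field_derivative D) (at z)" if z: "z \<in> S" for z
  proof -
    obtain r g where r: "r > 0" "cball z r \<subseteq> S" and g: "integrable M g"
      and bd: "\<And>w y. w \<in> cball z r \<Longrightarrow> norm (f w y) \<le> g y"
      using dom[OF z] by blast
    let ?d = "\<lambda>y. deriv (\<lambda>z. f z y) z"
    have intf: "integrable M (f w)" if "w \<in> cball z r" for w
      using that r by (intro Bochner_Integration.integrable_bound[OF g meas])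
        (auto intro!: AE_I2 order.trans[OF bd[OF that]])
    \<comment> \<open>The bound \<open>g\<close> on the disc of radius r becomes, by Cauchy's
      estimate on discs of radius r/2, a bound on the difference quotients; this is the dominating
      function for the limit.\<close>
    have quot: "norm ((f w y - f z y) / (w - z)) \<le> 2 * g y / r" if w: "w \<in> cball z (r/2)" "w \<noteq> z" for w y
    proof -
      have g0: "g y \<ge> 0" using bd[of z y] r by (meson centre_in_cball norm_ge_zero order.trans less_imp_le)
      have der: "norm (deriv (\<lambda>z. f z y) x) \<le> 2 * g y / r" if x: "x \<in> cball z (r/2)" for x
      proof -
        have sub: "cball x (r/2) \<subseteq> cball z r"
          using x by (subst cball_subset_cball_iff) (auto simp: dist_commute)
        have "norm ((deriv ^^ 1) (\<lambda>z. f z y) x) \<le> fact 1 * g y / (r/2)^1"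
        proof (rule Cauchy_inequality)
          show "(\<lambda>z. f z y) holomorphic_on ball x (r/2)"
            using hol sub r(2) by (meson ball_subset_cball holomorphic_on_subset order.trans)
          show "continuous_on (cball x (r/2)) (\<lambda>z. f z y)"
            using hol sub r(2) by (meson holomorphic_on_imp_continuous_on holomorphic_on_subset order.trans)
          show "norm (f v y) \<le> g y" if "norm (x - v) = r/2" for v
            using that sub by (intro bd) (auto simp: dist_norm)
        qed (use r in auto)
        then show ?thesis by (simp add: field_simps)
      qed
      have "norm (f w y - f z y) \<le> 2 * g y / r * norm (w - z)"
      proof (rule field_differentiable_bound[where S="cball z (r/2)" and f'="\<lambda>x. deriv (\<lambda>z. f z y) x"])
        fix x assume x: "x \<in> cball z (r/2)"
        then have "x \<in> S" using r by (auto simp: subset_iff)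
        then show "((\<lambda>z. f z y) has_field_derivative deriv (\<lambda>z. f z y) x) (at x within cball z (r/2))"
          using hol S by (metis holomorphic_derivI)
        show "norm (deriv (\<lambda>z. f z y) x) \<le> 2 * g y / r" by (rule der[OF x])
      qed (use w r in auto)
      then show ?thesis using w by (simp add: norm_divide field_simps)
    qed
    have lim: "((\<lambda>w. (f w y - f z y) / (w - z)) \<longlongrightarrow> ?d y) (at z)" for y
      using holomorphic_derivI[OF hol S z, of y] by (simp add: has_field_derivative_iff)
    have "((\<lambda>w. ((\<integral>y. f w y \<partial>M) - (\<integral>y. f z y \<partial>M)) / (w - z)) \<longlongrightarrow> (\<integral>y. ?d y \<partial>M)) (at z)"
      unfolding tendsto_at_iff_sequentially comp_def
    proof (intro allI impI)
      fix X :: "nat \<Rightarrow> complex"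
      assume X: "\<forall>i. X i \<in> UNIV - {z}" and Xl: "X \<longlonglongrightarrow> z"
      have "eventually (\<lambda>i. X i \<in> ball z (r/2)) sequentially"
        using Xl r by (intro topological_tendstoD[OF Xl]) auto
      then obtain N where N: "\<And>i. i \<ge> N \<Longrightarrow> X i \<in> cball z (r/2)"
        unfolding eventually_sequentially by (meson ball_subset_cball subsetD)
      have XS: "X (i + N) \<in> cball z r" "X (i+N) \<noteq> z" for i
        using N[of "i+N"] r X by auto
      have "(\<lambda>i. \<integral>y. (f (X (i + N)) y - f z y) / (X (i + N) - z) \<partial>M) \<longlonglongrightarrow> (\<integral>y. ?d y \<partial>M)"
      proof (rule integral_dominated_convergence)
        have lims: "(\<lambda>i. (f (X (i + N)) y - f z y) / (X (i + N) - z)) \<longlonglongrightarrow> ?d y" for y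
          using lim[of y] X Xl LIMSEQ_ignore_initial_segment[where k=N]
          unfolding tendsto_at_iff_sequentially comp_def by blast
        show ms: "(\<lambda>y. (f (X (i + N)) y - f z y) / (X (i + N) - z)) \<in> borel_measurable M" for i
          using XS(1)[of i] r by (intro borel_measurable_divide borel_measurable_diff meas) (auto simp: z subset_iff)
        show "?d \<in> borel_measurable M"
          using lims by (rule borel_measurable_LIMSEQ_metric[OF ms])
        show "integrable M (\<lambda>y. 2 * g y / r)" using g by auto
        show "AE x in M. (\<lambda>i. (f (X (i + N)) x - f z x) / (X (i + N) - z)) \<longlonglongrightarrow> deriv (\<lambda>z. f z x) z"
          using lims by auto
        show "AE x in M. norm ((f (X (i + N)) x - f z x) / (X (i + N) - z)) \<le> 2 * g x / r" for i
          using quot[OF N XS(2)] by auto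
      qed
      then have "(\<lambda>i. ((\<integral>y. f (X (i+N)) y \<partial>M) - (\<integral>y. f z y \<partial>M)) / (X (i+N) - z)) \<longlonglongrightarrow> (\<integral>y. ?d y \<partial>M)"
        using intf XS(1) r by simp
      then show "(\<lambda>i. ((\<integral>y. f (X i) y \<partial>M) - (\<integral>y. f z y \<partial>M)) / (X i - z)) \<longlonglongrightarrow> (\<integral>y. ?d y \<partial>M)"
        by (rule LIMSEQ_offset)
    qed
    then show ?thesis by (auto simp: has_field_derivative_iff)
  qed
  then show ?thesis using S by (simp add: holomorphic_on_open)
qed

text \<open>The characteristic function of the standard normal law after the substitution y -> c y
  with c^2 = 2 pi a, which turns the exponent of the density into - pi a y^2.\<close>

lemma gaussian_integral_real:
  fixes a b :: real
  assumes a: "a > 0"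
  shows "has_bochner_integral lborel (\<lambda>y. exp (- (pi * a * y\<^sup>2) + 2 * pi * \<i> * b * y) :: complex)
           (exp (- (pi * b\<^sup>2 / a)) / sqrt a)"
proof -
  define c where "c = sqrt (2 * pi * a)"
  define t where "t = 2 * pi * b / c"
  have c: "c > 0" "c\<^sup>2 = 2 * pi * a" using a by (auto simp: c_def)
  have 1: "has_bochner_integral lborel (\<lambda>x. std_normal_density x *\<^sub>R iexp (t * x)) (exp (- t\<^sup>2 / 2) :: complex)"
  proof -
    interpret real_distribution std_normal_distribution by (rule real_dist_normal_dist)
    have "integrable std_normal_distribution (\<lambda>x. iexp (t * x))"
      by (rule integrable_iexp) auto
    then have i: "integrable lborel (\<lambda>x. std_normal_density x *\<^sub>R iexp (t * x))"
      by (subst (asm) integrable_density) auto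
    have "(\<integral>x. iexp (t * x) \<partial>std_normal_distribution) = (exp (- t\<^sup>2 / 2) :: complex)"
      using fun_cong[OF char_std_normal_distribution, of t] by (simp add: char_def exp_of_real)
    then have "(\<integral>x. std_normal_density x *\<^sub>R iexp (t * x) \<partial>lborel) = (exp (- t\<^sup>2 / 2) :: complex)"
      by (subst (asm) integral_density) auto
    with i show ?thesis by (simp add: has_bochner_integral_iff)
  qed
  have "has_bochner_integral lborel (\<lambda>y. std_normal_density (0 + c * y) *\<^sub>R iexp (t * (0 + c * y)))
      ((exp (- t\<^sup>2 / 2) :: complex) /\<^sub>R \<bar>c\<bar>)"
    using 1 c by (subst lborel_has_bochner_integral_real_affine_iff[symmetric]) auto
  then have "has_bochner_integral lborel (\<lambda>y. complex_of_real (sqrt (2*pi)) * (std_normal_density (0 + c * y) *\<^sub>R iexp (t * (0 + c * y))))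
      (complex_of_real (sqrt (2*pi)) * ((exp (- t\<^sup>2 / 2) :: complex) /\<^sub>R \<bar>c\<bar>))"
    by (rule has_bochner_integral_mult_right)
  moreover have "complex_of_real (sqrt (2*pi)) * (std_normal_density (0 + c * y) *\<^sub>R iexp (t * (0 + c * y)))
     = exp (- (pi * a * y\<^sup>2) + 2 * pi * \<i> * b * y)" for y
  proof -
    have "complex_of_real (sqrt (2*pi)) * (std_normal_density (0 + c * y) *\<^sub>R iexp (t * (0 + c * y)))
       = complex_of_real (exp (- (pi * a * y\<^sup>2))) * iexp (2 * pi * b * y)"
      using c by (simp add: std_normal_density_def power_mult_distrib t_def scaleR_conv_of_real mult.assoc)
    also have "\<dots> = exp (- (pi * a * y\<^sup>2) + 2 * pi * \<i> * b * y)"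
      unfolding exp_of_real[symmetric] exp_add[symmetric] by (simp add: algebra_simps)
    finally show ?thesis .
  qed
  moreover have "complex_of_real (sqrt (2*pi)) * ((exp (- t\<^sup>2 / 2) :: complex) /\<^sub>R \<bar>c\<bar>) = exp (- (pi * b\<^sup>2 / a)) / sqrt a"
  proof -
    have e: "sqrt (2*pi) / c = 1 / sqrt a" using a by (simp add: c_def real_sqrt_mult)
    have e2: "t\<^sup>2 / 2 = pi * b\<^sup>2 / a" 
      unfolding t_def power_divide c(2) using a by (simp add: power_mult_distrib) (simp add: power2_eq_square)
    have "sqrt (2*pi) * (exp (- t\<^sup>2 / 2) / \<bar>c\<bar>) = sqrt (2*pi) / c * exp (-(t\<^sup>2 / 2))"
      using c(1) by simp
    also have "\<dots> = exp (-(pi * b\<^sup>2 / a)) / sqrt a" unfolding e e2 by simp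
    finally have "sqrt (2*pi) * (exp (- t\<^sup>2 / 2) / \<bar>c\<bar>) = exp (-(pi * b\<^sup>2 / a)) / sqrt a" .
    then have "complex_of_real (sqrt (2*pi) * (exp (- t\<^sup>2 / 2) / \<bar>c\<bar>)) = complex_of_real (exp (-(pi * b\<^sup>2 / a)) / sqrt a)"
      by (rule arg_cong)
    moreover have "(exp (- t\<^sup>2 / 2) :: complex) = complex_of_real (exp (- t\<^sup>2 / 2))"
      "(exp (- (pi * b\<^sup>2 / a)) :: complex) = complex_of_real (exp (- (pi * b\<^sup>2 / a)))"
      by (simp_all flip: exp_of_real)
    ultimately show ?thesis
      by (simp only: scaleR_conv_of_real divide_inverse of_real_mult of_real_inverse mult.commute)
  qed
  ultimately show ?thesis by simp
qed

text \<open>Half of the quadratic decay pays for the linear term, since the square of p |y| - 2 B is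
  non-negative.\<close>

lemma gaussian_dominated:
  fixes p B y :: real assumes "p > 0" 
  shows "exp (- (pi * p * y\<^sup>2) + 2 * pi * B * \<bar>y\<bar>) \<le> exp (2 * pi * B\<^sup>2 / p) * exp (- (pi * (p/2) * y\<^sup>2))"
proof -
  have "0 \<le> (p * \<bar>y\<bar> - 2 * B)\<^sup>2" by simp
  then have "2 * B * \<bar>y\<bar> \<le> p/2 * y\<^sup>2 + 2 * B\<^sup>2 / p"
    using assms by (simp add: power2_eq_square field_simps)
  then have "pi * (2 * B * \<bar>y\<bar>) \<le> pi * (p/2 * y\<^sup>2 + 2 * B\<^sup>2 / p)" by (intro mult_left_mono) auto
  then show ?thesis by (simp add: algebra_simps flip: exp_add)
qed

lemma integrable_real_gaussian:
  assumes "p > 0" shows "integrable lborel (\<lambda>y::real. exp (- (pi * p * y\<^sup>2)))"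
proof -
  have "integrable lborel (\<lambda>y::real. exp (- (pi * p * y\<^sup>2) + 2 * pi * \<i> * (0::real) * y) :: complex)"
    using gaussian_integral_real[OF assms, of 0] by (simp add: has_bochner_integral_iff)
  then have "integrable lborel (\<lambda>y::real. norm (exp (- (pi * p * y\<^sup>2) + 2 * pi * \<i> * (0::real) * y) :: complex))"
    by (rule integrable_norm)
  then show ?thesis by simp
qed

text \<open>Two parameters leave the real axis, so the identity theorem is applied twice: in a from
  the positive reals to the right half-plane with b real, and then in b from the real line to the
  plane. \<open>csqrt\<close> is holomorphic on Re a > 0 and hence the right branch
  throughout.\<close>

lemma gaussian_integral_complex:
  fixes a b :: complex
  assumes a: "Re a > 0"
  shows "has_bochner_integral lborel (\<lambda>y::real. exp (- (pi * a * y\<^sup>2) + 2 * pi * \<i> * b * y))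
           (exp (- (pi * b\<^sup>2 / a)) / csqrt a)"
proof -
  define f where "f a b y = exp (- (pi * a * y\<^sup>2) + 2 * pi * \<i> * b * y)" for a b :: complex and y :: real
  have nf: "norm (f a b y) = exp (- (pi * Re a * y\<^sup>2) - 2 * pi * Im b * y)" for a b y
    by (simp add: f_def flip: of_real_power)
  have dom: "norm (f w v y) \<le> exp (2 * pi * B\<^sup>2 / p) * exp (- (pi * (p/2) * y\<^sup>2))"
    if "Re w \<ge> p" "p > 0" "norm v \<le> B" for w v p B y
  proof -
    have "- (Im v * y) \<le> B * \<bar>y\<bar>"
      using mult_right_mono[OF order.trans[OF abs_Im_le_cmod[of v] that(3)] abs_ge_zero[of y]] abs_ge_minus_self[of "Im v * y"]
      by (simp add: abs_mult)
    then have "- (2 * pi * Im v * y) \<le> 2 * pi * B * \<bar>y\<bar>"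
      using mult_left_mono[of "- (Im v * y)" "B * \<bar>y\<bar>" "2*pi"] by (simp add: algebra_simps)
    moreover have "pi * p * y\<^sup>2 \<le> pi * Re w * y\<^sup>2" using that by (intro mult_right_mono mult_left_mono) auto
    ultimately have "norm (f w v y) \<le> exp (- (pi * p * y\<^sup>2) + 2 * pi * B * \<bar>y\<bar>)"
      unfolding nf exp_le_cancel_iff by linarith
    also note gaussian_dominated[OF that(2)]
    finally show ?thesis .
  qed
  have meas: "f w v \<in> borel_measurable lborel" for w v unfolding f_def by measurable
  have int: "integrable lborel (f w v)" if "Re w > 0" for w v

  proof (rule Bochner_Integration.integrable_bound[OF _ meas AE_I2])
    show "integrable lborel (\<lambda>y. exp (2 * pi * (norm v)\<^sup>2 / Re w) * exp (- (pi * (Re w/2) * y\<^sup>2)))"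
      using that by (intro integrable_mult_right integrable_real_gaussian) auto
    show "norm (f w v y) \<le> norm (exp (2 * pi * (norm v)\<^sup>2 / Re w) * exp (- (pi * (Re w/2) * y\<^sup>2)))" for y
      using dom[OF order.refl that order.refl, of v y] by simp
  qed
  have hol_a: "(\<lambda>w. \<integral>y. f w v y \<partial>lborel) holomorphic_on {w. Re w > 0}" for v
  proof (rule holomorphic_on_parametric_integral)
    fix z assume z: "z \<in> {w. Re w > 0}"
    let ?r = "Re z / 2"
    have re: "Re w \<ge> Re z / 2" if "w \<in> cball z ?r" for w
      using that abs_Re_le_cmod[of "z - w"] by (auto simp: dist_norm)
    show "\<exists>r>0. \<exists>g. cball z r \<subseteq> {w. Re w > 0} \<and> integrable lborel g \<and> (\<forall>w\<in>cball z r. \<forall>y. norm (f w v y) \<le> g y)"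
      using z re by (intro exI[of _ ?r] conjI exI[of _ "\<lambda>y. exp (2 * pi * (norm v)\<^sup>2 / ?r) * exp (- (pi * (?r/2) * y\<^sup>2))"]
         integrable_mult_right integrable_real_gaussian ballI allI dom)
        (auto, fastforce)
  qed (auto simp: f_def intro!: holomorphic_intros open_halfspace_Re_gt)
  have hol_b: "(\<lambda>v. \<integral>y. f w v y \<partial>lborel) holomorphic_on UNIV" if w: "Re w > 0" for w
  proof (rule holomorphic_on_parametric_integral)
    fix z :: complex
    have nb: "norm v \<le> norm z + 1" if "v \<in> cball z 1" for v
      using that norm_triangle_ineq2[of v z] by (auto simp: dist_norm norm_minus_commute)
    show "\<exists>r>0. \<exists>g. cball z r \<subseteq> UNIV \<and> integrable lborel g \<and> (\<forall>v\<in>cball z r. \<forall>y. norm (f w v y) \<le> g y)"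
      using w nb by (intro exI[of _ 1] conjI exI[of _ "\<lambda>y. exp (2 * pi * (norm z + 1)\<^sup>2 / Re w) * exp (- (pi * (Re w/2) * y\<^sup>2))"]
         integrable_mult_right integrable_real_gaussian ballI allI dom) auto
  qed (auto simp: f_def intro!: holomorphic_intros)
  have real: "(\<integral>y. f (of_real p) (of_real q) y \<partial>lborel) = exp (- (complex_of_real pi * (complex_of_real q)\<^sup>2 / complex_of_real p)) / csqrt (complex_of_real p)"
    if "p > 0" for p q :: real
    using gaussian_integral_real[OF that, of q] that unfolding f_def by (simp add: has_bochner_integral_iff flip: exp_of_real)
  have lim: "(1::complex) islimpt of_real ` {0<..}"
  proof -
    have "(1::complex) islimpt complex_of_real ` {0<..}"
      unfolding islimpt_approachable
    proof (intro allI impI)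
      fix e :: real assume "e > 0"
      then show "\<exists>x'\<in>complex_of_real ` {0<..}. x' \<noteq> 1 \<and> dist x' 1 < e"
        by (intro bexI[of _ "complex_of_real (1 + e/2)"]) (auto simp: dist_norm norm_divide intro!: image_eqI[of _ _ "1 + e/2"])
    qed
    then show ?thesis by simp
  qed
  have step1: "(\<integral>y. f w (of_real q) y \<partial>lborel) = exp (- (pi * (of_real q)\<^sup>2 / w)) / csqrt w" if w: "Re w > 0" for w :: complex and q :: real
  proof -
    have "(\<integral>y. f w (of_real q) y \<partial>lborel) - exp (- (pi * (of_real q)\<^sup>2 / w)) / csqrt w = 0"
    proof (rule analytic_continuation[where f="\<lambda>w. (\<integral>y. f w (of_real q) y \<partial>lborel) - exp (- (pi * (of_real q)\<^sup>2 / w)) / csqrt w"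
          and S="{w. Re w > 0}" and U="of_real ` {0<..}" and \<xi>=1])
      show "(\<lambda>w. (\<integral>y. f w (of_real q) y \<partial>lborel) - exp (- (pi * (of_real q)\<^sup>2 / w)) / csqrt w) holomorphic_on {w. Re w > 0}"
        by (intro holomorphic_intros hol_a) (auto simp: complex_nonpos_Reals_iff)
      show "connected {w. Re w > 0}" by (simp add: convex_halfspace_Re_gt convex_connected)
    qed (use w lim real in \<open>auto simp: open_halfspace_Re_gt\<close>)
    then show ?thesis by simp
  qed
  have lim2: "(1::complex) islimpt range of_real"
    by (rule islimpt_subset[OF lim]) auto
  have "(\<integral>y. f a b y \<partial>lborel) - exp (- (pi * b\<^sup>2 / a)) / csqrt a = 0"
    by (rule analytic_continuation[where f="\<lambda>b. (\<integral>y. f a b y \<partial>lborel) - exp (- (pi * b\<^sup>2 / a)) / csqrt a" and S=UNIV and U="range of_real" and \<xi>=1])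
      (use a step1 lim2 in \<open>auto intro!: holomorphic_intros hol_b\<close>)
  then show ?thesis using int[OF a, of b] unfolding has_bochner_integral_iff f_def[symmetric] by simp
qed

section \<open>Sums over vectors\<close>

lemma vec_set_eq_image_PiE: "{x::'a^'n. \<forall>i. x $ i \<in> B i} = vec_lambda ` (PiE UNIV B)"
proof (intro equalityI subsetI)
  fix x :: "'a^'n" assume "x \<in> {x. \<forall>i. x $ i \<in> B i}"
  then show "x \<in> vec_lambda ` (PiE UNIV B)" by (intro image_eqI[of _ _ "vec_nth x"]) auto
qed auto

lemma inj_vec_lambda: "inj_on vec_lambda X"
  by (metis inj_onI vec_lambda_inject UNIV_I)

lemma finite_vec_set:
  assumes "\<And>i. finite (B i)" shows "finite {x::'a^'n. \<forall>i. x $ i \<in> B i}"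
  unfolding vec_set_eq_image_PiE using assms by (intro finite_imageI finite_PiE) auto

lemma card_vec_set:
  assumes "\<And>i. finite (B i)" shows "card {x::'a^'n. \<forall>i. x $ i \<in> B i} = (\<Prod>i\<in>UNIV. card (B i))"
  unfolding vec_set_eq_image_PiE using assms by (simp add: card_image inj_vec_lambda card_PiE)

lemma sum_vec_prod:
  fixes g :: "'n::finite \<Rightarrow> 'a \<Rightarrow> 'c::comm_semiring_1"
  assumes "\<And>i. finite (B i)"
  shows "(\<Sum>x\<in>{x::'a^'n. \<forall>i. x $ i \<in> B i}. \<Prod>i\<in>UNIV. g i (x $ i)) = (\<Prod>i\<in>UNIV. \<Sum>y\<in>B i. g i y)"
  unfolding vec_set_eq_image_PiE
  by (subst sum.reindex[OF inj_vec_lambda]) (simp add: prod_sum_PiE assms)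

text \<open>Two geometric series, one per sign; both count k = 0, which only weakens the
  bound.\<close>

lemma sum_exp_neg_abs_int_le:
  "(\<Sum>k\<in>{-int m..int m}. exp (- \<bar>real_of_int k\<bar>)) \<le> 2 / (1 - exp (-1::real))"
proof -
  have geo: "(\<Sum>k\<le>m. exp (-1::real) ^ k) \<le> 1 / (1 - exp (-1))"
    by (subst sum_gp0) (auto simp: divide_simps)
  have e: "exp (-1::real) ^ k = exp (- real k)" for k by (simp add: exp_of_nat_mult[symmetric])
  have "(\<Sum>k\<in>{-int m..int m}. exp (- \<bar>real_of_int k\<bar>)) \<le> (\<Sum>k\<in>int ` {..m} \<union> (\<lambda>j. - int j) ` {..m}. exp (- \<bar>real_of_int k\<bar>))"
  proof (intro sum_mono2)
    show "{-int m..int m} \<subseteq> int ` {..m} \<union> (\<lambda>j. - int j) ` {..m}"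
    proof
      fix k assume "k \<in> {-int m..int m}"
      then have "k = int (nat k) \<and> nat k \<in> {..m} \<or> k = - int (nat (-k)) \<and> nat (-k) \<in> {..m}" by auto
      then show "k \<in> int ` {..m} \<union> (\<lambda>j. - int j) ` {..m}" by blast
    qed
  qed auto
  also have "\<dots> \<le> (\<Sum>k\<in>int ` {..m}. exp (- \<bar>real_of_int k\<bar>)) + (\<Sum>k\<in>(\<lambda>j. - int j) ` {..m}. exp (- \<bar>real_of_int k\<bar>))"
    by (subst sum.union_inter[symmetric]) (auto intro: sum_nonneg)
  also have "\<dots> = (\<Sum>k\<le>m. exp (-1::real) ^ k) + (\<Sum>k\<le>m. exp (-1::real) ^ k)"
    by (subst (1 2) sum.reindex) (auto simp: inj_on_def e)
  finally show ?thesis using geo by simp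
qed

lemma int_vec_in_box:
  fixes F :: "(int^'n) set" assumes "finite F"
  obtains m where "F \<subseteq> {x. \<forall>i. x $ i \<in> {-int m..int m}}"
proof
  let ?m = "nat (\<Sum>x\<in>F. \<Sum>i\<in>UNIV. \<bar>x $ i\<bar>)"
  show "F \<subseteq> {x. \<forall>i. x $ i \<in> {-int ?m..int ?m}}"
  proof clarify
    fix x i assume x: "x \<in> F"
    have "\<bar>x $ i\<bar> \<le> (\<Sum>i\<in>UNIV. \<bar>x $ i\<bar>)" by (rule member_le_sum) auto
    also have "\<dots> \<le> (\<Sum>x\<in>F. \<Sum>i\<in>UNIV. \<bar>x $ i\<bar>)" by (rule member_le_sum[OF x]) (auto simp: assms intro: sum_nonneg)
    finally have "\<bar>x $ i\<bar> \<le> int ?m" by linarith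
    then show "x $ i \<in> {-int ?m..int ?m}" by auto
  qed
qed

text \<open>A finite set of integer vectors lies in a box, and over a box the sum factors into n
  one-dimensional sums.\<close>

lemma summable_on_exp_neg_l1:
  "(\<lambda>x::int^'n. \<Prod>i\<in>UNIV. exp (- \<bar>real_of_int (x $ i)\<bar>)) summable_on UNIV"
proof (rule nonneg_bounded_partial_sums_imp_summable_on)
  show "\<forall>\<^sub>F X in finite_subsets_at_top UNIV. (\<Sum>x\<in>X. \<Prod>i\<in>(UNIV::'n set). exp (- \<bar>real_of_int (x $ i)\<bar>)) \<le> (2 / (1 - exp (-1::real))) ^ CARD('n)"
  proof (rule eventually_finite_subsets_at_top_weakI)
    fix X :: "(int^'n) set" assume X: "finite X"
    obtain m where m: "X \<subseteq> {x. \<forall>i. x $ i \<in> {-int m..int m}}" using int_vec_in_box[OF X] by blast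
    have "(\<Sum>x\<in>X. \<Prod>i\<in>UNIV. exp (- \<bar>real_of_int (x $ i)\<bar>)) \<le>
       (\<Sum>x\<in>{x::int^'n. \<forall>i. x $ i \<in> {-int m..int m}}. \<Prod>i\<in>UNIV. exp (- \<bar>real_of_int (x $ i)\<bar>))"
      using m by (intro sum_mono2 finite_vec_set) (auto intro: prod_nonneg)
    also have "\<dots> = (\<Prod>i\<in>(UNIV::'n set). \<Sum>k\<in>{-int m..int m}. exp (- \<bar>real_of_int k\<bar>))"
      by (rule sum_vec_prod) simp
    also have "\<dots> \<le> (\<Prod>i\<in>(UNIV::'n set). 2 / (1 - exp (-1::real)))"
      by (intro prod_mono conjI sum_nonneg sum_exp_neg_abs_int_le) auto
    finally show "(\<Sum>x\<in>X. \<Prod>i\<in>(UNIV::'n set). exp (- \<bar>real_of_int (x $ i)\<bar>)) \<le> (2 / (1 - exp (-1::real))) ^ CARD('n)"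
      by simp
  qed
qed (auto intro: prod_nonneg)

lemma linear_minus_square_le:
  fixes e C r :: real assumes "e > 0"
  shows "- e * r\<^sup>2 + C * r \<le> C\<^sup>2 / (4 * e)"
proof -
  have "0 \<le> (2 * e * r - C)\<^sup>2" by simp
  then show ?thesis using assms by (simp add: field_simps power2_eq_square)
qed

text \<open>n |x| dominates the l1 norm of x, so completing the square with linear coefficient C + n
  leaves a constant times the product of exponentials in the coordinates.\<close>

lemma summable_on_gaussian:
  fixes e C :: real assumes e: "e > 0"
  shows "(\<lambda>x::int^'n. exp (- e * (norm (rvec x))\<^sup>2 + C * norm (rvec x))) summable_on UNIV"
proof -
  define K where "K = (C + real CARD('n))\<^sup>2 / (4 * e)"
  have bd: "exp (- e * (norm (rvec x))\<^sup>2 + C * norm (rvec x)) \<le> exp K * (\<Prod>i\<in>UNIV. exp (- \<bar>real_of_int (x $ i)\<bar>))" for x :: "int^'n"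
  proof -
    have "(\<Sum>i\<in>UNIV. \<bar>real_of_int (x $ i)\<bar>) \<le> (\<Sum>i\<in>(UNIV::'n set). norm (rvec x))"
      by (intro sum_mono) (metis rvec_def vec_lambda_beta component_le_norm_cart)
    then have "(\<Sum>i\<in>UNIV. \<bar>real_of_int (x $ i)\<bar>) \<le> real CARD('n) * norm (rvec x)" by simp
    moreover have "- e * (norm (rvec x))\<^sup>2 + (C + real CARD('n)) * norm (rvec x) \<le> K"
      unfolding K_def by (rule linear_minus_square_le[OF e])
    ultimately have "- e * (norm (rvec x))\<^sup>2 + C * norm (rvec x) \<le> K + - (\<Sum>i\<in>UNIV. \<bar>real_of_int (x $ i)\<bar>)"
      by (simp add: algebra_simps)
    then have "exp (- e * (norm (rvec x))\<^sup>2 + C * norm (rvec x)) \<le> exp (K + - (\<Sum>i\<in>UNIV. \<bar>real_of_int (x $ i)\<bar>))" by simp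
    also have "\<dots> = exp K * (\<Prod>i\<in>UNIV. exp (- \<bar>real_of_int (x $ i)\<bar>))"
      unfolding exp_add sum_negf[symmetric] by (simp add: exp_sum)
    finally show ?thesis .
  qed
  show ?thesis
    by (rule summable_on_comparison_test[OF summable_on_cmult_right[OF summable_on_exp_neg_l1, of "exp K"] bd]) auto
qed

section \<open>Integrals over vectors\<close>

text \<open>Lebesgue measure on vectors is the image of a product measure indexed by basis vectors
  rather than by coordinates; the factors are therefore reindexed along
  \<open>axis i 1\<close>.\<close>

lemma integral_vec_prod:
  fixes f :: "'n::finite \<Rightarrow> real \<Rightarrow> complex"
  assumes f: "\<And>i. integrable lborel (f i)"
  shows "integrable lborel (\<lambda>x::real^'n. \<Prod>i\<in>UNIV. f i (x $ i))"
    and "(\<integral>x. (\<Prod>i\<in>UNIV. f i (x $ i)) \<partial>(lborel :: (real^'n) measure)) = (\<Prod>i\<in>UNIV. \<integral>y. f i y \<partial>lborel)"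
proof -
  interpret product_sigma_finite "\<lambda>b::real^'n. lborel :: real measure" ..
  define g where "g b = f (THE i. b = axis i (1::real))" for b :: "real^'n"
  have g: "g (axis i 1) = f i" for i
    unfolding g_def by (rule arg_cong[where f=f]) (auto simp: axis_eq_axis)
  have B: "(Basis :: (real^'n) set) = (\<lambda>i. axis i 1) ` UNIV" by (auto simp: Basis_vec_def)
  have inj: "inj (\<lambda>i::'n. axis i (1::real))" by (auto simp: inj_on_def axis_eq_axis)
  have lb: "(lborel :: (real^'n) measure) = distr (\<Pi>\<^sub>M b\<in>Basis. lborel) borel (\<lambda>f. \<Sum>b\<in>Basis. f b *\<^sub>R b)"
    by (rule lborel_eq)
  have pr: "(\<Prod>i\<in>UNIV. f i ((\<Sum>b\<in>Basis. x b *\<^sub>R b) $ i)) = (\<Prod>b\<in>Basis. g b (x b))" for x :: "real^'n \<Rightarrow> real"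
  proof -
    have "(\<Sum>b\<in>Basis. x b *\<^sub>R b) $ i = x (axis i 1)" for i
      unfolding B by (subst sum.reindex[OF inj]) (simp add: axis_def if_distrib cong: if_cong)
    then show ?thesis unfolding B by (subst prod.reindex[OF inj]) (simp add: g)
  qed
  have gi: "b \<in> Basis \<Longrightarrow> integrable lborel (g b)" for b
    unfolding B using f g by auto
  have ms: "(\<lambda>x::real^'n. \<Prod>i\<in>UNIV. f i (x $ i)) \<in> borel_measurable borel"
  proof (intro borel_measurable_prod)
    fix i
    have [measurable]: "f i \<in> borel_measurable borel" using f[of i] by (simp add: borel_measurable_integrable)
    have "(\<lambda>x::real^'n. x $ i) \<in> borel_measurable borel" by (intro borel_measurable_continuous_onI continuous_intros)
    then show "(\<lambda>x::real^'n. f i (x $ i)) \<in> borel_measurable borel" by measurable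
  qed
  show "integrable lborel (\<lambda>x::real^'n. \<Prod>i\<in>UNIV. f i (x $ i))"
    unfolding lb by (subst integrable_distr_eq[OF _ ms], simp, unfold pr) (auto simp: gi intro!: product_integrable_prod)
  have "(\<integral>x. (\<Prod>i\<in>UNIV. f i (x $ i)) \<partial>(lborel :: (real^'n) measure)) = (\<integral>x. (\<Prod>b\<in>Basis. g b (x b)) \<partial>(\<Pi>\<^sub>M b\<in>Basis. lborel))"
    unfolding lb by (subst integral_distr[OF _ ms], simp, unfold pr) simp
  also have "\<dots> = (\<Prod>b\<in>Basis. \<integral>y. g b y \<partial>lborel)"
    by (rule product_integral_prod) (auto simp: gi)
  also have "\<dots> = (\<Prod>i\<in>UNIV. \<integral>y. f i y \<partial>lborel)"
    unfolding B by (subst prod.reindex[OF inj]) (simp add: g)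
  finally show "(\<integral>x. (\<Prod>i\<in>UNIV. f i (x $ i)) \<partial>(lborel :: (real^'n) measure)) = (\<Prod>i\<in>UNIV. \<integral>y. f i y \<partial>lborel)" .
qed

text \<open>Weil's uniqueness argument for Haar measures: substituting a linear map multiplies
  all integrals by the same constant, whose value is never needed.\<close>

lemma lborel_integral_translate:
  fixes F :: "'a::euclidean_space \<Rightarrow> 'b::{banach,second_countable_topology}"
  assumes [measurable]: "F \<in> borel_measurable borel"
  shows "(\<integral>y. F (y + a) \<partial>lborel) = (\<integral>y. F y \<partial>lborel)"
    and "integrable lborel (\<lambda>y. F (y + a)) \<longleftrightarrow> integrable lborel F"
proof -
  have "(\<integral>y. F y \<partial>distr lborel borel ((+) a)) = (\<integral>y. F (y + a) \<partial>lborel)"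
    by (subst integral_distr) (auto simp: add.commute)
  then show "(\<integral>y. F (y + a) \<partial>lborel) = (\<integral>y. F y \<partial>lborel)" by (simp add: lborel_distr_plus)
  have "integrable (distr lborel borel ((+) a)) F \<longleftrightarrow> integrable lborel (\<lambda>y. F (y + a))"
    by (subst integrable_distr_eq) (auto simp: add.commute)
  then show "integrable lborel (\<lambda>y. F (y + a)) \<longleftrightarrow> integrable lborel F" by (simp add: lborel_distr_plus)
qed

lemma integral_linear_substitution:
  fixes f g :: "'a::euclidean_space \<Rightarrow> complex" and R R' :: "'a \<Rightarrow> 'a"
  assumes R: "linear R" and R': "\<And>y. R (R' y) = y"
    and cont: "continuous_on UNIV f" "continuous_on UNIV g"
    and f: "integrable lborel f" "integrable lborel (\<lambda>x. f (R x))"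
    and g: "integrable lborel g" "integrable lborel (\<lambda>x. g (R x))"
    and even: "\<And>x. g (- x) = g x"
  shows "(\<integral>x. f x \<partial>lborel) * (\<integral>x. g (R x) \<partial>lborel) = (\<integral>x. f (R x) \<partial>lborel) * (\<integral>x. g x \<partial>lborel)"
proof -
  have cR: "continuous_on A R" for A using R by (simp add: linear_continuous_on linear_conv_bounded_linear)
  have cc: "continuous_on A (\<lambda>z. f (u z))" "continuous_on A (\<lambda>z. g (u z))" "continuous_on A (\<lambda>z. R (u z))"
    if "continuous_on A u" for u :: "'c::topological_space \<Rightarrow> 'a" and A
    using cont that cR by (auto intro: continuous_on_compose2)
  have mf [measurable]: "f \<in> borel_measurable borel" "g \<in> borel_measurable borel" "R \<in> borel_measurable borel"
    using cont cR by (auto intro: borel_measurable_continuous_onI)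
  have key: "integrable (lborel \<Otimes>\<^sub>M lborel) (\<lambda>(x, y). F (y + R x) * G (R x))"
    if F: "integrable lborel F" and G: "integrable lborel (\<lambda>x. G (R x))"
      and m: "F \<in> borel_measurable borel" "G \<in> borel_measurable borel" for F G :: "'a \<Rightarrow> complex"
  proof (rule lborel_pair.Fubini_integrable)
    note [measurable] = m
    show "(\<lambda>(x, y). F (y + R x) * G (R x)) \<in> borel_measurable (lborel \<Otimes>\<^sub>M lborel)" by measurable
    have n: "(\<lambda>y. norm (F y)) \<in> borel_measurable borel" by measurable
    have "(\<integral>y. norm (case (x, y) of (x, y) \<Rightarrow> F (y + R x) * G (R x)) \<partial>lborel) = (\<integral>y. norm (F y) \<partial>lborel) * norm (G (R x))" for x
      by (simp add: norm_mult lborel_integral_translate(1)[OF n])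
    then show "integrable lborel (\<lambda>x. \<integral>y. norm (case (x, y) of (x, y) \<Rightarrow> F (y + R x) * G (R x)) \<partial>lborel)"
      using G by simp
    show "AE x in lborel. integrable lborel (\<lambda>y. case (x, y) of (x, y) \<Rightarrow> F (y + R x) * G (R x))"
      using F by (intro AE_I2) (simp add: lborel_integral_translate(2)[OF m(1)])
  qed
  have intg: "integrable lborel (\<lambda>y. g (- y))" using g(1) even by simp
  \<comment> \<open>Both sides are the double integral of f(y + Rx) g(Rx). Integrating over y at
    once gives the left side. After the swap, translating x by R' y moves y from f to g, and the
    evenness of g frees the y-integral for the right side.\<close>
  have "(\<integral>x. f x \<partial>lborel) * (\<integral>x. g (R x) \<partial>lborel) = (\<integral>x. (\<integral>y. f (y + R x) * g (R x) \<partial>lborel) \<partial>lborel)"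
    by (simp add: lborel_integral_translate(1)[OF mf(1)])
  also have "\<dots> = (\<integral>y. (\<integral>x. f (y + R x) * g (R x) \<partial>lborel) \<partial>lborel)"
    by (rule lborel_pair.Fubini_integral[symmetric]) (rule key[OF f(1) g(2) mf(1,2)])
  also have "(\<lambda>y. \<integral>x. f (y + R x) * g (R x) \<partial>lborel) = (\<lambda>y. \<integral>x. g (- y + R x) * f (R x) \<partial>lborel)"
  proof
    fix y
    have "(\<integral>x. f (y + R x) * g (R x) \<partial>lborel) = (\<integral>x. f (R (x + R' y)) * g (R (x + R' y) - y) \<partial>lborel)"
      by (simp add: linear_add[OF R] R' add.commute)
    also have "\<dots> = (\<integral>x. f (R x) * g (R x - y) \<partial>lborel)"
      by (rule lborel_integral_translate(1)) measurable
    finally show "(\<integral>x. f (y + R x) * g (R x) \<partial>lborel) = (\<integral>x. g (- y + R x) * f (R x) \<partial>lborel)"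
      by (simp add: mult.commute)
  qed
  also have "(\<lambda>y. \<integral>x. g (- y + R x) * f (R x) \<partial>lborel) = (\<lambda>y. \<integral>x. g (y + - R x) * f (R x) \<partial>lborel)"
  proof -
    have "g (- y + R x) = g (y + - R x)" for x y using even[of "y + - R x"] by simp
    then show ?thesis by simp
  qed
  also have "(\<integral>y. (\<integral>x. g (y + - R x) * f (R x) \<partial>lborel) \<partial>lborel) = (\<integral>x. (\<integral>y. g (y + - R x) * f (R x) \<partial>lborel) \<partial>lborel)"
  proof (rule lborel_pair.Fubini_integral)
    have [measurable]: "g \<in> borel_measurable borel" by (rule mf)
    have n: "(\<lambda>y. norm (g y)) \<in> borel_measurable borel" by measurable
    show "integrable (lborel \<Otimes>\<^sub>M lborel) (\<lambda>(x, y). g (y + - R x) * f (R x))"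
    proof (rule lborel_pair.Fubini_integrable)
      show "(\<lambda>(x, y). g (y + - R x) * f (R x)) \<in> borel_measurable (lborel \<Otimes>\<^sub>M lborel)" by measurable
      have "(\<integral>y. norm (case (x, y) of (x, y) \<Rightarrow> g (y + - R x) * f (R x)) \<partial>lborel) = (\<integral>y. norm (g y) \<partial>lborel) * norm (f (R x))" for x
        using lborel_integral_translate(1)[OF n, of "- R x"] by (simp add: norm_mult)
      then show "integrable lborel (\<lambda>x. \<integral>y. norm (case (x, y) of (x, y) \<Rightarrow> g (y + - R x) * f (R x)) \<partial>lborel)"
        using f(2) by simp
      show "AE x in lborel. integrable lborel (\<lambda>y. case (x, y) of (x, y) \<Rightarrow> g (y + - R x) * f (R x))"
        using g(1) lborel_integral_translate(2)[OF mf(2), of "- R _"] by (intro AE_I2) simp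
    qed
  qed
  also have "\<dots> = (\<integral>x. f (R x) \<partial>lborel) * (\<integral>x. g x \<partial>lborel)"
    using lborel_integral_translate(1)[OF mf(2), of "- R _"] by (simp add: mult.commute)
  finally show ?thesis .
qed

section \<open>Poisson summation\<close>

lemma rvec_simps [simp]: "rvec 0 = 0" "rvec (- k) = - rvec k" "rvec (k + l) = rvec k + rvec l" "rvec (k - l) = rvec k - rvec l"
  "rvec k $ i = real_of_int (k $ i)"
  by (simp_all add: rvec_def vec_eq_iff)

definition torus_char :: "int^'n \<Rightarrow> real^'n \<Rightarrow> complex" where
  "torus_char k x = cis (2 * pi * (rvec k \<bullet> x))"

lemma inner_rvec: "rvec k \<bullet> rvec l = real_of_int (\<Sum>i\<in>UNIV. k $ i * l $ i)"
  by (simp add: inner_vec_def)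

lemma torus_char_simps [simp]:
  "torus_char 0 x = 1" "norm (torus_char k x) = 1" "torus_char k 0 = 1"
  by (simp_all add: torus_char_def)

lemma torus_char_add: "torus_char (k + l) x = torus_char k x * torus_char l x"
  and cnj_torus_char: "cnj (torus_char k x) = torus_char (- k) x"
  by (simp_all add: torus_char_def cis_mult inner_add_left algebra_simps cis_cnj)

lemma torus_char_translate [simp]: "torus_char k (x + rvec l) = torus_char k x"
proof -
  have "torus_char k (x + rvec l) = torus_char k x * cis (2 * pi * (rvec k \<bullet> rvec l))"
    by (simp add: torus_char_def cis_mult inner_add_right algebra_simps)
  then show ?thesis unfolding inner_rvec cis_multiple_2pi[OF Ints_of_int] by simp
qed

lemma continuous_on_torus_char [continuous_intros]: "continuous_on A (torus_char k)"
  unfolding torus_char_def[abs_def] cis_conv_exp by (intro continuous_intros)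

lemma borel_measurable_torus_char [measurable]: "torus_char k \<in> borel_measurable borel"
  by (intro borel_measurable_continuous_onI continuous_intros)

lemma torus_char_prod: "torus_char k x = (\<Prod>i\<in>UNIV. cis (2 * pi * real_of_int (k $ i) * x $ i))"
  unfolding torus_char_def inner_vec_def cis_conv_exp
  by (simp add: sum_distrib_left exp_sum mult.assoc)

definition unit_cube :: "(real^'n) set" where
  "unit_cube = {x. \<forall>i. x $ i \<in> {0..<1}}"

lemma sets_unit_cube [measurable]: "unit_cube \<in> sets borel"
proof -
  have [measurable]: "(\<lambda>x::real^'n. x $ i) \<in> borel_measurable borel" for i
    by (intro borel_measurable_continuous_onI continuous_intros)
  have "unit_cube = (\<Inter>i. {x::real^'n. 0 \<le> x $ i \<and> x $ i < 1})" by (auto simp: unit_cube_def)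
  also have "\<dots> \<in> sets borel" by (intro sets.countable_INT'') (auto simp: pred_def[symmetric])
  finally show ?thesis .
qed

lemma integral_cis_unit_interval:
  "has_bochner_integral lborel (\<lambda>y. indicator {0..<1} y *\<^sub>R cis (2 * pi * real_of_int k * y)) (if k = 0 then 1 else 0)"
proof -
  have "has_bochner_integral lborel (\<lambda>y. indicator {0..1} y *\<^sub>R cis (2 * pi * real_of_int k * y)) (if k = 0 then 1 else 0)"
  proof (cases "k = 0")
    case True
    have "has_bochner_integral lborel (\<lambda>y::real. indicator {0..1} y *\<^sub>R (1::complex)) (measure lborel {0..1::real} *\<^sub>R 1)"
      by (intro has_bochner_integral_scaleR_left has_bochner_integral_real_indicator) auto
    with True show ?thesis by simp
  next
    case False
    let ?F = "\<lambda>y. exp (\<i> * (2 * pi * real_of_int k) * complex_of_real y) / (\<i> * (2 * pi * real_of_int k))"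
    have "has_bochner_integral lborel (\<lambda>y. indicator {0..1} y *\<^sub>R cis (2 * pi * real_of_int k * y)) (?F 1 - ?F 0)"
    proof (rule has_bochner_integral_FTC_Icc)
      fix x :: real
      have "((\<lambda>z. exp (\<i> * (2 * pi * real_of_int k) * z) / (\<i> * (2 * pi * real_of_int k))) has_field_derivative
          exp (\<i> * (2 * pi * real_of_int k) * complex_of_real x)) (at (complex_of_real x))"
        using False by (auto intro!: derivative_eq_intros)
      then show "(?F has_vector_derivative cis (2 * pi * real_of_int k * x)) (at x within {0..1})"
        unfolding cis_conv_exp
        by (intro has_vector_derivative_real_field[THEN has_vector_derivative_at_within]) (simp add: mult_ac)
      show "continuous_on {0..1} (\<lambda>x. cis (2 * pi * real_of_int k * x))" by (intro continuous_intros)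
    qed simp
    moreover have "?F 1 = ?F 0"
      using cis_multiple_2pi[of "real_of_int k"] by (simp add: cis_conv_exp mult_ac)
    ultimately show ?thesis using False by simp
  qed
  moreover have "AE y in lborel. indicat_real {0..1} y *\<^sub>R cis (2 * pi * real_of_int k * y) = indicator {0..<1} y *\<^sub>R cis (2 * pi * real_of_int k * y)"
    using AE_lborel_singleton[of "1::real"] by eventually_elim (auto simp: indicator_def)
  moreover have [measurable]: "(\<lambda>y. cis (2 * pi * real_of_int k * y)) \<in> borel_measurable borel"
    by (intro borel_measurable_continuous_onI continuous_intros)
  ultimately show ?thesis
    by (subst (asm) has_bochner_integral_cong_AE) (auto simp del: scaleR_cancel_right)
qed

lemma integral_torus_char_unit_cube:
  "has_bochner_integral lborel (\<lambda>x::real^'n. indicator unit_cube x *\<^sub>R torus_char k x) (if k = 0 then 1 else 0)"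
proof -
  let ?f = "\<lambda>i y. indicator {0..<1} y *\<^sub>R cis (2 * pi * real_of_int (k $ i) * y)"
  have eq: "indicator unit_cube x *\<^sub>R torus_char k x = (\<Prod>i\<in>UNIV. ?f i (x $ i))" for x
  proof -
    have "indicat_real unit_cube x = (\<Prod>i\<in>UNIV. indicat_real {0..<1} (x $ i))"
      by (auto simp: unit_cube_def indicator_def)
    then show ?thesis unfolding torus_char_prod scaleR_conv_of_real by (simp add: prod.distrib)
  qed
  have i: "integrable lborel (?f i)" for i using integral_cis_unit_interval by (auto simp: has_bochner_integral_iff)
  have v: "(\<integral>y. ?f i y \<partial>lborel) = (if k $ i = 0 then 1 else 0)" for i
    using integral_cis_unit_interval by (auto simp: has_bochner_integral_iff)
  have "(\<Prod>i\<in>UNIV. (if k $ i = 0 then 1 else 0::complex)) = (if k = 0 then 1 else 0)"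
    by (auto simp: vec_eq_iff)
  then show ?thesis
    unfolding eq has_bochner_integral_iff using integral_vec_prod[of ?f, OF i] by (simp add: v)
qed

lemma infinite_int_vec: "infinite (UNIV :: (int^'n) set)"
proof
  assume "finite (UNIV :: (int^'n) set)"
  then have "finite ((\<lambda>x::int^'n. x $ undefined) ` UNIV)" by (rule finite_imageI)
  moreover have "(\<lambda>x::int^'n. x $ undefined) ` UNIV = UNIV"
    by (auto intro!: image_eqI[of _ _ "vec _"])
  ultimately show False by simp
qed

lemma translate_into_unit_cube:
  fixes x :: "real^'n" shows "\<exists>!l. x - rvec l \<in> unit_cube"
proof
  show "x - rvec (\<chi> i. \<lfloor>x $ i\<rfloor>) \<in> unit_cube"
    by (auto simp: unit_cube_def) linarith+
  fix l assume "x - rvec l \<in> unit_cube"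
  then show "l = (\<chi> i. \<lfloor>x $ i\<rfloor>)"
    by (auto simp: unit_cube_def vec_eq_iff floor_eq_iff diff_le_eq less_diff_eq[symmetric] intro!: floor_unique[symmetric])
       (metis add.commute less_diff_eq diff_less_eq)
qed

text \<open>The integer translates of the half-open cube tile the space, so the integral is a sum
  over l of integrals over one cube, through which the periodic factor K passes unchanged. M and C
  dominate the series and allow the sum under the integral.\<close>

lemma integral_unfold_unit_cube:
  fixes f K :: "real^'n \<Rightarrow> complex" and M :: "int^'n \<Rightarrow> real"
  assumes f: "f \<in> borel_measurable borel" and K: "K \<in> borel_measurable borel"
    and per: "\<And>x l. K (x + rvec l) = K x"
    and bdK: "\<And>x. norm (K x) \<le> C"
    and int: "integrable lborel (\<lambda>x. f x * K x)"
    and bd: "\<And>x l. x \<in> unit_cube \<Longrightarrow> norm (f (x + rvec l)) \<le> M l"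
    and M: "M summable_on UNIV"
  shows "(\<integral>x. f x * K x \<partial>lborel) = (\<integral>x. indicator unit_cube x *\<^sub>R ((\<Sum>\<^sub>\<infinity>l. f (x + rvec l)) * K x) \<partial>lborel)"
proof -
  define e where "e = from_nat_into (UNIV :: (int^'n) set)"
  have e: "bij e" unfolding e_def
    using bij_betw_from_nat_into[OF countableI_type infinite_int_vec] by simp
  note [measurable] = f K
  have M0: "M l \<ge> 0" for l
    using bd[of 0 l] by (auto simp: unit_cube_def intro: order.trans[OF norm_ge_zero])
  have C0: "C \<ge> 0" using bdK[of 0] norm_ge_zero order.trans by blast
  define A where "A i = {x::real^'n. x - rvec (e i) \<in> unit_cube}" for i
  have Am: "A i \<in> sets lborel" for i
  proof -
    have "(\<lambda>x. x - rvec (e i)) -` unit_cube \<inter> space borel \<in> sets borel"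
      by (rule measurable_sets[OF _ sets_unit_cube]) measurable
    then show ?thesis by (simp add: A_def vimage_def)
  qed
  have UA: "(\<Union>i. A i) = UNIV"
  proof -
    have "\<exists>i. x \<in> A i" for x
    proof -
      obtain l where "x - rvec l \<in> unit_cube" using translate_into_unit_cube[of x] by blast
      moreover obtain i where "e i = l" using e by (metis bij_pointE)
      ultimately show ?thesis by (auto simp: A_def)
    qed
    then show ?thesis by blast
  qed
  have disj: "A i \<inter> A j = {}" if "i \<noteq> j" for i j
  proof -
    have "e i \<noteq> e j" using that e by (metis bij_pointE)
    then show ?thesis using translate_into_unit_cube by (auto simp: A_def)
  qed
  have "(\<integral>x. f x * K x \<partial>lborel) = (LINT x:(\<Union>i. A i)|lborel. f x * K x)"
    by (simp add: UA set_lebesgue_integral_def)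
  also have "\<dots> = (\<Sum>i. (LINT x:A i|lborel. f x * K x))"
    using Am disj int by (intro lebesgue_integral_countable_add) (auto simp: UA set_integrable_def)
  also have "(\<lambda>i. (LINT x:A i|lborel. f x * K x)) = (\<lambda>i. \<integral>x. indicator unit_cube x *\<^sub>R (f (x + rvec (e i)) * K x) \<partial>lborel)"
  proof
    fix i
    have [measurable]: "A i \<in> sets borel" using Am[of i] by simp
    have "(LINT x:A i|lborel. f x * K x) = (\<integral>x. indicator (A i) (x + rvec (e i)) *\<^sub>R (f (x + rvec (e i)) * K (x + rvec (e i))) \<partial>lborel)"
      unfolding set_lebesgue_integral_def by (rule lborel_integral_translate(1)[symmetric]) measurable
    also have "\<dots> = (\<integral>x. indicator unit_cube x *\<^sub>R (f (x + rvec (e i)) * K x) \<partial>lborel)"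
      by (simp add: per A_def indicator_def)
    finally show "(LINT x:A i|lborel. f x * K x) = (\<integral>x. indicator unit_cube x *\<^sub>R (f (x + rvec (e i)) * K x) \<partial>lborel)" .
  qed
  also have "(\<Sum>i. \<integral>x. indicator unit_cube x *\<^sub>R (f (x + rvec (e i)) * K x) \<partial>lborel)
     = (\<integral>x. (\<Sum>i. indicator unit_cube x *\<^sub>R (f (x + rvec (e i)) * K x)) \<partial>lborel)"
  proof (rule integral_suminf[symmetric])
    have Ms: "summable (\<lambda>i. M (e i))"
    proof -
      have "(\<lambda>i. M (e i)) summable_on UNIV" using M e by (simp add: summable_on_reindex_bij_betw)
      then show ?thesis by (simp add: summable_on_imp_summable)
    qed
    have nb: "norm (indicat_real unit_cube x *\<^sub>R (f (x + rvec (e i)) * K x)) \<le> indicat_real unit_cube x * (M (e i) * C)" for x i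
      using bd[of x "e i"] bdK[of x] M0 C0 by (auto simp: indicator_def norm_mult intro!: mult_mono)
    have ic: "integrable lborel (\<lambda>x::real^'n. indicat_real unit_cube x * c)" for c
    proof -
      have "integrable lborel (\<lambda>x::real^'n. norm (indicat_real unit_cube x *\<^sub>R torus_char 0 x))"
        using integral_torus_char_unit_cube[of 0, unfolded has_bochner_integral_iff, THEN conjunct1] by (rule integrable_norm)
      then show ?thesis by simp
    qed
    have vc: "(\<integral>x. indicat_real unit_cube (x::real^'n) * c \<partial>lborel) = (\<integral>x. indicat_real unit_cube (x::real^'n) \<partial>lborel) * c" for c
      by simp
    show int1: "integrable lborel (\<lambda>x. indicat_real unit_cube x *\<^sub>R (f (x + rvec (e i)) * K x))" for i
    proof (rule Bochner_Integration.integrable_bound[OF ic[of "M (e i) * C"] _ AE_I2])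
      show "norm (indicat_real unit_cube x *\<^sub>R (f (x + rvec (e i)) * K x)) \<le> norm (indicat_real unit_cube x * (M (e i) * C))" for x
        unfolding real_norm_def[of "_ * _"] by (rule order.trans[OF nb abs_ge_self])
    qed measurable
    show "AE x in lborel. summable (\<lambda>i. norm (indicat_real unit_cube x *\<^sub>R (f (x + rvec (e i)) * K x)))"
      by (intro AE_I2 summable_comparison_test'[OF summable_mult[OF summable_mult2[OF Ms]]]) (use nb in auto)
    show "summable (\<lambda>i. \<integral>x. norm (indicat_real unit_cube x *\<^sub>R (f (x + rvec (e i)) * K x)) \<partial>lborel)"
    proof (rule summable_comparison_test'[OF summable_mult[OF summable_mult2[OF Ms, of C], of "\<integral>x. indicat_real unit_cube (x::real^'n) \<partial>lborel"]])
      fix i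
      have "(\<integral>x. norm (indicat_real unit_cube x *\<^sub>R (f (x + rvec (e i)) * K x)) \<partial>lborel) \<le> (\<integral>x. indicat_real unit_cube (x::real^'n) * (M (e i) * C) \<partial>lborel)"
        by (intro integral_mono integrable_norm int1 ic nb)
      then show "norm (\<integral>x. norm (indicat_real unit_cube x *\<^sub>R (f (x + rvec (e i)) * K x)) \<partial>lborel) \<le> (\<integral>x. indicat_real unit_cube (x::real^'n) \<partial>lborel) * (M (e i) * C)"
        unfolding vc by (simp add: integral_nonneg_AE)
    qed
  qed
  also have "(\<lambda>x. \<Sum>i. indicator unit_cube x *\<^sub>R (f (x + rvec (e i)) * K x)) = (\<lambda>x. indicator unit_cube x *\<^sub>R ((\<Sum>\<^sub>\<infinity>l. f (x + rvec l)) * K x))"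
  proof
    fix x
    show "(\<Sum>i. indicator unit_cube x *\<^sub>R (f (x + rvec (e i)) * K x)) = indicat_real unit_cube x *\<^sub>R ((\<Sum>\<^sub>\<infinity>l. f (x + rvec l)) * K x)"
    proof (cases "x \<in> unit_cube")
      case True
      have "(\<lambda>l. f (x + rvec l)) summable_on UNIV"
        by (rule abs_summable_summable, rule summable_on_comparison_test[OF M]) (auto intro: bd[OF True])
      then have "((\<lambda>l. f (x + rvec l)) has_sum (\<Sum>\<^sub>\<infinity>l. f (x + rvec l))) UNIV" by (rule has_sum_infsum)
      then have "((\<lambda>i. f (x + rvec (e i))) has_sum (\<Sum>\<^sub>\<infinity>l. f (x + rvec l))) UNIV"
        using e by (subst has_sum_reindex_bij_betw) auto
      then have "(\<lambda>i. f (x + rvec (e i))) sums (\<Sum>\<^sub>\<infinity>l. f (x + rvec l))" by (rule has_sum_imp_sums)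
      then show ?thesis using True by (simp add: sums_iff suminf_mult2[symmetric])
    qed simp
  qed
  finally show ?thesis .
qed

text \<open>The Cesaro weight, a product of factors max(0, 1 - |k_i|/m). It is written as the number
  of j' in [0,m) for which j' + k_i is in [0,m) too, because counting pairs with a given difference
  produces it in this form.\<close>

definition fejer_weight :: "nat \<Rightarrow> int^'n \<Rightarrow> real" where
  "fejer_weight m k = (\<Prod>i\<in>UNIV. real (card {max 0 (- (k $ i))..<min (int m) (int m - k $ i)}) / real m)"

definition int_box :: "nat \<Rightarrow> (int^'n) set" where
  "int_box m = {j. \<forall>i. j $ i \<in> {0..<int m}}"

text \<open>A squared Dirichlet kernel divided by m^n: non-negative by construction, with the Cesaro
  weights as Fourier coefficients.\<close>

definition fejer_kernel :: "nat \<Rightarrow> real^'n \<Rightarrow> real" where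
  "fejer_kernel m x = (norm (\<Sum>j\<in>int_box m. torus_char j x))\<^sup>2 / real m ^ CARD('n)"

lemma finite_int_box [simp]: "finite (int_box m)"
  unfolding int_box_def by (rule finite_vec_set) simp

lemma fejer_kernel_nonneg: "fejer_kernel m x \<ge> 0" by (simp add: fejer_kernel_def)

lemma fejer_kernel_eq:
  "complex_of_real (fejer_kernel m x) = (\<Sum>j\<in>int_box m. \<Sum>j'\<in>int_box m. torus_char (j - j') x) / real m ^ CARD('n)"
  for x :: "real^'n"
  unfolding fejer_kernel_def of_real_divide complex_norm_square
  by (simp add: cnj_torus_char sum_product diff_conv_add_uminus torus_char_add del: add_uminus_conv_diff)

text \<open>Pairs in the box are grouped by their difference. An arbitrary h is allowed since the
  regrouping is applied to the Fourier integrals of f and also to the orthogonality relations on the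
  cube.\<close>

lemma sum_differences_int_box:
  fixes h :: "int^'n \<Rightarrow> complex"
  assumes "m > 0"
  shows "((\<lambda>k. fejer_weight m k * h k) has_sum ((\<Sum>j\<in>int_box m. \<Sum>j'\<in>int_box m. h (j - j')) / real m ^ CARD('n))) UNIV"
proof -
  define X where "X = (\<lambda>(j, j'). j - j') ` (int_box m \<times> int_box m :: ((int^'n) \<times> (int^'n)) set)"
  have finX: "finite X" unfolding X_def by simp
  have cd: "card {p \<in> int_box m \<times> int_box m. (case p of (j, j') \<Rightarrow> j - j') = k} = (\<Prod>i\<in>UNIV. card {max 0 (- (k $ i))..<min (int m) (int m - k $ i)})" for k :: "int^'n"
  proof -
    have "bij_betw (\<lambda>j'. (j' + k, j')) {x. \<forall>i. x $ i \<in> {max 0 (- (k $ i))..<min (int m) (int m - k $ i)}} {p \<in> int_box m \<times> int_box m. (case p of (j, j') \<Rightarrow> j - j') = k}"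
      by (rule bij_betwI[where g=snd]) (auto simp: int_box_def algebra_simps, smt (verit))
    then show ?thesis using card_vec_set[of "\<lambda>i. {max 0 (- (k $ i))..<min (int m) (int m - k $ i)}"] bij_betw_same_card by fastforce
  qed
  have w: "fejer_weight m k = real (card {p \<in> int_box m \<times> int_box m. (case p of (j, j') \<Rightarrow> j - j') = k}) / real m ^ CARD('n)" for k :: "int^'n"
    unfolding cd fejer_weight_def by (simp add: prod_dividef)
  have "(\<Sum>j\<in>int_box m. \<Sum>j'\<in>int_box m. h (j - j')) = (\<Sum>p\<in>int_box m \<times> int_box m. h (case p of (j, j') \<Rightarrow> j - j'))"
    by (simp add: sum.cartesian_product case_prod_unfold)
  also have "\<dots> = (\<Sum>k\<in>X. \<Sum>p\<in>{p \<in> int_box m \<times> int_box m. (case p of (j, j') \<Rightarrow> j - j') = k}. h (case p of (j, j') \<Rightarrow> j - j'))"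
    unfolding X_def by (rule sum.image_gen) simp
  also have "\<dots> = (\<Sum>k\<in>X. card {p \<in> int_box m \<times> int_box m. (case p of (j, j') \<Rightarrow> j - j') = k} * h k)"
  proof (intro sum.cong refl)
    fix k assume "k \<in> X"
    have "(\<Sum>p\<in>{p \<in> int_box m \<times> int_box m. (case p of (j, j') \<Rightarrow> j - j') = k}. h (case p of (j, j') \<Rightarrow> j - j')) =
       (\<Sum>p\<in>{p \<in> int_box m \<times> int_box m. (case p of (j, j') \<Rightarrow> j - j') = k}. h k)"
      by (rule sum.cong) auto
    then show "(\<Sum>p\<in>{p \<in> int_box m \<times> int_box m. (case p of (j, j') \<Rightarrow> j - j') = k}. h (case p of (j, j') \<Rightarrow> j - j')) =
       card {p \<in> int_box m \<times> int_box m. (case p of (j, j') \<Rightarrow> j - j') = k} * h k" by simp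
  qed
  finally have eq: "(\<Sum>j\<in>int_box m. \<Sum>j'\<in>int_box m. h (j - j')) / real m ^ CARD('n) = (\<Sum>k\<in>X. fejer_weight m k * h k)"
    by (simp add: w sum_divide_distrib)
  have z: "fejer_weight m k = 0" if "k \<notin> X" for k
  proof -
    have "{p \<in> int_box m \<times> int_box m. (case p of (j, j') \<Rightarrow> j - j') = k} = {}" using that by (auto simp: X_def)
    then show ?thesis by (simp add: w)
  qed
  show ?thesis unfolding eq
    by (rule has_sum_finite_neutralI[OF finX]) (auto simp: z)
qed

lemma fejer_weight_bounds: "0 \<le> fejer_weight m k" "fejer_weight m k \<le> 1"
proof -
  show "0 \<le> fejer_weight m k" unfolding fejer_weight_def by (intro prod_nonneg) auto
  have "card {max 0 (- (k $ i))..<min (int m) (int m - k $ i)} \<le> m" for i by auto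
  then show "fejer_weight m k \<le> 1" unfolding fejer_weight_def
    by (intro prod_le_1) (auto simp: divide_le_eq_1)
qed

lemma fejer_weight_tendsto: "(\<lambda>m. fejer_weight m k) \<longlonglongrightarrow> 1"
proof -
  have "(\<lambda>m. real (card {max 0 (- c)..<min (int m) (int m - c)}) / real m) \<longlonglongrightarrow> 1" for c :: int
  proof (rule Lim_transform_eventually)
    show "(\<lambda>m. (real m - \<bar>real_of_int c\<bar>) / real m) \<longlonglongrightarrow> 1" by real_asymp
    show "\<forall>\<^sub>F m in sequentially. (real m - \<bar>real_of_int c\<bar>) / real m = real (card {max 0 (- c)..<min (int m) (int m - c)}) / real m"
      using eventually_ge_at_top[of "nat \<bar>c\<bar>"]
    proof eventually_elim
      case (elim m)
      then have "min (int m) (int m - c) - max 0 (- c) = int m - \<bar>c\<bar>" by auto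
      then show ?case using elim by simp
    qed
  qed
  then have "(\<lambda>m. fejer_weight m k) \<longlonglongrightarrow> (\<Prod>i\<in>(UNIV::'a set). 1)"
    unfolding fejer_weight_def by (intro tendsto_prod)
  then show ?thesis by simp
qed

lemma fejer_weight_0: "m > 0 \<Longrightarrow> fejer_weight m 0 = 1"
  by (simp add: fejer_weight_def)


lemma continuous_on_fejer_kernel [continuous_intros]: "continuous_on A (fejer_kernel m)"
  unfolding fejer_kernel_def[abs_def] divide_inverse by (intro continuous_intros)

lemma fejer_kernel_periodic [simp]: "fejer_kernel m (x + rvec l) = fejer_kernel m x"
  by (simp add: fejer_kernel_def)

lemma norm_fejer_kernel_le: "norm (complex_of_real (fejer_kernel m x)) \<le> (real (card (int_box m :: (int^'n) set)))\<^sup>2 / real m ^ CARD('n)"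
  for x :: "real^'n"
proof -
  have "norm (\<Sum>j\<in>int_box m. torus_char j x) \<le> (\<Sum>j\<in>(int_box m :: (int^'n) set). 1)"
    by (rule sum_norm_le) simp
  then have "(norm (\<Sum>j\<in>int_box m. torus_char j x))\<^sup>2 \<le> (real (card (int_box m :: (int^'n) set)))\<^sup>2"
    by (intro power_mono) auto
  then have "fejer_kernel m x \<le> (real (card (int_box m :: (int^'n) set)))\<^sup>2 / real m ^ CARD('n)"
    unfolding fejer_kernel_def by (rule divide_right_mono) simp
  then show ?thesis unfolding norm_of_real using fejer_kernel_nonneg[of m x] by simp
qed

lemma integral_fejer_unit_cube:
  assumes m: "m > 0"
  shows "has_bochner_integral lborel (\<lambda>x::real^'n. indicator unit_cube x *\<^sub>R (torus_char k x * fejer_kernel m x)) (fejer_weight m (- k))"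
proof -
  have eq: "indicator unit_cube x *\<^sub>R (torus_char k x * fejer_kernel m x) =
     (\<Sum>j\<in>int_box m. \<Sum>j'\<in>int_box m. indicator unit_cube x *\<^sub>R torus_char (k + (j - j')) x) / real m ^ CARD('n)" for x :: "real^'n"
    unfolding fejer_kernel_eq torus_char_add[of k] by (simp add: indicator_def sum_distrib_left)
  have 1: "has_bochner_integral lborel (\<lambda>x::real^'n. indicator unit_cube x *\<^sub>R (torus_char k x * fejer_kernel m x))
     ((\<Sum>j\<in>int_box m. \<Sum>j'\<in>int_box m. if k + (j - j') = 0 then 1 else 0 :: complex) / real m ^ CARD('n))"
    unfolding eq of_real_power[symmetric]
    by (intro has_bochner_integral_divide_zero has_bochner_integral_sum integral_torus_char_unit_cube)
  have 2: "((\<lambda>k'. fejer_weight m k' * (if k + k' = 0 then 1 else 0 :: complex)) has_sum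
     ((\<Sum>j\<in>int_box m. \<Sum>j'\<in>int_box m. if k + (j - j') = 0 then 1 else 0 :: complex) / real m ^ CARD('n))) UNIV"
    by (rule sum_differences_int_box[OF m])
  have 3: "((\<lambda>k'. fejer_weight m k' * (if k + k' = 0 then 1 else 0 :: complex)) has_sum complex_of_real (fejer_weight m (- k))) UNIV"
    by (rule has_sum_finite_neutralI[of "{-k}"]) (auto simp: add_eq_0_iff)
  show ?thesis using 1 unfolding has_sum_unique[OF 2 3] .
qed

text \<open>sin^2(pi x_i) detects the distance of x_i from the integers and is a combination of
  three characters, so that its integral against the Fejer kernel is explicit.\<close>

lemma sin_square_torus_char:
  "complex_of_real ((sin (pi * x $ i))\<^sup>2) = 1/2 - (torus_char (axis i 1) x + torus_char (- axis i 1) x) / 4"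
proof -
  have ax: "rvec (axis i 1) = axis i 1" by (simp add: rvec_def axis_def vec_eq_iff)
  have "complex_of_real ((sin (pi * x $ i))\<^sup>2) = complex_of_real (1/2 - cos (2 * pi * x $ i) / 2)"
    using cos_double_sin[of "pi * x $ i"] by (intro arg_cong[where f=complex_of_real]) (simp add: mult.assoc field_simps)
  then show ?thesis
    by (simp add: torus_char_def ax inner_axis' complex_eq_iff)
qed

text \<open>The integral of f against the Fejer kernel is computed in two ways. Expanding the kernel
  gives Cesaro means of the dual series, which tend to its sum; unfolding gives the periodisation F
  against an approximate identity, which tends to F(0).\<close>

lemma poisson_summation:
  fixes f :: "real^'n \<Rightarrow> complex" and M :: "int^'n \<Rightarrow> real"
  assumes cont: "continuous_on UNIV f" and int: "integrable lborel f"
    and bd: "\<And>x l. x \<in> cbox 0 (\<chi> i. 1) \<Longrightarrow> norm (f (x + rvec l)) \<le> M l"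
    and M: "M summable_on UNIV"
    and fhat: "\<And>k. fhat k = (\<integral>x. f x * torus_char k x \<partial>lborel)"
    and sfhat: "(\<lambda>k. norm (fhat k)) summable_on UNIV"
  shows "(\<Sum>\<^sub>\<infinity>l. f (rvec l)) = (\<Sum>\<^sub>\<infinity>k. fhat k)"
proof -
  let ?Q = "cbox 0 (\<chi> i. 1) :: (real^'n) set"
  define F where "F x = (\<Sum>\<^sub>\<infinity>l. f (x + rvec l))" for x
  have cubeQ: "x \<in> ?Q" if "x \<in> unit_cube" for x :: "real^'n"
    using that by (auto simp: unit_cube_def mem_box_cart less_imp_le)
  have ulim: "uniform_limit ?Q (\<lambda>X x. \<Sum>l\<in>X. f (x + rvec l)) F (finite_subsets_at_top UNIV)"
    unfolding F_def using bd by (intro Weierstrass_m_test_general[OF _ M]) auto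
  have contF: "continuous_on ?Q F"
    by (rule uniform_limit_theorem[OF _ ulim])
       (auto intro!: always_eventually continuous_intros continuous_on_compose2[OF cont])
  define I where "I m = (\<integral>x. f x * fejer_kernel m x \<partial>lborel)" for m
  have fm [measurable]: "f \<in> borel_measurable borel" using cont by (rule borel_measurable_continuous_onI)
  have intk: "integrable lborel (\<lambda>x. f x * torus_char k x)" for k
    by (rule Bochner_Integration.integrable_bound[OF int]) (auto simp: norm_mult)
  have I1: "I m = (\<Sum>\<^sub>\<infinity>k. fejer_weight m k * fhat k)" if m: "m > 0" for m
  proof -
    have "I m = (\<integral>x. (\<Sum>j\<in>int_box m. \<Sum>j'\<in>int_box m. f x * torus_char (j - j') x) / real m ^ CARD('n) \<partial>lborel)"
      unfolding I_def fejer_kernel_eq by (simp add: sum_distrib_left)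
    also have "\<dots> = (\<Sum>j\<in>int_box m. \<Sum>j'\<in>int_box m. fhat (j - j')) / real m ^ CARD('n)"
      unfolding of_real_power[symmetric] by (simp add: intk fhat)
    finally show ?thesis using sum_differences_int_box[OF m, of fhat] by (simp add: infsumI)
  qed
  have lim1: "I \<longlonglongrightarrow> (\<Sum>\<^sub>\<infinity>k. fhat k)"
  proof (rule Lim_transform_eventually)
    show "(\<lambda>m. \<Sum>\<^sub>\<infinity>k. fejer_weight m k * fhat k) \<longlonglongrightarrow> (\<Sum>\<^sub>\<infinity>k. fhat k)"
    proof (rule swap_uniform_limit'[where S=UNIV and F="finite_subsets_at_top UNIV"])
      show "uniform_limit UNIV (\<lambda>X m. \<Sum>k\<in>X. fejer_weight m k * fhat k) (\<lambda>m. \<Sum>\<^sub>\<infinity>k. fejer_weight m k * fhat k) (finite_subsets_at_top UNIV)"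
        using fejer_weight_bounds by (intro Weierstrass_m_test_general[OF _ sfhat]) (auto simp: norm_mult abs_of_nonneg[OF fejer_weight_bounds(1)] intro!: mult_left_le_one_le)
      show "\<forall>\<^sub>F X in finite_subsets_at_top UNIV. (\<lambda>m. \<Sum>k\<in>X. fejer_weight m k * fhat k) \<longlonglongrightarrow> (\<Sum>k\<in>X. fhat k)"
      proof (intro always_eventually allI tendsto_sum)
        fix k
        have "(\<lambda>m. complex_of_real (fejer_weight m k) * fhat k) \<longlonglongrightarrow> complex_of_real 1 * fhat k"
          by (intro tendsto_intros fejer_weight_tendsto)
        then show "(\<lambda>m. complex_of_real (fejer_weight m k) * fhat k) \<longlonglongrightarrow> fhat k" by simp
      qed
      show "(sum fhat \<longlongrightarrow> (\<Sum>\<^sub>\<infinity>k. fhat k)) (finite_subsets_at_top UNIV)"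
        using has_sum_infsum[OF abs_summable_summable[OF sfhat]] by (simp add: has_sum_def)
    qed auto
    show "\<forall>\<^sub>F m in sequentially. (\<Sum>\<^sub>\<infinity>k. fejer_weight m k * fhat k) = I m"
      using eventually_gt_at_top[of 0] by eventually_elim (simp add: I1)
  qed
  have I2: "I m = (\<integral>x. indicator unit_cube x *\<^sub>R (F x * fejer_kernel m x) \<partial>lborel)" for m
    unfolding I_def F_def
  proof (rule integral_unfold_unit_cube[OF fm _ _ norm_fejer_kernel_le _ _ M])
    show km: "(\<lambda>x. complex_of_real (fejer_kernel m x)) \<in> borel_measurable borel"
      by (intro borel_measurable_continuous_onI continuous_intros)
    show "integrable lborel (\<lambda>x. f x * complex_of_real (fejer_kernel m x))"
    proof (rule Bochner_Integration.integrable_bound[OF integrable_mult_right[OF int, of "of_real ((real (card (int_box m :: (int^'n) set)))\<^sup>2 / real m ^ CARD('n))"]])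
      show "AE x in lborel. norm (f x * complex_of_real (fejer_kernel m x)) \<le> norm (complex_of_real ((real (card (int_box m :: (int^'n) set)))\<^sup>2 / real m ^ CARD('n)) * f x)"
        unfolding norm_mult norm_of_real[of "(real (card (int_box m :: (int^'n) set)))\<^sup>2 / real m ^ CARD('n)"]
        by (intro AE_I2) (subst mult.commute, intro mult_right_mono order.trans[OF norm_fejer_kernel_le abs_ge_self] norm_ge_zero)
    qed (use km in measurable)
  qed (use bd cubeQ in auto)
  \<comment> \<open>A test function in the manner of Korovkin: in the closed cube it vanishes only
    at the corners, where periodicity gives F the value F(0), and its integral against the kernel
    tends to 0. It is therefore enough to bound |F - F(0)| by e + C S.\<close>
  define S where "S x = (\<Sum>i\<in>UNIV. (sin (pi * x $ i))\<^sup>2)" for x :: "real^'n"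
  have S0: "S x \<ge> 0" for x unfolding S_def by (intro sum_nonneg) auto
  have corner: "F x = F 0" if "x \<in> ?Q" "S x = 0" for x
  proof -
    have "sin (pi * x $ i) = 0" for i
      using that(2) unfolding S_def by (subst (asm) sum_nonneg_eq_0_iff) auto
    then have "\<exists>z::int. x $ i = z" for i by (auto simp: sin_zero_iff_int2)
    then obtain z where z: "\<And>i. x $ i = real_of_int (z i)" by metis
    then have x: "x = rvec (\<chi> i. z i)" by (simp add: vec_eq_iff)
    have "F x = (\<Sum>\<^sub>\<infinity>l. f (0 + rvec ((\<chi> i. z i) + l)))" unfolding F_def x by simp
    also have "\<dots> = F 0" unfolding F_def
      by (rule infsum_reindex_bij_betw) (rule bij_betwI[where g="\<lambda>l. l - (\<chi> i. z i)"], auto)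
    finally show ?thesis .
  qed
  have bound: "\<exists>C\<ge>0. \<forall>x\<in>?Q. norm (F x - F 0) \<le> e + C * S x" if e: "e > 0" for e
  proof -
    define U where "U = {x\<in>?Q. norm (F x - F 0) \<ge> e}"
    have cn: "continuous_on ?Q (\<lambda>x. norm (F x - F 0))" by (intro continuous_intros contF)
    have "closed U" unfolding U_def
      using continuous_on_closed_Collect_le[OF continuous_on_const cn closed_cbox] .
    then have U: "compact U" unfolding U_def
      by (metis (no_types, lifting) U_def compact_cbox compact_Int_closed inf.absorb_iff2 mem_Collect_eq subsetI)
    obtain B where B: "\<And>x. x \<in> ?Q \<Longrightarrow> norm (F x - F 0) \<le> B"
      using continuous_attains_sup[OF compact_cbox _ cn] by (metis (no_types) empty_iff)
    have cS: "continuous_on U S" unfolding S_def by (intro continuous_intros)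
    show ?thesis
    proof (cases "U = {}")
      case True
      then have "norm (F x - F 0) \<le> e" if "x \<in> ?Q" for x using that by (force simp: U_def)
      then show ?thesis by (intro exI[of _ 0]) auto
    next
      case False
      \<comment> \<open>On the compact set where |F - F(0)| is at least e, S has a positive minimum;
        a bound for |F - F(0)| divided by this minimum serves as C.\<close>
      obtain x0 where x0: "x0 \<in> U" "\<And>x. x \<in> U \<Longrightarrow> S x0 \<le> S x"
        using continuous_attains_inf[OF U False cS] by blast
      have s: "S x0 > 0"
        using corner[of x0] x0(1) e S0[of x0] by (auto simp: U_def less_le)
      have B0: "B \<ge> 0" using B x0(1) unfolding U_def by (metis (no_types, lifting) mem_Collect_eq norm_ge_zero order.trans)
      have "norm (F x - F 0) \<le> e + B / S x0 * S x" if x: "x \<in> ?Q" for x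
      proof (cases "x \<in> U")
        case True
        have "B * S x0 \<le> B * S x" using x0(2)[OF True] B0 by (rule mult_left_mono)
        then have "B \<le> B / S x0 * S x" using s by (simp add: field_simps)
        then show ?thesis using B[OF x] e by linarith
      next
        case False
        then have "norm (F x - F 0) \<le> e" using x by (auto simp: U_def)
        then show ?thesis using B0 S0[of x] s by (simp add: add_increasing2)
      qed
      then show ?thesis using B0 s by (intro exI[of _ "B / S x0"]) auto
    qed
  qed
  have one: "has_bochner_integral lborel (\<lambda>x::real^'n. indicator unit_cube x *\<^sub>R fejer_kernel m x) 1" if m: "m > 0" for m
  proof -
    have "has_bochner_integral lborel (\<lambda>x::real^'n. Re (indicator unit_cube x *\<^sub>R (torus_char 0 x * fejer_kernel m x))) (Re (fejer_weight m (- 0 :: int^'n)))"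
      by (rule has_bochner_integral_Re[OF integral_fejer_unit_cube[OF m]])
    then show ?thesis using m by (simp add: fejer_weight_0)
  qed
  define r where "r m = (\<Sum>i\<in>UNIV. 1/2 - (fejer_weight m (axis i 1 :: int^'n) + fejer_weight m (- axis i 1)) / 4)" for m
  have sinint: "has_bochner_integral lborel (\<lambda>x::real^'n. indicator unit_cube x *\<^sub>R (S x * fejer_kernel m x)) (r m)" if m: "m > 0" for m
  proof -
    have eq: "indicator unit_cube x *\<^sub>R (S x * fejer_kernel m x) = (\<Sum>i\<in>UNIV. Re (indicator unit_cube x *\<^sub>R (torus_char 0 x * fejer_kernel m x)) / 2 -
      (Re (indicator unit_cube x *\<^sub>R (torus_char (axis i 1) x * fejer_kernel m x)) + Re (indicator unit_cube x *\<^sub>R (torus_char (- axis i 1) x * fejer_kernel m x))) / 4)" for x :: "real^'n"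
    proof -
      have "(sin (pi * x $ i))\<^sup>2 = Re (1/2 - (torus_char (axis i 1) x + torus_char (- axis i 1) x) / 4)" for i
        unfolding sin_square_torus_char[symmetric] by simp
      then have sn: "(sin (pi * x $ i))\<^sup>2 = 1/2 - (Re (torus_char (axis i 1) x) + Re (torus_char (- axis i 1) x)) / 4" for i
        by simp
      show ?thesis unfolding S_def sn
        by (cases "x \<in> unit_cube") (auto simp: sum_distrib_right intro!: sum.cong, simp add: field_simps)
    qed
    have "has_bochner_integral lborel (\<lambda>x::real^'n. indicator unit_cube x *\<^sub>R (S x * fejer_kernel m x))
       (\<Sum>i\<in>UNIV. Re (fejer_weight m (- 0 :: int^'n)) / 2 - (Re (fejer_weight m (- axis i 1 :: int^'n)) + Re (fejer_weight m (- (- axis i 1) :: int^'n))) / 4)"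
      unfolding eq
      by (intro has_bochner_integral_sum has_bochner_integral_diff has_bochner_integral_divide_zero has_bochner_integral_add
          has_bochner_integral_Re[OF integral_fejer_unit_cube[OF m]])
    then show ?thesis using m by (simp add: fejer_weight_0 r_def add.commute)
  qed
  have rlim: "r \<longlonglongrightarrow> 0"
  proof -
    have "r \<longlonglongrightarrow> (\<Sum>i\<in>(UNIV::'n set). 1/2 - (1 + 1) / 4)"
      unfolding r_def by (intro tendsto_intros fejer_weight_tendsto) auto
    then show ?thesis by simp
  qed
  have contFm: "(\<lambda>x. indicator unit_cube x *\<^sub>R F x) \<in> borel_measurable borel"
  proof -
    have "(\<lambda>x. indicator ?Q x *\<^sub>R F x) \<in> borel_measurable borel"
      by (rule borel_measurable_continuous_on_indicator) (auto intro: contF)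
    then have "(\<lambda>x. indicat_real unit_cube x *\<^sub>R (indicat_real ?Q x *\<^sub>R F x)) \<in> borel_measurable borel" by measurable
    moreover have "indicat_real unit_cube x *\<^sub>R (indicat_real ?Q x *\<^sub>R F x) = indicat_real unit_cube x *\<^sub>R F x" for x
      using cubeQ[of x] by (auto simp: indicator_def)
    ultimately show ?thesis by (simp only:)
  qed
  have lim2: "I \<longlonglongrightarrow> F 0"
  proof (rule LIMSEQ_I)
    fix e :: real assume e: "e > 0"
    obtain C where C: "C \<ge> 0" "\<And>x. x \<in> ?Q \<Longrightarrow> norm (F x - F 0) \<le> e/2 + C * S x"
      using bound[of "e/2"] e by auto
    have "(\<lambda>m. C * r m) \<longlonglongrightarrow> C * 0" by (intro tendsto_intros rlim)
    then have ev: "\<forall>\<^sub>F m in sequentially. C * r m < e/2" using e by (intro order_tendstoD) auto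
    have le: "norm (I m - F 0) \<le> e/2 + C * r m" if m: "m > 0" for m
    proof -
      let ?w = "\<lambda>x::real^'n. indicat_real unit_cube x *\<^sub>R fejer_kernel m x"
      have dom: "has_bochner_integral lborel (\<lambda>x. e/2 * ?w x + C * (indicator unit_cube x *\<^sub>R (S x * fejer_kernel m x))) (e/2 * 1 + C * r m)"
        by (intro has_bochner_integral_add has_bochner_integral_mult_right one sinint m)
      have w1: "has_bochner_integral lborel (\<lambda>x. F 0 * complex_of_real (?w x)) (F 0 * complex_of_real 1)"
        by (intro has_bochner_integral_mult_right has_bochner_integral_of_real one m)
      have le: "norm (indicator unit_cube x *\<^sub>R ((F x - F 0) * fejer_kernel m x)) \<le> e/2 * ?w x + C * (indicator unit_cube x *\<^sub>R (S x * fejer_kernel m x))" for x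
      proof (cases "x \<in> unit_cube")
        case True
        have "norm ((F x - F 0) * fejer_kernel m x) = norm (F x - F 0) * fejer_kernel m x"
          using fejer_kernel_nonneg[of m x] by (simp add: norm_mult)
        also have "\<dots> \<le> (e/2 + C * S x) * fejer_kernel m x"
          by (intro mult_right_mono C(2) cubeQ True fejer_kernel_nonneg)
        finally show ?thesis using True by (simp add: algebra_simps)
      qed simp
      have mk: "(\<lambda>x. complex_of_real (fejer_kernel m x)) \<in> borel_measurable borel" 
        by (intro borel_measurable_continuous_onI continuous_intros)
      have meas: "(\<lambda>x. indicator unit_cube x *\<^sub>R ((F x - F 0) * fejer_kernel m x)) \<in> borel_measurable borel"
      proof -
        have "(\<lambda>x. (indicat_real unit_cube x *\<^sub>R F x - indicat_real unit_cube x *\<^sub>R F 0) * fejer_kernel m x) \<in> borel_measurable borel"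
          using contFm mk by measurable
        then show ?thesis by (simp add: algebra_simps)
      qed
      have i1: "integrable lborel (\<lambda>x. indicator unit_cube x *\<^sub>R ((F x - F 0) * fejer_kernel m x))"
      proof (rule Bochner_Integration.integrable_bound[OF dom[unfolded has_bochner_integral_iff, THEN conjunct1] _ AE_I2])
        show "norm (indicator unit_cube x *\<^sub>R ((F x - F 0) * fejer_kernel m x)) \<le> norm (e/2 * ?w x + C * (indicator unit_cube x *\<^sub>R (S x * fejer_kernel m x)))" for x
          unfolding real_norm_def[of "_ + _"] by (rule order.trans[OF le abs_ge_self])
      qed (use meas in simp)
      have "I m - F 0 = (\<integral>x. indicator unit_cube x *\<^sub>R ((F x - F 0) * fejer_kernel m x) \<partial>lborel)"
      proof -
        have "(\<integral>x. indicator unit_cube x *\<^sub>R ((F x - F 0) * fejer_kernel m x) + F 0 * complex_of_real (?w x) \<partial>lborel) =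
          (\<integral>x. indicator unit_cube x *\<^sub>R ((F x - F 0) * fejer_kernel m x) \<partial>lborel) + F 0"
          using i1 w1 by (subst Bochner_Integration.integral_add) (auto simp: has_bochner_integral_iff)
        moreover have "indicator unit_cube x *\<^sub>R ((F x - F 0) * fejer_kernel m x) + F 0 * complex_of_real (?w x) = indicator unit_cube x *\<^sub>R (F x * fejer_kernel m x)" for x
          by (simp add: algebra_simps indicator_def)
        ultimately show ?thesis unfolding I2 by simp
      qed
      also have "norm \<dots> \<le> (\<integral>x. e/2 * ?w x + C * (indicator unit_cube x *\<^sub>R (S x * fejer_kernel m x)) \<partial>lborel)"
        by (intro order.trans[OF integral_norm_bound integral_mono] integrable_norm i1 le dom[unfolded has_bochner_integral_iff, THEN conjunct1])
      also have "\<dots> = e/2 + C * r m" using dom by (simp add: has_bochner_integral_iff)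
      finally show ?thesis .
    qed
    have "\<forall>\<^sub>F m in sequentially. norm (I m - F 0) < e"
      using ev eventually_gt_at_top[of 0]
    proof eventually_elim
      case (elim m)
      then show ?case using le[of m] by linarith
    qed
    then show "\<exists>no. \<forall>n\<ge>no. norm (I n - F 0) < e" by (simp add: eventually_sequentially)
  qed
  show ?thesis using LIMSEQ_unique[OF lim2 lim1] by (simp add: F_def)
qed

section \<open>Poisson summation for Gaussians\<close>

text \<open>A theta summand in diagonal coordinates: t holds one modular parameter for each
  coordinate, b is the elliptic variable.\<close>

definition gexp :: "('n::finite \<Rightarrow> complex) \<Rightarrow> ('n \<Rightarrow> complex) \<Rightarrow> real^'n \<Rightarrow> complex" where
  "gexp t b y = exp (\<Sum>i\<in>UNIV. pi * \<i> * t i * (y $ i)\<^sup>2 + 2 * pi * \<i> * b i * y $ i)"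

lemma gexp_prod: "gexp t b y = (\<Prod>i\<in>UNIV. exp (- (pi * (- \<i> * t i) * (y $ i)\<^sup>2) + 2 * pi * \<i> * b i * y $ i))"
  by (simp add: gexp_def exp_sum algebra_simps)

lemma continuous_on_gexp [continuous_intros]:
  assumes "continuous_on A u" shows "continuous_on A (\<lambda>x. gexp t b (u x))"
  unfolding gexp_def by (intro continuous_intros assms)

lemma gexp_norm_le:
  fixes t b :: "'n::finite \<Rightarrow> complex"
  assumes "\<And>i. Im (t i) > 0"
  shows "\<exists>e>0. \<exists>C\<ge>0. \<forall>y. norm (gexp t b y) \<le> exp (- e * (norm y)\<^sup>2 + C * norm y)"
proof -
  define p where "p = Min (range (\<lambda>i. Im (t i)))"
  have p: "p > 0" "\<And>i. p \<le> Im (t i)" using assms by (auto simp: p_def)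
  define C where "C = (\<Sum>i\<in>UNIV. 2 * pi * norm (b i))"
  have "norm (gexp t b y) \<le> exp (- (pi * p) * (norm y)\<^sup>2 + C * norm y)" for y
  proof -
    have n: "(norm y)\<^sup>2 = (\<Sum>i\<in>UNIV. (y $ i)\<^sup>2)"
      unfolding power2_norm_eq_inner inner_vec_def by (simp add: power2_eq_square)
    have "norm (gexp t b y) = exp (\<Sum>i\<in>UNIV. - (pi * Im (t i) * (y $ i)\<^sup>2) - 2 * pi * Im (b i) * y $ i)"
      unfolding gexp_def norm_exp_eq_Re Re_sum by (simp flip: of_real_power)
    also have "\<dots> \<le> exp (\<Sum>i\<in>UNIV. - (pi * p) * (y $ i)\<^sup>2 + 2 * pi * norm (b i) * norm y)"
      unfolding exp_le_cancel_iff
    proof (intro sum_mono)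
      fix i
      have "pi * p * (y $ i)\<^sup>2 \<le> pi * Im (t i) * (y $ i)\<^sup>2" using p(2) by (intro mult_right_mono mult_left_mono) auto
      moreover have "- (Im (b i) * y $ i) \<le> norm (b i) * norm y"
      proof -
        have "\<bar>Im (b i)\<bar> * \<bar>y $ i\<bar> \<le> norm (b i) * norm y"
          by (intro mult_mono abs_Im_le_cmod component_le_norm_cart) auto
        then show ?thesis using abs_ge_minus_self[of "Im (b i) * y $ i"] by (simp add: abs_mult)
      qed
      then have "2 * pi * (- (Im (b i) * y $ i)) \<le> 2 * pi * (norm (b i) * norm y)" by (intro mult_left_mono) auto
      then have "- (2 * pi * Im (b i) * y $ i) \<le> 2 * pi * norm (b i) * norm y" by (simp only: mult.assoc mult_minus_right)
      moreover have "- (pi * p) * (y $ i)\<^sup>2 = - (pi * p * (y $ i)\<^sup>2)" by simp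
      ultimately show "- (pi * Im (t i) * (y $ i)\<^sup>2) - 2 * pi * Im (b i) * y $ i \<le> - (pi * p) * (y $ i)\<^sup>2 + 2 * pi * norm (b i) * norm y"
        by linarith
    qed
    also have "\<dots> = exp (- (pi * p) * (norm y)\<^sup>2 + C * norm y)"
      unfolding n C_def by (simp add: sum_subtractf sum_negf sum_distrib_left sum_distrib_right)
    finally show ?thesis .
  qed
  moreover have "C \<ge> 0" unfolding C_def by (intro sum_nonneg) auto
  ultimately show ?thesis using p by (intro exI[of _ "pi * p"]) auto
qed

lemma gexp_linear_norm_le:
  fixes t b :: "'n::finite \<Rightarrow> complex" and R R' :: "real^'n^'n"
  assumes "\<And>i. Im (t i) > 0" and R: "R' ** R = mat 1"
  shows "\<exists>e>0. \<exists>C\<ge>0. \<forall>x. norm (gexp t b (R *v x)) \<le> exp (- e * (norm x)\<^sup>2 + C * norm x)"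
proof -
  obtain e C where e: "e > 0" "C \<ge> 0" "\<And>y. norm (gexp t b y) \<le> exp (- e * (norm y)\<^sup>2 + C * norm y)"
    using gexp_norm_le[of t b] assms by blast
  obtain K where K: "K > 0" "\<And>x. norm (R *v x) \<le> norm x * K"
    using bounded_linear.pos_bounded[OF matrix_vector_mul_bounded_linear] by blast
  obtain K' where K': "K' > 0" "\<And>x. norm (R' *v x) \<le> norm x * K'"
    using bounded_linear.pos_bounded[OF matrix_vector_mul_bounded_linear] by blast
  have "norm (gexp t b (R *v x)) \<le> exp (- (e / K'\<^sup>2) * (norm x)\<^sup>2 + (C * K) * norm x)" for x
  proof -
    have "R' *v (R *v x) = x" by (simp add: matrix_vector_mul_assoc R)
    then have "norm x \<le> norm (R *v x) * K'" using K'(2)[of "R *v x"] by simp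
    then have "(norm x)\<^sup>2 \<le> (norm (R *v x) * K')\<^sup>2" by (intro power_mono) auto
    then have "(norm x)\<^sup>2 / K'\<^sup>2 \<le> (norm (R *v x))\<^sup>2" using K'(1) by (simp add: field_simps power_mult_distrib)
    then have "e * ((norm x)\<^sup>2 / K'\<^sup>2) \<le> e * (norm (R *v x))\<^sup>2" using e(1) by (intro mult_left_mono) auto
    moreover have "C * norm (R *v x) \<le> C * (norm x * K)" using K(2) e(2) by (intro mult_left_mono)
    ultimately show ?thesis using e(3)[of "R *v x"] by (intro order.trans[OF e(3)]) (simp add: algebra_simps)
  qed
  then show ?thesis using e K K' by (intro exI[of _ "e / K'\<^sup>2"] conjI exI[of _ "C * K"]) auto
qed

lemma integrable_gaussian_bound:
  fixes e C :: real assumes e: "e > 0"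
  shows "integrable lborel (\<lambda>x::real^'n. exp (- e * (norm x)\<^sup>2 + C * norm x))"
proof -
  define p where "p = e / (2 * pi)"
  have p: "p > 0" using e by (simp add: p_def)
  have g: "exp (- (e/2) * (norm x)\<^sup>2) = norm (\<Prod>i\<in>UNIV. complex_of_real (exp (- (pi * p * (x $ i)\<^sup>2))))" for x :: "real^'n"
  proof -
    have "(norm x)\<^sup>2 = (\<Sum>i\<in>UNIV. (x $ i)\<^sup>2)"
      unfolding power2_norm_eq_inner inner_vec_def by (simp add: power2_eq_square)
    then have "- (e/2) * (norm x)\<^sup>2 = (\<Sum>i\<in>UNIV. - (pi * p * (x $ i)\<^sup>2))"
      by (simp add: p_def sum_distrib_left sum_negf)
    then have "exp (- (e/2) * (norm x)\<^sup>2) = (\<Prod>i\<in>UNIV. exp (- (pi * p * (x $ i)\<^sup>2)))" by (simp only: exp_sum finite)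
    also have "\<dots> = norm (\<Prod>i\<in>UNIV. complex_of_real (exp (- (pi * p * (x $ i)\<^sup>2))))"
      by (simp add: prod_norm[symmetric])
    finally show ?thesis .
  qed
  have i: "integrable lborel (\<lambda>x::real^'n. exp (- (e/2) * (norm x)\<^sup>2))"
    unfolding g by (intro integrable_norm integral_vec_prod(1) integrable_of_real integrable_real_gaussian p)
  have cm: "(\<lambda>x::real^'n. exp (- e * (norm x)\<^sup>2 + C * norm x)) \<in> borel_measurable lborel"
    by measurable
  show ?thesis
  proof (rule Bochner_Integration.integrable_bound[OF integrable_mult_right[OF i, of "exp (C\<^sup>2 / (4 * (e/2)))"] cm AE_I2])
    fix x :: "real^'n"
    have "- (e/2) * (norm x)\<^sup>2 + C * norm x \<le> C\<^sup>2 / (4 * (e/2))" by (rule linear_minus_square_le) (use e in simp)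
    then have "- e * (norm x)\<^sup>2 + C * norm x \<le> C\<^sup>2 / (4 * (e/2)) + - (e/2) * (norm x)\<^sup>2" by (simp add: algebra_simps)
    then have "exp (- e * (norm x)\<^sup>2 + C * norm x) \<le> exp (C\<^sup>2 / (4 * (e/2)) + - (e/2) * (norm x)\<^sup>2)" by (simp only: exp_le_cancel_iff)
    then show "norm (exp (- e * (norm x)\<^sup>2 + C * norm x)) \<le> norm (exp (C\<^sup>2 / (4 * (e/2))) * exp (- (e/2) * (norm x)\<^sup>2))"
      unfolding exp_add by simp
  qed
qed

lemma integrable_gexp_linear:
  fixes t b :: "'n::finite \<Rightarrow> complex" and R R' :: "real^'n^'n"
  assumes "\<And>i. Im (t i) > 0" and R: "R' ** R = mat 1"
  shows "integrable lborel (\<lambda>x. gexp t b (R *v x))"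
proof -
  obtain e C where e: "e > 0" "\<And>x. norm (gexp t b (R *v x)) \<le> exp (- e * (norm x)\<^sup>2 + C * norm x)"
    using gexp_linear_norm_le[where t=t and b=b, OF assms] by blast
  show ?thesis
  proof (rule Bochner_Integration.integrable_bound[OF integrable_gaussian_bound[OF e(1)] _ AE_I2])
    show "(\<lambda>x. gexp t b (R *v x)) \<in> borel_measurable lborel"
      by (simp, intro borel_measurable_continuous_onI continuous_intros)
  qed (use e(2) in simp)
qed

lemma integral_gexp:
  fixes t b :: "'n::finite \<Rightarrow> complex"
  assumes "\<And>i. Im (t i) > 0"
  shows "(\<integral>y. gexp t b y \<partial>lborel) = (\<Prod>i\<in>UNIV. exp (- (pi * \<i> * (b i)\<^sup>2 / t i)) / csqrt (- \<i> * t i))"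
proof -
  have h: "has_bochner_integral lborel (\<lambda>y::real. exp (- (pi * (- \<i> * t i) * y\<^sup>2) + 2 * pi * \<i> * b i * y))
      (exp (- (pi * (b i)\<^sup>2 / (- \<i> * t i))) / csqrt (- \<i> * t i))" for i
    using assms by (intro gaussian_integral_complex) auto
  have eq: "- (pi * (b i)\<^sup>2 / (- \<i> * t i)) = - (pi * \<i> * (b i)\<^sup>2 / t i)" for i
  proof -
    have "t i \<noteq> 0" using assms[of i] by auto
    then show ?thesis by (simp add: field_simps)
  qed
  have "(\<integral>y. gexp t b y \<partial>lborel) = (\<Prod>i\<in>UNIV. \<integral>y. exp (- (pi * (- \<i> * t i) * (y::real)\<^sup>2) + 2 * pi * \<i> * b i * y) \<partial>lborel)"
    unfolding gexp_prod using h by (intro integral_vec_prod(2)) (simp only: has_bochner_integral_iff)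
  also have "\<dots> = (\<Prod>i\<in>UNIV. exp (- (pi * \<i> * (b i)\<^sup>2 / t i)) / csqrt (- \<i> * t i))"
    using h unfolding has_bochner_integral_iff eq by simp
  finally show ?thesis .
qed

text \<open>The integral of exp(- pi |Rx|^2), that is 1/|det R|. It cancels between the two uses of
  Poisson summation in the theta law.\<close>

definition gauss_covolume :: "real^'n^'n \<Rightarrow> complex" where
  "gauss_covolume R = (\<integral>x. gexp (\<lambda>_. \<i>) (\<lambda>_. 0) (R *v x) \<partial>lborel)"

text \<open>The effect of x -> Rx is compared on the given Gaussian and on the standard one, which
  is even and has integral 1.\<close>

lemma integral_gexp_linear:
  fixes t b :: "'n::finite \<Rightarrow> complex" and R R' :: "real^'n^'n"
  assumes t: "\<And>i. Im (t i) > 0" and R: "R' ** R = mat 1" "R ** R' = mat 1"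
  shows "(\<integral>x. gexp t b (R *v x) \<partial>lborel) = gauss_covolume R * (\<Prod>i\<in>UNIV. exp (- (pi * \<i> * (b i)\<^sup>2 / t i)) / csqrt (- \<i> * t i))"
proof -
  let ?g = "gexp (\<lambda>_. \<i>) (\<lambda>_. 0) :: real^'n \<Rightarrow> complex"
  have one: "mat 1 ** mat 1 = (mat 1 :: real^'n^'n)" by simp
  have "(\<integral>x. gexp t b x \<partial>lborel) * (\<integral>x. ?g (R *v x) \<partial>lborel) = (\<integral>x. gexp t b (R *v x) \<partial>lborel) * (\<integral>x. ?g x \<partial>lborel)"
  proof (rule integral_linear_substitution[where R'="\<lambda>x. R' *v x"])
    show "?g (- x) = ?g x" for x by (simp add: gexp_def)
    show "integrable lborel (gexp t b)" "integrable lborel ?g"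
      using integrable_gexp_linear[OF _ one, of t b] integrable_gexp_linear[OF _ one, of "\<lambda>_. \<i>" "\<lambda>_. 0"] t by simp_all
    show "integrable lborel (\<lambda>x. gexp t b (R *v x))" "integrable lborel (\<lambda>x. ?g (R *v x))"
      using t by (auto intro!: integrable_gexp_linear[OF _ R(1)])
  qed (auto intro!: continuous_intros simp: matrix_vector_mul_assoc R)
  moreover have "(\<integral>x. ?g x \<partial>lborel) = 1" by (subst integral_gexp) auto
  ultimately show ?thesis by (simp add: gauss_covolume_def integral_gexp[OF t] mult.commute)
qed

lemma gauss_covolume_scale:
  fixes R :: "real^'n^'n"
  assumes c: "c > 0"
  shows "gauss_covolume (c *\<^sub>R R) = gauss_covolume R / c ^ CARD('n)"
proof -
  let ?F = "\<lambda>x. gexp (\<lambda>_. \<i>) (\<lambda>_. 0) (R *v x)"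
  have [measurable]: "?F \<in> borel_measurable borel" by (intro borel_measurable_continuous_onI continuous_intros)
  have "(\<integral>x. ?F x \<partial>lborel) = (\<integral>x. ?F x \<partial>density (distr lborel borel (\<lambda>x::real^'n. 0 + c *\<^sub>R x)) (\<lambda>_. ennreal (\<bar>c\<bar>^DIM(real^'n))))"
    using c by (subst lborel_affine[of c 0]) auto
  also have "\<dots> = \<bar>c\<bar>^DIM(real^'n) *\<^sub>R (\<integral>x. ?F (c *\<^sub>R x) \<partial>lborel)"
    by (subst integral_density) (auto simp: integral_distr)
  also have "(\<lambda>x. ?F (c *\<^sub>R x)) = (\<lambda>x. gexp (\<lambda>_. \<i>) (\<lambda>_. 0) ((c *\<^sub>R R) *v x))"
    by (simp add: scaleR_matrix_vector_assoc matrix_vector_mult_scaleR)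
  finally show ?thesis using c by (simp add: gauss_covolume_def scaleR_conv_of_real)
qed

lemma summable_on_gexp:
  fixes t b :: "'n::finite \<Rightarrow> complex" and R R' :: "real^'n^'n"
  assumes "\<And>i. Im (t i) > 0" and R: "R' ** R = mat 1"
  shows "(\<lambda>l. norm (gexp t b (R *v rvec l))) summable_on UNIV"
proof -
  obtain e C where e: "e > 0" "\<And>x. norm (gexp t b (R *v x)) \<le> exp (- e * (norm x)\<^sup>2 + C * norm x)"
    using gexp_linear_norm_le[where t=t and b=b, OF assms] by blast
  show ?thesis by (rule summable_on_comparison_test[OF summable_on_gaussian[OF e(1)]]) (use e(2) in auto)
qed

text \<open>Expanding the square turns the dual term into a constant times a Gaussian with
  parameters -1/t, and -1/t is again in the upper half-plane.\<close>

lemma summable_on_gexp_dual: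
  fixes t b :: "'n::finite \<Rightarrow> complex" and R R' :: "real^'n^'n"
  assumes t: "\<And>i. Im (t i) > 0" and R: "R' ** R = mat 1"
  shows "(\<lambda>k. norm (exp (\<Sum>i\<in>UNIV. - (pi * \<i> * (b i + (transpose R' *v rvec k) $ i)\<^sup>2 / t i)))) summable_on UNIV"
proof -
  have t0: "t i \<noteq> 0" for i using t[of i] by auto
  have "norm (exp (\<Sum>i\<in>UNIV. - (pi * \<i> * (b i + (transpose R' *v rvec k) $ i)\<^sup>2 / t i))) = norm (exp (\<Sum>i\<in>UNIV. - (pi * \<i> * (b i)\<^sup>2 / t i))) *
      norm (gexp (\<lambda>i. - 1 / t i) (\<lambda>i. - b i / t i) (transpose R' *v rvec k))" for k
  proof -
    have "(\<Sum>i\<in>UNIV. - (pi * \<i> * (b i + (transpose R' *v rvec k) $ i)\<^sup>2 / t i)) = (\<Sum>i\<in>UNIV. - (pi * \<i> * (b i)\<^sup>2 / t i)) +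
      (\<Sum>i\<in>UNIV. pi * \<i> * (- 1 / t i) * ((transpose R' *v rvec k) $ i)\<^sup>2 + 2 * pi * \<i> * (- b i / t i) * (transpose R' *v rvec k) $ i)"
      unfolding sum.distrib[symmetric] using t0 by (intro sum.cong refl) (simp add: field_simps power2_eq_square)
    then show ?thesis unfolding gexp_def norm_mult[symmetric] by (simp add: exp_add mult.assoc)
  qed
  moreover have "(\<lambda>k. norm (gexp (\<lambda>i. - 1 / t i) (\<lambda>i. - b i / t i) (transpose R' *v rvec k))) summable_on UNIV"
  proof (rule summable_on_gexp)
    show "Im (- 1 / t i) > 0" for i using t[of i] t0[of i] by (simp add: Im_divide sum_power2_gt_zero_iff complex_eq_iff)
    show "transpose R ** transpose R' = mat 1"
      by (metis R matrix_transpose_mul transpose_mat)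
  qed
  ultimately show ?thesis by (simp add: summable_on_cmult_right)
qed

theorem gexp_poisson:
  fixes t b :: "'n::finite \<Rightarrow> complex" and R R' :: "real^'n^'n"
  assumes t: "\<And>i. Im (t i) > 0" and R: "R' ** R = mat 1" "R ** R' = mat 1"
  shows "(\<Sum>\<^sub>\<infinity>l. gexp t b (R *v rvec l)) = gauss_covolume R / (\<Prod>i\<in>UNIV. csqrt (- \<i> * t i)) *
     (\<Sum>\<^sub>\<infinity>k. exp (\<Sum>i\<in>UNIV. - (pi * \<i> * (b i + (transpose R' *v rvec k) $ i)\<^sup>2 / t i)))"
proof -
  define fhat where "fhat k = gauss_covolume R / (\<Prod>i\<in>UNIV. csqrt (- \<i> * t i)) *
     exp (\<Sum>i\<in>UNIV. - (pi * \<i> * (b i + (transpose R' *v rvec k) $ i)\<^sup>2 / t i))" for k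
  obtain e C where e: "e > 0" "C \<ge> 0" "\<And>x. norm (gexp t b (R *v x)) \<le> exp (- e * (norm x)\<^sup>2 + C * norm x)"
    using gexp_linear_norm_le[where t=t and b=b, OF t R(1)] by blast
  define a where "a = real CARD('n)"
  have "(\<Sum>\<^sub>\<infinity>l. gexp t b (R *v rvec l)) = (\<Sum>\<^sub>\<infinity>k. fhat k)"
  proof (rule poisson_summation[where M="\<lambda>l. exp (e * a\<^sup>2 + C * a) * exp (- (e/2) * (norm (rvec l))\<^sup>2 + C * norm (rvec l))"])
    fix x :: "real^'n" and l :: "int^'n" assume x: "x \<in> cbox 0 (\<chi> i. 1)"
    have "norm x \<le> (\<Sum>i\<in>UNIV. \<bar>x $ i\<bar>)" by (rule norm_le_l1_cart)
    also have "\<dots> \<le> (\<Sum>i\<in>(UNIV::'n set). 1)" using x by (intro sum_mono) (auto simp: mem_box_cart)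
    finally have nx: "norm x \<le> a" by (simp add: a_def)
    \<comment> \<open>A shift by a vector of the unit cube, whose norm is at most a = n, costs half
      of the quadratic decay and a constant.\<close>
    have lo: "(norm (rvec l))\<^sup>2 / 2 - a\<^sup>2 \<le> (norm (x + rvec l))\<^sup>2"
    proof -
      have "norm (rvec l) \<le> norm (x + rvec l) + norm x" using norm_triangle_ineq4[of "x + rvec l" x] by simp
      also have "\<dots> \<le> norm (x + rvec l) + a" using nx by simp
      finally have "(norm (rvec l))\<^sup>2 \<le> (norm (x + rvec l) + a)\<^sup>2" by (intro power_mono) auto
      moreover have "(norm (x + rvec l) + a)\<^sup>2 \<le> 2 * (norm (x + rvec l))\<^sup>2 + 2 * a\<^sup>2"
        using sum_squares_bound[of "norm (x + rvec l)" a] by (simp add: power2_sum)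
      ultimately show ?thesis by simp
    qed
    have hi: "norm (x + rvec l) \<le> a + norm (rvec l)" using norm_triangle_ineq[of x "rvec l"] nx by simp
    have "e * ((norm (rvec l))\<^sup>2 / 2 - a\<^sup>2) \<le> e * (norm (x + rvec l))\<^sup>2" using lo e by simp
    moreover have "C * norm (x + rvec l) \<le> C * (a + norm (rvec l))" using hi e by (intro mult_left_mono)
    ultimately have "- e * (norm (x + rvec l))\<^sup>2 + C * norm (x + rvec l) \<le> (e * a\<^sup>2 + C * a) + (- (e/2) * (norm (rvec l))\<^sup>2 + C * norm (rvec l))"
      by (simp add: algebra_simps)
    then show "norm (gexp t b (R *v (x + rvec l))) \<le> exp (e * a\<^sup>2 + C * a) * exp (- (e/2) * (norm (rvec l))\<^sup>2 + C * norm (rvec l))"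
      unfolding exp_add[symmetric] by (intro order.trans[OF e(3)]) (simp only: exp_le_cancel_iff)
  next
    show "(\<lambda>l. exp (e * a\<^sup>2 + C * a) * exp (- (e/2) * (norm (rvec l :: real^'n))\<^sup>2 + C * norm (rvec l))) summable_on UNIV"
      using e by (intro summable_on_cmult_right summable_on_gaussian) auto
    fix k :: "int^'n"
    \<comment> \<open>A character in x is a linear exponential in R x with coefficients
      \<open>transpose R' *v rvec k\<close>; multiplying by it only shifts b.\<close>
    have "gexp t b (R *v x) * torus_char k x = gexp t (\<lambda>i. b i + (transpose R' *v rvec k) $ i) (R *v x)" for x
    proof -
      have "rvec k \<bullet> x = rvec k \<bullet> (R' *v (R *v x))" by (simp add: matrix_vector_mul_assoc R)
      also have "\<dots> = (transpose R' *v rvec k) \<bullet> (R *v x)" by (simp add: dot_lmul_matrix)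
      finally have "rvec k \<bullet> x = (\<Sum>i\<in>UNIV. (transpose R' *v rvec k) $ i * (R *v x) $ i)" by (simp add: inner_vec_def)
      then have "torus_char k x = exp (\<Sum>i\<in>UNIV. 2 * pi * \<i> * complex_of_real ((transpose R' *v rvec k) $ i) * (R *v x) $ i)"
        unfolding torus_char_def cis_conv_exp by (simp add: sum_distrib_left mult_ac)
      then show ?thesis unfolding gexp_def exp_add[symmetric] sum.distrib[symmetric]
        by (simp add: exp_add[symmetric] sum.distrib[symmetric] algebra_simps)
    qed
    then show "fhat k = (\<integral>x. gexp t b (R *v x) * torus_char k x \<partial>lborel)"
      by (simp add: integral_gexp_linear[OF t R] fhat_def exp_sum prod_dividef)
  next
    show "(\<lambda>k. norm (fhat k)) summable_on UNIV"
      unfolding fhat_def norm_mult by (intro summable_on_cmult_right summable_on_gexp_dual[OF t R(1)])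
  qed (use integrable_gexp_linear[OF t R(1)] in \<open>auto intro!: continuous_intros\<close>)
  also have "\<dots> = gauss_covolume R / (\<Prod>i\<in>UNIV. csqrt (- \<i> * t i)) *
     (\<Sum>\<^sub>\<infinity>k. exp (\<Sum>i\<in>UNIV. - (pi * \<i> * (b i + (transpose R' *v rvec k) $ i)\<^sup>2 / t i)))"
    unfolding fhat_def by (rule infsum_cmult_right')
  finally show ?thesis .
qed

section \<open>Theta transformation\<close>

lemma rmat_mult_rvec: "rmat A *v rvec w = rvec (A *v w)"
  by (simp add: vec_eq_iff matrix_vector_mult_def map_matrix_def)

lemma symmetric_matrix_inner: "transpose M = M \<Longrightarrow> x \<bullet> (M *v y) = y \<bullet> (M *v x)" for M :: "real^'n^'n"
  by (metis dot_lmul_matrix inner_commute matrix_transpose_mul transpose_matrix_vector vector_transpose_matrix)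

lemma inner_matrix_transpose: "(M *v x) \<bullet> y = x \<bullet> (transpose M *v y)" for M :: "real^'n^'m"
  by (metis dot_lmul_matrix inner_commute transpose_matrix_vector)

lemma scaleR_matrix_mult: "(a *\<^sub>R M) ** (b *\<^sub>R N) = (a * b) *\<^sub>R (M ** N)" for M :: "real^'n^'m"
  by (simp add: vec_eq_iff matrix_matrix_mult_def sum_distrib_left mult_ac)

lemma transpose_rmat: "transpose (rmat A) = rmat (transpose A)"
  by (simp add: vec_eq_iff transpose_def map_matrix_def)

lemma even_symmetricD: "even_symmetric A \<Longrightarrow> transpose (rmat A) = rmat A"
  by (simp add: transpose_rmat even_symmetric_def)

lemma qf_add: "even_symmetric A \<Longrightarrow> qf A (x + y) = qf A x + x \<bullet> (rmat A *v y) + qf A y"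
  using symmetric_matrix_inner[OF even_symmetricD, of A x y]
  by (simp add: qf_def matrix_vector_right_distrib inner_add_left inner_add_right algebra_simps)

text \<open>The floor changes nothing, as Q is integral on the lattice by evenness; an integer value
  makes the Gauss sums accessible to congruences.\<close>

definition qint :: "int^'n^'n \<Rightarrow> int^'n \<Rightarrow> int" where
  "qint A l = \<lfloor>qf A (rvec l)\<rfloor>"

lemma real_qint: "even_symmetric A \<Longrightarrow> real_of_int (qint A l) = qf A (rvec l)"
  unfolding qint_def by (metis Ints_cases floor_of_int qf_rvec_Ints)

definition idot :: "int^'n \<Rightarrow> int^'n \<Rightarrow> int" where
  "idot x y = (\<Sum>i\<in>UNIV. x $ i * y $ i)"

lemma real_idot: "real_of_int (idot x y) = rvec x \<bullet> rvec y"
  by (simp add: inner_rvec idot_def)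

lemma idot_scale: "idot x (c *s y) = c * idot x y"
  by (simp add: idot_def sum_distrib_left mult_ac)

lemma idot_comm: "idot x y = idot y x" by (simp add: idot_def mult.commute)

lemma qint_add:
  assumes "even_symmetric A"
  shows "qint A (x + y) = qint A x + idot x (A *v y) + qint A y"
proof -
  have "real_of_int (qint A (x + y)) = real_of_int (qint A x + idot x (A *v y) + qint A y)"
    using assms by (simp add: real_qint real_idot qf_add rmat_mult_rvec)
  then show ?thesis by (simp only: of_int_eq_iff)
qed

lemma two_qint:
  assumes "even_symmetric A" shows "2 * qint A x = idot x (A *v x)"
proof -
  have "real_of_int (2 * qint A x) = real_of_int (idot x (A *v x))"
    using assms by (simp add: real_qint real_idot qf_def rmat_mult_rvec)
  then show ?thesis by (simp only: of_int_eq_iff)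
qed

lemma matrix_vector_scale: "A *v (c *s x) = c *s (A *v x)" for A :: "int^'n^'m"
  by (simp add: vec_eq_iff matrix_vector_mult_def sum_distrib_left mult_ac)

lemma qint_scale: "even_symmetric A \<Longrightarrow> qint A (c *s x) = c\<^sup>2 * qint A x"
proof -
  assume a: "even_symmetric A"
  have "2 * qint A (c *s x) = 2 * (c\<^sup>2 * qint A x)"
    using two_qint[OF a, of "c *s x"] two_qint[OF a, of x]
    by (simp add: matrix_vector_scale idot_scale idot_comm[of "c *s x"] power2_eq_square)
       (simp add: idot_comm)
  then show ?thesis by simp
qed

definition int_phase :: "int \<Rightarrow> int \<Rightarrow> complex" where
  "int_phase d k = cis (2 * pi * real_of_int k / real_of_int d)"

lemma int_phase_simps [simp]: "int_phase d 0 = 1" "norm (int_phase d k) = 1" "int_phase d k \<noteq> 0"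
  by (simp_all add: int_phase_def)

lemma int_phase_add: "int_phase d (k + l) = int_phase d k * int_phase d l"
  by (simp add: int_phase_def cis_mult add_divide_distrib distrib_left)

lemma int_phase_mult_self [simp]: "d \<noteq> 0 \<Longrightarrow> int_phase d (d * k) = 1"
  using cis_multiple_2pi[of "real_of_int k"] by (simp add: int_phase_def mult.assoc)

lemma int_phase_cong:
  assumes "[k = l] (mod d)" "d \<noteq> 0" shows "int_phase d k = int_phase d l"
proof -
  obtain m where "k = l + d * m" using assms(1) by (metis cong_iff_lin cong_sym)
  then show ?thesis using assms(2) by (simp add: int_phase_add)
qed

lemma bij_residue_box:
  assumes d: "d > 0"
  shows "bij_betw (\<lambda>(g, m). g + d *s m) (int_box (nat d) \<times> UNIV) (UNIV :: (int^'n) set)"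
proof (rule bij_betwI[where g="\<lambda>l. ((\<chi> i. l $ i mod d), (\<chi> i. l $ i div d))"])
  fix x :: "(int^'n) \<times> (int^'n)" assume x: "x \<in> int_box (nat d) \<times> UNIV"
  obtain g m where gm: "x = (g, m)" by (cases x)
  have "0 \<le> g $ i \<and> g $ i < d" for i using x d by (auto simp: gm int_box_def)
  then have "(g $ i + d * m $ i) mod d = g $ i" "(g $ i + d * m $ i) div d = m $ i" for i
    using d by (simp_all add: mod_pos_pos_trivial div_pos_pos_trivial)
  then show "((\<chi> i. (case x of (g, m) \<Rightarrow> g + d *s m) $ i mod d), (\<chi> i. (case x of (g, m) \<Rightarrow> g + d *s m) $ i div d)) = x"
    by (simp add: gm vec_eq_iff)
next
  fix l :: "int^'n"
  show "(case ((\<chi> i. l $ i mod d), (\<chi> i. l $ i div d)) of (g, m) \<Rightarrow> g + d *s m) = l"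
    by (simp add: vec_eq_iff)
qed (use d in \<open>auto simp: int_box_def\<close>)

lemma sum_box_shift:
  fixes F :: "int^'n \<Rightarrow> complex"
  assumes d: "d > 0" and per: "\<And>x m. F (x + d *s m) = F x"
  shows "(\<Sum>g\<in>int_box (nat d). F (g + w)) = (\<Sum>g\<in>int_box (nat d). F g)"
proof -
  define r where "r x = (\<chi> i. x $ i mod d)" for x :: "int^'n"
  have r: "F (r x) = F x" for x
  proof -
    have "x = r x + d *s (\<chi> i. x $ i div d)" by (simp add: r_def vec_eq_iff)
    then show ?thesis using per by metis
  qed
  have box: "g \<in> int_box (nat d) \<longleftrightarrow> (\<forall>i. 0 \<le> g $ i \<and> g $ i < d)" for g :: "int^'n"
    using d by (auto simp: int_box_def)
  have "bij_betw (\<lambda>g. r (g + w)) (int_box (nat d)) (int_box (nat d))"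
  proof (rule bij_betwI[where g="\<lambda>g. r (g - w)"])
    fix g :: "int^'n" assume "g \<in> int_box (nat d)"
    then have "g $ i mod d = g $ i" for i unfolding box by (simp add: mod_pos_pos_trivial)
    then show "r (r (g + w) - w) = g" "r (r (g - w) + w) = g"
      by (simp_all add: r_def vec_eq_iff mod_simps)
  qed (use d in \<open>auto simp: box r_def\<close>)
  then have "(\<Sum>g\<in>int_box (nat d). F (r (g + w))) = (\<Sum>g\<in>int_box (nat d). F g)"
    by (rule sum.reindex_bij_betw)
  then show ?thesis by (simp add: r)
qed

definition gauss_sum :: "int^'n^'n \<Rightarrow> int \<Rightarrow> int \<Rightarrow> complex" where
  "gauss_sum A b d = (\<Sum>g\<in>int_box (nat d). int_phase d (b * qint A g))"

lemma int_phase_qint_periodic: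
  assumes A: "even_symmetric A" and d: "d \<noteq> 0"
  shows "int_phase d (b * qint A (x + d *s m)) = int_phase d (b * qint A x)"
proof (rule int_phase_cong[OF _ d])
  have "qint A (x + d *s m) = qint A x + d * (idot x (A *v m) + d * qint A m)"
    by (simp add: qint_add[OF A] qint_scale[OF A] matrix_vector_scale idot_scale power2_eq_square algebra_simps)
  then have "b * qint A (x + d *s m) = b * qint A x + d * (b * (idot x (A *v m) + d * qint A m))"
    by (simp add: algebra_simps)
  then show "[b * qint A (x + d *s m) = b * qint A x] (mod d)" by (simp add: cong_def)
qed

text \<open>Completing the square modulo \<open>d\<close>; the shift \<open>M k = c A\<^sup>-\<^sup>1 k\<close> is integral.\<close>

lemma twisted_gauss_sum:
  assumes A: "even_symmetric A" and M: "even_symmetric M" and AM: "A ** M = mat c"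
    and det: "a * d - b * c = 1" and d: "d > 0"
  shows "(\<Sum>g\<in>int_box (nat d). int_phase d (b * qint A g - idot g k)) = int_phase d (qint M k) * gauss_sum A b d"
proof -
  define w where "w = M *v k"
  have Aw: "A *v w = c *s k"
    unfolding w_def matrix_vector_mul_assoc AM by (simp add: matrix_vector_mult_def mat_def vec_eq_iff if_distrib if_distribR cong: if_cong)
  have qw: "qint A w = c * qint M k"
  proof -
    have "2 * qint A w = idot w (c *s k)" by (simp add: two_qint[OF A] Aw)
    also have "\<dots> = 2 * (c * qint M k)" using two_qint[OF M, of k] by (simp add: idot_scale w_def idot_comm[of "M *v k"] mult.left_commute)
    finally show ?thesis by simp
  qed
  have "int_phase d (b * qint A g - idot g k) = int_phase d (qint M k) * int_phase d (b * qint A (g + w))" for g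
    unfolding int_phase_add[symmetric]
  proof (rule int_phase_cong)
    \<comment> \<open>As b c is -1 modulo d, the cross term becomes \<open>- idot g k\<close> and
      the constant term cancels \<open>qint M k\<close>.\<close>
    have bc: "b * c = a * d - 1" using det by simp
    have "qint M k + b * qint A (g + w) = qint M k + b * qint A g + (b * c) * (idot g k + qint M k)"
      by (simp add: qint_add[OF A] Aw qw idot_scale algebra_simps)
    also have "\<dots> = b * qint A g - idot g k + d * (a * (idot g k + qint M k))" unfolding bc by (simp add: algebra_simps)
    finally show "[b * qint A g - idot g k = qint M k + b * qint A (g + w)] (mod d)" by (simp add: cong_def)
  qed (use d in simp)
  then have "(\<Sum>g\<in>int_box (nat d). int_phase d (b * qint A g - idot g k)) =
     int_phase d (qint M k) * (\<Sum>g\<in>int_box (nat d). int_phase d (b * qint A (g + w)))"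
    by (simp add: sum_distrib_left)
  also have "(\<Sum>g\<in>int_box (nat d). int_phase d (b * qint A (g + w))) = gauss_sum A b d"
    unfolding gauss_sum_def using d by (intro sum_box_shift int_phase_qint_periodic A) auto
  finally show ?thesis .
qed

text \<open>With t' = t/(d j), the number -i t is the product of -i t', d and j; the point is that
  the principal roots multiply. The candidate s squares to -i t, of positive real part, so s lies
  within angle pi/4 of the real axis, as does u. But s times the conjugate of u is a positive
  multiple of \<open>csqrt j\<close>, whose real part is positive, so s cannot lie on the negative
  side.\<close>

lemma csqrt_upper_half_plane_quotient:
  fixes t j :: complex and c d :: int
  assumes t: "Im t > 0" and d: "d > 0" and j: "j = of_int c * t + of_int d"
  shows "Im (t / (of_int d * j)) = Im t / (norm j)\<^sup>2" "j \<notin> \<real>\<^sub>\<le>\<^sub>0"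
    "csqrt (- \<i> * t) = csqrt (- \<i> * (t / (of_int d * j))) * sqrt (of_int d) * csqrt j"
proof -
  show jn: "j \<notin> \<real>\<^sub>\<le>\<^sub>0"
  proof
    assume "j \<in> \<real>\<^sub>\<le>\<^sub>0"
    then have "Im j = 0" "Re j \<le> 0" by (auto simp: complex_nonpos_Reals_iff)
    then show False using t d by (auto simp: j)
  qed
  then have j0: "j \<noteq> 0" by auto
  show im: "Im (t / (of_int d * j)) = Im t / (norm j)\<^sup>2"
  proof -
    have "t / (of_int d * j) = t * cnj j / (of_int d * of_real ((norm j)\<^sup>2))"
      using j0 d by (simp add: complex_norm_square field_simps del: of_real_power)
    also have "\<dots> = (t * cnj j) / of_real (of_int d * (norm j)\<^sup>2)" by simp
    finally have "Im (t / (of_int d * j)) = Im (t * cnj j) / (of_int d * (norm j)\<^sup>2)" by (simp only: Im_divide_of_real)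
    moreover have "Im (t * cnj j) = of_int d * Im t" by (simp add: j algebra_simps)
    ultimately show ?thesis using d by simp
  qed
  define u where "u = csqrt (- \<i> * (t / (of_int d * j)))"
  define v where "v = csqrt j"
  define s where "s = u * sqrt (of_int d) * v"
  have ref: "\<bar>Im z\<bar> < \<bar>Re z\<bar>" if "Re (z\<^sup>2) > 0" for z :: complex
  proof -
    have "(Im z)\<^sup>2 < (Re z)\<^sup>2" using that by (simp add: Re_power2)
    then show ?thesis by (metis abs_ge_zero power2_abs power2_less_imp_less)
  qed
  have u2: "u\<^sup>2 = - \<i> * (t / (of_int d * j))" by (simp add: u_def)
  have "Re (- \<i> * z) = Im z" for z by simp
  then have "Re (u\<^sup>2) = Im t / (norm j)\<^sup>2" unfolding u2 im[symmetric] .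
  then have "Re (u\<^sup>2) > 0" using t j0 by simp
  then have u: "\<bar>Im u\<bar> < \<bar>Re u\<bar>" by (rule ref)
  have "Re u \<ge> 0" unfolding u_def using csqrt_principal[of "- \<i> * (t / (of_int d * j))"] by linarith
  with u have u': "\<bar>Im u\<bar> < Re u" by simp
  have v: "Re v > 0"
  proof (rule ccontr)
    assume "\<not> Re v > 0"
    then have "Re v = 0" using csqrt_principal[of j] unfolding v_def by linarith
    then have "v\<^sup>2 \<in> \<real>\<^sub>\<le>\<^sub>0" by (simp add: complex_nonpos_Reals_iff Re_power2 Im_power2)
    then show False using jn by (simp add: v_def)
  qed
  have s2: "s\<^sup>2 = - \<i> * t" unfolding s_def power_mult_distrib u2 v_def
    using j0 d by (simp flip: of_real_power)
  have "Re (s\<^sup>2) > 0" unfolding s2 using t by simp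
  then have s: "\<bar>Im s\<bar> < \<bar>Re s\<bar>" by (rule ref)
  have "Re s > 0"
  proof (rule ccontr)
    assume "\<not> Re s > 0"
    with s have sn: "\<bar>Im s\<bar> < - Re s" by linarith
    have "Re (s * cnj u) = Re s * Re u + Im s * Im u" by simp
    also have "\<dots> < 0"
    proof -
      have "Im s * Im u \<le> \<bar>Im s\<bar> * \<bar>Im u\<bar>" by (metis abs_ge_self abs_mult)
      also have "\<dots> \<le> \<bar>Im s\<bar> * Re u" using u' by (intro mult_left_mono) auto
      also have "\<dots> < (- Re s) * Re u" using sn u' by (intro mult_strict_right_mono) auto
      finally show ?thesis by simp
    qed
    finally have neg: "Re (s * cnj u) < 0" .
    have "s * cnj u = of_real ((norm u)\<^sup>2 * sqrt (of_int d)) * v"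
      by (simp add: s_def complex_norm_square mult_ac del: of_real_power)
    then have "Re (s * cnj u) = (norm u)\<^sup>2 * sqrt (of_int d) * Re v" by simp
    then show False using neg v d by (simp add: mult_less_0_iff)
  qed
  then have "csqrt (s\<^sup>2) = s" by (intro csqrt_square) auto
  then show "csqrt (- \<i> * t) = csqrt (- \<i> * (t / (of_int d * j))) * sqrt (of_int d) * csqrt j"
    unfolding s2 by (simp add: s_def u_def v_def)
qed

text \<open>A frame: the columns of P are orthogonal for A with values \<open>sg\<close> of the
  form, and R gives the coordinates. Every signature is allowed because the definite one-dimensional
  case is needed besides the Lorentzian one.\<close>

locale diag_form =
  fixes A :: "int^'n^'n" and P R :: "real^'n^'n" and sg :: "'n \<Rightarrow> real"
  assumes ev: "even_symmetric A"
    and PR: "P ** R = mat 1" "R ** P = mat 1"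
    and diag: "transpose P ** rmat A ** P = (\<chi> i j. if i = j then sg i else 0)"
    and sg: "sg i = 1 \<or> sg i = - 1"
begin

text \<open>t on the positive directions and minus its conjugate on the negative ones. The imaginary
  part is Im t in all of them, which replaces Q by its majorant, while the real part keeps the signs
  and still multiplies Q.\<close>

definition sgt :: "complex \<Rightarrow> 'n \<Rightarrow> complex" where
  "sgt t i = (if sg i = 1 then t else - cnj t)"

definition Th :: "complex \<Rightarrow> ('n \<Rightarrow> complex) \<Rightarrow> complex" where
  "Th t b = (\<Sum>\<^sub>\<infinity>l. gexp (sgt t) b (R *v rvec l))"

lemma Im_sgt: "Im t > 0 \<Longrightarrow> Im (sgt t i) > 0" by (simp add: sgt_def)

lemma diag_mult_vec: "(\<chi> i j. if i = j then sg i else 0) *v y = (\<chi> i. sg i * y $ i)"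
  by (simp add: vec_eq_iff matrix_vector_mult_def if_distrib if_distribR cong: if_cong)

lemma bil_diag: "bil A x y = (\<Sum>i\<in>UNIV. sg i * (R *v x) $ i * (R *v y) $ i)"
proof -
  have x: "x = P *v (R *v x)" and y: "y = P *v (R *v y)" by (simp_all add: matrix_vector_mul_assoc PR)
  have "bil A x y = (P *v (R *v x)) \<bullet> (rmat A *v (P *v (R *v y)))" unfolding bil_def using x y by simp
  also have "\<dots> = (R *v x) \<bullet> ((transpose P ** rmat A ** P) *v (R *v y))"
    unfolding matrix_vector_mul_assoc[symmetric] inner_matrix_transpose ..
  also have "\<dots> = (\<Sum>i\<in>UNIV. sg i * (R *v x) $ i * (R *v y) $ i)"
    unfolding diag diag_mult_vec inner_vec_def by (simp add: mult_ac)
  finally show ?thesis .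
qed

lemma qf_diag: "qf A x = (\<Sum>i\<in>UNIV. sg i * ((R *v x) $ i)\<^sup>2) / 2"
  using bil_diag[of x x] by (simp add: qf_def bil_def power2_eq_square mult.assoc)

lemma inverse_diag: "rmat A ** (P ** (\<chi> i j. if i = j then sg i else 0) ** transpose P) = mat 1"
proof -
  let ?D = "(\<chi> i j. if i = j then sg i else 0) :: real^'n^'n"
  have ss: "sg i * sg i = 1" for i using sg[of i] by auto
  have DD: "?D ** ?D = mat 1"
  proof -
    have "(\<Sum>k\<in>UNIV. (if i = k then sg i else 0) * (if k = j then sg k else 0)) = (\<Sum>k\<in>UNIV. if k = i then (if i = j then 1 else 0) else 0)" for i j
      by (intro sum.cong) (auto simp: ss)
    then show ?thesis by (simp add: vec_eq_iff matrix_matrix_mult_def mat_def)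
  qed
  have RP: "transpose R ** transpose P = mat 1" by (metis PR(1) matrix_transpose_mul transpose_mat)
  have "rmat A = transpose R ** (transpose P ** rmat A ** P) ** R"
    by (simp add: matrix_mul_assoc RP) (simp add: matrix_mul_assoc[symmetric] PR)
  then have "rmat A = transpose R ** ?D ** R" unfolding diag .
  then have "rmat A ** (P ** ?D ** transpose P) = transpose R ** ?D ** R ** (P ** ?D ** transpose P)" by (rule arg_cong)
  also have "\<dots> = transpose R ** ?D ** (R ** P) ** ?D ** transpose P" by (simp add: matrix_mul_assoc)
  also have "\<dots> = transpose R ** (?D ** ?D) ** transpose P" by (simp add: PR matrix_mul_assoc)
  also have "\<dots> = mat 1" by (simp add: DD RP)
  finally show ?thesis .
qed

text \<open>M is c times the inverse of A, and that inverse is diagonal with the same signs in the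
  dual coordinates given by the transpose of P.\<close>

lemma dual_form:
  assumes "A ** M = mat c"
  shows "rvec k \<bullet> (rmat M *v rvec k) = c * (\<Sum>i\<in>UNIV. sg i * ((transpose P *v rvec k) $ i)\<^sup>2)"
proof -
  let ?D = "(\<chi> i j. if i = j then sg i else 0) :: real^'n^'n"
  let ?W = "P ** ?D ** transpose P"
  have AM: "rmat A ** rmat M = of_int c *\<^sub>R mat 1"
  proof -
    have "rmat A ** rmat M = rmat (A ** M)" by (simp add: vec_eq_iff matrix_matrix_mult_def map_matrix_def)
    also have "\<dots> = of_int c *\<^sub>R mat 1" unfolding assms by (simp add: vec_eq_iff mat_def map_matrix_def)
    finally show ?thesis .
  qed
  have WA: "?W ** rmat A = mat 1" using inverse_diag matrix_left_right_inverse by blast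
  have "rmat M = ?W ** (rmat A ** rmat M)" by (simp add: matrix_mul_assoc WA)
  also have "\<dots> = of_int c *\<^sub>R ?W" unfolding AM
    by (simp add: vec_eq_iff matrix_matrix_mult_def mat_def if_distrib if_distribR mult_ac sum_distrib_left cong: if_cong)
  finally have 1: "rmat M *v rvec k = of_int c *\<^sub>R (?W *v rvec k)" by (simp add: scaleR_matrix_vector_assoc)
  have 2: "rvec k \<bullet> (?W *v rvec k) = (transpose P *v rvec k) \<bullet> (?D *v (transpose P *v rvec k))"
    unfolding matrix_vector_mul_assoc[symmetric] inner_matrix_transpose transpose_transpose ..
  have 3: "y \<bullet> (?D *v y) = (\<Sum>i\<in>UNIV. sg i * (y $ i)\<^sup>2)" for y :: "real^'n"
    unfolding diag_mult_vec by (simp add: inner_vec_def power2_eq_square mult_ac)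
  show ?thesis unfolding 1 inner_scaleR_right 2 3 ..
qed

lemma Th_summable: "Im t > 0 \<Longrightarrow> (\<lambda>l. norm (gexp (sgt t) b (R *v rvec l))) summable_on UNIV"
  by (rule summable_on_gexp[OF Im_sgt PR(1)])

lemma Th_poisson:
  fixes b :: "'n \<Rightarrow> complex"
  assumes t: "Im t > 0"
  shows "Th t b = gauss_covolume R / (\<Prod>i\<in>UNIV. csqrt (- \<i> * sgt t i)) *
     (\<Sum>\<^sub>\<infinity>k. exp (\<Sum>i\<in>UNIV. - (pi * \<i> * (b i + (transpose P *v rvec k) $ i)\<^sup>2 / sgt t i)))"
  unfolding Th_def by (rule gexp_poisson[OF Im_sgt[OF t] PR])

text \<open>Poisson summation on a dilated and translated lattice: the dilation moves the dual
  points to k/d, and the translation by g survives only as the phase e(-g.k/d).\<close>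

lemma coset_poisson:
  fixes b :: "'n \<Rightarrow> complex"
  assumes t: "Im t > 0" and d: "d > 0"
  shows "(\<Sum>\<^sub>\<infinity>m. gexp (sgt t) b (R *v rvec (g + d *s m))) =
     gauss_covolume R / of_int d ^ CARD('n) / (\<Prod>i\<in>UNIV. csqrt (- \<i> * sgt t i)) *
     (\<Sum>\<^sub>\<infinity>k. int_phase d (- idot g k) * exp (\<Sum>i\<in>UNIV. - (pi * \<i> * (b i + (transpose P *v rvec k) $ i / of_int d)\<^sup>2 / sgt t i)))"
proof -
  define a where "a = R *v rvec g"
  define s where "s = sgt t"
  have s0: "s i \<noteq> 0" for i using Im_sgt[OF t, of i] by (auto simp: s_def)
  define E where "E = exp (\<Sum>i\<in>UNIV. pi * \<i> * s i * (a $ i)\<^sup>2 + 2 * pi * \<i> * b i * a $ i)"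
  have split: "gexp s b (R *v rvec (g + d *s m)) = E * gexp s (\<lambda>i. s i * a $ i + b i) ((of_int d *\<^sub>R R) *v rvec m)" for m
  proof -
    have "rvec (d *s m) = of_int d *\<^sub>R rvec m" by (simp add: vec_eq_iff)
    then have "R *v rvec (g + d *s m) = a + (of_int d *\<^sub>R R) *v rvec m"
      by (simp add: a_def matrix_vector_right_distrib scaleR_matrix_vector_assoc matrix_vector_mult_scaleR)
    then show ?thesis unfolding gexp_def E_def exp_add[symmetric] sum.distrib[symmetric]
      by (simp add: power2_eq_square algebra_simps)
  qed
  have inv: "((1 / of_int d) *\<^sub>R P) ** (of_int d *\<^sub>R R) = mat 1" "(of_int d *\<^sub>R R) ** ((1 / of_int d) *\<^sub>R P) = mat 1"
    using d PR by (simp_all add: scaleR_matrix_mult)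
  have tr: "(transpose ((1 / of_int d) *\<^sub>R P) *v rvec k) $ i = (transpose P *v rvec k) $ i / of_int d" for k i
    by (simp add: transpose_def matrix_vector_mult_def sum_divide_distrib)
  have "(\<Sum>\<^sub>\<infinity>m. gexp s b (R *v rvec (g + d *s m))) = E * (\<Sum>\<^sub>\<infinity>m. gexp s (\<lambda>i. s i * a $ i + b i) ((of_int d *\<^sub>R R) *v rvec m))"
    unfolding split by (rule infsum_cmult_right')
  also have "(\<Sum>\<^sub>\<infinity>m. gexp s (\<lambda>i. s i * a $ i + b i) ((of_int d *\<^sub>R R) *v rvec m)) = 
    gauss_covolume (of_int d *\<^sub>R R) / (\<Prod>i\<in>UNIV. csqrt (- \<i> * s i)) *
     (\<Sum>\<^sub>\<infinity>k. exp (\<Sum>i\<in>UNIV. - (pi * \<i> * (s i * a $ i + b i + (transpose ((1 / of_int d) *\<^sub>R P) *v rvec k) $ i)\<^sup>2 / s i)))"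
    by (rule gexp_poisson[OF _ inv]) (simp add: s_def Im_sgt t)
  also have "E * \<dots> = gauss_covolume R / of_int d ^ CARD('n) / (\<Prod>i\<in>UNIV. csqrt (- \<i> * s i)) *
     (\<Sum>\<^sub>\<infinity>k. E * exp (\<Sum>i\<in>UNIV. - (pi * \<i> * (s i * a $ i + b i + (transpose P *v rvec k) $ i / of_int d)\<^sup>2 / s i)))"
    unfolding tr using d by (simp add: gauss_covolume_scale infsum_cmult_right' mult_ac)
  also have "(\<lambda>k. E * exp (\<Sum>i\<in>UNIV. - (pi * \<i> * (s i * a $ i + b i + (transpose P *v rvec k) $ i / of_int d)\<^sup>2 / s i))) =
     (\<lambda>k. int_phase d (- idot g k) * exp (\<Sum>i\<in>UNIV. - (pi * \<i> * (b i + (transpose P *v rvec k) $ i / of_int d)\<^sup>2 / s i)))"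
  proof
    fix k
    have "rvec g \<bullet> rvec k = (P *v a) \<bullet> rvec k" by (simp add: a_def matrix_vector_mul_assoc PR)
    also have "\<dots> = a \<bullet> (transpose P *v rvec k)" by (rule inner_matrix_transpose)
    finally have gk: "real_of_int (idot g k) = (\<Sum>i\<in>UNIV. a $ i * (transpose P *v rvec k) $ i)"
      by (simp add: real_idot inner_vec_def)
    have ph: "int_phase d (- idot g k) = exp (\<Sum>i\<in>UNIV. - (2 * pi * \<i> * a $ i * (transpose P *v rvec k) $ i / of_int d))"
      unfolding int_phase_def cis_conv_exp of_int_minus gk
      by (simp add: sum_distrib_left sum_divide_distrib sum_negf mult_ac)
    show "E * exp (\<Sum>i\<in>UNIV. - (pi * \<i> * (s i * a $ i + b i + (transpose P *v rvec k) $ i / of_int d)\<^sup>2 / s i)) =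
      int_phase d (- idot g k) * exp (\<Sum>i\<in>UNIV. - (pi * \<i> * (b i + (transpose P *v rvec k) $ i / of_int d)\<^sup>2 / s i))"
      unfolding E_def ph exp_add[symmetric] sum.distrib[symmetric]
    proof (intro arg_cong[where f=exp] sum.cong refl)
      fix i
      have alg: "p * S * X\<^sup>2 + 2 * p * B * X + - (p * (S * X + B + K)\<^sup>2 / S) = - (2 * p * X * K) + - (p * (B + K)\<^sup>2 / S)"
        if "S \<noteq> 0" for p S X B K :: complex
        using that by (simp add: field_simps power2_eq_square)
      show "pi * \<i> * s i * (a $ i)\<^sup>2 + 2 * pi * \<i> * b i * a $ i + - (pi * \<i> * (s i * a $ i + b i + (transpose P *v rvec k) $ i / of_int d)\<^sup>2 / s i) =
         - (2 * pi * \<i> * a $ i * (transpose P *v rvec k) $ i / of_int d) + - (pi * \<i> * (b i + (transpose P *v rvec k) $ i / of_int d)\<^sup>2 / s i)"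
        using alg[OF s0[of i], of "pi * \<i>" "a $ i" "b i" "(transpose P *v rvec k) $ i / of_int d"] by (simp add: mult_ac)
    qed
  qed
  finally show ?thesis by (simp add: s_def)
qed

end

section \<open>The theta law for a positive lower right entry\<close>

context diag_form begin

text \<open>On a negative direction \<open>- \<i> * sgt t i\<close> is the conjugate of -i t, and
  the principal root commutes with conjugation off its cut.\<close>

lemma prod_csqrt_quotient:
  fixes t j :: complex and c d :: int
  assumes t: "Im t > 0" and d: "d > 0" and j: "j = of_int c * t + of_int d"
  shows "(\<Prod>i\<in>UNIV. csqrt (- \<i> * sgt t i)) =
    (\<Prod>i\<in>UNIV. csqrt (- \<i> * sgt (t / (of_int d * j)) i)) * of_real (sqrt (of_int d) ^ CARD('n)) * (\<Prod>i\<in>UNIV. csqrt (if sg i = 1 then j else cnj j))"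
proof -
  note q = csqrt_upper_half_plane_quotient[OF t d j]
  have "csqrt (- \<i> * sgt t i) = csqrt (- \<i> * sgt (t / (of_int d * j)) i) * sqrt (of_int d) * csqrt (if sg i = 1 then j else cnj j)" for i
  proof (cases "sg i = 1")
    case True then show ?thesis using q(3) by (simp add: sgt_def)
  next
    case False
    have c: "csqrt (- \<i> * - cnj z) = cnj (csqrt (- \<i> * z))" if "Im z > 0" for z
    proof -
      have "- \<i> * z \<notin> \<real>\<^sub>\<le>\<^sub>0" using that by (simp add: complex_nonpos_Reals_iff)
      then show ?thesis by (subst cnj_csqrt) simp_all
    qed
    have im: "Im (t / (of_int d * j)) > 0"
      unfolding q(1) using t q(2) by (auto intro!: divide_pos_pos zero_less_power)
    have "csqrt (- \<i> * sgt t i) = cnj (csqrt (- \<i> * (t / (of_int d * j))) * sqrt (of_int d) * csqrt j)"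
      using False c[OF t] q(3) by (simp add: sgt_def)
    also have "\<dots> = csqrt (- \<i> * - cnj (t / (of_int d * j))) * sqrt (of_int d) * csqrt (cnj j)"
      using c[OF im] cnj_csqrt[OF q(2)] by (simp only: complex_cnj_mult complex_cnj_complex_of_real)
    finally show ?thesis using False by (simp add: sgt_def)
  qed
  then show ?thesis by (simp add: prod.distrib)
qed

text \<open>Poisson summation there and back. The image point is b/d + t' with t' = t/(d j), and b/d
  only yields the phase e(b Q(l)/d), constant on cosets of d Z^n. Poisson summation on each coset
  leaves a twisted Gauss sum, which splits off a phase quadratic in k. This phase and the dual
  Gaussian at t' combine to the dual Gaussian at t, and Poisson summation backwards returns to the
  lattice.\<close>

theorem Th_transform:
  fixes \<beta> :: "'n \<Rightarrow> complex" and t j :: complex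
  assumes t: "Im t > 0" and d: "d > 0" and det: "a * d - b * c = 1"
    and M: "even_symmetric M" and AM: "A ** M = mat c"
    and \<beta>: "\<And>i. sg i \<noteq> 1 \<Longrightarrow> \<beta> i = 0"
    and j: "j = of_int c * t + of_int d"
  shows "Th ((of_int a * t + of_int b) / j) (\<lambda>i. \<beta> i / j) =
    gauss_sum A b d / of_real (sqrt (of_int d) ^ CARD('n)) * (\<Prod>i\<in>UNIV. csqrt (if sg i = 1 then j else cnj j)) *
    exp (pi * \<i> * of_int c * (\<Sum>i\<in>UNIV. (\<beta> i)\<^sup>2) / j) * Th t \<beta>"
proof -
  define t' where "t' = t / (of_int d * j)"
  define g where "g = (of_int a * t + of_int b) / j"
  define b' where "b' i = \<beta> i / j" for i
  note q = csqrt_upper_half_plane_quotient[OF t d j, folded t'_def]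
  have j0: "j \<noteq> 0" using q(2) by auto
  have t0: "t \<noteq> 0" using t by auto
  have t': "Im t' > 0" unfolding q(1) using t j0 by simp
  have g: "g = of_int b / of_int d + t'"
  proof -
    have "of_int d * (of_int a * t + of_int b) = of_int b * j + t * of_int (a * d - b * c)"
      by (simp add: j algebra_simps)
    then show ?thesis using j0 d unfolding g_def t'_def det by (simp add: field_simps)
  qed
  have sg_split: "sgt g i = of_real (sg i) * (of_int b / of_int d) + sgt t' i" for i
    using sg[of i] unfolding g sgt_def by auto
  have gex: "gexp (sgt g) b' (R *v rvec l) = int_phase d (b * qint A l) * gexp (sgt t') b' (R *v rvec l)" for l
  proof -
    have "real_of_int (qint A l) = (\<Sum>i\<in>UNIV. sg i * ((R *v rvec l) $ i)\<^sup>2) / 2"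
      by (simp add: real_qint[OF ev] qf_diag)
    then have "int_phase d (b * qint A l) = exp (\<Sum>i\<in>UNIV. pi * \<i> * (of_real (sg i) * (of_int b / of_int d)) * ((R *v rvec l) $ i)\<^sup>2)"
      unfolding int_phase_def cis_conv_exp by (simp add: sum_distrib_left sum_distrib_right sum_divide_distrib mult_ac)
    then show ?thesis unfolding gexp_def exp_add[symmetric] sum.distrib[symmetric] sg_split by (simp add: exp_add[symmetric] sum.distrib[symmetric] algebra_simps)
  qed
  define X where "X k = exp (\<Sum>i\<in>UNIV. - (pi * \<i> * (b' i + (transpose P *v rvec k) $ i / of_int d)\<^sup>2 / sgt t' i))" for k
  define Y where "Y k = exp (\<Sum>i\<in>UNIV. - (pi * \<i> * (\<beta> i + (transpose P *v rvec k) $ i)\<^sup>2 / sgt t i))" for k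
  define e where "e = exp (pi * \<i> * of_int c * (\<Sum>i\<in>UNIV. (\<beta> i)\<^sup>2) / j)"
  define C where "C = gauss_covolume R / of_int d ^ CARD('n) / (\<Prod>i\<in>UNIV. csqrt (- \<i> * sgt t' i))"
  \<comment> \<open>In each coordinate this is -1/t' = -d^2/t - c d. On negative directions t and j
    appear conjugated while \<open>b'\<close> is divided by j itself; there the identity rests on
    \<beta> being 0.\<close>
  have XY: "int_phase d (qint M k) * X k = e * Y k" for k
  proof -
    let ?K = "\<lambda>i. (transpose P *v rvec k) $ i"
    have "real_of_int (qint M k) = c * (\<Sum>i\<in>UNIV. sg i * (?K i)\<^sup>2) / 2"
      using dual_form[OF AM, of k] by (simp add: real_qint[OF M] qf_def)
    then have ph: "int_phase d (qint M k) = exp (\<Sum>i\<in>UNIV. pi * \<i> * of_int c * of_real (sg i) * of_real ((?K i)\<^sup>2) / of_int d)"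
      unfolding int_phase_def cis_conv_exp by (simp add: sum_distrib_left sum_distrib_right sum_divide_distrib mult_ac)
    have e: "e = exp (\<Sum>i\<in>UNIV. pi * \<i> * of_int c * (\<beta> i)\<^sup>2 / j)"
      unfolding e_def by (simp add: sum_distrib_left sum_divide_distrib)
    show ?thesis unfolding ph e X_def Y_def exp_add[symmetric] sum.distrib[symmetric]
    proof (intro arg_cong[where f=exp] sum.cong refl)
      fix i
      have d0: "of_int d \<noteq> (0::complex)" using d by simp
      show "pi * \<i> * of_int c * of_real (sg i) * of_real ((?K i)\<^sup>2) / of_int d + - (pi * \<i> * (b' i + ?K i / of_int d)\<^sup>2 / sgt t' i) =
         pi * \<i> * of_int c * (\<beta> i)\<^sup>2 / j + - (pi * \<i> * (\<beta> i + ?K i)\<^sup>2 / sgt t i)"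
      proof (cases "sg i = 1")
        case True
        have alg: "p * C * K\<^sup>2 / D + - (p * (B / J + K / D)\<^sup>2 / (T / (D * J))) = p * C * B\<^sup>2 / J + - (p * (B + K)\<^sup>2 / T)"
          if "J = C * T + D" "J \<noteq> 0" "D \<noteq> 0" "T \<noteq> 0" for p C K D B J T :: complex
        proof -
          have "p * C * K\<^sup>2 / D + - (p * (B / J + K / D)\<^sup>2 / (T / (D * J))) = (p * C * K\<^sup>2 * J * T - p * (B * D + K * J)\<^sup>2) / (D * J * T)"
            using that(2-) by (simp add: field_simps power2_eq_square)
          also have "p * C * K\<^sup>2 * J * T - p * (B * D + K * J)\<^sup>2 = D * (p * C * B\<^sup>2 * T - p * (B + K)\<^sup>2 * J)"
            unfolding that(1) by (simp add: algebra_simps power2_eq_square)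
          also have "D * (p * C * B\<^sup>2 * T - p * (B + K)\<^sup>2 * J) / (D * J * T) = p * C * B\<^sup>2 / J + - (p * (B + K)\<^sup>2 / T)"
            using that(2-) by (simp add: field_simps)
          finally show ?thesis .
        qed
        show ?thesis using True alg[OF j j0 d0 t0, of "pi * \<i>" "?K i" "\<beta> i"]
          by (simp add: sgt_def t'_def b'_def)
      next
        case False
        then have s: "sg i = - 1" using sg by blast
        have alg: "p * C * (- 1) * K\<^sup>2 / D + - (p * (K / D)\<^sup>2 / (- T / (D * J))) = - (p * K\<^sup>2 / (- T))"
          if "J = C * T + D" "J \<noteq> 0" "D \<noteq> 0" "T \<noteq> 0" for p C K D J T :: complex
        proof -
          have "p * C * (- 1) * K\<^sup>2 / D + - (p * (K / D)\<^sup>2 / (- T / (D * J))) = p * K\<^sup>2 * (J - C * T) / (D * T)"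
            using that(2-) by (simp add: field_simps power2_eq_square)
          also have "J - C * T = D" using that(1) by simp
          finally show ?thesis using that by simp
        qed
        have cj: "cnj j = of_int c * cnj t + of_int d" by (simp add: j)
        show ?thesis using False s \<beta>[OF False] alg[OF cj _ d0, of "pi * \<i>" "?K i"] j0 t0
          by (simp add: sgt_def t'_def b'_def)
      qed
    qed
  qed
  have sumY: "(\<lambda>k. norm (Y k)) summable_on UNIV"
    unfolding Y_def by (rule summable_on_gexp_dual[OF Im_sgt[OF t] PR(1)])
  have nX: "norm (X k) = norm e * norm (Y k)" for k
    using arg_cong[OF XY[of k], of norm] by (simp add: norm_mult)
  have sumX: "(\<lambda>k. norm (X k)) summable_on UNIV"
    unfolding nX by (rule summable_on_cmult_right[OF sumY])
  have bij: "bij_betw (\<lambda>(g, m). g + d *s m) (int_box (nat d) \<times> UNIV) (UNIV :: (int^'n) set)" by (rule bij_residue_box[OF d])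
  have sumG: "(\<lambda>l. gexp (sgt g) b' (R *v rvec l)) summable_on UNIV"
  proof (rule abs_summable_summable, rule Th_summable)
    have "Im (of_int b / of_int d :: complex) = 0" by (simp add: Im_divide)
    then show "Im g > 0" unfolding g using t' by (simp only: plus_complex.sel)
  qed
  have "Th g b' = (\<Sum>\<^sub>\<infinity>p\<in>int_box (nat d) \<times> UNIV. gexp (sgt g) b' (R *v rvec (case p of (g, m) \<Rightarrow> g + d *s m)))"
    unfolding Th_def by (rule infsum_reindex_bij_betw[OF bij, symmetric])
  also have "\<dots> = (\<Sum>\<^sub>\<infinity>h\<in>int_box (nat d). \<Sum>\<^sub>\<infinity>m. gexp (sgt g) b' (R *v rvec (h + d *s m)))"
  proof (subst infsum_Sigma_banach[symmetric])
    show "(\<lambda>p. gexp (sgt g) b' (R *v rvec (case p of (g, m) \<Rightarrow> g + d *s m))) summable_on (int_box (nat d) \<times> UNIV)"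
      using sumG by (subst summable_on_reindex_bij_betw[OF bij])
  qed simp
  also have "\<dots> = (\<Sum>h\<in>int_box (nat d). \<Sum>\<^sub>\<infinity>m. gexp (sgt g) b' (R *v rvec (h + d *s m)))" by simp
  also have "\<dots> = (\<Sum>h\<in>int_box (nat d). C * (\<Sum>\<^sub>\<infinity>k. int_phase d (b * qint A h - idot h k) * X k))"
  proof (rule sum.cong[OF refl])
    fix h
    have "(\<Sum>\<^sub>\<infinity>m. gexp (sgt g) b' (R *v rvec (h + d *s m))) = int_phase d (b * qint A h) * (\<Sum>\<^sub>\<infinity>m. gexp (sgt t') b' (R *v rvec (h + d *s m)))"
      unfolding gex using d by (simp add: int_phase_qint_periodic[OF ev] infsum_cmult_right')
    also have "\<dots> = C * (int_phase d (b * qint A h) * (\<Sum>\<^sub>\<infinity>k. int_phase d (- idot h k) * X k))"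
      unfolding coset_poisson[OF t' d] C_def X_def by (simp add: mult_ac)
    also have "int_phase d (b * qint A h) * (\<Sum>\<^sub>\<infinity>k. int_phase d (- idot h k) * X k) = (\<Sum>\<^sub>\<infinity>k. int_phase d (b * qint A h - idot h k) * X k)"
      unfolding diff_conv_add_uminus int_phase_add by (simp add: infsum_cmult_right' mult.assoc)
    finally show "(\<Sum>\<^sub>\<infinity>m. gexp (sgt g) b' (R *v rvec (h + d *s m))) = C * (\<Sum>\<^sub>\<infinity>k. int_phase d (b * qint A h - idot h k) * X k)" .
  qed
  also have "\<dots> = C * (\<Sum>\<^sub>\<infinity>k. \<Sum>h\<in>int_box (nat d). int_phase d (b * qint A h - idot h k) * X k)"
  proof -
    have s: "(\<lambda>k. int_phase d (b * qint A h - idot h k) * X k) summable_on UNIV" for h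
      by (rule abs_summable_summable) (use sumX in \<open>simp add: norm_mult\<close>)
    have "finite H \<Longrightarrow> ((\<lambda>k. \<Sum>h\<in>H. int_phase d (b * qint A h - idot h k) * X k) has_sum
       (\<Sum>h\<in>H. \<Sum>\<^sub>\<infinity>k. int_phase d (b * qint A h - idot h k) * X k)) UNIV" for H
      by (induction H rule: finite_induct) (auto intro!: has_sum_add has_sum_infsum s)
    from this[of "int_box (nat d)"]
    show ?thesis by (simp add: infsumI sum_distrib_left)
  qed
  also have "(\<lambda>k. \<Sum>h\<in>int_box (nat d). int_phase d (b * qint A h - idot h k) * X k) = (\<lambda>k. gauss_sum A b d * e * Y k)"
  proof
    fix k
    show "(\<Sum>h\<in>int_box (nat d). int_phase d (b * qint A h - idot h k) * X k) = gauss_sum A b d * e * Y k"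
      unfolding sum_distrib_right[symmetric] twisted_gauss_sum[OF ev M AM det d] using XY[of k] by (simp add: mult_ac)
  qed
  also have "C * (\<Sum>\<^sub>\<infinity>k. gauss_sum A b d * e * Y k) = gauss_sum A b d * e * (C * (\<Sum>\<^sub>\<infinity>k. Y k))"
    unfolding infsum_cmult_right' by (simp add: mult_ac)
  also have "C * (\<Sum>\<^sub>\<infinity>k. Y k) = (\<Prod>i\<in>UNIV. csqrt (if sg i = 1 then j else cnj j)) / of_real (sqrt (of_int d) ^ CARD('n)) * Th t \<beta>"
  proof -
    have nz: "(\<Prod>i\<in>UNIV. csqrt (- \<i> * sgt t' i)) \<noteq> 0" "(\<Prod>i\<in>UNIV. csqrt (if sg i = 1 then j else cnj j)) \<noteq> 0"
    proof -
      have "sgt t' i \<noteq> 0" for i using Im_sgt[OF t', of i] by auto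
      then show "(\<Prod>i\<in>UNIV. csqrt (- \<i> * sgt t' i)) \<noteq> 0" "(\<Prod>i\<in>UNIV. csqrt (if sg i = 1 then j else cnj j)) \<noteq> 0"
        using j0 by auto
    qed
    have dd: "complex_of_int d ^ CARD('n) = of_real (sqrt (of_int d) ^ CARD('n)) * of_real (sqrt (of_int d) ^ CARD('n))"
      using d by (simp flip: power_mult_distrib of_real_mult)
    have s0: "complex_of_real (sqrt (of_int d) ^ CARD('n)) \<noteq> 0" using d by simp
    show ?thesis unfolding Th_poisson[OF t] C_def Y_def[symmetric] dd prod_csqrt_quotient[OF t d j, folded t'_def]
      using nz s0 by (simp add: field_simps)
  qed
  finally show ?thesis unfolding g_def b'_def e_def by (simp add: mult_ac)
qed

end

section \<open>Gauss sums\<close>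

lemma int_box_eq: "d > 0 \<Longrightarrow> int_box (nat d) = {x. \<forall>i. x $ i \<in> {0..<d}}"
  by (auto simp: int_box_def)

lemma mem_int_box: "d > 0 \<Longrightarrow> x \<in> int_box (nat d) \<longleftrightarrow> (\<forall>i. 0 \<le> x $ i \<and> x $ i < d)"
  by (auto simp: int_box_def)

lemma sum_int_box_prod:
  fixes f :: "'n::finite \<Rightarrow> int \<Rightarrow> complex"
  assumes "d > 0"
  shows "(\<Sum>x\<in>int_box (nat d). \<Prod>i\<in>UNIV. f i (x $ i)) = (\<Prod>i\<in>UNIV. \<Sum>y\<in>{0..<d}. f i y)"
  unfolding int_box_eq[OF assms] by (rule sum_vec_prod) simp

lemma card_int_box: "d > 0 \<Longrightarrow> card (int_box (nat d) :: (int^'n) set) = nat d ^ CARD('n)"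
  unfolding int_box_eq by (subst card_vec_set) auto

lemma int_phase_mult_common: "k \<noteq> 0 \<Longrightarrow> int_phase (k * d) (k * x) = int_phase d x"
  by (simp add: int_phase_def mult.assoc)

lemma int_phase_of_nat_mult: "int_phase d (int m * x) = int_phase d x ^ m"
  unfolding int_phase_def by (simp add: Complex.DeMoivre mult_ac)

lemma sum_int_phase:
  assumes d: "d > 0"
  shows "(\<Sum>y\<in>{0..<d}. int_phase d (w * y)) = (if d dvd w then of_int d else 0)"
proof (cases "d dvd w")
  case True
  then obtain m where "w = d * m" by blast
  then have "int_phase d (w * y) = 1" for y using d by (simp add: mult.assoc)
  then show ?thesis using True d by simp
next
  case False
  let ?z = "int_phase d w"
  have "{0..<d} = int ` {..<nat d}" using d by (auto simp: image_iff intro!: bexI[of _ "nat _"])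
  then have "(\<Sum>y\<in>{0..<d}. int_phase d (w * y)) = (\<Sum>m<nat d. int_phase d (w * int m))"
    by (simp add: sum.reindex)
  also have "\<dots> = (\<Sum>m<nat d. ?z ^ m)" by (simp add: int_phase_of_nat_mult[symmetric] mult.commute)
  also have "\<dots> = 0"
  proof -
    have "?z \<noteq> 1"
    proof
      assume "?z = 1"
      then obtain n :: int where "2 * pi * real_of_int w / real_of_int d = real_of_int (2 * n) * pi"
        unfolding int_phase_def cis_conv_exp exp_eq_1 by auto
      then have "real_of_int w = real_of_int (d * n)" using d by (simp add: field_simps)
      then have "w = d * n" by (simp only: of_int_eq_iff)
      then show False using False by simp
    qed
    moreover have "?z ^ nat d = 1" using d int_phase_of_nat_mult[of d "nat d" w] by simp
    ultimately show ?thesis by (simp add: geometric_sum)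
  qed
  finally show ?thesis using False by simp
qed

lemma sum_int_phase_idot:
  fixes w :: "int^'n"
  assumes d: "d > 0"
  shows "(\<Sum>z\<in>int_box (nat d). int_phase d (idot w z)) = (if \<forall>i. d dvd w $ i then of_int d ^ CARD('n) else 0)"
proof -
  have ph: "int_phase d (sum f S) = (\<Prod>i\<in>S. int_phase d (f i))" if "finite S" for f and S :: "'n set"
    using that by (induction S rule: finite_induct) (auto simp: int_phase_add)
  have "(\<Sum>z\<in>int_box (nat d). int_phase d (idot w z)) = (\<Prod>i\<in>UNIV. \<Sum>y\<in>{0..<d}. int_phase d (w $ i * y))"
    unfolding idot_def by (subst sum_int_box_prod[OF d, symmetric]) (simp add: ph)
  then show ?thesis by (auto simp: sum_int_phase[OF d])
qed

lemma bij_int_box_mult: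
  assumes "d > 0" "e > 0"
  shows "bij_betw (\<lambda>(g, z). g + d *s z) (int_box (nat d) \<times> int_box (nat e)) (int_box (nat (d * e)) :: (int^'n) set)"
proof (rule bij_betw_subset[OF bij_residue_box[OF assms(1)]])
  have de: "d * e > 0" using assms by simp
  show "(\<lambda>(g, z). g + d *s z) ` (int_box (nat d) \<times> int_box (nat e)) = (int_box (nat (d * e)) :: (int^'n) set)"
  proof (intro equalityI subsetI)
    fix x :: "int^'n" assume "x \<in> (\<lambda>(g, z). g + d *s z) ` (int_box (nat d) \<times> int_box (nat e))"
    then obtain g z :: "int^'n" where x: "x = g + d *s z" and g: "\<And>i. 0 \<le> g $ i \<and> g $ i < d" and z: "\<And>i. 0 \<le> z $ i \<and> z $ i < e"
      using assms by (auto simp: mem_int_box)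
    have "0 \<le> g $ i + d * z $ i \<and> g $ i + d * z $ i < d * e" for i
    proof -
      have "d * z $ i \<le> d * (e - 1)" using z[of i] assms by (intro mult_left_mono) auto
      then show ?thesis using g[of i] z[of i] assms by (auto simp: algebra_simps)
    qed
    then show "x \<in> int_box (nat (d * e))" unfolding mem_int_box[OF de] x by simp
  next
    fix x :: "int^'n" assume "x \<in> int_box (nat (d * e))"
    then have x: "0 \<le> x $ i \<and> x $ i < d * e" for i unfolding mem_int_box[OF de] by blast
    have "x = (\<chi> i. x $ i mod d) + d *s (\<chi> i. x $ i div d)" by (simp add: vec_eq_iff)
    moreover have "x $ i div d < e" for i
    proof -
      have "d * (x $ i div d) \<le> x $ i" using assms mult_div_mod_eq[of d "x $ i"] pos_mod_sign[of d "x $ i"] by linarith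
      also have "\<dots> < d * e" using x by blast
      finally show ?thesis using assms by simp
    qed
    then have "(\<chi> i. x $ i mod d) \<in> int_box (nat d)" "(\<chi> i. x $ i div d) \<in> int_box (nat e)"
      using assms x by (auto simp: mem_int_box pos_imp_zdiv_nonneg_iff)
    ultimately show "x \<in> (\<lambda>(g, z). g + d *s z) ` (int_box (nat d) \<times> int_box (nat e))" by force
  qed
qed auto

text \<open>Put x = g + p m z with z modulo p. The phase is linear in z, so the sum over z keeps
  only those g with b A g = 0 modulo p. Since M A = c is prime to p, A is invertible modulo p and
  such g are divisible by p.\<close>

lemma gauss_sum_prime_square:
  fixes A :: "int^'n^'n"
  assumes A: "even_symmetric A" and M: "M ** A = mat c" and p: "prime p" "\<not> p dvd c" "\<not> p dvd b" and m: "m > 0"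
  shows "gauss_sum A b (p\<^sup>2 * m) = of_int p ^ CARD('n) * gauss_sum A b m"
proof -
  have p0: "p > 0" using p(1) by (simp add: prime_gt_0_int)
  have pm: "p * m > 0" using p0 m by simp
  have bij: "bij_betw (\<lambda>g. p *s g) (int_box (nat m) :: (int^'n) set) {g \<in> int_box (nat (p * m)). \<forall>i. p dvd g $ i}"
  proof (rule bij_betwI[where g="\<lambda>x::int^'n. \<chi> i. x $ i div p"])
    show "(\<lambda>g::int^'n. p *s g) \<in> int_box (nat m) \<rightarrow> {g \<in> int_box (nat (p * m)). \<forall>i. p dvd g $ i}"
      using p0 m by (auto simp: mem_int_box)
    show "(\<lambda>x::int^'n. \<chi> i. x $ i div p) \<in> {g \<in> int_box (nat (p * m)). \<forall>i. p dvd g $ i} \<rightarrow> int_box (nat m)"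
    proof clarify
      fix x :: "int^'n" assume x: "x \<in> int_box (nat (p * m))" and dv: "\<forall>i. p dvd x $ i"
      have "0 \<le> x $ i div p \<and> x $ i div p < m" for i
      proof -
        obtain k where "x $ i = p * k" using dv by blast
        then show ?thesis using x p0 m by (auto simp: mem_int_box[OF pm] zero_le_mult_iff dest!: spec[of _ i])
      qed
      then show "(\<chi> i. x $ i div p) \<in> int_box (nat m)" using m by (simp add: mem_int_box)
    qed
  qed (use p0 in \<open>auto simp: vec_eq_iff\<close>)
  have "gauss_sum A b (p\<^sup>2 * m) = (\<Sum>x\<in>int_box (nat ((p * m) * p)). int_phase (p\<^sup>2 * m) (b * qint A x))"
    unfolding gauss_sum_def by (simp add: power2_eq_square mult_ac)
  also have "\<dots> = (\<Sum>(g, z)\<in>int_box (nat (p * m)) \<times> int_box (nat p). int_phase (p\<^sup>2 * m) (b * qint A (g + (p * m) *s z)))"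
    by (subst sum.reindex_bij_betw[OF bij_int_box_mult[OF pm p0], symmetric]) (simp add: case_prod_unfold)
  also have "\<dots> = (\<Sum>g\<in>int_box (nat (p * m)). \<Sum>z\<in>int_box (nat p). int_phase (p\<^sup>2 * m) (b * qint A (g + (p * m) *s z)))"
    by (simp add: sum.cartesian_product)
  also have "\<dots> = (\<Sum>g\<in>int_box (nat (p * m)). int_phase (p\<^sup>2 * m) (b * qint A g) * (if \<forall>i. p dvd g $ i then of_int p ^ CARD('n) else 0))"
  proof (rule sum.cong[OF refl])
    fix g :: "int^'n"
    have ph: "int_phase (p\<^sup>2 * m) (b * qint A (g + (p * m) *s z)) = int_phase (p\<^sup>2 * m) (b * qint A g) * int_phase p (idot (b *s (A *v g)) z)" for z
    proof -
      have sym: "idot g (A *v z) = idot (A *v g) z"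
      proof -
        have "real_of_int (idot g (A *v z)) = real_of_int (idot (A *v g) z)"
          using symmetric_matrix_inner[OF even_symmetricD[OF A], of "rvec g" "rvec z"]
          by (simp add: real_idot rmat_mult_rvec inner_commute)
        then show ?thesis by (simp only: of_int_eq_iff)
      qed
      have eq: "b * qint A (g + (p * m) *s z) = b * qint A g + ((p * m) * idot (b *s (A *v g)) z + (p\<^sup>2 * m) * (b * m * qint A z))"
        by (simp add: qint_add[OF A] qint_scale[OF A] matrix_vector_scale idot_scale sym idot_comm[of "b *s _"] idot_comm[of z] power2_eq_square algebra_simps)
      have third: "int_phase (p\<^sup>2 * m) ((p\<^sup>2 * m) * (b * m * qint A z)) = 1"
        using p0 m by (intro int_phase_mult_self) auto
      have "int_phase ((p * m) * p) ((p * m) * idot (b *s (A *v g)) z) = int_phase p (idot (b *s (A *v g)) z)"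
        using pm by (intro int_phase_mult_common) auto
      moreover have "(p * m) * p = p\<^sup>2 * m" by (simp add: power2_eq_square)
      ultimately show ?thesis unfolding eq int_phase_add third by simp
    qed
    have iff: "(\<forall>i. p dvd (b *s (A *v g)) $ i) \<longleftrightarrow> (\<forall>i. p dvd g $ i)"
    proof
      assume h: "\<forall>i. p dvd (b *s (A *v g)) $ i"
      then have h': "p dvd (A *v g) $ i" for i using p by (simp add: prime_dvd_mult_iff)
      have "M *v (A *v g) = c *s g"
        unfolding matrix_vector_mul_assoc M by (simp add: matrix_vector_mult_def mat_def vec_eq_iff if_distrib if_distribR cong: if_cong)
      then have "p dvd c * g $ i" for i
        using h' by (metis (no_types, lifting) dvd_mult dvd_sum matrix_vector_mult_def vec_lambda_beta vector_smult_component)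
      then show "\<forall>i. p dvd g $ i" using p by (simp add: prime_dvd_mult_iff)
    next
      assume "\<forall>i. p dvd g $ i"
      then show "\<forall>i. p dvd (b *s (A *v g)) $ i" by (auto simp: matrix_vector_mult_def intro!: dvd_mult dvd_sum)
    qed
    show "(\<Sum>z\<in>int_box (nat p). int_phase (p\<^sup>2 * m) (b * qint A (g + (p * m) *s z))) =
      int_phase (p\<^sup>2 * m) (b * qint A g) * (if \<forall>i. p dvd g $ i then of_int p ^ CARD('n) else 0)"
      unfolding ph sum_distrib_left[symmetric] sum_int_phase_idot[OF p0] iff ..
  qed
  also have "\<dots> = (\<Sum>g\<in>{g \<in> int_box (nat (p * m)). \<forall>i. p dvd g $ i}. int_phase (p\<^sup>2 * m) (b * qint A g) * of_int p ^ CARD('n))"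
    by (rule sum.mono_neutral_cong_right) auto
  also have "\<dots> = (\<Sum>g\<in>int_box (nat m). int_phase (p\<^sup>2 * m) (b * qint A (p *s g)) * of_int p ^ CARD('n))"
    by (rule sum.reindex_bij_betw[OF bij, symmetric])
  also have "\<dots> = of_int p ^ CARD('n) * gauss_sum A b m"
  proof -
    have "int_phase (p\<^sup>2 * m) (b * qint A (p *s g)) = int_phase m (b * qint A g)" for g
    proof -
      have eq: "b * qint A (p *s g) = p\<^sup>2 * (b * qint A g)" by (simp add: qint_scale[OF A])
      show ?thesis unfolding eq using p0 int_phase_mult_common[of "p\<^sup>2" m "b * qint A g"] by simp
    qed
    then show ?thesis unfolding gauss_sum_def sum_distrib_right[symmetric] by simp
  qed
  finally show ?thesis .
qed

text \<open>The Chinese remainder theorem in the form k x + m y: the cross term is divisible by m k,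
  and of each of the squares k^2 and m^2 one factor cancels against the denominator.\<close>

lemma gauss_sum_coprime_mult:
  fixes A :: "int^'n^'n"
  assumes A: "even_symmetric A" and m: "m > 0" and k: "k > 0" and cop: "coprime m k"
  shows "gauss_sum A b (m * k) = gauss_sum A (b * k) m * gauss_sum A (b * m) k"
proof -
  have mk: "m * k > 0" using m k by simp
  define r where "r x = (\<chi> i. x $ i mod (m * k))" for x :: "int^'n"
  define h where "h = (\<lambda>(x, y). r (k *s x + m *s y))"
  have r: "int_phase (m * k) (b * qint A (r x)) = int_phase (m * k) (b * qint A x)" for x
  proof -
    have "x = r x + (m * k) *s (\<chi> i. x $ i div (m * k))" by (simp add: r_def vec_eq_iff)
    then have "qint A x = qint A (r x + (m * k) *s (\<chi> i. x $ i div (m * k)))" by (rule arg_cong)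
    then show ?thesis using int_phase_qint_periodic[OF A, of "m * k" b "r x"] m k by simp
  qed
  have inj: "inj_on h (int_box (nat m) \<times> int_box (nat k))"
  proof (rule inj_onI, clarify)
    fix x y x' y' :: "int^'n"
    assume b: "x \<in> int_box (nat m)" "y \<in> int_box (nat k)" "x' \<in> int_box (nat m)" "y' \<in> int_box (nat k)"
      and eq: "h (x, y) = h (x', y')"
    have "x $ i = x' $ i \<and> y $ i = y' $ i" for i
    proof -
      have c: "[k * x $ i + m * y $ i = k * x' $ i + m * y' $ i] (mod m * k)"
        using eq by (simp add: h_def r_def vec_eq_iff cong_def)
      have "[k * x $ i + m * y $ i = k * x' $ i + m * y' $ i] (mod m)" using c by (rule cong_modulus_mult)
      then have "[k * x $ i = k * x' $ i] (mod m)" by (simp add: cong_def)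
      then have 1: "[x $ i = x' $ i] (mod m)" using cop by (simp add: cong_mult_lcancel coprime_commute)
      have "[k * x $ i + m * y $ i = k * x' $ i + m * y' $ i] (mod k)" using c by (metis cong_modulus_mult mult.commute)
      then have "[m * y $ i = m * y' $ i] (mod k)" by (simp add: cong_def)
      then have 2: "[y $ i = y' $ i] (mod k)" using cop by (simp add: cong_mult_lcancel)
      show ?thesis using 1 2 b m k by (auto simp: mem_int_box intro!: cong_less_imp_eq_int)
    qed
    then show "x = x' \<and> y = y'" by (simp add: vec_eq_iff)
  qed
  have bij: "bij_betw h (int_box (nat m) \<times> int_box (nat k)) (int_box (nat (m * k)))"
    unfolding bij_betw_def
  proof (intro conjI inj card_subset_eq)
    show "h ` (int_box (nat m) \<times> int_box (nat k)) \<subseteq> int_box (nat (m * k))"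
      using mk by (auto simp: h_def r_def mem_int_box)
    show "card (h ` (int_box (nat m) \<times> int_box (nat k))) = card (int_box (nat (m * k)) :: (int^'n) set)"
      unfolding card_image[OF inj] card_cartesian_product card_int_box[OF m] card_int_box[OF k] card_int_box[OF mk]
      using m k by (simp add: nat_mult_distrib power_mult_distrib)
  qed simp
  have ph: "int_phase (m * k) (b * qint A (h (x, y))) = int_phase m (b * k * qint A x) * int_phase k (b * m * qint A y)" for x y
  proof -
    have "b * qint A (k *s x + m *s y) = k * (b * k * qint A x) + (m * k) * (b * idot x (A *v y)) + m * (b * m * qint A y)"
      by (simp add: qint_add[OF A] qint_scale[OF A] matrix_vector_scale idot_scale idot_comm[of "k *s x"] idot_comm[of "A *v y"] power2_eq_square algebra_simps)
    then have "int_phase (m * k) (b * qint A (h (x, y))) = int_phase (k * m) (k * (b * k * qint A x)) * int_phase (m * k) (m * (b * m * qint A y))"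
      using mk m k by (simp add: h_def r int_phase_add mult.commute[of k m])
    then show ?thesis using m k by (simp only: int_phase_mult_common)
  qed
  have "gauss_sum A b (m * k) = (\<Sum>p\<in>int_box (nat m) \<times> int_box (nat k). int_phase (m * k) (b * qint A (h p)))"
    unfolding gauss_sum_def by (rule sum.reindex_bij_betw[OF bij, symmetric])
  also have "\<dots> = (\<Sum>x\<in>int_box (nat m). \<Sum>y\<in>int_box (nat k). int_phase m (b * k * qint A x) * int_phase k (b * m * qint A y))"
    by (subst sum.cartesian_product) (auto intro!: sum.cong simp: ph)
  also have "\<dots> = gauss_sum A (b * k) m * gauss_sum A (b * m) k"
    unfolding gauss_sum_def by (simp add: sum_product)
  finally show ?thesis .
qed

section \<open>Diagonalisation of integral forms modulo an odd prime\<close>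

lemma det_cong:
  fixes A B :: "int^'n^'n"
  assumes "\<And>i j. [A $ i $ j = B $ i $ j] (mod m)"
  shows "[det A = det B] (mod m)"
  unfolding det_def by (intro cong_sum cong_mult cong_prod cong_refl assms)

text \<open>As a change of basis it adds \<open>w a\<close> times the basis vector k to the basis
  vector a; when \<open>w k = 0\<close>, negating w inverts it.\<close>

definition transvection :: "'n \<Rightarrow> ('n \<Rightarrow> int) \<Rightarrow> int^'n^'n" where
  "transvection k w = (\<chi> x a. (if x = a then 1 else 0) + (if x = k then w a else 0))"

lemma transvection_mult:
  assumes "w k = 0"
  shows "transvection k w ** transvection k (\<lambda>a. - w a) = mat 1"
proof -
  have "(\<Sum>y\<in>UNIV. ((if x = y then 1 else 0) + (if x = k then w y else 0)) * ((if y = a then 1 else 0) + (if y = k then - w a else 0))) = (if x = a then 1 else 0)" for x a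
  proof -
    have "((if x = y then 1 else 0) + (if x = k then w y else 0)) * ((if y = a then 1 else 0) + (if y = k then - w a else 0)) =
      (if y = x then (if y = a then 1 else 0) + (if y = k then - w a else 0) else 0) + (if y = a then (if x = k then w y else 0) else 0)
      + (if y = k then (if x = k then w y * - w a else 0) else 0)" for y by (auto simp: algebra_simps)
    then show ?thesis using assms by (simp add: sum.distrib)
  qed
  then show ?thesis by (simp add: vec_eq_iff matrix_matrix_mult_def transvection_def mat_def)
qed

lemma transvection_congruence:
  fixes M :: "int^'n^'n"
  shows "(transpose (transvection k w) ** M ** transvection k w) $ a $ l =
     M $ a $ l + w a * M $ k $ l + w l * M $ a $ k + w a * w l * M $ k $ k"
proof -
  have 1: "(N ** transvection k w) $ a $ l = N $ a $ l + w l * N $ a $ k" for N :: "int^'n^'n" and a l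
  proof -
    have "N $ a $ y * ((if y = l then 1 else 0) + (if y = k then w l else 0)) = (if y = l then N $ a $ l else 0) + (if y = k then w l * N $ a $ k else 0)" for y
      by (auto simp: algebra_simps)
    then show ?thesis by (simp add: matrix_matrix_mult_def transvection_def sum.distrib)
  qed
  have 2: "(transpose (transvection k w) ** N) $ a $ l = N $ a $ l + w a * N $ k $ l" for N :: "int^'n^'n" and a l
  proof -
    have "((if y = a then 1 else 0) + (if y = k then w a else 0)) * N $ y $ l = (if y = a then N $ a $ l else 0) + (if y = k then w a * N $ k $ l else 0)" for y
      by (auto simp: algebra_simps)
    then show ?thesis by (simp add: matrix_matrix_mult_def transvection_def transpose_def sum.distrib)
  qed
  show ?thesis unfolding 1 2 by (simp add: algebra_simps)
qed

lemma transpose_congruence: "transpose M = M \<Longrightarrow> transpose (transpose U ** M ** U) = transpose U ** M ** U"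
  for M :: "int^'n^'n"
  by (simp add: matrix_transpose_mul matrix_mul_assoc)

text \<open>Gram--Schmidt modulo an odd prime; when all remaining diagonal entries vanish, adding
  one basis vector to another creates a pivot.\<close>

lemma diagonalise_mod_prime:
  fixes A :: "int^'n^'n" and p :: int
  assumes A: "transpose A = A" and p: "prime p" "p \<noteq> 2"
  shows "\<exists>U V :: int^'n^'n. U ** V = mat 1 \<and> V ** U = mat 1 \<and> (\<forall>i j. i \<noteq> j \<longrightarrow> p dvd (transpose U ** A ** U) $ i $ j)"
proof -
  \<comment> \<open>The rows indexed by T vanish modulo p off the diagonal; T grows by one index at
    a time.\<close>
  define clean where "clean T M \<longleftrightarrow> (\<forall>i\<in>T. \<forall>j. i \<noteq> j \<longrightarrow> p dvd M $ i $ j)" for T :: "'n set" and M :: "int^'n^'n"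
  have tv: "\<exists>(U' :: int^'n^'n) V'. U' ** V' = mat 1 \<and> V' ** U' = mat 1 \<and> transpose U' ** A ** U' = transpose (transvection k w) ** (transpose U ** A ** U) ** transvection k w"
    if "U ** V = mat 1" "V ** U = mat 1" "w k = 0" for U V :: "int^'n^'n" and k w
  proof (intro exI conjI)
    have E: "transvection k w ** transvection k (\<lambda>a. - w a) = mat 1" "transvection k (\<lambda>a. - w a) ** transvection k w = mat 1"
      using transvection_mult[of w k] transvection_mult[of "\<lambda>a. - w a" k] that(3) by simp_all
    have "(U ** transvection k w) ** (transvection k (\<lambda>a. - w a) ** V) = U ** (transvection k w ** transvection k (\<lambda>a. - w a)) ** V"
      by (simp add: matrix_mul_assoc)
    then show "(U ** transvection k w) ** (transvection k (\<lambda>a. - w a) ** V) = mat 1" using that E by simp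
    have "(transvection k (\<lambda>a. - w a) ** V) ** (U ** transvection k w) = transvection k (\<lambda>a. - w a) ** (V ** U) ** transvection k w"
      by (simp add: matrix_mul_assoc)
    then show "(transvection k (\<lambda>a. - w a) ** V) ** (U ** transvection k w) = mat 1" using that E by simp
    show "transpose (U ** transvection k w) ** A ** (U ** transvection k w) = transpose (transvection k w) ** (transpose U ** A ** U) ** transvection k w"
      by (simp add: matrix_transpose_mul matrix_mul_assoc)
  qed
  have pivot: "\<exists>(U' :: int^'n^'n) V'. U' ** V' = mat 1 \<and> V' ** U' = mat 1 \<and> clean (insert i T) (transpose U' ** A ** U')"
    if UV: "U ** V = mat 1" "V ** U = mat 1" and cl: "clean T (transpose U ** A ** U)" and i: "i \<notin> T"
      and pv: "\<not> p dvd (transpose U ** A ** U) $ i $ i" for U V :: "int^'n^'n" and i T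
  proof -
    define M where "M = transpose U ** A ** U"
    have sym: "M $ a $ l = M $ l $ a" for a l
      using arg_cong[OF transpose_congruence[OF A, of U, folded M_def], of "\<lambda>X. X $ l $ a"] by (simp add: transpose_def)
    have "coprime (M $ i $ i) p" using pv p(1) unfolding M_def by (metis coprime_commute prime_imp_coprime)
    \<comment> \<open>r inverts the pivot modulo p, so - r M_il is the multiplier that clears entry
      l of row i. The rows in T stay clean because their multipliers are themselves divisible by
      p.\<close>
    then obtain r where r: "[M $ i $ i * r = 1] (mod p)" using cong_solve_coprime_int by blast
    define w where "w l = (if l = i then 0 else - (r * M $ i $ l))" for l
    have w0: "w i = 0" by (simp add: w_def)
    obtain U' V' where U': "U' ** V' = mat 1" "V' ** U' = mat 1" and eq: "transpose U' ** A ** U' = transpose (transvection i w) ** M ** transvection i w"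
      using tv[OF UV, of w, OF w0] unfolding M_def by blast
    have "clean (insert i T) (transpose U' ** A ** U')"
      unfolding clean_def eq transvection_congruence
    proof (intro ballI allI impI)
      fix a l assume a: "a \<in> insert i T" and al: "a \<noteq> l"
      show "p dvd M $ a $ l + w a * M $ i $ l + w l * M $ a $ i + w a * w l * M $ i $ i"
      proof (cases "a = i")
        case True
        have "M $ a $ l + w a * M $ i $ l + w l * M $ a $ i + w a * w l * M $ i $ i = M $ i $ l * (1 - M $ i $ i * r)"
          using True al by (simp add: w_def algebra_simps)
        moreover have "p dvd 1 - M $ i $ i * r" using r by (simp add: cong_iff_dvd_diff dvd_diff_commute)
        ultimately show ?thesis by simp
      next
        case False
        then have aT: "a \<in> T" using a by simp
        then have "p dvd M $ a $ l" "p dvd M $ a $ i" using cl al False by (auto simp: clean_def M_def)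
        moreover from this(2) have "p dvd w a" using False sym[of a i] by (simp add: w_def)
        ultimately show ?thesis by (intro dvd_add) auto
      qed
    qed
    with U' show ?thesis by blast
  qed
  have step: "\<exists>(U :: int^'n^'n) V i. i \<notin> T \<and> U ** V = mat 1 \<and> V ** U = mat 1 \<and> clean (insert i T) (transpose U ** A ** U)"
    if UV: "U ** V = mat 1" "V ** U = mat 1" and cl: "clean T (transpose U ** A ** U)" and T: "T \<noteq> UNIV" for U V :: "int^'n^'n" and T
  proof -
    define M where "M = transpose U ** A ** U"
    have sym: "M $ a $ l = M $ l $ a" for a l
      using arg_cong[OF transpose_congruence[OF A, of U, folded M_def], of "\<lambda>X. X $ l $ a"] by (simp add: transpose_def)
    consider (1) i where "i \<notin> T" "\<not> p dvd M $ i $ i" | (2) i j where "i \<notin> T" "j \<notin> T" "i \<noteq> j" "\<not> p dvd M $ i $ j" "p dvd M $ i $ i" "p dvd M $ j $ j"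
      | (3) "\<And>i j. i \<notin> T \<Longrightarrow> j \<notin> T \<Longrightarrow> i \<noteq> j \<Longrightarrow> p dvd M $ i $ j" by blast
    then show ?thesis
    proof cases
      case 1
      then show ?thesis using pivot[OF UV cl] unfolding M_def by blast
    next
      case 2
      \<comment> \<open>Replacing the basis vector i by the sum of i and j gives the diagonal entry
        M_ii + 2 M_ij + M_jj; the outer terms vanish modulo p and the middle one does not, as p is
        odd.\<close>
      define w where "w l = (if l = i then 1 else 0 :: int)" for l
      have w0: "w j = 0" using 2 by (simp add: w_def)
      obtain U' V' where U': "U' ** V' = mat 1" "V' ** U' = mat 1" and eq: "transpose U' ** A ** U' = transpose (transvection j w) ** M ** transvection j w"
        using tv[OF UV, of w, OF w0] unfolding M_def by blast
      have cl': "clean T (transpose U' ** A ** U')"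
        unfolding clean_def eq transvection_congruence
      proof (intro ballI allI impI)
        fix a l assume a: "a \<in> T" and al: "a \<noteq> l"
        then have "a \<noteq> i" "a \<noteq> j" using 2 by auto
        then have "p dvd M $ a $ l" "p dvd M $ a $ j" "w a = 0" using cl a al by (auto simp: clean_def M_def w_def)
        then show "p dvd M $ a $ l + w a * M $ j $ l + w l * M $ a $ j + w a * w l * M $ j $ j" by simp
      qed
      have "(transpose U' ** A ** U') $ i $ i = M $ i $ i + 2 * M $ i $ j + M $ j $ j"
        unfolding eq transvection_congruence using sym[of i j] by (simp add: w_def)
      moreover have "\<not> p dvd 2"
        using p by (metis order.antisym prime_ge_2_int zdvd_imp_le zero_less_numeral)
      then have "\<not> p dvd 2 * M $ i $ j" using 2 p by (simp add: prime_dvd_mult_iff)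
      ultimately have "\<not> p dvd (transpose U' ** A ** U') $ i $ i"
        using 2 by (metis dvd_add_left_iff dvd_add_right_iff)
      then show ?thesis using pivot[OF U' cl'] 2 by blast
    next
      case 3
      obtain i where i: "i \<notin> T" using T by blast
      have "clean (insert i T) M"
        unfolding clean_def
      proof (intro ballI allI impI)
        fix a l assume "a \<in> insert i T" "a \<noteq> l"
        then show "p dvd M $ a $ l" using 3[of i l] i cl sym[of i l] unfolding clean_def M_def by (metis insert_iff)
      qed
      then show ?thesis using UV i unfolding M_def by blast
    qed
  qed
  have "k \<le> CARD('n) \<Longrightarrow> \<exists>(T :: 'n set) (U :: int^'n^'n) V. card T = k \<and> U ** V = mat 1 \<and> V ** U = mat 1 \<and> clean T (transpose U ** A ** U)" for k
  proof (induction k)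
    case 0
    show ?case by (intro exI[of _ "{}"] exI[of _ "mat 1"]) (simp add: clean_def)
  next
    case (Suc k)
    then obtain T U V where T: "card T = k" "U ** V = mat 1" "V ** U = mat 1" "clean T (transpose U ** A ** U)" by auto
    have "T \<noteq> UNIV" using T(1) Suc.prems by auto
    from step[OF T(2,3,4) this] obtain U' V' i where "i \<notin> T" "U' ** V' = mat 1" "V' ** U' = mat 1" "clean (insert i T) (transpose U' ** A ** U')"
      by blast
    moreover have "card (insert i T) = Suc k" using T(1) \<open>i \<notin> T\<close> by simp
    ultimately show ?case by blast
  qed
  from this[of "CARD('n)"] obtain T U V where "card T = CARD('n)" "U ** V = mat 1" "V ** U = mat 1" "clean T (transpose U ** A ** U)" by auto
  moreover from this(1) have "T = UNIV" by (metis card_subset_eq finite subset_UNIV)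
  ultimately show ?thesis unfolding clean_def by blast
qed

lemma qint_congruence:
  assumes A: "even_symmetric A"
  shows "even_symmetric (transpose U ** A ** U)" "qint (transpose U ** A ** U) x = qint A (U *v x)"
proof -
  have id: "idot y ((transpose U ** A ** U) *v x) = idot (U *v y) (A *v (U *v x))" for x y
  proof -
    have "real_of_int (idot y ((transpose U ** A ** U) *v x)) = rvec y \<bullet> (transpose (rmat U) *v rvec (A *v (U *v x)))"
      by (simp add: real_idot transpose_rmat rmat_mult_rvec matrix_vector_mul_assoc matrix_mul_assoc)
    also have "\<dots> = real_of_int (idot (U *v y) (A *v (U *v x)))"
      unfolding inner_matrix_transpose[symmetric] real_idot rmat_mult_rvec ..
    finally show ?thesis by (simp only: of_int_eq_iff)
  qed
  show e: "even_symmetric (transpose U ** A ** U)"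
    unfolding even_symmetric_def
  proof (intro conjI allI)
    show "transpose (transpose U ** A ** U) = transpose U ** A ** U"
      using A by (simp add: transpose_congruence even_symmetric_def)
    fix i
    have "(transpose U ** A ** U) $ i $ i = idot (axis i 1) ((transpose U ** A ** U) *v axis i 1)"
      by (simp add: idot_def axis_def matrix_vector_mult_def if_distrib[of "\<lambda>x. x * _"] if_distrib[of "\<lambda>x. _ * x"] cong: if_cong)
    also have "\<dots> = 2 * qint A (U *v axis i 1)" unfolding id by (simp add: two_qint[OF A])
    finally show "even ((transpose U ** A ** U) $ i $ i)" by simp
  qed
  have "2 * qint (transpose U ** A ** U) x = 2 * qint A (U *v x)"
    unfolding two_qint[OF e] two_qint[OF A] id ..
  then show "qint (transpose U ** A ** U) x = qint A (U *v x)" by simp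
qed

text \<open>U has an integral inverse, so it permutes the residue vectors modulo d.\<close>

lemma gauss_sum_congruence:
  fixes A U V :: "int^'n^'n"
  assumes A: "even_symmetric A" and UV: "U ** V = mat 1" "V ** U = mat 1" and d: "d > 0"
  shows "gauss_sum (transpose U ** A ** U) b d = gauss_sum A b d"
proof -
  define r where "r x = (\<chi> i. x $ i mod d)" for x :: "int^'n"
  have rx: "x = r x + d *s (\<chi> i. x $ i div d)" for x by (simp add: r_def vec_eq_iff)
  have r: "int_phase d (b * qint A (r x)) = int_phase d (b * qint A x)" for x
  proof -
    have "qint A x = qint A (r x + d *s (\<chi> i. x $ i div d))" using rx[of x] by (rule arg_cong)
    then show ?thesis using int_phase_qint_periodic[OF A, of d b "r x"] d by simp
  qed
  have rr: "r (W *v r x) = r (W *v x)" for W x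
  proof -
    have "(W *v r x) $ i mod d = (W *v x) $ i mod d" for i
      by (simp add: r_def matrix_vector_mult_def mod_sum_eq[symmetric, of "\<lambda>j. W $ i $ j * (x $ j mod d)"] mod_mult_right_eq)
         (simp add: mod_sum_eq)
    then show ?thesis by (simp add: r_def)
  qed
  have rb: "r x = x" if "x \<in> int_box (nat d)" for x using that d by (simp add: r_def mem_int_box vec_eq_iff mod_pos_pos_trivial)
  have bij: "bij_betw (\<lambda>x. r (U *v x)) (int_box (nat d)) (int_box (nat d))"
    by (rule bij_betwI[where g="\<lambda>x. r (V *v x)"])
       (use d in \<open>auto simp: rr rb matrix_vector_mul_assoc UV\<close>, auto simp: r_def mem_int_box)
  have "gauss_sum (transpose U ** A ** U) b d = (\<Sum>x\<in>int_box (nat d). int_phase d (b * qint A (r (U *v x))))"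
    unfolding gauss_sum_def qint_congruence[OF A] r ..
  also have "\<dots> = gauss_sum A b d" unfolding gauss_sum_def
    by (rule sum.reindex_bij_betw[OF bij])
  finally show ?thesis .
qed

section \<open>Legendre and Jacobi symbols\<close>

lemma Legendre_cong: "[a = b] (mod p) \<Longrightarrow> Legendre a p = Legendre b p"
  unfolding Legendre_def QuadRes_def cong_def by simp

lemma odd_prime_gt_2: "prime p \<Longrightarrow> p \<noteq> 2 \<Longrightarrow> p > 2" for p :: int
  using prime_ge_2_int[of p] by auto

lemma Legendre_cases: "Legendre a p \<in> {-1, 0, 1}" by (simp add: Legendre_def)

lemma Legendre_eq_0_iff: "Legendre a p = 0 \<longleftrightarrow> p dvd a"
  by (simp add: Legendre_def cong_0_iff)

text \<open>Euler's criterion gives the identity modulo p; two numbers in {-1, 0, 1} that agree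
  modulo p > 2 are equal.\<close>

lemma Legendre_mult:
  fixes p :: int
  assumes p: "prime p" "p \<noteq> 2"
  shows "Legendre (a * b) p = Legendre a p * Legendre b p"
proof -
  have p2: "p > 2" using odd_prime_gt_2[OF p] .
  define q where "q = nat p"
  have q: "prime q" "2 < q" "int q = p" using p(1) p2 by (auto simp: q_def)
  note e = euler_criterion[OF q(1,2), unfolded q(3)]
  have "[Legendre (a * b) p = Legendre a p * Legendre b p] (mod p)"
    using cong_trans[OF e[of "a * b"]] cong_mult[OF e[of a] e[of b]]
    by (metis cong_sym power_mult_distrib)
  then have d: "p dvd Legendre (a * b) p - Legendre a p * Legendre b p" by (simp add: cong_iff_dvd_diff)
  have "\<bar>Legendre (a * b) p - Legendre a p * Legendre b p\<bar> \<le> 2"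
    using Legendre_cases[of "a * b" p] Legendre_cases[of a p] Legendre_cases[of b p] by auto
  then show ?thesis using d p2 zdvd_imp_le[of p "\<bar>Legendre (a * b) p - Legendre a p * Legendre b p\<bar>"] by auto
qed

lemma Legendre_1: "prime p \<Longrightarrow> Legendre 1 p = 1" for p :: int
proof -
  assume p: "prime p"
  then have "\<not> [1 = 0] (mod p)" using not_prime_unit[of p] by (auto simp: cong_0_iff)
  moreover have "QuadRes p 1" unfolding QuadRes_def by (rule exI[of _ 1]) simp
  ultimately show ?thesis by (simp add: Legendre_def)
qed

lemma card_square_roots_mod:
  fixes p y :: int
  assumes p: "prime p" "p \<noteq> 2" and y: "y \<in> {0..<p}"
  shows "int (card {x\<in>{0..<p}. x\<^sup>2 mod p = y}) = 1 + Legendre y p"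
proof -
  have p2: "p > 2" using odd_prime_gt_2[OF p] .
  have dz: "p dvd x \<longleftrightarrow> x = 0" if "x \<in> {0..<p}" for x using that by (auto dest: zdvd_imp_le)
  have ym: "y mod p = y" using y by simp
  show ?thesis
  proof (cases "y = 0")
    case True
    then have "{x\<in>{0..<p}. x\<^sup>2 mod p = y} = {0}"
      using p p2 dz by (auto simp: mod_eq_0_iff_dvd prime_dvd_power_iff)
    then show ?thesis using True by (simp add: Legendre_def)
  next
    case False
    then have npy: "\<not> p dvd y" using dz y by blast
    show ?thesis
    proof (cases "QuadRes p y")
      case True
      then obtain z where z: "[z\<^sup>2 = y] (mod p)" by (auto simp: QuadRes_def)
      define u where "u = z mod p"
      have u: "u\<^sup>2 mod p = y" "u \<in> {0..<p}" using z ym p2 by (auto simp: u_def cong_def power_mod)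
      have u0: "u \<noteq> 0" using u(1) False by auto
      have "{x\<in>{0..<p}. x\<^sup>2 mod p = y} = {u, p - u}"
      proof (intro equalityI subsetI)
        fix x assume "x \<in> {x\<in>{0..<p}. x\<^sup>2 mod p = y}"
        then have x: "x \<in> {0..<p}" "x\<^sup>2 mod p = u\<^sup>2 mod p" using u by auto
        then have "p dvd x\<^sup>2 - u\<^sup>2" by (simp add: mod_eq_dvd_iff)
        then have "p dvd (x - u) * (x + u)" by (simp add: power2_eq_square algebra_simps)
        then have "p dvd x - u \<or> p dvd x + u" using p(1) by (simp add: prime_dvd_mult_iff)
        then show "x \<in> {u, p - u}"
        proof
          assume "p dvd x - u"
          then have "x - u = 0" using dvd_imp_le_int[of "x - u" p] x u(2) by fastforce
          then show ?thesis by simp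
        next
          assume "p dvd x + u"
          then obtain k where k: "x + u = p * k" by blast
          have "0 < x + u" "x + u < p * 2" using x u(2) u0 by auto
          then have "0 < p * k" "p * k < p * 2" unfolding k .
          then have "k = 1" using p2 by (simp add: zero_less_mult_iff)
          then show ?thesis using k by simp
        qed
      next
        fix x assume "x \<in> {u, p - u}"
        moreover have "(p - u)\<^sup>2 mod p = u\<^sup>2 mod p"
          by (simp add: mod_eq_dvd_iff power2_eq_square algebra_simps)
        ultimately show "x \<in> {x\<in>{0..<p}. x\<^sup>2 mod p = y}" using u u0 by auto
      qed
      moreover have "u \<noteq> p - u"
      proof
        assume "u = p - u"
        then have "p = 2 * u" by simp
        then show False using p u0 by (metis dvd_triv_left primes_dvd_imp_eq two_is_prime_nat prime_int_numeral_eq order.refl)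
      qed
      ultimately show ?thesis using True npy by (simp add: Legendre_def cong_0_iff)
    next
      case False
      have e: "{x\<in>{0..<p}. x\<^sup>2 mod p = y} = {}" using False ym by (auto simp: QuadRes_def cong_def)
      show ?thesis unfolding e using False npy by (simp add: Legendre_def cong_0_iff)
    qed
  qed
qed

section \<open>Scalar quadratic Gauss sums\<close>

definition gauss1 :: "int \<Rightarrow> int \<Rightarrow> complex" where
  "gauss1 b d = (\<Sum>x\<in>{0..<d}. int_phase d (b * x\<^sup>2))"

lemma sum_residues_mult:
  fixes F :: "int \<Rightarrow> complex"
  assumes d: "d > 0" and cop: "coprime a d" and per: "\<And>x. F (x mod d) = F x"
  shows "(\<Sum>x\<in>{0..<d}. F (a * x)) = (\<Sum>x\<in>{0..<d}. F x)"
proof -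
  obtain a' where a': "[a * a' = 1] (mod d)" using cong_solve_coprime_int[OF cop] by blast
  have c: "a * (a' * x) mod d = x mod d" "a' * (a * x) mod d = x mod d" for x
  proof -
    have "[a * a' * x = 1 * x] (mod d)" using a' by (intro cong_mult cong_refl)
    then show "a * (a' * x) mod d = x mod d" "a' * (a * x) mod d = x mod d" by (simp_all add: cong_def mult_ac)
  qed
  have "bij_betw (\<lambda>x. a * x mod d) {0..<d} {0..<d}"
    by (rule bij_betwI[where g="\<lambda>x. a' * x mod d"]) (use d in \<open>auto simp: mod_simps c\<close>)
  then have "(\<Sum>x\<in>{0..<d}. F (a * x mod d)) = (\<Sum>x\<in>{0..<d}. F x)" by (rule sum.reindex_bij_betw)
  then show ?thesis by (simp add: per)
qed

text \<open>Grouping x by its square counts y with multiplicity 1 + (y/p), and the constant part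
  sums to 0.\<close>

lemma gauss1_prime_aux:
  fixes p :: int
  assumes p: "prime p" "p \<noteq> 2" and a: "\<not> p dvd a"
  shows "gauss1 a p = (\<Sum>y\<in>{0..<p}. of_int (Legendre y p) * int_phase p (a * y))"
proof -
  have p2: "p > 2" using odd_prime_gt_2[OF p] .
  have "gauss1 a p = (\<Sum>x\<in>{0..<p}. int_phase p (a * (x\<^sup>2 mod p)))"
    unfolding gauss1_def using p2 by (intro sum.cong refl int_phase_cong) (auto simp: cong_def mod_simps)
  also have "\<dots> = (\<Sum>y\<in>{0..<p}. \<Sum>x\<in>{x\<in>{0..<p}. x\<^sup>2 mod p = y}. int_phase p (a * (x\<^sup>2 mod p)))"
    using p2 by (intro sum.group[symmetric]) auto
  also have "\<dots> = (\<Sum>y\<in>{0..<p}. of_int (1 + Legendre y p) * int_phase p (a * y))"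
  proof (rule sum.cong[OF refl])
    fix y assume y: "y \<in> {0..<p}"
    have "(\<Sum>x\<in>{x\<in>{0..<p}. x\<^sup>2 mod p = y}. int_phase p (a * (x\<^sup>2 mod p))) = of_int (int (card {x\<in>{0..<p}. x\<^sup>2 mod p = y})) * int_phase p (a * y)"
      by simp
    then show "(\<Sum>x\<in>{x\<in>{0..<p}. x\<^sup>2 mod p = y}. int_phase p (a * (x\<^sup>2 mod p))) = of_int (1 + Legendre y p) * int_phase p (a * y)"
      unfolding card_square_roots_mod[OF p y] .
  qed
  also have "\<dots> = (\<Sum>y\<in>{0..<p}. int_phase p (a * y)) + (\<Sum>y\<in>{0..<p}. of_int (Legendre y p) * int_phase p (a * y))"
    by (simp add: distrib_right sum.distrib)
  finally show ?thesis using sum_int_phase[of p a] p2 a by simp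
qed

text \<open>In the character sum the substitution y -> a y splits off (a/p), which is a
  sign.\<close>

lemma gauss1_prime:
  fixes p :: int
  assumes p: "prime p" "p \<noteq> 2" and a: "\<not> p dvd a"
  shows "gauss1 a p = of_int (Legendre a p) * gauss1 1 p"
proof -
  have p2: "p > 2" using odd_prime_gt_2[OF p] .
  have n1: "\<not> p dvd 1" using p2 zdvd_imp_le[of p 1] by auto
  define F where "F x = of_int (Legendre x p) * int_phase p x" for x
  have per: "F (x mod p) = F x" for x
    unfolding F_def using p2 Legendre_cong[of "x mod p" x p] int_phase_cong[of "x mod p" x p] by simp
  have sq: "Legendre a p * Legendre a p = 1"
    using Legendre_cases[of a p] a Legendre_eq_0_iff[of a p] by auto
  have "(\<Sum>x\<in>{0..<p}. F (a * x)) = (\<Sum>x\<in>{0..<p}. F x)"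
    using p2 p a prime_imp_coprime[of p a] by (intro sum_residues_mult per) (auto simp: coprime_commute)
  moreover have "F (a * x) = of_int (Legendre a p) * (of_int (Legendre x p) * int_phase p (a * x))" for x
    by (simp add: F_def Legendre_mult[OF p])
  ultimately have "of_int (Legendre a p) * gauss1 a p = gauss1 1 p"
    unfolding gauss1_prime_aux[OF p a] gauss1_prime_aux[OF p n1] by (simp add: sum_distrib_left F_def mult.assoc)
  then have "of_int (Legendre a p * Legendre a p) * gauss1 a p = of_int (Legendre a p) * gauss1 1 p"
    by (simp add: mult.assoc)
  then show ?thesis unfolding sq by simp
qed

lemma even_symmetric_mat2: "even_symmetric (mat 2 :: int^'n^'n)"
  by (simp add: even_symmetric_def) (simp add: mat_def)

text \<open>The scalar sum belongs to the form x^2, whose matrix is 2; this makes the rules for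
  general forms available for it.\<close>

lemma gauss1_eq: 
  assumes "d > 0" shows "gauss_sum (mat 2 :: int^1^1) b d = gauss1 b d"
proof -
  have q: "qint (mat 2 :: int^1^1) x = (x $ 1)\<^sup>2" for x
    using two_qint[OF even_symmetric_mat2, of x] by (simp add: idot_def matrix_vector_mult_def mat_def power2_eq_square)
  have "gauss_sum (mat 2 :: int^1^1) b d = (\<Sum>g\<in>int_box (nat d). \<Prod>i\<in>(UNIV :: 1 set). int_phase d (b * (g $ i)\<^sup>2))"
    by (simp add: gauss_sum_def q)
  also have "\<dots> = (\<Prod>i\<in>(UNIV :: 1 set). \<Sum>y\<in>{0..<d}. int_phase d (b * y\<^sup>2))" by (rule sum_int_box_prod[OF assms])
  also have "\<dots> = gauss1 b d" by (simp add: gauss1_def)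
  finally show ?thesis .
qed

text \<open>After diagonalisation modulo p the sum is a product of scalar ones. The inverse h of 2
  modulo p stands for the 1/2 in the quadratic form and is the origin of the factors (2/p).\<close>

lemma gauss_sum_odd_prime:
  fixes A :: "int^'n^'n" and p :: int
  assumes A: "even_symmetric A" and p: "prime p" "p \<noteq> 2" and b: "\<not> p dvd b" and dA: "\<not> p dvd det A"
  shows "gauss_sum A b p = of_int (Legendre b p ^ CARD('n) * Legendre 2 p ^ CARD('n) * Legendre (det A) p) * gauss1 1 p ^ CARD('n)"
proof -
  have p2: "p > 2" using odd_prime_gt_2[OF p] .
  have sym: "transpose A = A" using A by (simp add: even_symmetric_def)
  obtain U V :: "int^'n^'n" where UV: "U ** V = mat 1" "V ** U = mat 1" and off: "\<And>i j. i \<noteq> j \<Longrightarrow> p dvd (transpose U ** A ** U) $ i $ j"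
    using diagonalise_mod_prime[OF sym p] by blast
  define B where "B = transpose U ** A ** U"
  have B: "even_symmetric B" unfolding B_def by (rule qint_congruence(1)[OF A])
  have np2: "\<not> p dvd 2" using p2 zdvd_imp_le[of p 2] by auto
  then have "coprime 2 p" using p(1) by (metis coprime_commute prime_imp_coprime)
  then obtain h where h: "[2 * h = 1] (mod p)" using cong_solve_coprime_int by blast
  have detU: "det U * det U = 1"
  proof -
    have "det U * det V = 1" using arg_cong[OF UV(1), of det] by (simp add: det_mul)
    then have "det U dvd 1" by (metis dvd_triv_left)
    then show ?thesis using abs_mult_self_eq[of "det U"] by simp
  qed
  have "det B = det A * (det U * det U)" unfolding B_def by (simp add: det_mul det_transpose mult_ac)
  then have detB: "det B = det A" unfolding detU by simp
  have "[det B = det (\<chi> i j. if i = j then B $ i $ i else 0)] (mod p)"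
    using off unfolding B_def[symmetric] by (intro det_cong) (auto simp: cong_0_iff)
  then have detD: "[det A = (\<Prod>i\<in>UNIV. B $ i $ i)] (mod p)"
    unfolding detB by (subst (asm) det_diagonal) auto
  have npB: "\<not> p dvd B $ i $ i" for i
  proof
    assume "p dvd B $ i $ i"
    then have "p dvd (\<Prod>i\<in>UNIV. B $ i $ i)" by (meson UNIV_I dvd_prod_eqI finite dvd_trans dvd_prodI)
    then show False using detD dA by (simp add: cong_dvd_iff)
  qed
  have ph: "int_phase p (b * qint B x) = (\<Prod>i\<in>UNIV. int_phase p (b * h * B $ i $ i * (x $ i)\<^sup>2))" for x
  proof -
    have prodph: "int_phase p (sum f S) = (\<Prod>i\<in>S. int_phase p (f i))" if "finite S" for f and S :: "'n set"
      using that by (induction S rule: finite_induct) (auto simp: int_phase_add)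
    have "[(B *v x) $ i = B $ i $ i * x $ i] (mod p)" for i
    proof -
      have "[(\<Sum>j\<in>UNIV. B $ i $ j * x $ j) = (\<Sum>j\<in>UNIV. if j = i then B $ i $ i * x $ i else 0)] (mod p)"
        using off unfolding B_def[symmetric] by (intro cong_sum) (auto simp: cong_0_iff)
      then show ?thesis by (simp add: matrix_vector_mult_def)
    qed
    then have "[idot x (B *v x) = (\<Sum>i\<in>UNIV. x $ i * (B $ i $ i * x $ i))] (mod p)"
      unfolding idot_def by (intro cong_sum cong_mult cong_refl)
    then have c1: "[b * h * idot x (B *v x) = b * h * (\<Sum>i\<in>UNIV. x $ i * (B $ i $ i * x $ i))] (mod p)"
      by (intro cong_mult cong_refl)
    have c2: "[b * h * idot x (B *v x) = b * qint B x] (mod p)"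
    proof -
      have "[(2 * h) * (b * qint B x) = 1 * (b * qint B x)] (mod p)" by (intro cong_mult h cong_refl)
      moreover have e: "b * h * idot x (B *v x) = (2 * h) * (b * qint B x)" unfolding two_qint[OF B, symmetric] by simp
      ultimately show ?thesis unfolding e by simp
    qed
    have e: "b * h * (\<Sum>i\<in>UNIV. x $ i * (B $ i $ i * x $ i)) = (\<Sum>i\<in>UNIV. b * h * B $ i $ i * (x $ i)\<^sup>2)"
      by (simp add: sum_distrib_left power2_eq_square mult_ac)
    have "[b * qint B x = (\<Sum>i\<in>UNIV. b * h * B $ i $ i * (x $ i)\<^sup>2)] (mod p)"
      using cong_trans[OF cong_sym[OF c2] c1[unfolded e]] .
    then have "int_phase p (b * qint B x) = int_phase p (\<Sum>i\<in>UNIV. b * h * B $ i $ i * (x $ i)\<^sup>2)" using p2 by (intro int_phase_cong) auto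
    then show ?thesis by (simp add: prodph)
  qed
  have hp: "\<not> p dvd h" using h p by (metis cong_dvd_iff dvd_mult not_prime_unit)
  have Lh: "Legendre h p = Legendre 2 p"
  proof -
    have "Legendre 2 p * Legendre h p = 1" using Legendre_cong[OF h] Legendre_mult[OF p, of 2 h] Legendre_1[OF p(1)] by simp
    then show ?thesis using Legendre_cases[of 2 p] Legendre_cases[of h p] by auto
  qed
  have Lprod: "Legendre (prod f S) p = (\<Prod>i\<in>S. Legendre (f i) p)" if "finite S" for f and S :: "'n set"
    using that by (induction S rule: finite_induct) (auto simp: Legendre_mult[OF p] Legendre_1[OF p(1)])
  have "gauss_sum A b p = gauss_sum B b p" unfolding B_def using gauss_sum_congruence[OF A UV, of p b] p2 by simp
  also have "\<dots> = (\<Prod>i\<in>UNIV. gauss1 (b * h * B $ i $ i) p)"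
    unfolding gauss_sum_def ph using p2 by (subst sum_int_box_prod) (auto simp: gauss1_def)
  also have "\<dots> = (\<Prod>i\<in>UNIV. of_int (Legendre (b * h * B $ i $ i) p) * gauss1 1 p)"
    using b hp npB p by (intro prod.cong refl gauss1_prime) (auto simp: prime_dvd_mult_iff)
  also have "\<dots> = of_int (Legendre b p ^ CARD('n) * Legendre 2 p ^ CARD('n) * Legendre (det A) p) * gauss1 1 p ^ CARD('n)"
    unfolding Legendre_cong[OF detD] Lprod[OF finite] by (simp add: Legendre_mult[OF p] Lh prod.distrib power_mult_distrib)
  finally show ?thesis .
qed

text \<open>The Kronecker symbol without its sign rule: for odd m the Jacobi symbol at |m|, with the
  Kronecker value for a factor 2.\<close>

definition jac :: "int \<Rightarrow> int \<Rightarrow> int" where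
  "jac a m = (\<Prod>p\<in>prime_factors m. kronecker_prime a p ^ multiplicity p m)"

lemma jac_mset: "jac a m = prod_mset (image_mset (kronecker_prime a) (prime_factorization m))"
  unfolding jac_def image_prod_mset_multiplicity
  by (intro prod.cong refl) (auto simp: count_prime_factorization_prime in_prime_factors_imp_prime)

lemma jac_mult_right: "m \<noteq> 0 \<Longrightarrow> k \<noteq> 0 \<Longrightarrow> jac a (m * k) = jac a m * jac a k"
  by (simp add: jac_mset prime_factorization_mult)

lemma jac_1_right [simp]: "jac a 1 = 1" by (simp add: jac_mset)

lemma jac_minus_right [simp]: "jac a (- m) = jac a m"
proof -
  have "prime_factorization (- m) = prime_factorization m"
    using prime_factorization_normalize[of "- m"] prime_factorization_normalize[of m] by (simp add: normalize_int_def)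
  then show ?thesis by (simp add: jac_mset)
qed

lemma jac_prime: "prime p \<Longrightarrow> jac a p = kronecker_prime a p"
  by (simp add: jac_mset prime_factorization_prime)

lemma odd_prime_factor: "odd m \<Longrightarrow> p \<in> prime_factors m \<Longrightarrow> prime p \<and> p \<noteq> 2 \<and> p dvd m" for m :: int
  by (auto simp: in_prime_factors_imp_dvd in_prime_factors_imp_prime)

lemma jac_mult_left:
  assumes "odd m" shows "jac (a * b) m = jac a m * jac b m"
proof -
  have "kronecker_prime (a * b) p = kronecker_prime a p * kronecker_prime b p" if "p \<in> prime_factors m" for p
    using odd_prime_factor[OF assms that] by (simp add: kronecker_prime_def Legendre_mult)
  then show ?thesis by (simp add: jac_def prod.distrib power_mult_distrib)
qed

lemma jac_cong:
  assumes "odd m" "\<And>p. prime p \<Longrightarrow> p dvd m \<Longrightarrow> [a = b] (mod p)" shows "jac a m = jac b m"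
proof -
  have "kronecker_prime a p = kronecker_prime b p" if "p \<in> prime_factors m" for p
    using odd_prime_factor[OF assms(1) that] Legendre_cong[OF assms(2)[of p]] by (simp add: kronecker_prime_def)
  then show ?thesis by (simp add: jac_def)
qed

lemma jac_1_left:
  assumes "odd m" shows "jac 1 m = 1"
proof -
  have "kronecker_prime 1 p = 1" if "p \<in> prime_factors m" for p
    using odd_prime_factor[OF assms that] by (simp add: kronecker_prime_def Legendre_1)
  then show ?thesis by (simp add: jac_def)
qed

lemma jac_square:
  assumes "odd m" "coprime a m" shows "jac a m * jac a m = 1"
proof -
  have "kronecker_prime a p * kronecker_prime a p = 1" if "p \<in> prime_factors m" for p
  proof -
    have p: "prime p" "p \<noteq> 2" "p dvd m" using odd_prime_factor[OF assms(1) that] by auto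
    then have "\<not> p dvd a" using assms(2) not_prime_unit by (auto dest: coprime_common_divisor)
    then show ?thesis using p Legendre_cases[of a p] Legendre_eq_0_iff[of a p] by (auto simp: kronecker_prime_def)
  qed
  then show ?thesis unfolding jac_def prod.distrib[symmetric] power_mult_distrib[symmetric] by (intro prod.neutral) auto
qed

lemma jac_cases: "odd m \<Longrightarrow> coprime a m \<Longrightarrow> jac a m = 1 \<or> jac a m = -1"
  using jac_square[of m a] by (metis square_eq_1_iff power2_eq_square mult.commute mult_1 zmult_eq_1_iff)

lemma jac_prod_square: "odd m \<Longrightarrow> coprime a m \<Longrightarrow> jac a (p\<^sup>2 * m) = jac a m" if "prime p" "p \<noteq> 2" "\<not> p dvd a" for p m :: int
proof -
  assume m: "odd m" "coprime a m"
  have "p \<noteq> 0" "m \<noteq> 0" using that m by auto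
  then have "jac a (p\<^sup>2 * m) = jac a p * jac a p * jac a m"
    by (simp add: power2_eq_square jac_mult_right)
  moreover have "jac a p * jac a p = 1"
    using that Legendre_cases[of a p] Legendre_eq_0_iff[of a p] by (auto simp: jac_prime kronecker_prime_def)
  ultimately show ?thesis by simp
qed

text \<open>Tailored to the two rules for Gauss sums: a repeated prime is removed as a square, a
  simple one as a coprime factor. In the square case p may still divide m.\<close>

lemma odd_int_induct [consumes 2, case_names one square coprime]:
  fixes m :: int
  assumes "odd m" "m > 0"
    and one: "P 1"
    and square: "\<And>p m. prime p \<Longrightarrow> p \<noteq> 2 \<Longrightarrow> odd m \<Longrightarrow> m > 0 \<Longrightarrow> P m \<Longrightarrow> P (p\<^sup>2 * m)"
    and coprime: "\<And>p m. prime p \<Longrightarrow> p \<noteq> 2 \<Longrightarrow> odd m \<Longrightarrow> m > 0 \<Longrightarrow> coprime p m \<Longrightarrow> P m \<Longrightarrow> P (p * m)"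
  shows "P m"
  using assms(1,2)
proof (induction "nat m" arbitrary: m rule: less_induct)
  case less
  show ?case
  proof (cases "m = 1")
    case True then show ?thesis using one by simp
  next
    case False
    then obtain p where p: "prime p" "p dvd m" using prime_factor_int[of m] less.prems by auto
    have p2: "p \<noteq> 2" using p less.prems by auto
    have pg: "p > 1" using p(1) by (simp add: prime_gt_1_int)
    obtain k where k: "m = p * k" using p by blast
    have k0: "k > 0" "odd k" using k less.prems pg by (auto simp: zero_less_mult_iff)
    show ?thesis
    proof (cases "p dvd k")
      case True
      then obtain l where l: "k = p * l" by blast
      have l0: "l > 0" "odd l" using l k0 pg by (auto simp: zero_less_mult_iff)
      have "l < m" using k l l0 pg by (simp add: less_1_mult)
      then have "P l" using less.hyps[of l] l0 by simp
      then show ?thesis using square[OF p(1) p2 l0(2,1)] k l by (simp add: power2_eq_square mult.assoc)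
    next
      case False
      then have "coprime p k" using p(1) by (simp add: prime_imp_coprime)
      moreover have "k < m" using k k0 pg by simp
      then have "P k" using less.hyps[of k] k0 by simp
      ultimately show ?thesis using coprime[OF p(1) p2 k0(2,1)] k by simp
    qed
  qed
qed

lemma gauss1_square: "prime p \<Longrightarrow> p \<noteq> 2 \<Longrightarrow> \<not> p dvd b \<Longrightarrow> m > 0 \<Longrightarrow> gauss1 b (p\<^sup>2 * m) = of_int p * gauss1 b m"
proof -
  assume a: "prime p" "p \<noteq> 2" "\<not> p dvd b" "m > 0"
  have "mat 2 ** mat 2 = (mat 4 :: int^1^1)" by (simp add: matrix_matrix_mult_def mat_def vec_eq_iff)
  moreover have "\<not> p dvd 4"
  proof
    assume "p dvd 4"
    then have "p dvd 2\<^sup>2" by simp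
    then have "p dvd 2" using a(1) prime_dvd_power by blast
    then show False using odd_prime_gt_2[OF a(1,2)] zdvd_imp_le[of p 2] by simp
  qed
  moreover have "p\<^sup>2 * m > 0" using a prime_gt_0_int by simp
  ultimately show ?thesis
    using gauss_sum_prime_square[OF even_symmetric_mat2, of "mat 2 :: int^1^1" 4 p b m] a by (simp add: gauss1_eq)
qed

lemma gauss1_coprime_mult: "m > 0 \<Longrightarrow> k > 0 \<Longrightarrow> coprime m k \<Longrightarrow> gauss1 b (m * k) = gauss1 (b * k) m * gauss1 (b * m) k"
  using gauss_sum_coprime_mult[OF even_symmetric_mat2[where 'n=1], of m k b] by (simp add: gauss1_eq)

lemma coprime_prime_not_dvd: "coprime b (p * m) \<Longrightarrow> prime p \<Longrightarrow> \<not> p dvd b" for p :: int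
  by (metis coprime_common_divisor dvd_triv_left not_prime_unit)

lemma gauss1_1_right [simp]: "gauss1 b 1 = 1"
proof -
  have "{0..<1::int} = {0}" by auto
  then show ?thesis by (simp add: gauss1_def)
qed

text \<open>In the coprime step the cross symbols (m/p) and (p/m) arise for b and for 1 alike, so
  that only (b/p)(b/m) distinguishes the two sums.\<close>

lemma gauss1_odd:
  assumes "odd m" "m > 0" "coprime b m"
  shows "gauss1 b m = of_int (jac b m) * gauss1 1 m"
  using assms
proof (induction m arbitrary: b rule: odd_int_induct)
  case one
  then show ?case by simp
next
  case (square p m)
  then have c: "coprime b m" "\<not> p dvd b" using coprime_prime_not_dvd[of b p "p * m"] by (auto simp: power2_eq_square mult.assoc)
  have n1: "\<not> p dvd 1" using square.hyps(1) not_prime_unit by blast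
  have "gauss1 b (p\<^sup>2 * m) = of_int p * gauss1 b m" "gauss1 1 (p\<^sup>2 * m) = of_int p * gauss1 1 m" "jac b (p\<^sup>2 * m) = jac b m"
    using square.hyps c n1 by (auto intro!: gauss1_square jac_prod_square)
  then show ?case unfolding square.IH[OF c(1)] by simp
next
  case (coprime p m)
  then have c: "coprime b m" "\<not> p dvd b" using coprime_prime_not_dvd[of b p m] by auto
  have p0: "p > 0" using coprime.hyps by (simp add: prime_gt_0_int)
  have npm: "\<not> p dvd m" using coprime_prime_not_dvd[of m p 1] coprime.hyps by (simp add: coprime_commute)
  have pr: "gauss1 (x * m) p = of_int (jac x p) * of_int (jac m p) * gauss1 1 p" if "\<not> p dvd x" for x
    using that coprime.hyps npm by (subst gauss1_prime) (auto simp: prime_dvd_mult_iff Legendre_mult jac_prime kronecker_prime_def)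
  have ot: "gauss1 (x * p) m = of_int (jac x m) * of_int (jac p m) * gauss1 1 m" if "coprime x m" for x
    using that coprime.hyps by (subst coprime.IH) (auto simp: jac_mult_left)
  have n1: "\<not> p dvd 1" using coprime.hyps(1) not_prime_unit by blast
  have "gauss1 b (p * m) = gauss1 (b * m) p * gauss1 (b * p) m" using coprime.hyps p0 by (intro gauss1_coprime_mult)
  moreover have "gauss1 1 (p * m) = gauss1 (1 * m) p * gauss1 (1 * p) m" using coprime.hyps p0 by (intro gauss1_coprime_mult)
  moreover have "jac b (p * m) = jac b p * jac b m" using coprime.hyps p0 by (intro jac_mult_right) auto
  ultimately show ?case
    using pr[OF c(2)] ot[OF c(1)] pr[OF n1] ot[of 1] coprime.hyps by (simp add: jac_prime jac_1_left kronecker_prime_def Legendre_1)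
qed

lemma det_mat: "det (mat c :: int^'n^'n) = c ^ CARD('n)"
  by (subst det_diagonal) (auto simp: mat_def)

lemma det_dvd_level:
  fixes A M :: "int^'n^'n"
  assumes "M ** A = mat c" shows "det A dvd c ^ CARD('n)"
proof -
  have "det M * det A = c ^ CARD('n)" using arg_cong[OF assms, of det] by (simp add: det_mul det_mat)
  then show ?thesis by (metis dvd_triv_right)
qed

lemma gauss_sum_1_right [simp]: "gauss_sum A b 1 = 1"
proof -
  have "(0 \<le> k \<and> k < 1) \<longleftrightarrow> k = 0" for k :: int by auto
  then have "x \<in> int_box (nat 1) \<longleftrightarrow> x = 0" for x :: "int^'a"
    unfolding mem_int_box[OF zero_less_one] vec_eq_iff by simp
  then have "int_box (nat 1) = {0::int^'a}" by blast
  then show ?thesis by (simp add: gauss_sum_def qint_def qf_def)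
qed

text \<open>det A divides c^n and is therefore prime to m. In the coprime step the cross symbols
  occur to the power n and are absorbed by the n-th power of the scalar sum of modulus p m, which
  contains the same ones.\<close>

lemma gauss_sum_odd:
  fixes A M :: "int^'n^'n"
  assumes A: "even_symmetric A" and M: "M ** A = mat c"
    and m: "odd m" "m > 0" "coprime b m" "coprime c m"
  shows "gauss_sum A b m = of_int (jac b m ^ CARD('n) * jac 2 m ^ CARD('n) * jac (det A) m) * gauss1 1 m ^ CARD('n)"
  using m
proof (induction m arbitrary: b rule: odd_int_induct)
  case one
  then show ?case by simp
next
  case (square p m)
  have c: "coprime b m" "\<not> p dvd b" "coprime c m" "\<not> p dvd c"
    using square.prems square.hyps coprime_prime_not_dvd[of b p "p * m"] coprime_prime_not_dvd[of c p "p * m"] by (auto simp: power2_eq_square mult.assoc)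
  have nd: "\<not> p dvd det A" using c(4) det_dvd_level[OF M] square.hyps by (metis dvd_trans prime_dvd_power)
  have cd: "coprime (det A) m"
    using det_dvd_level[OF M] c(3) by (metis coprime_divisors coprime_power_left_iff dvd_refl coprime_power_left_iff)
  have n1: "\<not> p dvd 1" using square.hyps(1) not_prime_unit by blast
  have n2: "\<not> p dvd 2" using odd_prime_gt_2[of p] square zdvd_imp_le[of p 2] by auto
  have c2: "coprime 2 m" using square by simp
  show ?case using square.IH[OF c(1,3)] square.hyps c cd nd n1 n2 c2
    by (simp add: gauss_sum_prime_square[OF A M] gauss1_square jac_prod_square power_mult_distrib)
next
  case (coprime p m)
  have c: "coprime b m" "\<not> p dvd b" "coprime c m" "\<not> p dvd c"
    using coprime.prems coprime.hyps coprime_prime_not_dvd[of b p m] coprime_prime_not_dvd[of c p m] by auto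
  have nd: "\<not> p dvd det A" using c(4) det_dvd_level[OF M] coprime.hyps by (metis dvd_trans prime_dvd_power)
  have p0: "p > 0" using coprime.hyps by (simp add: prime_gt_0_int)
  have npm: "\<not> p dvd m" using coprime_prime_not_dvd[of m p 1] coprime.hyps by (simp add: coprime_commute)
  have pb: "\<not> p dvd b * m" using c(2) npm coprime.hyps by (simp add: prime_dvd_mult_iff)
  have n1: "\<not> p dvd 1" using coprime.hyps(1) not_prime_unit by blast
  have k: "kronecker_prime x p = Legendre x p" for x using coprime.hyps by (simp add: kronecker_prime_def)
  have g1: "gauss1 1 (p * m) = of_int (jac m p) * of_int (jac p m) * (gauss1 1 p * gauss1 1 m)"
  proof -
    have "gauss1 1 (p * m) = gauss1 (1 * m) p * gauss1 (1 * p) m" using coprime.hyps p0 by (intro gauss1_coprime_mult)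
    also have "gauss1 (1 * m) p = of_int (jac m p) * gauss1 1 p" using gauss1_prime[of p m] npm coprime.hyps by (simp add: jac_prime k)
    also have "gauss1 (1 * p) m = of_int (jac p m) * gauss1 1 m" using gauss1_odd[of m p] coprime.hyps by simp
    finally show ?thesis by simp
  qed
  have "gauss_sum A b (p * m) = gauss_sum A (b * m) p * gauss_sum A (b * p) m"
    using coprime.hyps p0 by (intro gauss_sum_coprime_mult[OF A])
  also have "gauss_sum A (b * m) p = of_int ((jac b p * jac m p) ^ CARD('n) * jac 2 p ^ CARD('n) * jac (det A) p) * gauss1 1 p ^ CARD('n)"
    using coprime.hyps by (subst gauss_sum_odd_prime[OF A _ _ pb nd]) (simp_all add: jac_prime k Legendre_mult)
  also have "gauss_sum A (b * p) m = of_int ((jac b m * jac p m) ^ CARD('n) * jac 2 m ^ CARD('n) * jac (det A) m) * gauss1 1 m ^ CARD('n)"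
    using coprime.hyps c by (subst coprime.IH) (auto simp: jac_mult_left)
  finally show ?case unfolding g1 using coprime.hyps p0
    by (simp add: jac_mult_right power_mult_distrib mult_ac)
qed

section \<open>Periodicity of the theta series and its effect on Gauss sums\<close>

context diag_form begin

text \<open>The real part of \<open>sgt\<close> multiplies Q, which is integral on the
  lattice.\<close>

lemma Th_add_int: "Th (t + of_int k) b = Th t b"
proof -
  have "gexp (sgt (t + of_int k)) b (R *v rvec l) = gexp (sgt t) b (R *v rvec l)" for l
  proof -
    have s: "sgt (t + of_int k) i = of_real (sg i) * of_int k + sgt t i" for i using sg[of i] by (auto simp: sgt_def)
    have "real_of_int (qint A l) = (\<Sum>i\<in>UNIV. sg i * ((R *v rvec l) $ i)\<^sup>2) / 2"
      by (simp add: real_qint[OF ev] qf_diag)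
    then have "int_phase 1 (k * qint A l) = exp (\<Sum>i\<in>UNIV. pi * \<i> * (of_real (sg i) * of_int k) * ((R *v rvec l) $ i)\<^sup>2)"
      unfolding int_phase_def cis_conv_exp by (simp add: sum_distrib_left sum_distrib_right sum_divide_distrib mult_ac)
    moreover have "int_phase 1 (k * qint A l) = 1" using int_phase_mult_self[of 1 "k * qint A l"] by simp
    moreover have "gexp (sgt (t + of_int k)) b (R *v rvec l) = exp (\<Sum>i\<in>UNIV. pi * \<i> * (of_real (sg i) * of_int k) * ((R *v rvec l) $ i)\<^sup>2) * gexp (sgt t) b (R *v rvec l)"
      unfolding gexp_def exp_add[symmetric] sum.distrib[symmetric] s by (simp add: algebra_simps)
    ultimately show ?thesis by simp
  qed
  then show ?thesis by (simp add: Th_def)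
qed

text \<open>At t = i with elliptic variable 0 every term is positive; this is the value by which
  transformation laws are divided.\<close>

lemma Th_i_nonzero: "Th \<i> (\<lambda>_. 0) \<noteq> 0"
proof -
  define f where "f l = exp (- pi * (\<Sum>i\<in>UNIV. ((R *v rvec l) $ i)\<^sup>2))" for l
  have "sgt \<i> i = \<i>" for i by (simp add: sgt_def)
  then have g: "gexp (sgt \<i>) (\<lambda>_. 0) (R *v rvec l) = of_real (f l)" for l
    by (simp add: gexp_def f_def mult.assoc sum_distrib_left sum_negf exp_of_real[symmetric])
  have "(\<lambda>l. norm (gexp (sgt \<i>) (\<lambda>_. 0) (R *v rvec l))) summable_on UNIV" by (rule Th_summable) simp
  then have s: "f summable_on UNIV" unfolding g by (simp add: f_def[abs_def])
  have "f 0 \<le> infsum f UNIV"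
    using finite_sum_le_infsum[OF s, of "{0}"] by (simp add: f_def)
  moreover have "f 0 = 1" by (simp add: f_def)
  ultimately have "infsum f UNIV > 0" by simp
  moreover have "Th \<i> (\<lambda>_. 0) = of_real (infsum f UNIV)" unfolding Th_def g by (rule infsumI[OF has_sum_of_real[OF has_sum_infsum[OF s]]])
  ultimately show ?thesis by simp
qed

text \<open>The law of gamma T^k at i and the law of gamma at i + k describe the same theta value
  with the same factor j. Dividing by what they share equates the normalised Gauss sums, without
  evaluating either.\<close>

lemma gauss_sum_T_invariant:
  assumes M: "even_symmetric M" and AM: "A ** M = mat c" and det: "a * d - b * c = 1"
    and d: "d > 0" "d + k * c > 0"
  shows "gauss_sum A (b + k * a) (d + k * c) / of_real (sqrt (of_int (d + k * c)) ^ CARD('n)) = gauss_sum A b d / of_real (sqrt (of_int d) ^ CARD('n))"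
proof -
  define j where "j = of_int c * \<i> + of_int (d + k * c)"
  have j2: "j = of_int c * (\<i> + of_int k) + of_int d" by (simp add: j_def algebra_simps)
  have det': "a * (d + k * c) - (b + k * a) * c = 1" using det by (simp add: algebra_simps)
  let ?z = "\<lambda>_. 0 :: complex"
  have 1: "Th ((of_int a * \<i> + of_int (b + k * a)) / j) (\<lambda>i. ?z i / j) = gauss_sum A (b + k * a) (d + k * c) / of_real (sqrt (of_int (d + k * c)) ^ CARD('n)) *
     (\<Prod>i\<in>UNIV. csqrt (if sg i = 1 then j else cnj j)) * exp (pi * \<i> * of_int c * (\<Sum>i\<in>(UNIV::'n set). (?z i)\<^sup>2) / j) * Th \<i> ?z"
    by (rule Th_transform[OF _ d(2) det' M AM _ j_def]) auto
  have 2: "Th ((of_int a * (\<i> + of_int k) + of_int b) / j) (\<lambda>i. ?z i / j) = gauss_sum A b d / of_real (sqrt (of_int d) ^ CARD('n)) *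
     (\<Prod>i\<in>UNIV. csqrt (if sg i = 1 then j else cnj j)) * exp (pi * \<i> * of_int c * (\<Sum>i\<in>(UNIV::'n set). (?z i)\<^sup>2) / j) * Th (\<i> + of_int k) ?z"
    by (rule Th_transform[OF _ d(1) det M AM _ j2]) auto
  have e: "of_int a * \<i> + of_int (b + k * a) = of_int a * (\<i> + of_int k) + (of_int b :: complex)" by (simp add: algebra_simps)
  have "j \<noteq> 0" using d(2) by (auto simp: j_def complex_eq_iff)
  then have "(\<Prod>i\<in>UNIV. csqrt (if sg i = 1 then j else cnj j)) \<noteq> 0" by auto
  then have nz: "(\<Prod>i\<in>UNIV. csqrt (if sg i = 1 then j else cnj j)) * Th \<i> ?z \<noteq> 0" using Th_i_nonzero by simp
  have e0: "exp (pi * \<i> * of_int c * (\<Sum>i\<in>(UNIV::'n set). (?z i)\<^sup>2) / j) = 1" by simp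
  show ?thesis using trans[OF sym[OF 1[unfolded e e0 mult_1_right]] 2[unfolded Th_add_int e0 mult_1_right]]
    unfolding mult.assoc mult_right_cancel[OF nz] .
qed

end

section \<open>Quadratic reciprocity\<close>

text \<open>The form x^2, whose theta series decides the sign of the scalar Gauss sum.\<close>

interpretation one_dim: diag_form "mat 2 :: int^1^1" "mat (1 / sqrt 2)" "mat (sqrt 2)" "\<lambda>_. 1"
proof
  show "even_symmetric (mat 2 :: int^1^1)" by (rule even_symmetric_mat2)
qed (simp_all add: vec_eq_iff matrix_matrix_mult_def mat_def transpose_def map_matrix_def)

lemma mat2_mult: "mat 2 ** mat (2 * l) = (mat (4 * l) :: int^1^1)"
  by (simp add: matrix_matrix_mult_def mat_def vec_eq_iff)

lemma even_symmetric_mat_even: "even_symmetric (mat (2 * l) :: int^'n^'n)"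
  by (simp add: even_symmetric_def) (simp add: mat_def)

definition gauss_eps :: "int \<Rightarrow> complex" where
  "gauss_eps m = (if m mod 4 = 1 then 1 else \<i>)"

lemma odd_mod_4: "odd m \<Longrightarrow> m mod 4 \<noteq> 1 \<Longrightarrow> m mod 4 = 3" for m :: int
  by presburger

text \<open>The matrices \<open>(1 0; m - 1 1) T\<close> and \<open>- (1 0; m + 1 1) T\<^sup>-\<^sup>1\<close> of \<open>\<Gamma>\<^sub>0(4)\<close> have upper right
  entry \<open>1\<close> and lower right entry \<open>m\<close>; this determines the sign of the quadratic Gauss sum.\<close>

lemma gauss1_value:
  assumes m: "odd m" "m > 0"
  shows "gauss1 1 m = gauss_eps m * sqrt (of_int m)"
proof (cases "m mod 4 = 1")
  case True
  then have "4 dvd m - 1" by (simp add: mod_eq_dvd_iff[symmetric])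
  then obtain l where l: "m = 1 + 1 * (4 * l)" by (metis dvdE add.commute diff_add_cancel mult_1)
  have "gauss_sum (mat 2 :: int^1^1) (0 + 1 * 1) (1 + 1 * (4 * l)) / of_real (sqrt (of_int (1 + 1 * (4 * l))) ^ CARD(1)) =
     gauss_sum (mat 2 :: int^1^1) 0 1 / of_real (sqrt (of_int 1) ^ CARD(1))"
    by (rule one_dim.gauss_sum_T_invariant[OF even_symmetric_mat_even mat2_mult]) (use l m in auto)
  then show ?thesis unfolding l[symmetric] using m True by (simp add: gauss1_eq gauss_eps_def)
next
  case False
  then have "m mod 4 = 3" using odd_mod_4 m by blast
  then have "4 dvd m + 1" by presburger
  then obtain l where l: "m + 1 = 4 * l" by blast
  define j where "j = of_int (- (m + 1)) * \<i> + of_int m"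
  define j' where "j' = of_int (m + 1) * (\<i> + of_int (-1)) + of_int 1"
  \<comment> \<open>The two matrices differ by the factor -1, so the factors of weight 1/2 are
    \<open>csqrt j\<close> and \<open>csqrt (- j)\<close>. As j lies in the lower half-plane, their
    ratio is i, and this is the value sought.\<close>
  have jj: "j' = - j" by (simp add: j_def j'_def algebra_simps)
  let ?z = "\<lambda>_::1. 0 :: complex"
  have M: "mat 2 ** mat (2 * l) = (mat (m + 1) :: int^1^1)" "mat 2 ** mat (2 * (- l)) = (mat (- (m + 1)) :: int^1^1)"
    unfolding mat2_mult l by simp_all
  have 1: "one_dim.Th ((of_int (-1) * \<i> + of_int 1) / j) (\<lambda>i. ?z i / j) = gauss_sum (mat 2 :: int^1^1) 1 m / of_real (sqrt (of_int m) ^ CARD(1)) *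
    (\<Prod>i\<in>(UNIV::1 set). csqrt (if (1::real) = 1 then j else cnj j)) * exp (pi * \<i> * of_int (- (m + 1)) * (\<Sum>i\<in>(UNIV::1 set). (?z i)\<^sup>2) / j) * one_dim.Th \<i> ?z"
    by (rule one_dim.Th_transform[OF _ _ _ even_symmetric_mat_even M(2) _ j_def]) (use m in auto)
  have 2: "one_dim.Th ((of_int 1 * (\<i> + of_int (-1)) + of_int 0) / j') (\<lambda>i. ?z i / j') = gauss_sum (mat 2 :: int^1^1) 0 1 / of_real (sqrt (of_int 1) ^ CARD(1)) *
    (\<Prod>i\<in>(UNIV::1 set). csqrt (if (1::real) = 1 then j' else cnj j')) * exp (pi * \<i> * of_int (m + 1) * (\<Sum>i\<in>(UNIV::1 set). (?z i)\<^sup>2) / j') * one_dim.Th (\<i> + of_int (-1)) ?z"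
    by (rule one_dim.Th_transform[OF _ _ _ even_symmetric_mat_even M(1) _ j'_def]) (use m in auto)
  have e: "(of_int (-1) * \<i> + of_int 1) / j = (of_int 1 * (\<i> + of_int (-1)) + of_int 0) / j'"
    unfolding jj by (simp add: divide_simps)
  have c: "csqrt j' = \<i> * csqrt j" unfolding jj using m by (intro csqrt_minus) (auto simp: j_def)
  have j0: "csqrt j \<noteq> 0" using m by (auto simp: j_def complex_eq_iff)
  have "gauss_sum (mat 2 :: int^1^1) 1 m / of_real (sqrt (of_int m)) * csqrt j * one_dim.Th \<i> ?z = csqrt j' * one_dim.Th \<i> ?z"
    using 1 2 unfolding e one_dim.Th_add_int by simp
  then have "gauss_sum (mat 2 :: int^1^1) 1 m / of_real (sqrt (of_int m)) = \<i>"
    unfolding c mult.assoc using one_dim.Th_i_nonzero j0 by (simp only: mult_right_cancel[of "csqrt j * one_dim.Th \<i> ?z"] no_zero_divisors simp_thms)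
  then show ?thesis using m False by (simp add: gauss1_eq gauss_eps_def divide_eq_eq)
qed

text \<open>Replacing 1 by -1 conjugates the Gauss sum, whose known value is real or purely
  imaginary according to m modulo 4.\<close>

lemma jac_minus_one:
  assumes m: "odd m" "m > 0" shows "jac (-1) m = (if m mod 4 = 1 then 1 else -1)"
proof -
  have "gauss1 (-1) m = cnj (gauss1 1 m)"
    by (simp add: gauss1_def int_phase_def cis_cnj)
  then have "of_int (jac (-1) m) * gauss_eps m * sqrt (of_int m) = cnj (gauss_eps m) * sqrt (of_int m)"
    using gauss1_odd[OF m, of "-1"] gauss1_value[OF m] by simp
  then have "of_int (jac (-1) m) * gauss_eps m = cnj (gauss_eps m)" using m by simp
  then have "complex_of_int (jac (-1) m) = complex_of_int (if m mod 4 = 1 then 1 else -1)"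
    by (auto simp: gauss_eps_def complex_eq_iff split: if_splits)
  then show ?thesis by (simp only: of_int_eq_iff)
qed

text \<open>The Gauss sum of modulus m k, evaluated directly and through the Chinese remainder
  theorem; the usual sign is contained in \<open>gauss_eps\<close>.\<close>

lemma jac_reciprocity:
  assumes m: "odd m" "m > 0" and k: "odd k" "k > 0" and cop: "coprime m k"
  shows "gauss_eps (m * k) = of_int (jac k m) * of_int (jac m k) * gauss_eps m * gauss_eps k"
proof -
  have "gauss1 1 (m * k) = gauss1 (1 * k) m * gauss1 (1 * m) k" using m k cop by (intro gauss1_coprime_mult)
  then have "gauss_eps (m * k) * sqrt (of_int (m * k)) = of_int (jac k m) * of_int (jac m k) * gauss_eps m * gauss_eps k * sqrt (of_int (m * k))"
    using m k cop gauss1_odd[OF m, of k] gauss1_odd[OF k, of m] by (simp add: gauss1_value coprime_commute real_sqrt_mult)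
  then show ?thesis using m k by simp
qed

lemma gauss_eps_mult:
  assumes m: "odd m" and k: "odd k"
  shows "gauss_eps (m * k) = (if m mod 4 = 3 \<and> k mod 4 = 3 then - 1 else 1) * (gauss_eps m * gauss_eps k)"
proof -
  have e: "(m * k) mod 4 = (m mod 4) * (k mod 4) mod 4" by (simp add: mod_simps)
  have "m mod 4 = 1 \<or> m mod 4 = 3" "k mod 4 = 1 \<or> k mod 4 = 3" using odd_mod_4 m k by blast+
  then show ?thesis unfolding gauss_eps_def e by (elim disjE) simp_all
qed

text \<open>Descent from m to k = m - 2, using (-2/m) = (k/m) and (m/k) = (2/k). One of m and k is 1
  modulo 4, so reciprocity between them carries no sign, and the value of (-1/m) then yields (2/m)
  from (2/k).\<close>

lemma jac_two:
  assumes "odd m" "m > 0"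
  shows "jac 2 m = (if m mod 8 = 1 \<or> m mod 8 = 7 then 1 else -1)"
  using assms
proof (induction "nat m" arbitrary: m rule: less_induct)
  case less
  show ?case
  proof (cases "m = 1")
    case True then show ?thesis by simp
  next
    case False
    define k where "k = m - 2"
    have m3: "m \<ge> 3" using less.prems False by presburger
    have k: "odd k" "k > 0" using less.prems m3 by (auto simp: k_def)
    have cop: "coprime m k"
    proof -
      have "coprime k 2" using k by simp
      then have "coprime k (k + 2)" by (simp add: coprime_iff_gcd_eq_1 gcd_add2 add.commute)
      then show ?thesis by (simp add: k_def coprime_commute)
    qed
    have IH: "jac 2 k = (if k mod 8 = 1 \<or> k mod 8 = 7 then 1 else -1)"
      using less.hyps[of k] k m3 by (simp add: k_def)
    have "jac (-1) m * jac 2 m = jac (-2) m" using jac_mult_left[OF less.prems(1), of "-1" 2] by simp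
    also have "\<dots> = jac k m" using less.prems by (intro jac_cong) (auto simp: k_def cong_iff_dvd_diff)
    also have "\<dots> = jac m k"
    proof -
      have "gauss_eps (m * k) = gauss_eps m * gauss_eps k"
      proof -
        have "\<not> (m mod 4 = 3 \<and> k mod 4 = 3)" unfolding k_def by presburger
        then show ?thesis using gauss_eps_mult[OF less.prems(1) k(1)] by auto
      qed
      moreover have "gauss_eps x \<noteq> 0" for x by (simp add: gauss_eps_def)
      ultimately have "complex_of_int (jac k m) * of_int (jac m k) = 1"
        using jac_reciprocity[OF less.prems k cop] by simp
      then have "jac k m * jac m k = 1" by (metis of_int_mult of_int_eq_1_iff)
      then show ?thesis using zmult_eq_1_iff by metis
    qed
    also have "\<dots> = jac 2 k" using k by (intro jac_cong) (auto simp: k_def cong_iff_dvd_diff)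
    finally have eq: "jac (-1) m * jac 2 m = jac 2 k" .
    have "m mod 8 = 1 \<or> m mod 8 = 3 \<or> m mod 8 = 5 \<or> m mod 8 = 7" using less.prems(1) by presburger
    moreover have "k mod 8 = (m mod 8 - 2) mod 8" by (simp add: k_def mod_simps)
    moreover have "m mod 4 = (m mod 8) mod 4" by (simp add: mod_mod_cancel)
    ultimately have "(m mod 4 = 1 \<and> (m mod 8 = 1 \<and> k mod 8 = 7 \<or> m mod 8 = 5 \<and> k mod 8 = 3)) \<or> (m mod 4 = 3 \<and> (m mod 8 = 3 \<and> k mod 8 = 1 \<or> m mod 8 = 7 \<and> k mod 8 = 5))"
      by auto
    then show ?thesis using eq unfolding jac_minus_one[OF less.prems] IH by auto
  qed
qed

lemma jac_power_left: "odd m \<Longrightarrow> jac (a ^ k) m = jac a m ^ k"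
  by (induction k) (auto simp: jac_1_left jac_mult_left)

lemma kronecker_jac: "m \<noteq> 0 \<Longrightarrow> kronecker a m = (if m < 0 \<and> a < 0 then -1 else 1) * jac a m"
  by (simp add: kronecker_def jac_def)

text \<open>Reciprocity for D of either sign. For D = 1 modulo 4 the symbol (-1/m) of a negative D
  compensates the sign of reciprocity; for D = 3 modulo 4 exactly one of the two signs is present
  when m = 3 modulo 4.\<close>

lemma jac_swap:
  assumes D: "odd D" and m: "odd m" "m > 0" and cop: "coprime D m"
  shows "D mod 4 = 1 \<Longrightarrow> jac D m = jac m \<bar>D\<bar>"
    and "D mod 4 \<noteq> 1 \<Longrightarrow> m mod 4 = 3 \<Longrightarrow> jac D m = - jac m \<bar>D\<bar>"
proof -
  define E where "E = \<bar>D\<bar>"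
  have E: "odd E" "E > 0" using D by (auto simp: E_def)
  have cE: "coprime m E" using cop by (simp add: E_def coprime_commute)
  have nz: "gauss_eps x \<noteq> 0" for x by (simp add: gauss_eps_def)
  note rec = jac_reciprocity[OF m E cE]
  have pm: "jac m E = 1 \<or> jac m E = -1" using jac_cases[OF E(1) cE] .
  have jD: "jac D m = (if D < 0 then jac (-1) m else 1) * jac E m"
    using jac_mult_left[OF m(1), of "-1" E] by (auto simp: E_def)
  have i2: "\<i> * \<i> = -1" by simp
  have 1: "jac E m = jac m E" if "E mod 4 = 1 \<or> m mod 4 = 1"
  proof -
    have "gauss_eps (m * E) = gauss_eps m * gauss_eps E"
      using that gauss_eps_mult[OF m(1) E(1)] by auto
    then have "complex_of_int (jac E m) * of_int (jac m E) = 1" using rec nz by simp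
    then have "jac E m * jac m E = 1" by (metis of_int_mult of_int_eq_1_iff)
    then show ?thesis using pm by auto
  qed
  have 2: "jac E m = - jac m E" if "E mod 4 = 3" "m mod 4 = 3"
  proof -
    have "gauss_eps (m * E) = - (gauss_eps m * gauss_eps E)"
      using that gauss_eps_mult[OF m(1) E(1)] by simp
    then have "(complex_of_int (jac E m) * of_int (jac m E)) * (gauss_eps m * gauss_eps E) = (-1) * (gauss_eps m * gauss_eps E)"
      using rec by (simp only: mult.assoc mult_minus1)
    moreover have nz2: "gauss_eps m * gauss_eps E \<noteq> 0" using nz by simp
    ultimately have "complex_of_int (jac E m) * of_int (jac m E) = -1" by (simp only: mult_right_cancel[OF nz2])
    then have "complex_of_int (jac E m * jac m E) = complex_of_int (-1)" by simp
    then have "jac E m * jac m E = -1" by (simp only: of_int_eq_iff)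
    then show ?thesis using pm by auto
  qed
  have m4: "m mod 4 = 1 \<or> m mod 4 = 3" using odd_mod_4[OF m(1)] by blast
  have E4: "D mod 4 = 1 \<Longrightarrow> E mod 4 = (if D < 0 then 3 else 1)" "D mod 4 = 3 \<Longrightarrow> E mod 4 = (if D < 0 then 1 else 3)"
  proof -
    have n: "(- D) mod 4 = 3" if "D mod 4 = 1" using that by presburger
    have n': "(- D) mod 4 = 1" if "D mod 4 = 3" using that by presburger
    show "D mod 4 = 1 \<Longrightarrow> E mod 4 = (if D < 0 then 3 else 1)" "D mod 4 = 3 \<Longrightarrow> E mod 4 = (if D < 0 then 1 else 3)"
      using n n' by (auto simp: E_def)
  qed
  show "jac D m = jac m \<bar>D\<bar>" if "D mod 4 = 1"
    unfolding E_def[symmetric] jD jac_minus_one[OF m] using that m4 E4(1) 1 2 by auto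
  show "jac D m = - jac m \<bar>D\<bar>" if "D mod 4 \<noteq> 1" "m mod 4 = 3"
    unfolding E_def[symmetric] jD jac_minus_one[OF m] using that odd_mod_4[OF D] E4(2) 1 2 by auto
qed

section \<open>The character\<close>

text \<open>Modulo 2 an even symmetric matrix agrees with a skew-symmetric one.\<close>

lemma even_det_odd_dim:
  fixes A :: "int^'n^'n"
  assumes A: "even_symmetric A" and n: "odd CARD('n)"
  shows "even (det A)"
proof -
  obtain f :: "'n \<Rightarrow> nat" where f: "inj f" using finite_imp_inj_to_nat_seg[of "UNIV :: 'n set"] by auto
  define B :: "int^'n^'n" where "B = (\<chi> i j. if f i < f j then A $ i $ j else if f i > f j then - A $ i $ j else 0)"
  have sym: "A $ i $ j = A $ j $ i" for i j
  proof -
    have t: "transpose A = A" using A by (simp add: even_symmetric_def)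
    have "A $ i $ j = transpose A $ j $ i" by (simp add: transpose_def)
    then show ?thesis unfolding t .
  qed
  have "transpose B = (\<chi> i. (-1) *s B $ i)"
    using sym by (auto simp: B_def transpose_def vec_eq_iff)
  then have "det B = det (\<chi> i. (-1) *s B $ i)" by (metis det_transpose)
  also have "\<dots> = (-1) ^ CARD('n) * det (\<chi> i. B $ i)" by (simp add: det_rows_mul)
  also have "\<dots> = - det B" using n by (simp add: vec_lambda_eta)
  finally have "det B = 0" by simp
  moreover have "[det A = det B] (mod 2)"
  proof (rule det_cong)
    fix i j
    consider "i = j" | "f i < f j" | "f i > f j" using f by (metis injD linorder_neqE_nat)
    then show "[A $ i $ j = B $ i $ j] (mod 2)"
    proof cases
      case 1 then show ?thesis using A by (simp add: B_def even_symmetric_def cong_0_iff)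
    qed (auto simp: B_def cong_iff_dvd_diff)
  qed
  ultimately show ?thesis by (simp add: cong_0_iff)
qed

lemma not_coprime_common_prime:
  fixes a b :: int
  assumes "\<not> coprime a b" shows "\<exists>p. prime p \<and> p dvd a \<and> p dvd b"
proof -
  have "\<bar>gcd a b\<bar> \<noteq> 1" using assms by (simp add: coprime_iff_gcd_eq_1)
  then obtain p where "prime p" "p dvd gcd a b" using prime_factor_int by blast
  then show ?thesis by auto
qed

context diag_form begin

lemma left_inverse_level:
  assumes M: "even_symmetric M" and AM: "A ** M = mat c" shows "M ** A = mat c"
proof -
  have "transpose (A ** M) = transpose (mat c)" using AM by simp
  then show ?thesis using M ev by (simp add: matrix_transpose_mul even_symmetric_def)
qed

text \<open>For even n the symbols of b and of 2 occur to an even power and disappear, and the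
  square of \<open>gauss_eps d\<close> is (-1/d), which supplies the sign (-1)^(n/2) that completes
  det A to D.\<close>

lemma gauss_mult_even_dim:
  assumes M: "even_symmetric M" and AM: "A ** M = mat c" and det: "a * d - b * c = 1"
    and d: "odd d" "d > 0" and n: "even CARD('n)"
  shows "gauss_sum A b d / of_real (sqrt (of_int d) ^ CARD('n)) = of_int (jac (chi_D A) d)"
proof -
  have cop: "coprime b d" "coprime c d"
    by (rule coprimeI, metis det dvd_diff dvd_mult dvd_mult2 mult.commute)+
  obtain h where h: "CARD('n) = 2 * h" using n by blast
  have e2: "gauss_eps d ^ 2 = of_int (jac (-1) d)" unfolding jac_minus_one[OF d] by (simp add: gauss_eps_def)
  have sq: "x ^ CARD('n) = 1" if "x * x = 1" for x :: int using that by (simp add: h power_mult power2_eq_square)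
  have "gauss_sum A b d = of_int (jac (det A) d) * (gauss_eps d * sqrt (of_int d)) ^ CARD('n)"
    using gauss_sum_odd[OF ev left_inverse_level[OF M AM] d cop] gauss1_value[OF d] sq[OF jac_square[OF d(1) cop(1)]] sq[OF jac_square[OF d(1), of 2]] d by simp
  also have "\<dots> = of_int (jac (det A) d) * of_int (jac (-1) d) ^ h * of_real (sqrt (of_int d) ^ CARD('n))"
    by (simp add: power_mult_distrib h power_mult e2)
  finally show ?thesis using d n by (simp add: chi_D_def h jac_mult_left jac_power_left)
qed

text \<open>Up to sign D is det A, which divides c^n. Consequently d and d + k c agree modulo all
  primes of D.\<close>

lemma prime_dvd_chi_D:
  assumes M: "even_symmetric M" and AM: "A ** M = mat c" and n: "even CARD('n)" and p: "prime p" "p dvd chi_D A"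
  shows "p dvd c"
proof -
  have "p dvd det A"
    using p n by (auto simp: chi_D_def prime_dvd_mult_iff minus_one_power_iff split: if_splits)
  then have "p dvd c ^ CARD('n)" using det_dvd_level[OF left_inverse_level[OF M AM]] by (rule dvd_trans)
  then show ?thesis using p(1) prime_dvd_power by blast
qed

lemma odd_chi_D:
  assumes M: "even_symmetric M" and AM: "A ** M = mat c" and n: "even CARD('n)" and c: "odd c"
  shows "odd (chi_D A)"
  using prime_dvd_chi_D[OF M AM n, of 2] c by auto

text \<open>If \<open>D \<equiv> 3 (mod 4)\<close> then invariance under \<open>T\<^sup>2\<close> would contradict reciprocity.\<close>

lemma chi_D_mod_4:
  assumes M: "even_symmetric M" and AM: "A ** M = mat c" and n: "even CARD('n)" and c: "odd c"
  shows "chi_D A mod 4 = 1"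
proof (rule ccontr)
  assume D4: "chi_D A mod 4 \<noteq> 1"
  \<comment> \<open>m = 1 + 2 |c| is 3 modulo 4, as c is odd, and 1 modulo every prime of D.
    Reciprocity would give (D/m) = -(1/|D|) = -1, whereas T-invariance from the lower right entry 1
    gives 1.\<close>
  define k where "k = 2 * sgn c"
  define m where "m = 1 + k * c"
  have m: "m = 1 + 2 * \<bar>c\<bar>" by (simp add: m_def k_def abs_sgn mult.commute)
  have modd: "odd m" "m > 0" by (auto simp: m)
  have m4: "m mod 4 = 3" using c unfolding m by presburger
  note oD = odd_chi_D[OF M AM n c]
  have one: "[m = 1] (mod p)" if "prime p" "p dvd chi_D A" for p
    using prime_dvd_chi_D[OF M AM n that] by (simp add: m cong_iff_dvd_diff)
  have "coprime (chi_D A) m"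
  proof (rule ccontr)
    assume "\<not> coprime (chi_D A) m"
    then obtain p where p: "prime p" "p dvd chi_D A" "p dvd m" using not_coprime_common_prime by blast
    then have "p dvd 1" using one[OF p(1,2)] by (simp add: cong_dvd_iff)
    then show False using p(1) not_prime_unit by blast
  qed
  note swap = jac_swap(2)[OF oD modd this D4 m4]
  have "jac m \<bar>chi_D A\<bar> = jac 1 \<bar>chi_D A\<bar>" using oD one by (intro jac_cong) auto
  then have "jac (chi_D A) m = -1" using swap oD by (simp add: jac_1_left)
  moreover have "of_int (jac (chi_D A) m) = (1::complex)"
  proof -
    have "gauss_sum A (0 + k * 1) (1 + k * c) / of_real (sqrt (of_int (1 + k * c)) ^ CARD('n)) = gauss_sum A 0 1 / of_real (sqrt (of_int 1) ^ CARD('n))"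
      by (rule gauss_sum_T_invariant[OF M AM]) (use modd m_def in auto)
    moreover have "gauss_sum A k m / of_real (sqrt (of_int m) ^ CARD('n)) = of_int (jac (chi_D A) m)"
      by (rule gauss_mult_even_dim[OF M AM _ modd n, of 1]) (simp add: m_def)
    ultimately show ?thesis by (simp add: m_def)
  qed
  ultimately show False by simp
qed

text \<open>Factors 2 are split off d one at a time: the Kronecker value of D at 2 depends on D
  modulo 8 and coincides with (2/|D|). The odd part is reciprocity for D = 1 modulo 4.\<close>

lemma jac_chi_D_eq:
  assumes D: "chi_D A mod 4 = 1" and d: "d > 0" and cop: "coprime (chi_D A) d"
  shows "jac (chi_D A) d = jac d \<bar>chi_D A\<bar>"
  using d cop
proof (induction "nat d" arbitrary: d rule: less_induct)
  case less
  have oD: "odd (chi_D A)" using D by presburger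
  show ?case
  proof (cases "odd d")
    case True
    then show ?thesis using jac_swap(1)[OF oD True less.prems D] by simp
  next
    case False
    then obtain e where e: "d = 2 * e" by blast
    have e0: "e > 0" "e < d" using e less.prems by auto
    have IH: "jac (chi_D A) e = jac e \<bar>chi_D A\<bar>" using less.hyps[of e] e0 less.prems e by simp
    have k2: "kronecker_prime (chi_D A) 2 = jac 2 \<bar>chi_D A\<bar>"
    proof -
      have pos: "\<bar>chi_D A\<bar> > 0" using oD by auto
      have "\<bar>chi_D A\<bar> mod 8 = 1 \<or> \<bar>chi_D A\<bar> mod 8 = 7 \<longleftrightarrow> chi_D A mod 8 = 1 \<or> chi_D A mod 8 = 7"
      proof (cases "chi_D A \<ge> 0")
        case False
        then have "\<bar>chi_D A\<bar> = - chi_D A" by simp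
        then show ?thesis by (auto simp: zmod_zminus1_eq_if)
      qed simp
      then show ?thesis using oD pos by (simp add: jac_two kronecker_prime_def)
    qed
    have "jac (chi_D A) d = jac (chi_D A) 2 * jac (chi_D A) e" using e e0 by (simp add: jac_mult_right)
    also have "\<dots> = jac 2 \<bar>chi_D A\<bar> * jac e \<bar>chi_D A\<bar>" unfolding IH by (simp add: jac_prime k2)
    also have "\<dots> = jac d \<bar>chi_D A\<bar>" using oD by (simp add: e jac_mult_left)
    finally show ?thesis .
  qed
qed

lemma odd_lower_right:
  assumes M: "even_symmetric M" and AM: "A ** M = mat c" and det: "a * d - b * c = 1" and n: "odd CARD('n)"
  shows "odd d"
proof -
  have "2 dvd c ^ CARD('n)" using even_det_odd_dim[OF ev n] det_dvd_level[OF left_inverse_level[OF M AM]] by (rule dvd_trans)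
  then have "even c" by simp
  then show ?thesis using det by (metis dvd_diff dvd_mult odd_one)
qed

text \<open>For odd d the evaluated Gauss sum is matched with the definition of the character. An
  even d forces c odd and n even; T-invariance then replaces it by the odd number d + |c|.\<close>

lemma chi_gauss_sum:
  fixes \<gamma> :: "int^2^2"
  assumes M: "even_symmetric M" and AM: "A ** M = mat (\<gamma> $ 2 $ 1)" and det: "det \<gamma> = 1" and d: "\<gamma> $ 2 $ 2 > 0"
  shows "chi A \<gamma> = gauss_sum A (\<gamma> $ 1 $ 2) (\<gamma> $ 2 $ 2) / of_real (sqrt (of_int (\<gamma> $ 2 $ 2)) ^ CARD('n))"
proof -
  define a b c d where "a = \<gamma> $ 1 $ 1" "b = \<gamma> $ 1 $ 2" "c = \<gamma> $ 2 $ 1" "d = \<gamma> $ 2 $ 2"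
  note [simp] = a_b_c_d_def[symmetric]
  have det: "a * d - b * c = 1" using det by (simp add: det_2)
  have AM: "A ** M = mat c" using AM by simp
  have d: "d > 0" using d by simp
  have cop: "coprime b d" "coprime c d"
    by (rule coprimeI, metis det dvd_diff dvd_mult dvd_mult2 mult.commute)+
  show ?thesis
  proof (cases "even CARD('n)")
    case n: True
    have chi: "chi A \<gamma> = of_int (jac (chi_D A) d)" using n d by (simp add: chi_def chi_v_def kronecker_jac)
    show ?thesis
    proof (cases "odd d")
      case True
      then show ?thesis using gauss_mult_even_dim[OF M AM det True d n] chi by simp
    next
      case False
      then have c: "odd c" using det by (metis dvd_diff dvd_mult odd_one)
      define k where "k = sgn c"
      define m where "m = d + k * c"
      have m: "m = d + \<bar>c\<bar>" by (simp add: m_def k_def abs_sgn mult.commute)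
      have modd: "odd m" "m > 0" using False c d by (auto simp: m)
      have D4: "chi_D A mod 4 = 1" by (rule chi_D_mod_4[OF M AM n c])
      then have oD: "odd (chi_D A)" by presburger
      have mc: "[m = d] (mod p)" if "prime p" "p dvd chi_D A" for p
        using prime_dvd_chi_D[OF M AM n that] by (simp add: m cong_iff_dvd_diff)
      have cD: "coprime (chi_D A) x" if "x = d \<or> x = m" for x
      proof (rule ccontr)
        assume "\<not> coprime (chi_D A) x"
        then obtain p where p: "prime p" "p dvd chi_D A" "p dvd x" using not_coprime_common_prime by blast
        then have "p dvd d" using mc[OF p(1,2)] that by (auto simp: cong_dvd_iff)
        moreover have "p dvd c" using prime_dvd_chi_D[OF M AM n p(1,2)] .
        ultimately show False using cop(2) p(1) by (meson coprime_common_divisor not_prime_unit)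
      qed
      \<comment> \<open>In the form (d/|D|) the symbol depends only on d modulo the primes of D,
        which all divide c; this permits the passage from d to m.\<close>
      have "jac (chi_D A) d = jac d \<bar>chi_D A\<bar>" by (rule jac_chi_D_eq[OF D4 d cD]) simp
      also have "\<dots> = jac m \<bar>chi_D A\<bar>" using oD mc by (intro jac_cong) (auto simp: cong_sym)
      also have "\<dots> = jac (chi_D A) m" by (rule jac_chi_D_eq[OF D4 modd(2) cD, symmetric]) simp
      finally have j: "jac (chi_D A) d = jac (chi_D A) m" .
      have "gauss_sum A (b + k * a) (d + k * c) / of_real (sqrt (of_int (d + k * c)) ^ CARD('n)) = gauss_sum A b d / of_real (sqrt (of_int d) ^ CARD('n))"
        by (rule gauss_sum_T_invariant[OF M AM det d]) (use modd m_def in auto)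
      moreover have "gauss_sum A (b + k * a) m / of_real (sqrt (of_int m) ^ CARD('n)) = of_int (jac (chi_D A) m)"
        by (rule gauss_mult_even_dim[OF M AM _ modd n, of a]) (use det in \<open>simp add: m_def algebra_simps\<close>)
      ultimately show ?thesis using chi j by (simp add: m_def)
    qed
  next
    case n: False
    have dodd: "odd d" using odd_lower_right[OF M AM det n] .
    obtain h where h: "CARD('n) = 2 * h + 1" using n by (metis oddE)
    have sq: "x ^ CARD('n) = x" if "x * x = 1" for x :: int using that by (simp add: h power_add power_mult power2_eq_square)
    have G: "gauss_sum A b d / of_real (sqrt (of_int d) ^ CARD('n)) = of_int (jac b d * jac 2 d * jac (det A) d) * gauss_eps d ^ CARD('n)"
      using gauss_sum_odd[OF ev left_inverse_level[OF M AM] dodd d cop] gauss1_value[OF dodd d] sq[OF jac_square[OF dodd cop(1)]] sq[OF jac_square[OF dodd, of 2]] d dodd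
      by (simp add: power_mult_distrib)
    \<comment> \<open>The Gauss sum contains (b/d) where the character has (c/d); the determinant
      relates them through b c = -1 modulo d.\<close>
    have bc: "jac b d * jac c d = jac (-1) d"
    proof -
      have "[b * c = -1] (mod d)" using det by (simp add: cong_iff_dvd_diff) (metis add.commute diff_add_cancel dvd_triv_right diff_eq_eq)
      then have "jac (b * c) d = jac (-1) d" using dodd by (intro jac_cong) (auto intro: cong_dvd_modulus)
      then show ?thesis using dodd by (simp add: jac_mult_left)
    qed
    have jb: "jac b d = jac (-1) d * jac c d"
      using bc jac_square[OF dodd cop(2)] by (metis mult.assoc mult.right_neutral)
    have j4: "jac (-4) d = jac (-1) d"
    proof -
      have "jac (-4) d = jac (-1) d * (jac 2 d * jac 2 d)" using jac_mult_left[OF dodd, of "-1" 4] jac_mult_left[OF dodd, of 2 2] by simp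
      then show ?thesis using jac_square[OF dodd, of 2] dodd by simp
    qed
    have chi: "chi A \<gamma> = of_int (jac 2 d * jac (det A) d * jac c d) * of_int (jac (-1) d) powr (- (of_nat CARD('n) / 2))"
      using n d dodd by (simp add: chi_def chi_v_def kronecker_jac chi_D_def jac_mult_left j4)
    \<comment> \<open>The power of (-4/d) = (-1/d) on the principal branch. For d = 3 modulo 4 it is
      (-i)^n, which for odd n equals - i^n and so matches the left side.\<close>
    have "of_int (jac (-1) d) * gauss_eps d ^ CARD('n) = of_int (jac (-1) d) powr (- (of_nat CARD('n) / 2) :: complex)"
    proof (cases "d mod 4 = 1")
      case True
      then show ?thesis by (simp add: jac_minus_one[OF dodd d] gauss_eps_def)
    next
      case False
      have "(-1) powr (- (of_nat CARD('n) / 2) :: complex) = exp (- (of_nat CARD('n) * (\<i> * pi / 2)))"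
        by (simp add: powr_def mult_ac)
      also have "\<dots> = exp (- (\<i> * pi / 2)) ^ CARD('n)" by (simp add: exp_of_nat_mult[symmetric])
      also have "exp (- (\<i> * pi / 2)) = - \<i>" using cis_minus_pi_half by (simp add: cis_conv_exp)
      also have "(- \<i>) ^ CARD('n) = - (\<i> ^ CARD('n))" using n by simp
      finally show ?thesis using False by (simp add: jac_minus_one[OF dodd d] gauss_eps_def)
    qed
    then show ?thesis unfolding chi using G jb by (simp add: mult_ac)
  qed
qed

end

section \<open>Half-integral powers and the sign of the lower right entry\<close>

lemma det_rmat: "det (rmat A) = of_int (det A)"
  by (simp add: det_def map_matrix_def)

lemma half_integer_powr:
  fixes j :: complex assumes "j \<noteq> 0"
  shows "j powr (of_nat n / 2) = csqrt j ^ n"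
  using assms by (simp add: powr_def csqrt_exp_Ln exp_of_nat_mult[symmetric])

lemma minus_one_powr_half: "(-1) powr (- (of_nat n / 2) :: complex) = (- \<i>) ^ n"
proof -
  have "(-1) powr (- (of_nat n / 2) :: complex) = exp (of_nat n * (- (\<i> * pi / 2)))" by (simp add: powr_def)
  also have "\<dots> = exp (- (\<i> * pi / 2)) ^ n" by (rule exp_of_nat_mult)
  also have "exp (- (\<i> * pi / 2)) = - \<i>" using cis_minus_pi_half by (simp add: cis_conv_exp)
  finally show ?thesis .
qed

text \<open>\<open>Ln (- j)\<close> is \<open>Ln j\<close> plus or minus pi i, depending on the side
  of the real axis on which j lies; halved and exponentiated this is i or -i.\<close>

lemma minus_powr_half:
  fixes j :: complex assumes "j \<noteq> 0"
  shows "(- j) powr (of_nat n / 2) = (if Im j < 0 \<or> Im j = 0 \<and> Re j > 0 then \<i> ^ n else (- \<i>) ^ n) * j powr (of_nat n / 2)"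
proof -
  have e: "exp (\<i> * pi / 2) = \<i>" "exp (- (\<i> * pi / 2)) = - \<i>"
    using cis_pi_half cis_minus_pi_half by (simp_all add: cis_conv_exp)
  have "(- j) powr (of_nat n / 2) = exp (of_nat n * (Ln (- j) / 2))" using assms by (simp add: powr_def)
  also have "\<dots> = exp (Ln (- j) / 2) ^ n" by (rule exp_of_nat_mult)
  also have "exp (Ln (- j) / 2) = (if Im j < 0 \<or> Im j = 0 \<and> Re j > 0 then \<i> else - \<i>) * exp (Ln j / 2)"
  proof -
    have "j \<noteq> 0 \<Longrightarrow> Im j = 0 \<Longrightarrow> Re j \<noteq> 0" by (simp add: complex_eq_iff)
    then have "Ln (- j) = (if Im j < 0 \<or> Im j = 0 \<and> Re j > 0 then Ln j + \<i> * pi else Ln j - \<i> * pi)"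
      using assms by (subst Ln_minus) auto
    moreover have "exp ((Ln j + \<i> * pi) / 2) = \<i> * exp (Ln j / 2)"
      by (simp only: add_divide_distrib exp_add e mult.commute)
    moreover have "exp ((Ln j - \<i> * pi) / 2) = - \<i> * exp (Ln j / 2)"
    proof -
      have h: "(Ln j - \<i> * pi) / 2 = Ln j / 2 + - (\<i> * pi / 2)" by (simp add: diff_divide_distrib)
      show ?thesis unfolding h exp_add e by (rule mult.commute)
    qed
    ultimately show ?thesis by (cases "Im j < 0 \<or> Im j = 0 \<and> Re j > 0") (simp_all only: if_True if_False)
  qed
  also have "\<dots> ^ n = (if Im j < 0 \<or> Im j = 0 \<and> Re j > 0 then \<i> ^ n else (- \<i>) ^ n) * exp (Ln j / 2) ^ n"
    by (simp add: power_mult_distrib)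
  also have "exp (Ln j / 2) ^ n = j powr (of_nat n / 2)" using assms by (simp add: powr_def exp_of_nat_mult[symmetric])
  finally show ?thesis .
qed

text \<open>Signature (n-1,1) with its negative direction marked as \<open>i0\<close>, the
  coordinate in which the elliptic variable is going to vanish.\<close>

locale lorentz_form = diag_form A P R sg for A :: "int^'n^'n" and P R sg +
  fixes i0 :: 'n
  assumes neg: "sg i0 = -1" and pos: "i \<noteq> i0 \<Longrightarrow> sg i = 1"
begin

text \<open>Determines the sign of D, on which the Kronecker symbol at negative d depends.\<close>

lemma det_neg: "det A < 0"
proof -
  have "(\<Prod>i\<in>UNIV. sg i) = sg i0 * (\<Prod>i\<in>UNIV - {i0}. sg i)" by (rule prod.remove) auto
  also have "(\<Prod>i\<in>UNIV - {i0}. sg i) = 1" by (rule prod.neutral) (auto simp: pos)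
  finally have pr: "(\<Prod>i\<in>UNIV. sg i) = -1" by (simp add: neg)
  have "det P * det (rmat A) * det P = det (\<chi> i j. if i = j then sg i else 0)"
    using arg_cong[OF diag, of det] by (simp add: det_mul det_transpose)
  also have "\<dots> = -1" unfolding pr[symmetric] by (subst det_diagonal) auto
  finally have "real_of_int (det A) * (det P)\<^sup>2 = -1" by (simp add: det_rmat power2_eq_square mult_ac)
  then have "real_of_int (det A) < 0" by (metis mult_nonneg_nonneg not_le zero_le_power2 neg_0_le_iff_le not_one_le_zero)
  then show ?thesis by simp
qed

lemma Th_minus: "Th t (\<lambda>i. - b i) = Th t b"
proof -
  have "Th t (\<lambda>i. - b i) = (\<Sum>\<^sub>\<infinity>l. gexp (sgt t) b (R *v rvec (- l)))"
  proof -
    have "R *v rvec (- l) = - (R *v rvec l)" for l by (simp add: vec_eq_iff matrix_vector_mult_def sum_negf)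
    then show ?thesis unfolding Th_def gexp_def by simp
  qed
  also have "\<dots> = Th t b" unfolding Th_def
    by (rule infsum_reindex_bij_betw) (rule bij_uminus)
  finally show ?thesis .
qed

text \<open>All factors are \<open>csqrt j\<close> except the conjugate one at \<open>i0\<close>,
  and conj(z)/z = |z|^2/z^2 with z^2 = j.\<close>

lemma prod_csqrt_lorentz:
  assumes j: "j \<notin> \<real>\<^sub>\<le>\<^sub>0"
  shows "(\<Prod>i\<in>UNIV. csqrt (if sg i = 1 then j else cnj j)) = j powr (of_nat CARD('n) / 2) * (of_real (norm j) / j)"
proof -
  have j0: "j \<noteq> 0" using j by auto
  have "(\<Prod>i\<in>UNIV. csqrt (if sg i = 1 then j else cnj j)) = csqrt (if sg i0 = 1 then j else cnj j) * (\<Prod>i\<in>UNIV - {i0}. csqrt (if sg i = 1 then j else cnj j))"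
    by (rule prod.remove) auto
  also have "(\<Prod>i\<in>UNIV - {i0}. csqrt (if sg i = 1 then j else cnj j)) = (\<Prod>i\<in>UNIV - {i0}. csqrt j)"
    by (rule prod.cong) (auto simp: pos)
  also have "csqrt (if sg i0 = 1 then j else cnj j) = cnj (csqrt j)" using neg cnj_csqrt[OF j] by simp
  also have "cnj (csqrt j) * (\<Prod>i\<in>UNIV - {i0}. csqrt j) = csqrt j ^ CARD('n) * (cnj (csqrt j) / csqrt j)"
  proof -
    have "CARD('n) = Suc (card (UNIV - {i0}))" by (simp add: card_Diff_singleton)
    then have "csqrt j ^ CARD('n) = csqrt j * csqrt j ^ card (UNIV - {i0})" by (metis power_Suc)
    then show ?thesis using j0 by simp
  qed
  also have "cnj (csqrt j) / csqrt j = of_real (norm j) / j"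
  proof -
    have "cnj (csqrt j) * csqrt j = of_real ((norm (csqrt j))\<^sup>2)" unfolding complex_norm_square by simp
    also have "(norm (csqrt j))\<^sup>2 = norm j" by (metis norm_power power2_csqrt)
    finally have "cnj (csqrt j) * csqrt j / (csqrt j)\<^sup>2 = of_real (norm j) / j" by simp
    then show ?thesis using j0 by (simp add: power2_eq_square)
  qed
  finally show ?thesis using half_integer_powr[OF j0] by simp
qed

text \<open>gamma and -gamma act alike, and the minus sign here offsets that of |j|/j, which is odd
  in j. Its source is det A < 0: for even n, D has the sign -(-1)^(n/2); for odd n the Kronecker
  signs of 2 det A and of c at negative d meet the branch changes in the powers of (-4/d) and of
  -j.\<close>

lemma chi_uminus:
  fixes \<gamma> :: "int^2^2"
  assumes M: "even_symmetric M" and AM: "A ** M = mat (\<gamma> $ 2 $ 1)" and det: "det \<gamma> = 1" and d: "\<gamma> $ 2 $ 2 < 0"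
    and t: "Im t > 0" and j: "j = of_int (\<gamma> $ 2 $ 1) * t + of_int (\<gamma> $ 2 $ 2)"
  shows "chi A (- \<gamma>) * (- j) powr (of_nat CARD('n) / 2) = - chi A \<gamma> * j powr (of_nat CARD('n) / 2)"
proof -
  define a b c e where "a = \<gamma> $ 1 $ 1" "b = \<gamma> $ 1 $ 2" "c = \<gamma> $ 2 $ 1" "e = - \<gamma> $ 2 $ 2"
  have ent: "\<gamma> $ 2 $ 1 = c" "\<gamma> $ 2 $ 2 = - e" by (simp_all add: a_b_c_e_def)
  have e: "e > 0" using d by (simp add: a_b_c_e_def)
  have det': "a * (- e) - b * c = 1" using det by (simp add: a_b_c_e_def det_2)
  have jj: "j = of_int c * t - of_int e" by (simp add: j ent)
  have j0: "j \<noteq> 0" using t e by (auto simp: jj complex_eq_iff)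
  show ?thesis
  proof (cases "even CARD('n)")
    case n: True
    then obtain h where h: "CARD('n) = 2 * h" by blast
    have Ds: "chi_D A < 0 \<longleftrightarrow> even h" using det_neg n by (cases "even h") (auto simp: chi_D_def h)
    have pw: "z powr (of_nat CARD('n) / 2) = z ^ h" if "z \<noteq> 0" for z :: complex
      using that by (simp add: h powr_nat')
    have "(- j) ^ h = (-1) ^ h * j ^ h" by (metis power_minus)
    then show ?thesis using n e j0 Ds
      by (cases "even h") (auto simp: chi_def chi_v_def kronecker_jac ent pw)
  next
    case n: False
    have "odd (- e)" using odd_lower_right[OF M AM[unfolded ent] det' n] .
    then have eodd: "odd e" by simp
    define s where "s = jac (-1) e"
    have s: "s = 1 \<or> s = -1" unfolding s_def jac_minus_one[OF eodd e] by auto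
    have j4: "jac (-4) e = s"
    proof -
      have "jac (-4) e = jac (-1) e * (jac 2 e * jac 2 e)" using jac_mult_left[OF eodd, of "-1" 4] jac_mult_left[OF eodd, of 2 2] by simp
      then show ?thesis using jac_square[OF eodd, of 2] eodd by (simp add: s_def)
    qed
    have jc: "jac (- c) e = s * jac c e" using jac_mult_left[OF eodd, of "-1" c] by (simp add: s_def)
    have im: "Im j < 0 \<or> Im j = 0 \<and> Re j > 0 \<longleftrightarrow> c < 0"
      using t e by (auto simp: jj mult_less_0_iff)
    have 1: "chi A (- \<gamma>) = of_int (jac (2 * det A) e) * (of_int (s * jac c e) * of_int s powr (- (of_nat CARD('n) / 2)))"
      using n e by (simp add: chi_def chi_v_def chi_D_def kronecker_jac ent j4 jc)
    have 2: "chi A \<gamma> = - of_int (jac (2 * det A) e) * (of_int ((if c < 0 then -1 else 1) * jac c e) * of_int (- s) powr (- (of_nat CARD('n) / 2)))"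
      using n e det_neg by (simp add: chi_def chi_v_def chi_D_def kronecker_jac ent j4)
    have ii: "\<i> ^ CARD('n) * (- \<i>) ^ CARD('n) = 1" by (simp flip: power_mult_distrib)
    have ni: "(- \<i>) ^ CARD('n) = - (\<i> ^ CARD('n))" using n by simp
    have nn: "\<i> ^ CARD('n) * \<i> ^ CARD('n) = -1" using ii unfolding ni by (simp add: minus_equation_iff)
    show ?thesis unfolding 1 2 minus_powr_half[OF j0] im using s
    proof
      assume "s = 1"
      then show "of_int (jac (2 * det A) e) * (of_int (s * jac c e) * of_int s powr (- (of_nat CARD('n) / 2))) * ((if c < 0 then \<i> ^ CARD('n) else (- \<i>) ^ CARD('n)) * j powr (of_nat CARD('n) / 2)) =
        - (- of_int (jac (2 * det A) e) * (of_int ((if c < 0 then -1 else 1) * jac c e) * of_int (- s) powr (- (of_nat CARD('n) / 2)))) * j powr (of_nat CARD('n) / 2)"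
        using minus_one_powr_half[of "CARD('n)"] ni by simp
    next
      assume "s = -1"
      then show "of_int (jac (2 * det A) e) * (of_int (s * jac c e) * of_int s powr (- (of_nat CARD('n) / 2))) * ((if c < 0 then \<i> ^ CARD('n) else (- \<i>) ^ CARD('n)) * j powr (of_nat CARD('n) / 2)) =
        - (- of_int (jac (2 * det A) e) * (of_int ((if c < 0 then -1 else 1) * jac c e) * of_int (- s) powr (- (of_nat CARD('n) / 2)))) * j powr (of_nat CARD('n) / 2)"
        using minus_one_powr_half[of "CARD('n)"] ni nn by (simp add: mult_ac)
    qed
  qed
qed

lemma Th_law_pos:
  fixes \<gamma> :: "int^2^2"
  assumes M: "even_symmetric M" and AM: "A ** M = mat (\<gamma> $ 2 $ 1)" and det: "det \<gamma> = 1" and d: "\<gamma> $ 2 $ 2 > 0"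
    and t: "Im t > 0" and j: "j = of_int (\<gamma> $ 2 $ 1) * t + of_int (\<gamma> $ 2 $ 2)" and \<beta>: "\<beta> i0 = 0"
  shows "Th ((of_int (\<gamma> $ 1 $ 1) * t + of_int (\<gamma> $ 1 $ 2)) / j) (\<lambda>i. \<beta> i / j) =
    chi A \<gamma> * j powr (of_nat CARD('n) / 2) * (of_real (norm j) / j) * exp (pi * \<i> * of_int (\<gamma> $ 2 $ 1) * (\<Sum>i\<in>UNIV. (\<beta> i)\<^sup>2) / j) * Th t \<beta>"
proof -
  have det': "\<gamma> $ 1 $ 1 * \<gamma> $ 2 $ 2 - \<gamma> $ 1 $ 2 * \<gamma> $ 2 $ 1 = 1" using det by (simp add: det_2)
  have b0: "\<beta> i = 0" if "sg i \<noteq> 1" for i using that pos[of i] \<beta> by metis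
  note q = csqrt_upper_half_plane_quotient(2)[OF t d j]
  show ?thesis
    using Th_transform[where \<beta>=\<beta>, OF t d det' M AM b0 j] unfolding chi_gauss_sum[OF M AM det d] prod_csqrt_lorentz[OF q]
    by (simp add: mult.assoc)
qed

lemma Th_law_nonzero:
  fixes \<gamma> :: "int^2^2"
  assumes M: "even_symmetric M" and AM: "A ** M = mat (\<gamma> $ 2 $ 1)" and det: "det \<gamma> = 1" and d: "\<gamma> $ 2 $ 2 \<noteq> 0"
    and t: "Im t > 0" and j: "j = of_int (\<gamma> $ 2 $ 1) * t + of_int (\<gamma> $ 2 $ 2)" and \<beta>: "\<beta> i0 = 0"
  shows "Th ((of_int (\<gamma> $ 1 $ 1) * t + of_int (\<gamma> $ 1 $ 2)) / j) (\<lambda>i. \<beta> i / j) =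
    chi A \<gamma> * j powr (of_nat CARD('n) / 2) * (of_real (norm j) / j) * exp (pi * \<i> * of_int (\<gamma> $ 2 $ 1) * (\<Sum>i\<in>UNIV. (\<beta> i)\<^sup>2) / j) * Th t \<beta>"
proof (cases "\<gamma> $ 2 $ 2 > 0")
  case True
  show ?thesis by (rule Th_law_pos[where \<beta>=\<beta>, OF M AM det True t j \<beta>])
next
  case False
  then have d': "\<gamma> $ 2 $ 2 < 0" using d by simp
  have M': "even_symmetric (- M)" using M by (auto simp: even_symmetric_def transpose_def vec_eq_iff)
  have AM': "A ** (- M) = mat ((- \<gamma>) $ 2 $ 1)"
    using AM by (simp add: vec_eq_iff matrix_matrix_mult_def mat_def sum_negf)
  have det': "det (- \<gamma>) = 1" using det by (simp add: det_2)
  have "Th ((of_int ((- \<gamma>) $ 1 $ 1) * t + of_int ((- \<gamma>) $ 1 $ 2)) / (- j)) (\<lambda>i. - \<beta> i / (- j)) =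
    chi A (- \<gamma>) * (- j) powr (of_nat CARD('n) / 2) * (of_real (norm (- j)) / (- j)) * exp (pi * \<i> * of_int ((- \<gamma>) $ 2 $ 1) * (\<Sum>i\<in>UNIV. (- \<beta> i)\<^sup>2) / (- j)) * Th t (\<lambda>i. - \<beta> i)"
    by (rule Th_law_pos[where \<beta>="\<lambda>i. - \<beta> i", OF M' AM' det']) (use d' t j \<beta> in auto)
  moreover have "(of_int ((- \<gamma>) $ 1 $ 1) * t + of_int ((- \<gamma>) $ 1 $ 2)) / (- j) = (of_int (\<gamma> $ 1 $ 1) * t + of_int (\<gamma> $ 1 $ 2)) / j"
    by (simp add: divide_simps)
  ultimately show ?thesis
    unfolding Th_minus chi_uminus[OF M AM det d' t j] by simp
qed

text \<open>The case d = 0 forces c = 1 or -1, hence n even and det A = 1 or -1; as D is 1 modulo 4,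
  D = 1 and the character takes the value 1. Passing to gamma T at t - 1 makes the lower right entry
  equal to c, which is non-zero.\<close>

theorem Th_law:
  fixes \<gamma> :: "int^2^2"
  assumes M: "even_symmetric M" and AM: "A ** M = mat (\<gamma> $ 2 $ 1)" and det: "det \<gamma> = 1"
    and t: "Im t > 0" and j: "j = of_int (\<gamma> $ 2 $ 1) * t + of_int (\<gamma> $ 2 $ 2)" and \<beta>: "\<beta> i0 = 0"
  shows "Th ((of_int (\<gamma> $ 1 $ 1) * t + of_int (\<gamma> $ 1 $ 2)) / j) (\<lambda>i. \<beta> i / j) =
    chi A \<gamma> * j powr (of_nat CARD('n) / 2) * (of_real (norm j) / j) * exp (pi * \<i> * of_int (\<gamma> $ 2 $ 1) * (\<Sum>i\<in>UNIV. (\<beta> i)\<^sup>2) / j) * Th t \<beta>"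
proof (cases "\<gamma> $ 2 $ 2 = 0")
  case False
  show ?thesis by (rule Th_law_nonzero[where \<beta>=\<beta>, OF M AM det False t j \<beta>])
next
  case d: True
  define a b c where "a = \<gamma> $ 1 $ 1" "b = \<gamma> $ 1 $ 2" "c = \<gamma> $ 2 $ 1"
  note ent = a_b_c_def[symmetric] d
  have det': "a * 0 - b * c = 1" using det by (simp add: ent det_2)
  then have "c dvd 1" by (metis diff_0 dvd_minus_iff dvd_triv_right mult_zero_right)
  then have c: "c = 1 \<or> c = -1" by auto
  have AMc: "A ** M = mat c" using AM by (simp add: ent)
  have n: "even CARD('n)" using odd_lower_right[OF M AMc det'] by auto
  have codd: "odd c" using c by auto
  have D4: "chi_D A mod 4 = 1" by (rule chi_D_mod_4[OF M AMc n codd])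
  have "\<bar>det A\<bar> = 1"
  proof -
    have "det A dvd c ^ CARD('n)" by (rule det_dvd_level[OF left_inverse_level[OF M AMc]])
    moreover have "c ^ CARD('n) = 1" using c n by auto
    ultimately show ?thesis by simp
  qed
  then have "\<bar>chi_D A\<bar> = 1" using n by (simp add: chi_D_def abs_mult power_abs)
  then have "chi_D A = 1 \<or> chi_D A = -1" by linarith
  then have D: "chi_D A = 1" using D4 by (elim disjE) simp_all
  define \<gamma>' :: "int^2^2" where "\<gamma>' = vector [vector [a, a + b], vector [c, c]]"
  have ent': "\<gamma>' $ 1 $ 1 = a" "\<gamma>' $ 1 $ 2 = a + b" "\<gamma>' $ 2 $ 1 = c" "\<gamma>' $ 2 $ 2 = c"
    by (simp_all add: \<gamma>'_def vector_2)
  have chi: "chi A \<gamma>' = 1" "chi A \<gamma> = 1"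
    using n c D by (auto simp: chi_def chi_v_def ent ent' kronecker_jac) (simp_all add: kronecker_def)
  have dt: "det \<gamma>' = 1" using det' by (simp add: det_2 ent' algebra_simps)
  define s where "s = t - 1"
  have ts: "t = s + of_int 1" by (simp add: s_def)
  have js: "j = of_int (\<gamma>' $ 2 $ 1) * s + of_int (\<gamma>' $ 2 $ 2)" by (simp add: j ent ent' ts algebra_simps)
  have law: "Th ((of_int (\<gamma>' $ 1 $ 1) * s + of_int (\<gamma>' $ 1 $ 2)) / j) (\<lambda>i. \<beta> i / j) =
    chi A \<gamma>' * j powr (of_nat CARD('n) / 2) * (of_real (norm j) / j) * exp (pi * \<i> * of_int (\<gamma>' $ 2 $ 1) * (\<Sum>i\<in>UNIV. (\<beta> i)\<^sup>2) / j) * Th s \<beta>"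
    by (rule Th_law_nonzero[where \<beta>=\<beta>, OF M _ dt _ _ js \<beta>]) (use AMc c t in \<open>auto simp: ent' s_def\<close>)
  have num: "of_int (\<gamma>' $ 1 $ 1) * s + of_int (\<gamma>' $ 1 $ 2) = of_int (\<gamma> $ 1 $ 1) * t + of_int (\<gamma> $ 1 $ 2)"
    by (simp add: ent ent' ts algebra_simps)
  have Ths: "Th s \<beta> = Th t \<beta>" unfolding ts by (rule Th_add_int[symmetric])
  have c': "\<gamma>' $ 2 $ 1 = \<gamma> $ 2 $ 1" by (simp add: ent ent')
  show ?thesis using law unfolding num chi Ths c' .
qed

end

section \<open>Lorentz frames\<close>

lemma bil_add_left: "bil A (x + y) z = bil A x z + bil A y z"
  and bil_add_right: "bil A z (x + y) = bil A z x + bil A z y"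
  and bil_scale_left: "bil A (c *\<^sub>R x) z = c * bil A x z"
  and bil_scale_right: "bil A z (c *\<^sub>R x) = c * bil A z x"
  by (simp_all add: bil_def inner_add_left inner_add_right matrix_vector_right_distrib matrix_vector_mult_scaleR)

lemma bil_diff_left: "bil A (x - y) z = bil A x z - bil A y z"
  and bil_diff_right: "bil A z (x - y) = bil A z x - bil A z y"
  by (simp_all add: bil_def inner_diff_left inner_diff_right matrix_vector_mult_diff_distrib)

lemmas bil_simps = bil_add_left bil_add_right bil_diff_left bil_diff_right bil_scale_left bil_scale_right

lemma bil_commute: "even_symmetric A \<Longrightarrow> bil A x y = bil A y x"
  using symmetric_matrix_inner[OF even_symmetricD] by (simp add: bil_def)

lemma qf_bil: "qf A x = bil A x x / 2" by (simp add: qf_def bil_def)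

lemma matrix_inv_unique:
  fixes M W :: "real^'n^'n"
  assumes "M ** W = mat 1" "W ** M = mat 1" shows "matrix_inv M = W"
proof -
  have "M ** matrix_inv M = mat 1 \<and> matrix_inv M ** M = mat 1"
    unfolding matrix_inv_def using assms by (rule_tac someI_ex) blast
  then have "matrix_inv M = (W ** M) ** matrix_inv M" "W = W ** (M ** matrix_inv M)" using assms by simp_all
  then show ?thesis by (simp add: matrix_mul_assoc)
qed

lemma matrix_inv_invertible:
  fixes M :: "real^'n^'n"
  assumes "det M \<noteq> 0" shows "M ** matrix_inv M = mat 1" "matrix_inv M ** M = mat 1"
  using assms matrix_inv_unique unfolding invertible_det_nz[symmetric] invertible_def by blast+

text \<open>A diagonalising basis, scaled to signs, is moved by the reflection in x =
  \<open>col i0 - c'\<close>, which carries its negative vector to \<open>c'\<close>. The factor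
  sqrt 2 reflects B(c,c) = 2 Q(c) = -2.\<close>

lemma lorentz_frame_exists:
  fixes A :: "int^'n^'n"
  assumes ev: "even_symmetric A" and sig: "has_signature (rmat A) (CARD('n) - 1) 1" and c: "qf A c = -1"
  shows "\<exists>P R sg i0 \<sigma>. lorentz_form A P R sg i0 \<and> (\<sigma> = 1 \<or> \<sigma> = -1) \<and> c = (\<sigma> * sqrt 2) *\<^sub>R (P *v axis i0 1)"
proof -
  obtain P0 :: "real^'n^'n" and e :: "'n \<Rightarrow> real" where P0: "invertible P0"
    and diag0: "transpose P0 ** rmat A ** P0 = (\<chi> i j. if i = j then e i else 0)"
    and pc: "card {i. e i > 0} = CARD('n) - 1" and nc: "card {i. e i < 0} = 1"
    using sig unfolding has_signature_def by blast
  obtain i0 where i0: "{i. e i < 0} = {i0}" using nc card_1_singletonE by blast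
  have "{i. e i > 0} = UNIV - {i0}"
  proof (rule card_subset_eq)
    show "{i. e i > 0} \<subseteq> UNIV - {i0}" using i0 by force
    show "card {i. e i > 0} = card (UNIV - {i0})" using pc by (simp add: card_Diff_singleton)
  qed simp
  then have epos: "e i > 0" if "i \<noteq> i0" for i using that by blast
  have eneg: "e i0 < 0" using i0 by blast
  have e0: "e i \<noteq> 0" for i using epos[of i] eneg by (cases "i = i0") auto
  define sg where "sg i = sgn (e i)" for i
  have sg: "sg i0 = -1" "\<And>i. i \<noteq> i0 \<Longrightarrow> sg i = 1" using eneg epos by (auto simp: sg_def)
  have ss: "sg i * sg i = 1" for i using sg by (cases "i = i0") auto
  define r where "r i = 1 / sqrt \<bar>e i\<bar>" for i
  define col where "col i = r i *\<^sub>R (P0 *v axis i 1)" for i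
  have colB: "bil A (col i) (col j) = (if i = j then sg i else 0)" for i j
  proof -
    have "bil A (P0 *v axis i 1) (P0 *v axis j 1) = axis i 1 \<bullet> ((transpose P0 ** rmat A ** P0) *v axis j 1)"
      unfolding bil_def matrix_vector_mul_assoc[symmetric] inner_matrix_transpose ..
    also have "\<dots> = (if i = j then e i else 0)"
      unfolding diag0 by (simp add: inner_axis' matrix_vector_mult_basis column_def)
    finally have "bil A (col i) (col j) = r i * r j * (if i = j then e i else 0)"
      by (simp add: col_def bil_simps)
    moreover have "r i * r i * e i = sg i"
    proof -
      have "r i * r i = 1 / \<bar>e i\<bar>" by (simp add: r_def)
      then show ?thesis using e0[of i] by (cases "e i > 0") (auto simp: sg_def)
    qed
    ultimately show ?thesis by (cases "i = j") auto
  qed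
  \<comment> \<open>This sign makes B(col i0, c') non-negative, so B(x,x) = -2 - 2 B(col i0, c') is
    non-zero and the reflection in x is defined.\<close>
  define \<sigma> :: real where "\<sigma> = (if bil A (col i0) c \<ge> 0 then 1 else -1)"
  have \<sigma>: "\<sigma> = 1 \<or> \<sigma> = -1" "\<sigma> * \<sigma> = 1" by (auto simp: \<sigma>_def)
  define c' where "c' = (\<sigma> / sqrt 2) *\<^sub>R c"
  have cc: "bil A c' c' = -1" using c \<sigma> by (simp add: c'_def bil_simps qf_bil field_simps)
  have ec: "bil A (col i0) c' \<ge> 0" by (simp add: c'_def bil_simps \<sigma>_def)
  define x where "x = col i0 - c'"
  define b where "b = bil A x x"
  have b: "b = -2 - 2 * bil A (col i0) c'"
    using colB[of i0 i0] cc sg(1) bil_commute[OF ev, of c' "col i0"] by (simp add: b_def x_def bil_simps)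
  have b0: "b < 0" using b ec by linarith
  define refl where "refl v = v - (2 * bil A x v / b) *\<^sub>R x" for v
  have reflB: "bil A (refl u) (refl v) = bil A u v" for u v
  proof -
    have "bil A (refl u) (refl v) = bil A u v - (2 * bil A x v / b) * bil A u x - (2 * bil A x u / b) * bil A x v + (2 * bil A x u / b) * (2 * bil A x v / b) * b"
      by (simp add: refl_def bil_simps b_def algebra_simps)
    also have "\<dots> = bil A u v" using b0 bil_commute[OF ev, of u x] by (simp add: field_simps)
    finally show ?thesis .
  qed
  have refl0: "refl (col i0) = c'"
  proof -
    have "2 * bil A x (col i0) = b"
      using colB[of i0 i0] sg(1) bil_commute[OF ev, of c' "col i0"] by (simp add: b x_def bil_simps)
    then have "2 * bil A x (col i0) / b = 1" using b0 by simp
    then show ?thesis by (simp add: refl_def x_def)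
  qed
  define P :: "real^'n^'n" where "P = (\<chi> a i. refl (col i) $ a)"
  have Pcol: "P *v axis i 1 = refl (col i)" for i
    by (simp add: P_def matrix_vector_mult_basis column_def vec_eq_iff)
  have diag: "transpose P ** rmat A ** P = (\<chi> i j. if i = j then sg i else 0)"
  proof -
    have "(transpose P ** rmat A ** P) $ i $ j = (if i = j then sg i else 0)" for i j
    proof -
      have "(transpose P ** rmat A ** P) $ i $ j = axis i 1 \<bullet> ((transpose P ** rmat A ** P) *v axis j 1)"
        by (simp add: inner_axis' matrix_vector_mult_basis column_def)
      also have "\<dots> = bil A (P *v axis i 1) (P *v axis j 1)"
        unfolding bil_def matrix_vector_mul_assoc[symmetric] inner_matrix_transpose ..
      finally show ?thesis unfolding Pcol reflB colB .
    qed
    then show ?thesis by (simp add: vec_eq_iff)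
  qed
  define D :: "real^'n^'n" where "D = (\<chi> i j. if i = j then sg i else 0)"
  have DD: "D ** D = mat 1"
  proof -
    have "(\<Sum>k\<in>UNIV. (if i = k then sg i else 0) * (if k = j then sg k else 0)) = (\<Sum>k\<in>UNIV. if k = i then (if i = j then 1 else 0) else 0)" for i j
      by (intro sum.cong) (auto simp: ss)
    then show ?thesis by (simp add: D_def vec_eq_iff matrix_matrix_mult_def mat_def)
  qed
  define R where "R = D ** transpose P ** rmat A"
  have RP: "R ** P = mat 1"
  proof -
    have "R ** P = D ** (transpose P ** rmat A ** P)" by (simp add: R_def matrix_mul_assoc)
    then show ?thesis unfolding diag D_def[symmetric] DD .
  qed
  then have PR: "P ** R = mat 1" using matrix_left_right_inverse by blast
  have sgor: "sg i = 1 \<or> sg i = -1" for i using sg by (cases "i = i0") auto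
  have "lorentz_form A P R sg i0"
    by unfold_locales (use ev PR RP diag sg sgor in auto)
  moreover have "c = (\<sigma> * sqrt 2) *\<^sub>R (P *v axis i0 1)"
    unfolding Pcol refl0 c'_def using \<sigma>(2) by (simp add: mult.assoc[symmetric])
  ultimately show ?thesis using \<sigma>(1) by blast
qed

context lorentz_form begin

text \<open>The expressions quadratic in c are free of \<sigma>; only these enter the theta terms,
  so the choice of sign in the frame leaves no trace.\<close>

lemma frame_coordinate:
  assumes c: "c = (\<sigma> * sqrt 2) *\<^sub>R (P *v axis i0 1)" and s: "\<sigma> = 1 \<or> \<sigma> = -1"
  shows "bil A c x = - (\<sigma> * sqrt 2) * (R *v x) $ i0"
    and "(bil A c x)\<^sup>2 = 2 * ((R *v x) $ i0)\<^sup>2"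
    and "w \<bullet> c = \<sigma> * sqrt 2 * (transpose P *v w) $ i0"
    and "(w \<bullet> c) * bil A c x = - 2 * (transpose P *v w) $ i0 * (R *v x) $ i0"
    and "(w \<bullet> c)\<^sup>2 = 2 * ((transpose P *v w) $ i0)\<^sup>2"
proof -
  have ss: "\<sigma> * \<sigma> = 1" using s by auto
  have Rc: "R *v c = (\<sigma> * sqrt 2) *\<^sub>R axis i0 1"
    by (simp add: c matrix_vector_mult_scaleR matrix_vector_mul_assoc PR)
  have d: "(\<Sum>i\<in>UNIV. sg i * (k * axis i0 1 $ i) * y $ i) = sg i0 * k * y $ i0" for k and y :: "real^'n"
  proof -
    have "sg i * (k * axis i0 1 $ i) * y $ i = (if i = i0 then sg i0 * k * y $ i0 else 0)" for i by (simp add: axis_def)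
    then show ?thesis by simp
  qed
  show b: "bil A c x = - (\<sigma> * sqrt 2) * (R *v x) $ i0"
    unfolding bil_diag Rc using d[of "\<sigma> * sqrt 2" "R *v x"] neg by simp
  show "(bil A c x)\<^sup>2 = 2 * ((R *v x) $ i0)\<^sup>2"
    unfolding b using s by (auto simp: power_mult_distrib)
  have "w \<bullet> (P *v axis i0 1) = (transpose P *v w) $ i0"
    using inner_matrix_transpose[of P "axis i0 1" w] by (simp add: inner_commute inner_axis')
  then show w: "w \<bullet> c = \<sigma> * sqrt 2 * (transpose P *v w) $ i0" by (simp add: c)
  show "(w \<bullet> c) * bil A c x = - 2 * (transpose P *v w) $ i0 * (R *v x) $ i0"
    unfolding w b using s by auto
  show "(w \<bullet> c)\<^sup>2 = 2 * ((transpose P *v w) $ i0)\<^sup>2"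
    unfolding w using s by (auto simp: power_mult_distrib)
qed

text \<open>With y the coordinate at \<open>i0\<close>, B(c,x)^2/2 is y^2, which turns the
  contribution -y^2/2 of Q into y^2/2.\<close>

lemma majorant_diag:
  assumes c: "c = (\<sigma> * sqrt 2) *\<^sub>R (P *v axis i0 1)" and s: "\<sigma> = 1 \<or> \<sigma> = -1"
  shows "qf A x + (bil A c x)\<^sup>2 / 2 = (norm (R *v x))\<^sup>2 / 2"
proof -
  have "(norm (R *v x))\<^sup>2 = (\<Sum>i\<in>UNIV. ((R *v x) $ i)\<^sup>2)"
    unfolding power2_norm_eq_inner inner_vec_def by (simp add: power2_eq_square)
  also have "\<dots> = ((R *v x) $ i0)\<^sup>2 + (\<Sum>i\<in>UNIV - {i0}. ((R *v x) $ i)\<^sup>2)" by (rule sum.remove) auto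
  finally have n: "(norm (R *v x))\<^sup>2 = ((R *v x) $ i0)\<^sup>2 + (\<Sum>i\<in>UNIV - {i0}. ((R *v x) $ i)\<^sup>2)" .
  have "(\<Sum>i\<in>UNIV. sg i * ((R *v x) $ i)\<^sup>2) = sg i0 * ((R *v x) $ i0)\<^sup>2 + (\<Sum>i\<in>UNIV - {i0}. sg i * ((R *v x) $ i)\<^sup>2)" by (rule sum.remove) auto
  also have "(\<Sum>i\<in>UNIV - {i0}. sg i * ((R *v x) $ i)\<^sup>2) = (\<Sum>i\<in>UNIV - {i0}. ((R *v x) $ i)\<^sup>2)" by (rule sum.cong) (auto simp: pos)
  finally have "qf A x = (- ((R *v x) $ i0)\<^sup>2 + (\<Sum>i\<in>UNIV - {i0}. ((R *v x) $ i)\<^sup>2)) / 2" unfolding qf_diag by (simp add: neg)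
  then show ?thesis using n frame_coordinate(2)[OF c s, of x] by (simp add: field_simps)
qed

lemma inverse_form: "w \<bullet> (matrix_inv (rmat A) *v w) = (\<Sum>i\<in>UNIV. sg i * ((transpose P *v w) $ i)\<^sup>2)"
proof -
  let ?D = "(\<chi> i j. if i = j then sg i else 0) :: real^'n^'n"
  let ?W = "P ** ?D ** transpose P"
  have "rmat A ** ?W = mat 1" by (rule inverse_diag)
  moreover from this have "?W ** rmat A = mat 1" using matrix_left_right_inverse by blast
  ultimately have inv: "matrix_inv (rmat A) = ?W" by (rule matrix_inv_unique)
  have "w \<bullet> (?W *v w) = (transpose P *v w) \<bullet> (?D *v (transpose P *v w))"
    unfolding matrix_vector_mul_assoc[symmetric] inner_matrix_transpose transpose_transpose ..
  also have "\<dots> = (\<Sum>i\<in>UNIV. sg i * ((transpose P *v w) $ i)\<^sup>2)"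
    unfolding diag_mult_vec by (simp add: inner_vec_def power2_eq_square mult_ac)
  finally show ?thesis unfolding inv .
qed

end

lemma majorant_pos:
  fixes A :: "int^'n^'n"
  assumes "even_symmetric A" "has_signature (rmat A) (CARD('n) - 1) 1" "qf A c = -1" "x \<noteq> 0"
  shows "qf A x + (bil A c x)\<^sup>2 / 2 > 0"
proof -
  obtain P R sg i0 \<sigma> where L: "lorentz_form A P R sg i0" and s: "\<sigma> = 1 \<or> \<sigma> = -1" and c: "c = (\<sigma> * sqrt 2) *\<^sub>R (P *v axis i0 1)"
    using lorentz_frame_exists[OF assms(1-3)] by blast
  interpret lorentz_form A P R sg i0 by (rule L)
  have "R *v x \<noteq> 0"
  proof
    assume "R *v x = 0"
    then have "P *v (R *v x) = 0" by simp
    then show False using assms(4) by (simp add: matrix_vector_mul_assoc PR)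
  qed
  then show ?thesis unfolding majorant_diag[OF c s] by simp
qed

text \<open>The reversed Cauchy-Schwarz inequality. In the frame of c1 the pairing is - sqrt 2 times
  \<sigma> X_i0, and Q(c2) = -1 gives |X_i0| >= sqrt 2. Its sign is settled by c0: both vectors pair
  negatively with it, and for vectors with Q < 0 the coordinate at \<open>i0\<close> dominates the
  others.\<close>

lemma cone_sheet_bil:
  fixes A :: "int^'n^'n"
  assumes ev: "even_symmetric A" and sig: "has_signature (rmat A) (CARD('n) - 1) 1" and c0: "qf A c0 < 0"
    and c1: "c1 \<in> cone_sheet A c0" and c2: "c2 \<in> cone_sheet A c0"
  shows "bil A c1 c2 \<le> -2"
proof -
  have q1: "qf A c1 = -1" and q2: "qf A c2 = -1" and b1: "bil A c1 c0 < 0" and b2: "bil A c2 c0 < 0"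
    using c1 c2 by (auto simp: cone_sheet_def)
  obtain P R sg i0 \<sigma> where L: "lorentz_form A P R sg i0" and s: "\<sigma> = 1 \<or> \<sigma> = -1" and c: "c1 = (\<sigma> * sqrt 2) *\<^sub>R (P *v axis i0 1)"
    using lorentz_frame_exists[OF ev sig q1] by blast
  interpret lorentz_form A P R sg i0 by (rule L)
  define X where "X = R *v c2"
  define Y where "Y = R *v c0"
  define X' where "X' = (\<chi> i. if i = i0 then 0 else X $ i)"
  define Y' where "Y' = (\<chi> i. if i = i0 then 0 else Y $ i)"
  have split: "(\<Sum>i\<in>UNIV. sg i * u $ i * v $ i) = - (u $ i0 * v $ i0) + (\<chi> i. if i = i0 then 0 else u $ i) \<bullet> (\<chi> i. if i = i0 then 0 else v $ i)" for u v :: "real^'n"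
  proof -
    have "(\<Sum>i\<in>UNIV. sg i * u $ i * v $ i) = sg i0 * u $ i0 * v $ i0 + (\<Sum>i\<in>UNIV - {i0}. sg i * u $ i * v $ i)" by (rule sum.remove) auto
    moreover have "(\<Sum>i\<in>UNIV. (if i = i0 then 0 else u $ i) * (if i = i0 then 0 else v $ i)) = 0 + (\<Sum>i\<in>UNIV - {i0}. (if i = i0 then 0 else u $ i) * (if i = i0 then 0 else v $ i))"
      by (subst sum.remove[of _ i0]) auto
    moreover have "(\<Sum>i\<in>UNIV - {i0}. (if i = i0 then 0 else u $ i) * (if i = i0 then 0 else v $ i)) = (\<Sum>i\<in>UNIV - {i0}. sg i * u $ i * v $ i)"
      by (rule sum.cong) (auto simp: pos)
    ultimately show ?thesis by (simp add: neg inner_vec_def)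
  qed
  have e2: "- (X $ i0)\<^sup>2 + (norm X')\<^sup>2 = -2"
    using q2 split[of X X] unfolding qf_bil bil_diag X_def[symmetric] X'_def power2_norm_eq_inner by (simp add: power2_eq_square)
  have e0: "- (Y $ i0)\<^sup>2 + (norm Y')\<^sup>2 < 0"
    using c0 split[of Y Y] unfolding qf_bil bil_diag Y_def[symmetric] Y'_def power2_norm_eq_inner by (simp add: power2_eq_square)
  have f2: "- (X $ i0 * Y $ i0) + X' \<bullet> Y' < 0"
    using b2 split[of X Y] unfolding bil_diag X_def[symmetric] Y_def[symmetric] X'_def Y'_def by simp
  have "sqrt 2 * (\<sigma> * Y $ i0) > 0" using b1 frame_coordinate(1)[OF c s, of c0] by (simp add: Y_def mult_ac)
  then have f1: "\<sigma> * Y $ i0 > 0" by (simp add: zero_less_mult_iff)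
  have "(norm X')\<^sup>2 < \<bar>X $ i0\<bar>\<^sup>2" "(norm Y')\<^sup>2 < \<bar>Y $ i0\<bar>\<^sup>2" unfolding power2_abs using e2 e0 by linarith+
  then have nX: "norm X' < \<bar>X $ i0\<bar>" and nY: "norm Y' < \<bar>Y $ i0\<bar>"
    using power2_less_imp_less abs_ge_zero by blast+
  have "\<sigma> * X $ i0 > 0"
  proof (rule ccontr)
    assume "\<not> \<sigma> * X $ i0 > 0"
    then have "X $ i0 * Y $ i0 \<le> 0" using f1 s by (auto simp: mult_le_0_iff zero_less_mult_iff)
    then have "\<bar>X $ i0\<bar> * \<bar>Y $ i0\<bar> = - (X $ i0 * Y $ i0)" by (simp add: abs_mult[symmetric])
    moreover have "\<bar>X' \<bullet> Y'\<bar> \<le> norm X' * norm Y'" by (rule Cauchy_Schwarz_ineq2)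
    moreover have "norm X' * norm Y' \<le> \<bar>X $ i0\<bar> * \<bar>Y $ i0\<bar>" using nX nY by (intro mult_mono) auto
    ultimately show False using f2 by linarith
  qed
  moreover have "(X $ i0)\<^sup>2 \<ge> 2" using e2 zero_le_power2[of "norm X'"] by linarith
  then have "(\<sigma> * X $ i0)\<^sup>2 \<ge> (sqrt 2)\<^sup>2" using s by (auto simp: power_mult_distrib)
  ultimately have "sqrt 2 \<le> \<sigma> * X $ i0" by (meson less_imp_le power2_le_imp_le)
  then have "sqrt 2 * sqrt 2 \<le> sqrt 2 * (\<sigma> * X $ i0)" by (intro mult_left_mono) auto
  then show ?thesis using frame_coordinate(1)[OF c s, of c2] by (simp add: X_def mult_ac)
qed

text \<open>By Cramer's rule det A times the inverse is integral, and a further factor 2 makes the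
  diagonal even. It ensures that the minimum in \<open>level\<close> is taken over a non-empty
  set.\<close>

lemma inverse_matrix_integral:
  fixes A :: "int^'n^'n"
  assumes ev: "even_symmetric A" and d: "det A \<noteq> 0"
  shows "\<exists>N>0. \<exists>M. even_symmetric M \<and> real N *\<^sub>R matrix_inv (rmat A) = rmat M"
proof -
  define X :: "int^'n^'n" where "X = (\<chi> k l. det (\<chi> i j. if j = k then (if i = l then 1 else 0) else A $ i $ j))"
  have dr: "det (rmat A) \<noteq> 0" using d by (simp add: det_rmat)
  have AI: "rmat A ** matrix_inv (rmat A) = mat 1" "matrix_inv (rmat A) ** rmat A = mat 1"
    using matrix_inv_invertible[OF dr] by auto
  have col: "matrix_inv (rmat A) $ k $ l = real_of_int (X $ k $ l) / real_of_int (det A)" for k l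
  proof -
    have "rmat A *v (matrix_inv (rmat A) *v axis l 1) = axis l 1" by (simp add: matrix_vector_mul_assoc AI)
    then have "matrix_inv (rmat A) *v axis l 1 = (\<chi> k. det (\<chi> i j. if j = k then axis l 1 $ i else rmat A $ i $ j) / det (rmat A))"
      using cramer[OF dr] by blast
    then have "(matrix_inv (rmat A) *v axis l 1) $ k = det (\<chi> i j. if j = k then axis l 1 $ i else rmat A $ i $ j) / det (rmat A)" by simp
    moreover have "(\<chi> i j. if j = k then axis l 1 $ i else rmat A $ i $ j) = rmat (\<chi> i j. if j = k then (if i = l then 1 else 0) else A $ i $ j)"
      by (simp add: vec_eq_iff axis_def map_matrix_def)
    ultimately show ?thesis by (simp add: matrix_vector_mult_basis column_def det_rmat X_def)
  qed
  have sym: "transpose (matrix_inv (rmat A)) = matrix_inv (rmat A)"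
  proof -
    have "transpose (matrix_inv (rmat A)) ** rmat A = mat 1" "rmat A ** transpose (matrix_inv (rmat A)) = mat 1"
      using AI even_symmetricD[OF ev] by (metis matrix_transpose_mul transpose_mat)+
    then show ?thesis using matrix_inv_unique by metis
  qed
  define M where "M = (\<chi> k l. 2 * sgn (det A) * X $ k $ l)"
  have "real (nat (2 * \<bar>det A\<bar>)) *\<^sub>R matrix_inv (rmat A) = rmat M"
  proof -
    have "real_of_int (2 * \<bar>det A\<bar>) * (real_of_int x / real_of_int (det A)) = real_of_int (2 * sgn (det A) * x)" for x
      using d by (cases "det A > 0") auto
    then have "real (nat (2 * \<bar>det A\<bar>)) * matrix_inv (rmat A) $ k $ l = rmat M $ k $ l" for k l
      unfolding col by (simp add: M_def map_matrix_def)
    then show ?thesis by (simp only: vec_eq_iff vector_scaleR_component real_scaleR_def simp_thms)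
  qed
  moreover have "even_symmetric M"
  proof -
    have "X $ k $ l = X $ l $ k" for k l
    proof -
      have "matrix_inv (rmat A) $ k $ l = matrix_inv (rmat A) $ l $ k" using arg_cong[OF sym, of "\<lambda>Z. Z $ l $ k"] by (simp add: transpose_def)
      then show ?thesis using d by (simp add: col)
    qed
    then show ?thesis by (simp add: even_symmetric_def M_def transpose_def vec_eq_iff)
  qed
  moreover have "nat (2 * \<bar>det A\<bar>) > 0" using d by simp
  ultimately show ?thesis by blast
qed

text \<open>M is the multiple c/N of N A^-1, where N is the level. This is how the divisibility of c
  by N enters the transformation law.\<close>

lemma level_dvd_matrix:
  fixes A :: "int^'n^'n"
  assumes ev: "even_symmetric A" and d: "det A \<noteq> 0" and c: "int (level A) dvd c"
  shows "\<exists>M. even_symmetric M \<and> A ** M = mat c"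
proof -
  have "level A > 0 \<and> (\<exists>M. even_symmetric M \<and> real (level A) *\<^sub>R matrix_inv (rmat A) = rmat M)"
    unfolding level_def using inverse_matrix_integral[OF ev d] by (rule_tac LeastI_ex) blast
  then obtain M0 where M0: "even_symmetric M0" "real (level A) *\<^sub>R matrix_inv (rmat A) = rmat M0" by blast
  obtain k where k: "c = int (level A) * k" using c by blast
  define M where "M = (\<chi> i j. k * M0 $ i $ j)"
  have "even_symmetric M"
    using M0(1) by (simp add: even_symmetric_def M_def transpose_def vec_eq_iff)
  moreover have "A ** M = mat c"
  proof -
    have inv: "rmat A ** matrix_inv (rmat A) = mat 1" using d by (simp add: matrix_inv_invertible(1) det_rmat)
    have "rmat (A ** M) = real_of_int k *\<^sub>R (rmat A ** rmat M0)"
      by (simp add: vec_eq_iff matrix_matrix_mult_def map_matrix_def M_def sum_distrib_left mult_ac)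
    also have "rmat A ** rmat M0 = real (level A) *\<^sub>R (rmat A ** matrix_inv (rmat A))"
      unfolding M0(2)[symmetric] using scaleR_matrix_mult[of 1 "rmat A" "real (level A)"] by simp
    also have "real_of_int k *\<^sub>R real (level A) *\<^sub>R (rmat A ** matrix_inv (rmat A)) = rmat (mat c)"
      unfolding inv by (simp add: vec_eq_iff mat_def map_matrix_def k)
    finally show ?thesis by (simp add: vec_eq_iff map_matrix_def)
  qed
  ultimately show ?thesis by blast
qed

section \<open>The generating series\<close>

definition inv_form :: "int^'n^'n \<Rightarrow> real^'n \<Rightarrow> real" where
  "inv_form A w = w \<bullet> (matrix_inv (rmat A) *v w)"

text \<open>A Siegel theta term for the majorant of c with elliptic variable s w + r A e projected
  away from c: as B(c,c) = -2, the vector l + B(c,l) c/2 is orthogonal to c, and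
  \<open>inv_form A w + (w \<bullet> c)\<^sup>2 / 2\<close> is the inverse form at the projection of
  w. The last quotient is the correction that turns the theta law into plain scaling of (s,
  r).\<close>

definition eterm :: "int^'n^'n \<Rightarrow> complex \<Rightarrow> real^'n \<Rightarrow> real^'n \<Rightarrow> real^'n \<Rightarrow> int^'n \<Rightarrow> complex \<Rightarrow> complex \<Rightarrow> complex" where
  "eterm A t w c e l s r = exp (complex_of_real (2 * pi) * \<i> * t * complex_of_real (qf A (rvec l))
     - complex_of_real (pi * Im t * (bil A c (rvec l))\<^sup>2)
     + s * complex_of_real (w \<bullet> rvec l + (w \<bullet> c) * bil A c (rvec l) / 2) + r * complex_of_real (bil A e (rvec l))
     - (s\<^sup>2 * complex_of_real (inv_form A w + (w \<bullet> c)\<^sup>2 / 2) + 2 * s * r * complex_of_real (w \<bullet> e) + 2 * r\<^sup>2)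
       / complex_of_real (8 * pi * Im t))"

lemma Im_moebius:
  assumes det: "det \<gamma> = 1" and t: "Im t > 0"
  shows "aut_factor \<gamma> t \<noteq> 0" "Im (moebius_act \<gamma> t) = Im t / (norm (aut_factor \<gamma> t))\<^sup>2"
proof -
  define a b c d where "a = \<gamma> $ 1 $ 1" "b = \<gamma> $ 1 $ 2" "c = \<gamma> $ 2 $ 1" "d = \<gamma> $ 2 $ 2"
  define j where "j = of_int c * t + of_int d"
  have jj: "aut_factor \<gamma> t = j" by (simp add: aut_factor_def a_b_c_d_def j_def)
  have det: "a * d - b * c = 1" using det by (simp add: det_2 a_b_c_d_def)
  have j0: "j \<noteq> 0"
  proof
    assume "j = 0"
    then have "Im j = 0" "Re j = 0" by auto
    then have "c = 0" "d = 0" using t by (auto simp: j_def)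
    then show False using det by simp
  qed
  then show "aut_factor \<gamma> t \<noteq> 0" by (simp add: jj)
  have "(of_int a * t + of_int b) / j = ((of_int a * t + of_int b) * cnj j) / of_real ((norm j)\<^sup>2)"
    using j0 by (simp add: complex_norm_square del: of_real_power)
  then have "Im ((of_int a * t + of_int b) / j) = Im ((of_int a * t + of_int b) * cnj j) / (norm j)\<^sup>2"
    by (simp only: Im_divide_of_real)
  also have "Im ((of_int a * t + of_int b) * cnj j) = real_of_int (a * d - b * c) * Im t"
    by (simp add: j_def algebra_simps)
  finally show "Im (moebius_act \<gamma> t) = Im t / (norm (aut_factor \<gamma> t))\<^sup>2"
    unfolding det by (simp add: moebius_act_def jj a_b_c_d_def)
qed

context lorentz_form begin

lemma sum_split_i0:
  fixes f :: "'n \<Rightarrow> 'b::ab_group_add"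
  shows "sum f (UNIV - {i0}) = sum f UNIV - f i0"
  by (simp add: sum_diff1)

lemma sum_if_i0:
  fixes f :: "'n \<Rightarrow> 'b::ab_group_add"
  shows "(\<Sum>i\<in>UNIV. if i = i0 then 0 else f i) = sum f UNIV - f i0"
proof -
  have "(\<Sum>i\<in>UNIV. if i = i0 then 0 else f i) = (\<Sum>i\<in>UNIV - {i0}. f i)"
    by (rule sum.mono_neutral_cong_right) auto
  then show ?thesis by (simp add: sum_split_i0)
qed

text \<open>In the frame of c the projection drops the coordinate at \<open>i0\<close>: the terms in
  w.c remove that of w, and B(c,e) = 0 says that e has none. So \<zeta> vanishes at
  \<open>i0\<close>, as the transformation law requires.\<close>

lemma eterm_gexp:
  fixes \<zeta> :: "complex \<Rightarrow> complex \<Rightarrow> 'n \<Rightarrow> complex" and u r :: complex and w :: "real^'n"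
  assumes c: "c = (\<sigma> * sqrt 2) *\<^sub>R (P *v axis i0 1)" and s: "\<sigma> = 1 \<or> \<sigma> = -1"
    and ce: "bil A c e = 0" and qe: "qf A e = 1" and t: "Im t > 0"
  defines "\<zeta> \<equiv> \<lambda>s r i. if i = i0 then 0 else s * complex_of_real ((transpose P *v w) $ i) + r * complex_of_real ((R *v e) $ i)"
  shows "eterm A t w c e l u r = exp (- ((\<Sum>i\<in>UNIV. (\<zeta> u r i)\<^sup>2) / (8 * pi * Im t))) * gexp (sgt t) (\<lambda>i. \<zeta> u r i / (2 * pi * \<i>)) (R *v rvec l)"
proof -
  define om where "om i = (transpose P *v w) $ i" for i
  define et where "et i = (R *v e) $ i" for i
  define y where "y i = (R *v rvec l) $ i" for i
  have et0: "et i0 = 0" using ce frame_coordinate(1)[OF c s, of e] s by (auto simp: et_def)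
  have inn: "w \<bullet> x = (\<Sum>i\<in>UNIV. om i * (R *v x) $ i)" for x
  proof -
    have "w \<bullet> x = (P *v (R *v x)) \<bullet> w" by (simp add: matrix_vector_mul_assoc PR inner_commute)
    also have "\<dots> = (R *v x) \<bullet> (transpose P *v w)" by (rule inner_matrix_transpose)
    finally show ?thesis by (simp add: inner_vec_def om_def mult.commute)
  qed
  have sgsum: "(\<Sum>i\<in>UNIV. sg i * f i) = sum f UNIV - 2 * f i0" for f :: "'n \<Rightarrow> real"
  proof -
    have "sg i * f i = f i - 2 * (if i = i0 then f i0 else 0)" for i using pos[of i] neg by auto
    then show ?thesis by (simp add: sum_subtractf sum_distrib_left[symmetric])
  qed
  have B2: "(bil A c (rvec l))\<^sup>2 = 2 * (y i0)\<^sup>2" using frame_coordinate(2)[OF c s] by (simp add: y_def)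
  have kB: "(w \<bullet> c) * bil A c (rvec l) = - 2 * om i0 * y i0" using frame_coordinate(4)[OF c s] by (simp add: y_def om_def)
  have k2: "(w \<bullet> c)\<^sup>2 = 2 * (om i0)\<^sup>2" using frame_coordinate(5)[OF c s] by (simp add: om_def)
  have Q: "2 * qf A (rvec l) = (\<Sum>i\<in>UNIV. (y i)\<^sup>2) - 2 * (y i0)\<^sup>2" unfolding qf_diag using sgsum[of "\<lambda>i. (y i)\<^sup>2"] by (simp add: y_def)
  have W: "inv_form A w = (\<Sum>i\<in>UNIV. (om i)\<^sup>2) - 2 * (om i0)\<^sup>2" unfolding inv_form_def inverse_form using sgsum[of "\<lambda>i. (om i)\<^sup>2"] by (simp add: om_def)
  have Be: "bil A e (rvec l) = (\<Sum>i\<in>UNIV. et i * y i)"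
    using sgsum[of "\<lambda>i. et i * y i"] et0 unfolding bil_diag by (simp add: et_def y_def mult.assoc)
  have Qe: "(\<Sum>i\<in>UNIV. (et i)\<^sup>2) = 2" using qe sgsum[of "\<lambda>i. (et i)\<^sup>2"] et0 unfolding qf_diag by (simp add: et_def)
  have we: "w \<bullet> e = (\<Sum>i\<in>UNIV. om i * et i)" by (simp add: inn et_def)
  have wl: "w \<bullet> rvec l = (\<Sum>i\<in>UNIV. om i * y i)" by (simp add: inn y_def)
  have zsum: "(\<Sum>i\<in>UNIV. (\<zeta> u r i)\<^sup>2) = u\<^sup>2 * (inv_form A w + (w \<bullet> c)\<^sup>2 / 2) + 2 * u * r * (w \<bullet> e) + 2 * r\<^sup>2"
  proof -
    have "(\<Sum>i\<in>UNIV. (\<zeta> u r i)\<^sup>2) = (\<Sum>i\<in>UNIV. if i = i0 then 0 else (u * om i + r * et i)\<^sup>2)"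
      by (rule sum.cong) (auto simp: \<zeta>_def om_def et_def)
    also have "\<dots> = (\<Sum>i\<in>UNIV. (u * om i + r * et i)\<^sup>2) - (u * om i0)\<^sup>2" by (simp add: sum_if_i0 et0)
    also have "(\<Sum>i\<in>UNIV. (u * om i + r * et i)\<^sup>2) = u\<^sup>2 * of_real (\<Sum>i\<in>UNIV. (om i)\<^sup>2) + 2 * u * r * of_real (\<Sum>i\<in>UNIV. om i * et i) + r\<^sup>2 * of_real (\<Sum>i\<in>UNIV. (et i)\<^sup>2)"
      by (simp add: power2_sum power_mult_distrib sum.distrib sum_distrib_left mult_ac)
    finally show ?thesis unfolding Qe W k2 we by (simp add: power_mult_distrib algebra_simps)
  qed
  have lin: "(\<Sum>i\<in>UNIV. \<zeta> u r i * y i) = u * (w \<bullet> rvec l + (w \<bullet> c) * bil A c (rvec l) / 2) + r * bil A e (rvec l)"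
  proof -
    have "(\<Sum>i\<in>UNIV. \<zeta> u r i * y i) = (\<Sum>i\<in>UNIV. if i = i0 then 0 else (u * om i + r * et i) * y i)"
      by (rule sum.cong) (auto simp: \<zeta>_def om_def et_def)
    also have "\<dots> = (\<Sum>i\<in>UNIV. (u * om i + r * et i) * y i) - u * om i0 * y i0" by (simp add: sum_if_i0 et0)
    also have "(\<Sum>i\<in>UNIV. (u * om i + r * et i) * y i) = u * of_real (\<Sum>i\<in>UNIV. om i * y i) + r * of_real (\<Sum>i\<in>UNIV. et i * y i)"
      by (simp add: algebra_simps sum.distrib sum_distrib_left)
    finally show ?thesis unfolding kB wl Be by (simp add: algebra_simps)
  qed
  have quad: "(\<Sum>i\<in>UNIV. pi * \<i> * sgt t i * (y i)\<^sup>2) = 2 * pi * \<i> * t * qf A (rvec l) - pi * Im t * (bil A c (rvec l))\<^sup>2"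
  proof -
    have "pi * \<i> * sgt t i * (y i)\<^sup>2 = pi * \<i> * t * (y i)\<^sup>2 + (if i = i0 then pi * \<i> * (- cnj t - t) * (y i0)\<^sup>2 else 0)" for i
      using pos[of i] neg by (auto simp: sgt_def algebra_simps)
    then have "(\<Sum>i\<in>UNIV. pi * \<i> * sgt t i * (y i)\<^sup>2) = pi * \<i> * t * of_real (\<Sum>i\<in>UNIV. (y i)\<^sup>2) + pi * \<i> * (- cnj t - t) * (y i0)\<^sup>2"
      by (simp add: sum.distrib sum_distrib_left)
    also have "(\<Sum>i\<in>UNIV. (y i)\<^sup>2) = 2 * qf A (rvec l) + 2 * (y i0)\<^sup>2" using Q by simp
    also have "pi * \<i> * t * of_real (2 * qf A (rvec l) + 2 * (y i0)\<^sup>2) + pi * \<i> * (- cnj t - t) * (y i0)\<^sup>2 = 2 * pi * \<i> * t * qf A (rvec l) + pi * \<i> * (t - cnj t) * (y i0)\<^sup>2"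
      by (simp add: algebra_simps)
    also have "t - cnj t = 2 * \<i> * Im t" by (simp add: complex_eq_iff)
    finally show ?thesis unfolding B2 by (simp add: algebra_simps)
  qed
  have g: "gexp (sgt t) (\<lambda>i. \<zeta> u r i / (2 * pi * \<i>)) (R *v rvec l) = exp ((\<Sum>i\<in>UNIV. pi * \<i> * sgt t i * (y i)\<^sup>2) + (\<Sum>i\<in>UNIV. \<zeta> u r i * y i))"
    unfolding gexp_def y_def by (simp add: sum.distrib)
  show ?thesis unfolding g exp_add[symmetric] quad lin zsum eterm_def by (simp add: algebra_simps)
qed

end

theorem eterm_sum_law:
  fixes A :: "int^'n^'n" and u r :: complex
  assumes ev: "even_symmetric A" and sig: "has_signature (rmat A) (CARD('n) - 1) 1" and qc: "qf A c = -1"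
    and ce: "bil A c e = 0" and qe: "qf A e = 1" and g: "\<gamma> \<in> Gamma0 (level A)" and t: "Im t > 0"
  defines "j \<equiv> aut_factor \<gamma> t"
  shows "(\<Sum>\<^sub>\<infinity>l. eterm A (moebius_act \<gamma> t) w c e l u r) =
    chi A \<gamma> * j powr (of_nat CARD('n) / 2) * (of_real (norm j) / j) * (\<Sum>\<^sub>\<infinity>l. eterm A t w c e l (j * u) (j * r))"
proof -
  have det: "det \<gamma> = 1" and lev: "int (level A) dvd \<gamma> $ 2 $ 1" using g by (auto simp: Gamma0_def)
  obtain P R sg i0 \<sigma> where L: "lorentz_form A P R sg i0" and s: "\<sigma> = 1 \<or> \<sigma> = -1" and c: "c = (\<sigma> * sqrt 2) *\<^sub>R (P *v axis i0 1)"
    using lorentz_frame_exists[OF ev sig qc] by blast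
  interpret lorentz_form A P R sg i0 by (rule L)
  obtain M where M: "even_symmetric M" "A ** M = mat (\<gamma> $ 2 $ 1)"
    using level_dvd_matrix[OF ev _ lev] det_neg by auto
  define \<zeta> :: "complex \<Rightarrow> complex \<Rightarrow> 'n \<Rightarrow> complex" where "\<zeta> = (\<lambda>s r i. if i = i0 then 0 else s * complex_of_real ((transpose P *v w) $ i) + r * complex_of_real ((R *v e) $ i))"
  note im = Im_moebius[OF det t, folded j_def]
  have j: "j = of_int (\<gamma> $ 2 $ 1) * t + of_int (\<gamma> $ 2 $ 2)" by (simp add: j_def aut_factor_def)
  have tg: "Im (moebius_act \<gamma> t) > 0" unfolding im(2) using t im(1) by simp
  have S: "(\<Sum>\<^sub>\<infinity>l. eterm A t' w c e l u r) = exp (- ((\<Sum>i\<in>UNIV. (\<zeta> u r i)\<^sup>2) / (8 * pi * Im t'))) * Th t' (\<lambda>i. \<zeta> u r i / (2 * pi * \<i>))"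
    if "Im t' > 0" for t' u r
    unfolding eterm_gexp[OF c s ce qe that] Th_def \<zeta>_def by (rule infsum_cmult_right')
  define Z :: complex where "Z = (\<Sum>i\<in>UNIV. (\<zeta> u r i)\<^sup>2)"
  have zj: "\<zeta> (j * u) (j * r) i = j * \<zeta> u r i" for i by (simp add: \<zeta>_def algebra_simps)
  define \<beta> :: "'n \<Rightarrow> complex" where "\<beta> i = \<zeta> (j * u) (j * r) i / (2 * pi * \<i>)" for i
  have bj: "(\<lambda>i. \<beta> i / j) = (\<lambda>i. \<zeta> u r i / (2 * pi * \<i>))" using im(1) by (simp add: \<beta>_def zj)
  have b0: "\<beta> i0 = 0" by (simp add: \<beta>_def \<zeta>_def)
  have bs: "(\<Sum>i\<in>UNIV. (\<beta> i)\<^sup>2) = - (j\<^sup>2 * Z / (4 * pi\<^sup>2))"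
    unfolding \<beta>_def zj Z_def by (simp add: power_mult_distrib power_divide sum_distrib_left sum_divide_distrib sum_negf)
  have zs: "(\<Sum>i\<in>UNIV. (\<zeta> (j * u) (j * r) i)\<^sup>2) = j\<^sup>2 * Z" unfolding zj Z_def by (simp add: power_mult_distrib sum_distrib_left)
  have law: "Th (moebius_act \<gamma> t) (\<lambda>i. \<zeta> u r i / (2 * pi * \<i>)) =
    chi A \<gamma> * j powr (of_nat CARD('n) / 2) * (of_real (norm j) / j) * exp (pi * \<i> * of_int (\<gamma> $ 2 $ 1) * (\<Sum>i\<in>UNIV. (\<beta> i)\<^sup>2) / j) * Th t \<beta>"
    using Th_law[where \<beta>=\<beta>, OF M det t j b0] unfolding bj by (simp add: moebius_act_def j_def[symmetric])
  \<comment> \<open>The exponential factor of the theta law is the difference of the corrections at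
    the two points, because 1/Im(gamma t) = |j|^2/Im t and |j|^2 = j (j - 2 i c Im t), where c is
    the lower left entry.\<close>
  have ex: "- (Z / (8 * pi * Im (moebius_act \<gamma> t))) + pi * \<i> * of_int (\<gamma> $ 2 $ 1) * (- (j\<^sup>2 * Z / (4 * pi\<^sup>2))) / j = - (j\<^sup>2 * Z / (8 * pi * Im t))"
  proof -
    have y0: "complex_of_real (Im t) \<noteq> 0" using t by simp
    have cj: "cnj j = j - 2 * \<i> * of_int (\<gamma> $ 2 $ 1) * Im t" unfolding j by (simp add: complex_eq_iff)
    have n2: "complex_of_real ((norm j)\<^sup>2) = j * (j - 2 * \<i> * of_int (\<gamma> $ 2 $ 1) * Im t)" unfolding complex_norm_square cj ..
    have 1: "Z / (8 * pi * Im (moebius_act \<gamma> t)) = Z * (j * (j - 2 * \<i> * of_int (\<gamma> $ 2 $ 1) * Im t)) / (8 * pi * Im t)"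
      unfolding im(2) n2[symmetric] using im(1) by simp
    have 2: "pi * \<i> * of_int (\<gamma> $ 2 $ 1) * (- (j\<^sup>2 * Z / (4 * pi\<^sup>2))) / j = - (2 * \<i> * of_int (\<gamma> $ 2 $ 1) * Im t * j * Z) / (8 * pi * Im t)"
      using im(1) y0 by (simp add: field_simps power2_eq_square)
    show ?thesis unfolding 1 2 using y0 by (simp add: field_simps power2_eq_square)
  qed
  have "(\<Sum>\<^sub>\<infinity>l. eterm A (moebius_act \<gamma> t) w c e l u r) = chi A \<gamma> * j powr (of_nat CARD('n) / 2) * (of_real (norm j) / j) *
     (exp (- (Z / (8 * pi * Im (moebius_act \<gamma> t)))) * exp (pi * \<i> * of_int (\<gamma> $ 2 $ 1) * (- (j\<^sup>2 * Z / (4 * pi\<^sup>2))) / j) * Th t \<beta>)"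
    unfolding S[OF tg] law bs Z_def[symmetric] by (simp add: mult_ac)
  also have "exp (- (Z / (8 * pi * Im (moebius_act \<gamma> t)))) * exp (pi * \<i> * of_int (\<gamma> $ 2 $ 1) * (- (j\<^sup>2 * Z / (4 * pi\<^sup>2))) / j) * Th t \<beta> = (\<Sum>\<^sub>\<infinity>l. eterm A t w c e l (j * u) (j * r))"
    unfolding S[OF t] zs exp_add[symmetric] ex \<beta>_def by simp
  finally show ?thesis .
qed

section \<open>Homogeneous polynomials as sums of powers of linear forms\<close>

text \<open>The weights are the linear coefficients of the Lagrange polynomials at 0, ..., m:
  interpolating the values j^k returns x^k. They extract the linear coefficient of a polynomial from
  its values.\<close>

lemma vandermonde_dual:
  "\<exists>a :: nat \<Rightarrow> complex. \<forall>k\<le>m. (\<Sum>j\<le>m. a j * of_nat j ^ k) = (if k = 1 then 1 else 0)"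
proof -
  define L :: "nat \<Rightarrow> complex poly" where
    "L j = Polynomial.smult (1 / (\<Prod>i\<in>{..m}-{j}. of_nat j - of_nat i)) (\<Prod>i\<in>{..m}-{j}. [:- of_nat i, 1:])" for j
  have deg: "Polynomial.degree (L j) \<le> m" if "j \<le> m" for j
  proof -
    have "Polynomial.degree (\<Prod>i\<in>{..m}-{j}. [:- of_nat i, 1::complex:]) \<le> (\<Sum>i\<in>{..m}-{j}. Polynomial.degree [:- of_nat i, 1::complex:])"
      using degree_prod_sum_le[of "{..m}-{j}" "\<lambda>i. [:- of_nat i, 1::complex:]"] by (simp add: o_def)
    also have "\<dots> = m" using that by simp
    finally show ?thesis unfolding L_def using degree_smult_le le_trans by blast
  qed
  have L: "poly (L j) (of_nat i) = (if i = j then 1 else 0)" if "j \<le> m" "i \<le> m" for i j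
  proof (cases "i = j")
    case True
    then show ?thesis by (simp add: L_def poly_prod)
  next
    case False
    then have "(\<Prod>k\<in>{..m}-{j}. of_nat i - (of_nat k :: complex)) = 0" using that by (auto simp: prod_zero_iff)
    then show ?thesis using False by (simp add: L_def poly_prod)
  qed
  have "(\<Sum>j\<le>m. Polynomial.coeff (L j) 1 * of_nat j ^ k) = (if k = 1 then 1 else 0)" if k: "k \<le> m" for k
  proof -
    define p :: "complex poly" where "p = (\<Sum>j\<le>m. Polynomial.smult (of_nat j ^ k) (L j))"
    have "p = Polynomial.monom 1 k"
    proof (rule poly_eqI_degree[where A = "of_nat ` {..m}"])
      fix x :: complex assume "x \<in> of_nat ` {..m}"
      then obtain i where i: "x = of_nat i" "i \<le> m" by auto
      have "poly p x = (\<Sum>j\<le>m. if i = j then of_nat j ^ k else 0)"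
        unfolding p_def poly_sum by (rule sum.cong) (auto simp: i L)
      then show "poly p x = poly (Polynomial.monom 1 k) x" using i by (simp add: poly_monom)
    next
      have c: "card (of_nat ` {..m} :: complex set) = m + 1" by (subst card_image) (auto simp: inj_on_def)
      have "Polynomial.degree p \<le> m" unfolding p_def by (rule degree_sum_le) (use deg degree_smult_le le_trans in \<open>auto\<close>)
      then show "Polynomial.degree p < card (of_nat ` {..m} :: complex set)" using c by linarith
      show "Polynomial.degree (Polynomial.monom 1 k :: complex poly) < card (of_nat ` {..m} :: complex set)"
        unfolding c using k by (simp add: degree_monom_eq)
    qed
    then have "Polynomial.coeff p 1 = (if k = 1 then 1 else 0)" by simp
    then show ?thesis by (simp add: p_def coeff_sum mult.commute)
  qed
  then show ?thesis by (rule_tac x = "\<lambda>j. Polynomial.coeff (L j) 1" in exI) blast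
qed

definition power_form :: "nat \<Rightarrow> (real^'n \<Rightarrow> complex) \<Rightarrow> bool" where
  "power_form d f \<longleftrightarrow> (\<exists>xs :: (complex \<times> (real^'n)) list. f = (\<lambda>v. \<Sum>(a, w)\<leftarrow>xs. a * complex_of_real (w \<bullet> v) ^ d))"

lemma power_form_zero: "power_form d (\<lambda>v. 0)"
  unfolding power_form_def by (rule exI[of _ "[]"]) simp

lemma power_form_add:
  assumes "power_form d f" "power_form d g" shows "power_form d (\<lambda>v. f v + g v)"
proof -
  obtain xs ys where "f = (\<lambda>v. \<Sum>(a, w)\<leftarrow>xs. a * complex_of_real (w \<bullet> v) ^ d)" "g = (\<lambda>v. \<Sum>(a, w)\<leftarrow>ys. a * complex_of_real (w \<bullet> v) ^ d)"
    using assms unfolding power_form_def by blast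
  then show ?thesis unfolding power_form_def by (intro exI[of _ "xs @ ys"]) simp
qed

lemma power_form_sum:
  assumes "\<And>i. i \<in> I \<Longrightarrow> power_form d (f i)" shows "power_form d (\<lambda>v. \<Sum>i\<in>I. f i v)"
  using assms by (induction I rule: infinite_finite_induct) (auto simp: power_form_zero power_form_add)

lemma power_form_power: "power_form d (\<lambda>v. a * complex_of_real (w \<bullet> v) ^ d)"
  unfolding power_form_def by (rule exI[of _ "[(a, w)]"]) simp

lemma power_form_induct:
  assumes f: "power_form d f" and z: "P (\<lambda>v. 0)" and a: "\<And>g h. P g \<Longrightarrow> P h \<Longrightarrow> P (\<lambda>v. g v + h v)"
    and p: "\<And>a w. P (\<lambda>v. a * complex_of_real (w \<bullet> v) ^ d)"
  shows "P f"
proof -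
  have "P (\<lambda>v. \<Sum>(a, w)\<leftarrow>xs. a * complex_of_real (w \<bullet> v) ^ d)" for xs
  proof (induction xs)
    case (Cons x xs)
    then show ?case using a[OF p[of "fst x" "snd x"] Cons.IH] by (simp add: case_prod_beta)
  qed (use z in simp)
  then show ?thesis using f unfolding power_form_def by blast
qed

lemma power_form_scale:
  assumes "power_form d f" shows "power_form d (\<lambda>v. b * f v)"
  using assms
proof (rule power_form_induct)
  fix a w show "power_form d (\<lambda>v. b * (a * complex_of_real (w \<bullet> v) ^ d))"
    using power_form_power[of d "b * a" w] by (simp add: mult.assoc)
qed (auto simp: power_form_zero power_form_add distrib_left)

text \<open>Polarisation: (u.v) (w.v)^d is, up to the factor d + 1, the coefficient of x in ((w + x
  u).v)^(d+1), and the weights of \<open>vandermonde_dual\<close> extract it from x = 0, ..., d +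
  1.\<close>

lemma power_form_linear_mult:
  fixes u :: "real^'n"
  assumes "power_form d f" shows "power_form (Suc d) (\<lambda>v. complex_of_real (u \<bullet> v) * f v)"
  using assms
proof (rule power_form_induct)
  fix b :: complex and w :: "real^'n"
  obtain a :: "nat \<Rightarrow> complex" where a: "\<And>k. k \<le> Suc d \<Longrightarrow> (\<Sum>j\<le>Suc d. a j * of_nat j ^ k) = (if k = 1 then 1 else 0)"
    using vandermonde_dual[of "Suc d"] by blast
  have "(\<Sum>j\<le>Suc d. a j * complex_of_real ((w + of_nat j *\<^sub>R u) \<bullet> v) ^ Suc d) = of_nat (Suc d) * (complex_of_real (u \<bullet> v) * complex_of_real (w \<bullet> v) ^ d)" for v
  proof -
    define x y where "x = complex_of_real (w \<bullet> v)" and "y = complex_of_real (u \<bullet> v)"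
    have "(\<Sum>j\<le>Suc d. a j * complex_of_real ((w + of_nat j *\<^sub>R u) \<bullet> v) ^ Suc d) = (\<Sum>j\<le>Suc d. a j * (of_nat j * y + x) ^ Suc d)"
      by (simp add: x_def y_def inner_add_left add.commute)
    also have "\<dots> = (\<Sum>j\<le>Suc d. \<Sum>k\<le>Suc d. (a j * of_nat j ^ k) * (of_nat (Suc d choose k) * y ^ k * x ^ (Suc d - k)))"
      unfolding binomial_ring sum_distrib_left by (intro sum.cong refl) (simp add: power_mult_distrib mult_ac)
    also have "\<dots> = (\<Sum>k\<le>Suc d. (\<Sum>j\<le>Suc d. a j * of_nat j ^ k) * (of_nat (Suc d choose k) * y ^ k * x ^ (Suc d - k)))"
      unfolding sum_distrib_right by (rule sum.swap)
    also have "\<dots> = (\<Sum>k\<le>Suc d. if k = 1 then of_nat (Suc d choose k) * y ^ k * x ^ (Suc d - k) else 0)"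
      by (rule sum.cong) (auto simp only: a atMost_iff, auto)
    also have "\<dots> = of_nat (Suc d) * (y * x ^ d)" by simp
    finally show ?thesis by (simp only: x_def y_def)
  qed
  then have "(\<lambda>v. complex_of_real (u \<bullet> v) * (b * complex_of_real (w \<bullet> v) ^ d)) =
      (\<lambda>v. (b / of_nat (Suc d)) * (\<Sum>j\<le>Suc d. a j * complex_of_real ((w + of_nat j *\<^sub>R u) \<bullet> v) ^ Suc d))"
    by (simp add: mult.left_commute del: of_nat_Suc power_Suc sum.atMost_Suc)
  then show "power_form (Suc d) (\<lambda>v. complex_of_real (u \<bullet> v) * (b * complex_of_real (w \<bullet> v) ^ d))"
    by (simp only:) (intro power_form_scale power_form_sum power_form_power)
qed (auto simp: power_form_zero power_form_add distrib_left)

lemma power_form_monomial: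
  fixes \<alpha> :: "'n::finite \<Rightarrow> nat"
  assumes "finite S"
  shows "power_form (sum \<alpha> S) (\<lambda>v::real^'n. \<Prod>i\<in>S. complex_of_real (v $ i) ^ \<alpha> i)"
  using assms
proof (induction S rule: finite_induct)
  case empty
  show ?case using power_form_power[of 0 1 0] by simp
next
  case (insert x S)
  have "power_form (m + sum \<alpha> S) (\<lambda>v::real^'n. complex_of_real (v $ x) ^ m * (\<Prod>i\<in>S. complex_of_real (v $ i) ^ \<alpha> i))" for m
  proof (induction m)
    case (Suc m)
    then show ?case using power_form_linear_mult[OF Suc, of "axis x 1"] by (simp add: inner_axis' mult.assoc)
  qed (use insert.IH in simp)
  then show ?case using insert.hyps by simp
qed

theorem homogeneous_polynomial_power_form:
  assumes "homogeneous_polynomial d f" shows "power_form d f"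
proof -
  obtain a where a: "f = (\<lambda>v. \<Sum>\<alpha> | (\<Sum>i\<in>UNIV. \<alpha> i) = d. a \<alpha> * (\<Prod>i\<in>UNIV. complex_of_real (v $ i) ^ \<alpha> i))"
    using assms unfolding homogeneous_polynomial_def by (auto simp: fun_eq_iff)
  show ?thesis unfolding a
    by (intro power_form_sum power_form_scale) (use power_form_monomial[of UNIV] in auto)
qed

section \<open>Differential operators on ridge functions\<close>

text \<open>One-variable polynomials in linear forms. The class is stable under the operators of the
  theorem, which act on each summand as a scalar times a power of \<open>pderiv\<close>.\<close>

definition ridge :: "nat set \<Rightarrow> (nat \<Rightarrow> real^'n) \<Rightarrow> (nat \<Rightarrow> complex poly) \<Rightarrow> real^'n \<Rightarrow> complex" where
  "ridge I w q v = (\<Sum>i\<in>I. poly (q i) (complex_of_real (w i \<bullet> v)))"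

lemma pderiv_at_ridge: "pderiv_at k (ridge I w q) = ridge I w (\<lambda>i. Polynomial.smult (complex_of_real (w i $ k)) (pderiv (q i)))"
proof
  fix v
  have "((\<lambda>t. poly (q i) (complex_of_real (w i \<bullet> (v + t *\<^sub>R axis k 1)))) has_vector_derivative
      (complex_of_real (w i $ k) * poly (pderiv (q i)) (complex_of_real (w i \<bullet> v)))) (at 0)" for i
  proof -
    have "((\<lambda>t. complex_of_real (w i \<bullet> (v + t *\<^sub>R axis k 1))) has_vector_derivative complex_of_real (w i $ k)) (at 0)"
      unfolding inner_add_right inner_scaleR_right
      by (auto intro!: derivative_eq_intros simp: has_vector_derivative_def inner_axis scaleR_conv_of_real)
    from field_vector_diff_chain_at[OF this, of "poly (q i)" "poly (pderiv (q i)) (complex_of_real (w i \<bullet> v))"]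
    show ?thesis by (simp add: o_def poly_DERIV)
  qed
  then have "((\<lambda>t. ridge I w q (v + t *\<^sub>R axis k 1)) has_vector_derivative
      (\<Sum>i\<in>I. complex_of_real (w i $ k) * poly (pderiv (q i)) (complex_of_real (w i \<bullet> v)))) (at 0)"
    unfolding ridge_def by (rule has_vector_derivative_sum)
  then show "pderiv_at k (ridge I w q) v = ridge I w (\<lambda>i. Polynomial.smult (complex_of_real (w i $ k)) (pderiv (q i))) v"
    unfolding pderiv_at_def by (simp add: vector_derivative_at ridge_def)
qed

lemma dir_deriv_ridge: "dir_deriv c (ridge I w q) = ridge I w (\<lambda>i. Polynomial.smult (complex_of_real (w i \<bullet> c)) (pderiv (q i)))"
proof
  fix v
  have "dir_deriv c (ridge I w q) v = (\<Sum>i\<in>I. \<Sum>k\<in>UNIV. complex_of_real (c $ k) * (complex_of_real (w i $ k) * poly (pderiv (q i)) (complex_of_real (w i \<bullet> v))))"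
    unfolding dir_deriv_def pderiv_at_ridge ridge_def sum_distrib_left by (subst sum.swap) simp
  then show "dir_deriv c (ridge I w q) v = ridge I w (\<lambda>i. Polynomial.smult (complex_of_real (w i \<bullet> c)) (pderiv (q i))) v"
    by (simp add: ridge_def inner_vec_def sum_distrib_right sum_distrib_left mult_ac)
qed

lemma laplace_ridge:
  "laplace A (ridge I w q) = ridge I w (\<lambda>i. Polynomial.smult (complex_of_real (w i \<bullet> (matrix_inv (rmat A) *v w i))) (pderiv (pderiv (q i))))"
proof
  fix v
  have "laplace A (ridge I w q) v = (\<Sum>k\<in>UNIV. \<Sum>l\<in>UNIV. \<Sum>i\<in>I. complex_of_real (matrix_inv (rmat A) $ k $ l) * (complex_of_real (w i $ k) * (complex_of_real (w i $ l) * poly (pderiv (pderiv (q i))) (complex_of_real (w i \<bullet> v)))))"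
    unfolding laplace_def pderiv_at_ridge unfolding ridge_def sum_distrib_left by (simp add: pderiv_smult mult_ac)
  also have "\<dots> = (\<Sum>k\<in>UNIV. \<Sum>i\<in>I. \<Sum>l\<in>UNIV. complex_of_real (matrix_inv (rmat A) $ k $ l) * (complex_of_real (w i $ k) * (complex_of_real (w i $ l) * poly (pderiv (pderiv (q i))) (complex_of_real (w i \<bullet> v)))))"
    by (intro sum.cong refl sum.swap)
  also have "\<dots> = (\<Sum>i\<in>I. \<Sum>k\<in>UNIV. \<Sum>l\<in>UNIV. complex_of_real (matrix_inv (rmat A) $ k $ l) * (complex_of_real (w i $ k) * (complex_of_real (w i $ l) * poly (pderiv (pderiv (q i))) (complex_of_real (w i \<bullet> v)))))"
    by (rule sum.swap)
  finally show "laplace A (ridge I w q) v = ridge I w (\<lambda>i. Polynomial.smult (complex_of_real (w i \<bullet> (matrix_inv (rmat A) *v w i))) (pderiv (pderiv (q i)))) v"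
    by (simp add: ridge_def inner_vec_def matrix_vector_mult_def sum_distrib_right sum_distrib_left mult_ac)
qed

lemma dir_deriv_funpow_ridge:
  "(dir_deriv c ^^ k) (ridge I w q) = ridge I w (\<lambda>i. Polynomial.smult (complex_of_real (w i \<bullet> c) ^ k) ((pderiv ^^ k) (q i)))"
proof (induction k)
  case (Suc k)
  show ?case by (simp add: Suc.IH dir_deriv_ridge pderiv_smult)
qed simp

lemma laplace_funpow_ridge:
  "(laplace A ^^ k) (ridge I w q) = ridge I w (\<lambda>i. Polynomial.smult (complex_of_real (w i \<bullet> (matrix_inv (rmat A) *v w i)) ^ k) ((pderiv ^^ (2 * k)) (q i)))"
proof (induction k)
  case (Suc k)
  show ?case by (simp add: Suc.IH laplace_ridge pderiv_smult)
qed simp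

text \<open>The k-th power of the Laplacian differentiates the monomial 2 k times, so the terms with
  k > d vanish and the series is a finite sum.\<close>

lemma heat_ridge_monom:
  assumes "finite I"
  shows "heat A (ridge I w (\<lambda>i. Polynomial.monom (a i) d)) = ridge I w (\<lambda>i. \<Sum>k\<le>d.
    Polynomial.smult (complex_of_real ((- (w i \<bullet> (matrix_inv (rmat A) *v w i)) / (8 * pi)) ^ k / fact k)) ((pderiv ^^ (2 * k)) (Polynomial.monom (a i) d)))"
proof
  fix v
  let ?W = "\<lambda>i. w i \<bullet> (matrix_inv (rmat A) *v w i)"
  have co: "complex_of_real ((- W / (8 * pi)) ^ k / fact k) = complex_of_real ((-1) ^ k / ((8 * pi) ^ k * fact k)) * complex_of_real W ^ k" for W :: real and k
    by (simp add: power_divide power_mult_distrib power_minus[of "complex_of_real W / (8 * complex_of_real pi)"])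
  have z: "(laplace A ^^ k) (ridge I w (\<lambda>i. Polynomial.monom (a i) d)) v = 0" if "k \<notin> {..d}" for k
  proof -
    have "(pderiv ^^ (2 * k)) (Polynomial.monom (a i) d) = 0" for i using that by (intro higher_pderiv_monom_eq_zero) auto
    then show ?thesis unfolding laplace_funpow_ridge ridge_def by simp
  qed
  have "heat A (ridge I w (\<lambda>i. Polynomial.monom (a i) d)) v = (\<Sum>k\<le>d. complex_of_real ((-1) ^ k / ((8 * pi) ^ k * fact k)) * (laplace A ^^ k) (ridge I w (\<lambda>i. Polynomial.monom (a i) d)) v)"
    unfolding heat_def by (rule suminf_finite) (auto simp: z)
  also have "\<dots> = (\<Sum>i\<in>I. \<Sum>k\<le>d. complex_of_real ((-1) ^ k / ((8 * pi) ^ k * fact k)) * (complex_of_real (?W i) ^ k * poly ((pderiv ^^ (2 * k)) (Polynomial.monom (a i) d)) (complex_of_real (w i \<bullet> v))))"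
    unfolding laplace_funpow_ridge ridge_def sum_distrib_left by (subst sum.swap) simp
  also have "\<dots> = ridge I w (\<lambda>i. \<Sum>k\<le>d. Polynomial.smult (complex_of_real ((- ?W i / (8 * pi)) ^ k / fact k)) ((pderiv ^^ (2 * k)) (Polynomial.monom (a i) d))) v"
    unfolding ridge_def poly_sum
    by (intro sum.cong refl) (simp only: co poly_smult mult.assoc)
  finally show "heat A (ridge I w (\<lambda>i. Polynomial.monom (a i) d)) v = ridge I w (\<lambda>i. \<Sum>k\<le>d.
    Polynomial.smult (complex_of_real ((- ?W i / (8 * pi)) ^ k / fact k)) ((pderiv ^^ (2 * k)) (Polynomial.monom (a i) d))) v" .
qed

section \<open>The generating function of the polynomial factor\<close>

text \<open>Along the real axis the complex derivative is the vector derivative of a real function: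
  its imaginary part is 0 and its real part the real derivative. This lets an entire extension stand
  in for \<open>err\<close>.\<close>

lemma higher_deriv_of_real:
  assumes F: "F holomorphic_on UNIV" and g: "\<And>x. F (complex_of_real x) = complex_of_real (g x)"
  shows "(deriv ^^ k) F (complex_of_real x) = complex_of_real ((deriv ^^ k) g x)"
proof (induction k arbitrary: x)
  case (Suc k)
  let ?F = "(deriv ^^ k) F" and ?g = "(deriv ^^ k) g"
  define D where "D = deriv ?F (complex_of_real x)"
  have "?F holomorphic_on UNIV" using F by (rule holomorphic_higher_deriv) simp
  then have "(?F has_field_derivative D) (at (complex_of_real x))"
    unfolding D_def by (meson UNIV_I holomorphic_derivI open_UNIV)
  then have "((\<lambda>x. ?F (complex_of_real x)) has_vector_derivative D) (at x)"
    by (rule has_vector_derivative_real_field)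
  then have d: "((\<lambda>x. complex_of_real (?g x)) has_vector_derivative D) (at x)" by (simp only: Suc.IH)
  have "((\<lambda>x. Im (complex_of_real (?g x))) has_vector_derivative Im D) (at x)"
    using d by (rule bounded_linear.has_vector_derivative[OF bounded_linear_Im])
  then have "((\<lambda>x. 0) has_vector_derivative Im D) (at x)" by simp
  then have "Im D = 0" by (rule vector_derivative_unique_at) (rule has_vector_derivative_const)
  have "((\<lambda>x. Re (complex_of_real (?g x))) has_vector_derivative Re D) (at x)"
    using d by (rule bounded_linear.has_vector_derivative[OF bounded_linear_Re])
  then have "(?g has_real_derivative Re D) (at x)" by (simp add: has_real_derivative_iff_has_vector_derivative)
  then have "deriv ?g x = Re D" by (rule DERIV_imp_deriv)
  then show ?case using \<open>Im D = 0\<close> by (simp add: D_def[symmetric] complex_eq_iff)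
qed (use g in simp)

lemma err_entire:
  "\<exists>E. (\<forall>z. (E has_field_derivative 2 * exp (- complex_of_real pi * z\<^sup>2)) (at z)) \<and> (\<forall>x. E (complex_of_real x) = complex_of_real (err x))"
proof -
  have "(\<lambda>z. 2 * exp (- complex_of_real pi * z\<^sup>2)) holomorphic_on UNIV" by (intro holomorphic_intros)
  then obtain G where G: "\<And>z. (G has_field_derivative 2 * exp (- complex_of_real pi * z\<^sup>2)) (at z)"
    using holomorphic_convex_primitive'[of UNIV "\<lambda>z. 2 * exp (- complex_of_real pi * z\<^sup>2)"] by auto
  define E where "E z = G z - G 0" for z
  have E: "(E has_field_derivative 2 * exp (- complex_of_real pi * z\<^sup>2)) (at z)" for z
    unfolding E_def by (auto intro!: derivative_eq_intros G)
  have "E (complex_of_real x) = complex_of_real (err x)" for x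
  proof -
    have "(LBINT u=ereal 0..ereal x. complex_of_real (2 * exp (- pi * u\<^sup>2))) = E (complex_of_real x) - E (complex_of_real 0)"
    proof (rule interval_integral_FTC_finite)
      show "continuous_on {min 0 x..max 0 x} (\<lambda>u. complex_of_real (2 * exp (- pi * u\<^sup>2)))" by (intro continuous_intros)
      fix u
      show "((\<lambda>u. E (complex_of_real u)) has_vector_derivative complex_of_real (2 * exp (- pi * u\<^sup>2))) (at u within {min 0 x..max 0 x})"
        using has_vector_derivative_real_field[OF E[of "complex_of_real u"]]
        unfolding of_real_mult of_real_numeral exp_of_real[symmetric]
        by (rule_tac has_vector_derivative_at_within) simp
    qed
    then have "complex_of_real (LBINT u=ereal 0..ereal x. 2 * exp (- pi * u\<^sup>2)) = E (complex_of_real x)"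
      unfolding interval_lebesgue_integral_of_real by (simp add: E_def)
    then show ?thesis by (simp add: err_def zero_ereal_def)
  qed
  then show ?thesis using E by blast
qed

text \<open>The entire extension of the error function; it is needed because the argument is shifted
  by the complex variable s.\<close>

definition cerr :: "complex \<Rightarrow> complex" where
  "cerr = (SOME E. (\<forall>z. (E has_field_derivative 2 * exp (- complex_of_real pi * z\<^sup>2)) (at z)) \<and> (\<forall>x. E (complex_of_real x) = complex_of_real (err x)))"

lemma DERIV_cerr: "(cerr has_field_derivative 2 * exp (- complex_of_real pi * z\<^sup>2)) (at z)"
  and cerr_of_real: "cerr (complex_of_real x) = complex_of_real (err x)"
  using someI_ex[OF err_entire] unfolding cerr_def by blast+

lemma holomorphic_cerr: "cerr holomorphic_on S"
  using DERIV_cerr by (meson field_differentiable_at_within field_differentiable_def holomorphic_on_def)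

lemma holomorphic_cerr_compose [holomorphic_intros]:
  "f holomorphic_on S \<Longrightarrow> (\<lambda>s. cerr (f s)) holomorphic_on S"
  using holomorphic_on_compose[OF _ holomorphic_cerr] by (simp add: o_def)

text \<open>The equation E' = -2 b s E gives a two-step recursion for the Taylor
  coefficients.\<close>

lemma higher_deriv_exp_quadratic:
  "(deriv ^^ j) (\<lambda>s::complex. exp (- (b * s\<^sup>2))) 0 / fact j = (if even j then (- b) ^ (j div 2) / fact (j div 2) else 0)"
proof -
  let ?E = "\<lambda>s::complex. exp (- (b * s\<^sup>2))"
  have hE: "?E holomorphic_on UNIV" by (intro holomorphic_intros)
  have dE: "deriv ?E = (\<lambda>s. (- 2 * b) * (s * ?E s))"
    by (rule ext, rule DERIV_imp_deriv) (auto intro!: derivative_eq_intros)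
  have rec: "(deriv ^^ Suc (Suc j)) ?E 0 = - 2 * b * of_nat (Suc j) * (deriv ^^ j) ?E 0" for j
  proof -
    have "(deriv ^^ Suc (Suc j)) ?E 0 = (deriv ^^ Suc j) (\<lambda>s. (- 2 * b) * (s * ?E s)) 0"
      unfolding funpow_Suc_right[of "Suc j"] comp_apply dE ..
    also have "\<dots> = (- 2 * b) * (deriv ^^ Suc j) (\<lambda>s. s * ?E s) 0"
      by (rule higher_deriv_cmult[where A = UNIV]) (auto intro!: holomorphic_intros)
    also have "(deriv ^^ Suc j) (\<lambda>s. s * ?E s) 0 = (\<Sum>i = 0..Suc j. of_nat (Suc j choose i) * (deriv ^^ i) (\<lambda>s. s) 0 * (deriv ^^ (Suc j - i)) ?E 0)"
      by (rule higher_deriv_mult[where S = UNIV]) (use hE in auto)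
    also have "\<dots> = (\<Sum>i\<in>{1}. of_nat (Suc j choose i) * (deriv ^^ i) (\<lambda>s. s) 0 * (deriv ^^ (Suc j - i)) ?E 0)"
      by (rule sum.mono_neutral_right) (auto simp del: funpow.simps)
    also have "\<dots> = of_nat (Suc j) * (deriv ^^ j) ?E 0" by simp
    finally show ?thesis by (simp add: mult_ac del: funpow.simps)
  qed
  show ?thesis
  proof (induction j rule: induct_nat_012)
    case 1
    show ?case using fun_cong[OF dE, of 0] by simp
  next
    case (ge2 n)
    have "(deriv ^^ Suc (Suc n)) ?E 0 / fact (Suc (Suc n)) = (- 2 * b) / of_nat (Suc (Suc n)) * ((deriv ^^ n) ?E 0 / fact n)"
      unfolding rec by (simp add: fact_Suc field_simps del: funpow.simps of_nat_Suc)
    also have "\<dots> = (if even n then - b * (- b) ^ (n div 2) / (of_nat (Suc (n div 2)) * fact (n div 2)) else 0)"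
    proof (cases "even n")
      case True
      then obtain m where "n = 2 * m" by auto
      moreover have "complex_of_nat (Suc (Suc (2 * m))) = 2 * of_nat (Suc m)" by simp
      ultimately show ?thesis unfolding ge2.IH(1) by (simp add: field_simps del: of_nat_Suc)
    qed (simp add: ge2.IH(1))
    also have "\<dots> = (if even (Suc (Suc n)) then (- b) ^ (Suc (Suc n) div 2) / fact (Suc (Suc n) div 2) else 0)" by simp
    finally show ?case .
  qed simp
qed

lemma higher_pderiv_monom_one:
  "(pderiv ^^ k) (Polynomial.monom (1::complex) d) = (if k \<le> d then Polynomial.monom (fact d / fact (d - k)) (d - k) else 0)"
proof (induction k)
  case (Suc k)
  show ?case
  proof (cases "Suc k \<le> d")
    case True
    then obtain m where m: "d - k = Suc m" "d - Suc k = m" by (metis Suc_diff_Suc less_eq_Suc_le)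
    show ?thesis using True by (simp add: Suc.IH pderiv_monom m fact_Suc del: of_nat_Suc)
  next
    case False
    then show ?thesis using Suc.IH by (cases "k = d") (auto simp: pderiv_monom)
  qed
qed simp

text \<open>Leibniz' rule, in which x^(d-k) d!/(d-k)! is recognised as the k-th derivative of x^d:
  orders in s become differentiations of the polynomial.\<close>

lemma higher_deriv_mult_exp:
  fixes x :: complex
  assumes F: "F holomorphic_on UNIV"
  shows "(deriv ^^ d) (\<lambda>s. F s * exp (x * s)) 0 = (\<Sum>k\<le>d. (deriv ^^ k) F 0 / fact k * poly ((pderiv ^^ k) (Polynomial.monom 1 d)) x)"
proof -
  have dexp: "(deriv ^^ m) exp = (exp :: complex \<Rightarrow> complex)" for m
  proof (induction m)
    case (Suc m)
    show ?case unfolding funpow.simps comp_apply Suc.IH by (rule ext, rule DERIV_imp_deriv) (rule DERIV_exp)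
  qed simp
  have e: "(deriv ^^ m) (\<lambda>s. exp (x * s)) 0 = x ^ m" for m
    using higher_deriv_compose_linear[of exp UNIV UNIV 0 x m] by (simp add: dexp holomorphic_on_exp)
  have "(deriv ^^ d) (\<lambda>s. F s * exp (x * s)) 0 = (\<Sum>k = 0..d. of_nat (d choose k) * (deriv ^^ k) F 0 * (deriv ^^ (d - k)) (\<lambda>s. exp (x * s)) 0)"
    by (rule higher_deriv_mult[where S = UNIV]) (use F in \<open>auto intro!: holomorphic_intros\<close>)
  also have "\<dots> = (\<Sum>k\<le>d. (deriv ^^ k) F 0 / fact k * poly ((pderiv ^^ k) (Polynomial.monom 1 d)) x)"
    by (rule sum.cong) (auto simp: e higher_pderiv_monom_one poly_monom binomial_fact)
  finally show ?thesis .
qed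

text \<open>Order k taken from the error function and order 2 j taken from the Gaussian
  differentiate x^d altogether k + 2 j times, which is the effect of the k-th directional derivative
  on the j-th term of the heat operator.\<close>

lemma generating_function_coefficient:
  fixes z \<kappa> W :: real and x :: complex
  shows "(deriv ^^ d) (\<lambda>s. cerr (complex_of_real z - s * complex_of_real (\<kappa> / (4 * pi))) * exp (x * s - s\<^sup>2 * complex_of_real (W / (8 * pi)))) 0 =
    (\<Sum>k\<le>d. complex_of_real ((-1) ^ k / ((4 * pi) ^ k * fact k) * (deriv ^^ k) err z) *
      (complex_of_real \<kappa> ^ k * (\<Sum>j\<le>d. complex_of_real ((- W / (8 * pi)) ^ j / fact j) * poly ((pderiv ^^ (k + 2 * j)) (Polynomial.monom 1 d)) x)))"
proof -
  define b where "b = complex_of_real (W / (8 * pi))"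
  define F where "F s = cerr (complex_of_real z - s * complex_of_real (\<kappa> / (4 * pi)))" for s
  define E where "E s = exp (- (b * s\<^sup>2))" for s
  define P where "P m = poly ((pderiv ^^ m) (Polynomial.monom 1 d)) x" for m
  define u where "u k = (deriv ^^ k) F 0 / fact k" for k
  define e where "e k = (deriv ^^ k) E 0 / fact k" for k
  have hF: "F holomorphic_on UNIV" and hE: "E holomorphic_on UNIV" unfolding F_def E_def by (intro holomorphic_intros)+
  have P0: "P m = 0" if "m > d" for m using that by (simp add: P_def higher_pderiv_monom_one)
  have u: "u k = complex_of_real ((-1) ^ k / ((4 * pi) ^ k * fact k) * (deriv ^^ k) err z) * complex_of_real \<kappa> ^ k" for k
  proof -
    have "(deriv ^^ k) F 0 = (- complex_of_real (\<kappa> / (4 * pi))) ^ k * (deriv ^^ k) cerr (complex_of_real z)"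
      using higher_deriv_compose_linear'[of cerr UNIV UNIV 0 "- complex_of_real (\<kappa> / (4 * pi))" "complex_of_real z" k]
      by (simp add: F_def[abs_def] holomorphic_cerr mult.commute)
    also have "(deriv ^^ k) cerr (complex_of_real z) = complex_of_real ((deriv ^^ k) err z)"
      by (rule higher_deriv_of_real[OF holomorphic_cerr cerr_of_real])
    finally show ?thesis
      by (simp add: u_def power_minus[of "complex_of_real (\<kappa> / (4 * pi))"] power_divide power_mult_distrib power_minus[of "complex_of_real \<kappa> / (4 * complex_of_real pi)"])
  qed
  have e: "e j = (if even j then (- b) ^ (j div 2) / fact (j div 2) else 0)" for j
    unfolding e_def E_def[abs_def] by (rule higher_deriv_exp_quadratic)
  have ue: "(deriv ^^ m) (\<lambda>s. F s * E s) 0 / fact m = (\<Sum>i\<le>m. u i * e (m - i))" for m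
  proof -
    have "(deriv ^^ m) (\<lambda>s. F s * E s) 0 = (\<Sum>i = 0..m. of_nat (m choose i) * (deriv ^^ i) F 0 * (deriv ^^ (m - i)) E 0)"
      by (rule higher_deriv_mult[where S = UNIV]) (use hF hE in auto)
    then show ?thesis unfolding sum_divide_distrib
      by (simp add: u_def e_def binomial_fact sum_divide_distrib atMost_atLeast0 mult_ac)
  qed
  have ev: "(\<Sum>j\<le>2 * d. e j * P (k + j)) = (\<Sum>j\<le>d. complex_of_real ((- W / (8 * pi)) ^ j / fact j) * P (k + 2 * j))" for k
  proof -
    have "(\<Sum>j\<le>2 * d. e j * P (k + j)) = (\<Sum>j\<in>(\<lambda>j. 2 * j) ` {..d}. e j * P (k + j))"
      by (rule sum.mono_neutral_right) (auto simp: e image_iff elim!: evenE)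
    also have "\<dots> = (\<Sum>j\<le>d. e (2 * j) * P (k + 2 * j))" by (subst sum.reindex) (auto simp: inj_on_def)
    finally show ?thesis by (simp add: e b_def)
  qed
  have fe: "(\<lambda>s. cerr (complex_of_real z - s * complex_of_real (\<kappa> / (4 * pi))) * exp (x * s - s\<^sup>2 * complex_of_real (W / (8 * pi)))) = (\<lambda>s. (F s * E s) * exp (x * s))"
    unfolding F_def E_def mult.assoc exp_add[symmetric] b_def by (simp add: algebra_simps)
  have "(deriv ^^ d) (\<lambda>s. (F s * E s) * exp (x * s)) 0 = (\<Sum>m\<le>d. (\<Sum>i\<le>m. u i * e (m - i)) * P m)"
    by (subst higher_deriv_mult_exp) (use hF hE in \<open>auto simp: P_def ue intro!: holomorphic_intros\<close>)
  also have "\<dots> = (\<Sum>m\<le>d. \<Sum>i\<le>m. u i * e (m - i) * P (i + (m - i)))" by (simp add: sum_distrib_right)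
  also have "\<dots> = (\<Sum>(i, j)\<in>{(i, j). i + j \<le> d}. u i * e j * P (i + j))" by (rule sum.triangle_reindex_eq[symmetric])
  \<comment> \<open>The triangle i + j <= d is enlarged to a rectangle, as P vanishes beyond d; the
    bound 2 d makes the even indices exactly the 2 j with j <= d.\<close>
  also have "\<dots> = (\<Sum>(i, j)\<in>{..d} \<times> {..2 * d}. u i * e j * P (i + j))"
    by (rule sum.mono_neutral_left) (auto, meson P0 not_le)
  also have "\<dots> = (\<Sum>i\<le>d. u i * (\<Sum>j\<le>2 * d. e j * P (i + j)))"
    by (simp add: sum.cartesian_product[symmetric] sum_distrib_left mult.assoc)
  finally show ?thesis unfolding fe ev u unfolding P_def by (simp only: mult.assoc)
qed

theorem p_fun_generating:
  assumes I: "finite (I :: nat set)"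
  shows "p_fun A d c (\<lambda>v. \<Sum>i\<in>I. a i * complex_of_real (w i \<bullet> v) ^ d) v = (\<Sum>i\<in>I. a i *
    (deriv ^^ d) (\<lambda>s. cerr (complex_of_real (bil A c v) - s * complex_of_real ((w i \<bullet> c) / (4 * pi))) *
       exp (complex_of_real (w i \<bullet> v) * s - s\<^sup>2 * complex_of_real (inv_form A (w i) / (8 * pi)))) 0)"
proof -
  have f: "(\<lambda>v. \<Sum>i\<in>I. a i * complex_of_real (w i \<bullet> v) ^ d) = ridge I w (\<lambda>i. Polynomial.monom (a i) d)"
    by (simp add: ridge_def poly_monom fun_eq_iff)
  have m: "Polynomial.monom (a i) d = Polynomial.smult (a i) (Polynomial.monom 1 d)" for i by (simp add: smult_monom)
  have "(dir_deriv c ^^ k) (heat A (\<lambda>v. \<Sum>i\<in>I. a i * complex_of_real (w i \<bullet> v) ^ d)) v = (\<Sum>i\<in>I. a i *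
      (complex_of_real (w i \<bullet> c) ^ k * (\<Sum>j\<le>d. complex_of_real ((- inv_form A (w i) / (8 * pi)) ^ j / fact j) * poly ((pderiv ^^ (k + 2 * j)) (Polynomial.monom 1 d)) (complex_of_real (w i \<bullet> v)))))" for k
    unfolding f heat_ridge_monom[OF I] dir_deriv_funpow_ridge unfolding ridge_def inv_form_def m
    by (simp add: higher_pderiv_sum higher_pderiv_smult poly_sum funpow_add sum_distrib_left mult_ac)
  then show ?thesis
    unfolding p_fun_def generating_function_coefficient atMost_atLeast0
    by (simp add: sum_distrib_left mult_ac sum.swap[of _ I])
qed

section \<open>Termwise operations on series and integrals\<close>

lemma higher_deriv_sum_open:
  fixes f :: "'b \<Rightarrow> complex \<Rightarrow> complex"
  assumes "\<And>l. f l holomorphic_on S" "open S" "z \<in> S"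
  shows "(deriv ^^ m) (\<lambda>s. \<Sum>l\<in>F. f l s) z = (\<Sum>l\<in>F. (deriv ^^ m) (f l) z)"
proof (induction F rule: infinite_finite_induct)
  case (insert x F)
  have "(deriv ^^ m) (\<lambda>s. f x s + (\<Sum>l\<in>F. f l s)) z = (deriv ^^ m) (f x) z + (deriv ^^ m) (\<lambda>s. \<Sum>l\<in>F. f l s) z"
    by (rule higher_deriv_add[where S = S]) (use assms in \<open>auto intro!: holomorphic_intros\<close>)
  then show ?case using insert by simp
qed (simp_all add: higher_deriv_const)

text \<open>Uniform convergence of holomorphic functions passes to all derivatives, so a bound for
  the terms themselves suffices.\<close>

lemma higher_deriv_has_sum:
  fixes f :: "'b \<Rightarrow> complex \<Rightarrow> complex"
  assumes f: "\<And>l. f l holomorphic_on S" and S: "open S" "z \<in> S"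
    and M: "M summable_on UNIV" "\<And>l s. s \<in> S \<Longrightarrow> norm (f l s) \<le> M l"
  shows "((\<lambda>l. (deriv ^^ m) (f l) z) has_sum (deriv ^^ m) (\<lambda>s. \<Sum>\<^sub>\<infinity>l. f l s) z) UNIV"
proof -
  have "uniform_limit S (\<lambda>F s. \<Sum>l\<in>F. f l s) (\<lambda>s. \<Sum>\<^sub>\<infinity>l. f l s) (finite_subsets_at_top UNIV)"
    by (rule Weierstrass_m_test_general[OF _ M(1)]) (use M(2) in auto)
  then have "((\<lambda>F. (deriv ^^ m) (\<lambda>s. \<Sum>l\<in>F. f l s) z) \<longlongrightarrow> (deriv ^^ m) (\<lambda>s. \<Sum>\<^sub>\<infinity>l. f l s) z) (finite_subsets_at_top UNIV)"
    by (rule higher_deriv_complex_uniform_limit) (use f S in \<open>auto intro!: holomorphic_intros always_eventually\<close>)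
  moreover have "(deriv ^^ m) (\<lambda>s. \<Sum>l\<in>F. f l s) z = (\<Sum>l\<in>F. (deriv ^^ m) (f l) z)" for F
    by (rule higher_deriv_sum_open) (use f S in auto)
  ultimately show ?thesis unfolding has_sum_def by simp
qed

lemma infsum_integral_interchange:
  fixes f :: "'b \<Rightarrow> real \<Rightarrow> complex"
  assumes c: "\<And>l. continuous_on {a..b} (f l)"
    and M: "M summable_on UNIV" "\<And>l t. t \<in> {a..b} \<Longrightarrow> norm (f l t) \<le> M l"
    and i: "\<And>l. (f l has_integral i l) {a..b}"
  shows "(\<Sum>\<^sub>\<infinity>l. i l) = integral {a..b} (\<lambda>t. \<Sum>\<^sub>\<infinity>l. f l t)"
proof -
  have "uniform_limit (cbox a b) (\<lambda>F t. \<Sum>l\<in>F. f l t) (\<lambda>t. \<Sum>\<^sub>\<infinity>l. f l t) (finite_subsets_at_top UNIV)"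
    by (rule Weierstrass_m_test_general[OF _ M(1)]) (use M(2) in auto)
  moreover have "continuous_on (cbox a b) (\<lambda>t. \<Sum>l\<in>F. f l t)" for F using c by (auto intro!: continuous_intros)
  ultimately obtain I J where I: "\<And>F. ((\<lambda>t. \<Sum>l\<in>F. f l t) has_integral I F) (cbox a b)"
    and J: "((\<lambda>t. \<Sum>\<^sub>\<infinity>l. f l t) has_integral J) (cbox a b)" and lim: "(I \<longlongrightarrow> J) (finite_subsets_at_top UNIV)"
    using uniform_limit_integral_cbox by (metis finite_subsets_at_top_neq_bot)
  have "\<forall>\<^sub>F F in finite_subsets_at_top UNIV. I F = (\<Sum>l\<in>F. i l)"
  proof (rule eventually_finite_subsets_at_top_weakI)
    fix F :: "'b set" assume "finite F"
    then have "((\<lambda>t. \<Sum>l\<in>F. f l t) has_integral (\<Sum>l\<in>F. i l)) (cbox a b)" using i by (intro has_integral_sum) auto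
    then show "I F = (\<Sum>l\<in>F. i l)" using I has_integral_unique by blast
  qed
  then have "((\<lambda>F. \<Sum>l\<in>F. i l) \<longlongrightarrow> J) (finite_subsets_at_top UNIV)" using lim by (rule_tac Lim_transform_eventually)
  then have "(\<Sum>\<^sub>\<infinity>l. i l) = J" unfolding has_sum_def[symmetric] by (rule infsumI)
  then show ?thesis using J by (simp add: integral_unique)
qed

section \<open>Interpolation along a geodesic\<close>

text \<open>The derivative of \<open>eterm\<close> in r at r = 0.\<close>

definition dterm :: "int^'n^'n \<Rightarrow> complex \<Rightarrow> real^'n \<Rightarrow> real^'n \<Rightarrow> real^'n \<Rightarrow> int^'n \<Rightarrow> complex \<Rightarrow> complex" where
  "dterm A t w c e l s = (complex_of_real (bil A e (rvec l)) - s * complex_of_real ((w \<bullet> e) / (4 * pi * Im t))) * eterm A t w c e l s 0"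

text \<open>The generating function of one theta term for c, with s rescaled by 1/sqrt(Im t), so
  that the d-th derivative at 0 includes the factor (Im t)^(-d/2).\<close>

definition gterm :: "int^'n^'n \<Rightarrow> complex \<Rightarrow> real^'n \<Rightarrow> real^'n \<Rightarrow> int^'n \<Rightarrow> complex \<Rightarrow> complex" where
  "gterm A t w c l s = cerr (complex_of_real (sqrt (Im t) * bil A c (rvec l)) - s * complex_of_real ((w \<bullet> c) / (4 * pi * sqrt (Im t)))) *
     exp (complex_of_real (w \<bullet> rvec l) * s - s\<^sup>2 * complex_of_real (inv_form A w / (8 * pi * Im t))) *
     exp (2 * complex_of_real pi * \<i> * t * complex_of_real (qf A (rvec l)))"

lemma holomorphic_eterm [holomorphic_intros]:
  assumes "f holomorphic_on S" "g holomorphic_on S"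
  shows "(\<lambda>r. eterm A t w c e l (f r) (g r)) holomorphic_on S"
  unfolding eterm_def divide_inverse by (intro holomorphic_intros assms)

lemma holomorphic_gterm [holomorphic_intros]:
  assumes "f holomorphic_on S"
  shows "(\<lambda>s. gterm A t w c l (f s)) holomorphic_on S"
  unfolding gterm_def by (intro holomorphic_intros assms)

lemma DERIV_eterm:
  assumes "Im t > 0"
  shows "((\<lambda>r. eterm A t w c e l s r) has_field_derivative dterm A t w c e l s) (at 0)"
proof -
  have z: "complex_of_real (8 * pi * Im t) \<noteq> 0" using assms by simp
  show ?thesis unfolding eterm_def dterm_def
    by (rule derivative_eq_intros refl z | simp add: power2_eq_square)+
qed

lemma gterm_higher_deriv:
  assumes t: "Im t > 0"
  shows "complex_of_real (Im t powr (- (real d / 2))) * ((deriv ^^ d) (\<lambda>s. cerr (complex_of_real (bil A c (sqrt (Im t) *\<^sub>R rvec l)) - s * complex_of_real ((w \<bullet> c) / (4 * pi))) *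
       exp (complex_of_real (w \<bullet> (sqrt (Im t) *\<^sub>R rvec l)) * s - s\<^sup>2 * complex_of_real (inv_form A w / (8 * pi)))) 0 *
       exp (2 * complex_of_real pi * \<i> * t * complex_of_real (qf A (rvec l)))) = (deriv ^^ d) (gterm A t w c l) 0"
proof -
  define y where "y = sqrt (Im t)"
  have y: "y > 0" "Im t = y\<^sup>2" using t by (auto simp: y_def)
  define F where "F s = cerr (complex_of_real (bil A c (y *\<^sub>R rvec l)) - s * complex_of_real ((w \<bullet> c) / (4 * pi))) *
       exp (complex_of_real (w \<bullet> (y *\<^sub>R rvec l)) * s - s\<^sup>2 * complex_of_real (inv_form A w / (8 * pi)))" for s
  define q where "q = exp (2 * complex_of_real pi * \<i> * t * complex_of_real (qf A (rvec l)))"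
  have hF: "F holomorphic_on UNIV" unfolding F_def by (intro holomorphic_intros)
  have "gterm A t w c l = (\<lambda>s. q * F (complex_of_real (1 / y) * s))"
  proof
    fix s
    have 1: "complex_of_real (1 / y) * s * complex_of_real ((w \<bullet> c) / (4 * pi)) = s * complex_of_real ((w \<bullet> c) / (4 * pi * y))"
      by simp
    have 2: "complex_of_real (y * (w \<bullet> rvec l)) * (complex_of_real (1 / y) * s) = complex_of_real (w \<bullet> rvec l) * s"
      using y by simp
    have 3: "(complex_of_real (1 / y) * s)\<^sup>2 * complex_of_real (inv_form A w / (8 * pi)) = s\<^sup>2 * complex_of_real (inv_form A w / (8 * pi * y\<^sup>2))"
      by (simp add: power_mult_distrib power_divide)
    show "gterm A t w c l s = q * F (complex_of_real (1 / y) * s)"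
      unfolding gterm_def F_def q_def[symmetric] y_def[symmetric] unfolding y(2) bil_simps inner_scaleR_right 1 2 3 by (simp add: mult_ac)
  qed
  then have "(deriv ^^ d) (gterm A t w c l) 0 = (deriv ^^ d) (\<lambda>s. q * F (complex_of_real (1 / y) * s)) 0" by simp
  also have "\<dots> = q * (deriv ^^ d) (\<lambda>s. F (complex_of_real (1 / y) * s)) 0"
    by (rule higher_deriv_cmult[where A = UNIV]) (auto intro!: holomorphic_on_compose_gen[OF _ hF, unfolded o_def] holomorphic_intros)
  also have "(deriv ^^ d) (\<lambda>s. F (complex_of_real (1 / y) * s)) 0 = complex_of_real (1 / y) ^ d * (deriv ^^ d) F 0"
    using higher_deriv_compose_linear[OF hF, of UNIV 0 "complex_of_real (1 / y)" d] by simp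
  also have "complex_of_real (1 / y) ^ d = complex_of_real (Im t powr (- (real d / 2)))"
  proof -
    have "y = Im t powr (1 / 2)" using t by (simp add: y_def powr_half_sqrt)
    then have "y ^ d = Im t powr (real d / 2)" using t y(1) by (simp add: powr_powr powr_realpow[symmetric])
    then show ?thesis by (simp add: powr_minus inverse_eq_divide power_divide flip: of_real_power)
  qed
  finally show ?thesis unfolding F_def[abs_def] q_def y_def by (simp add: mult_ac)
qed

text \<open>Here \<open>c0\<close> is the starting point of the geodesic, not the reference vector
  of the cone, and \<open>e0\<close> is the normalised initial direction.\<close>

locale lorentz_geodesic =
  fixes A :: "int^'n^'n" and c0 e0 :: "real^'n"
  assumes ev: "even_symmetric A" and sig: "has_signature (rmat A) (CARD('n) - 1) 1"
    and qc0: "qf A c0 = -1" and ce0: "bil A c0 e0 = 0" and qe0: "qf A e0 = 1"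
begin

text \<open>The geodesic, followed by its velocity; the pair is a hyperbolic rotation of (c0, e0)
  and satisfies the same relations for all t.\<close>

definition ct :: "real \<Rightarrow> real^'n" where "ct t = cosh t *\<^sub>R c0 + sinh t *\<^sub>R e0"
definition et :: "real \<Rightarrow> real^'n" where "et t = sinh t *\<^sub>R c0 + cosh t *\<^sub>R e0"

lemma ct_et: "qf A (ct t) = -1" "bil A (ct t) (et t) = 0" "qf A (et t) = 1"
proof -
  have 1: "bil A c0 c0 = -2" "bil A e0 e0 = 2" "bil A e0 c0 = 0"
    using qc0 qe0 ce0 bil_commute[OF ev] by (auto simp: qf_bil)
  have 2: "(cosh t)\<^sup>2 = (sinh t)\<^sup>2 + 1" by (rule cosh_square_eq)
  show "qf A (ct t) = -1" "bil A (ct t) (et t) = 0" "qf A (et t) = 1"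
    using 2 by (auto simp: qf_bil ct_def et_def bil_simps 1 ce0 algebra_simps power2_eq_square)
qed

lemma continuous_ct_et [continuous_intros]:
  "continuous_on S ct" "continuous_on S et"
  unfolding ct_def et_def by (intro continuous_intros)+

text \<open>The majorant is positive definite for each t; compactness of [0,T] times the unit sphere
  makes the lower bound uniform, and homogeneity extends it to all x.\<close>

lemma majorant_bound:
  assumes T: "T \<ge> 0"
  shows "\<exists>\<epsilon>>0. \<forall>t\<in>{0..T}. \<forall>x. qf A x + (bil A (ct t) x)\<^sup>2 / 2 \<ge> \<epsilon> * (norm x)\<^sup>2"
proof -
  define f where "f = (\<lambda>p. qf A (snd p) + (bil A (ct (fst p)) (snd p))\<^sup>2 / 2)"
  let ?S = "{0..T} \<times> (sphere 0 1 :: (real^'n) set)"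
  have "axis undefined 1 \<in> (sphere 0 1 :: (real^'n) set)" by (simp add: norm_axis_1)
  then have ne: "?S \<noteq> {}" using T by auto
  have cS: "compact ?S" by (intro compact_Times) auto
  have "continuous_on ?S f" unfolding f_def qf_def bil_def ct_def
    by (intro continuous_intros bounded_linear.continuous_on[OF matrix_vector_mul_bounded_linear]) auto
  then obtain p where p: "p \<in> ?S" "\<And>q. q \<in> ?S \<Longrightarrow> f p \<le> f q"
    using continuous_attains_inf[OF cS ne] by blast
  have "snd p \<noteq> 0" using p(1) by auto
  then have pos: "f p > 0" unfolding f_def using majorant_pos[OF ev sig ct_et(1)] by blast
  have "qf A x + (bil A (ct t) x)\<^sup>2 / 2 \<ge> f p * (norm x)\<^sup>2" if t: "t \<in> {0..T}" for t x
  proof (cases "x = 0")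
    case False
    define u where "u = x /\<^sub>R norm x"
    have x: "x = norm x *\<^sub>R u" using False by (simp add: u_def)
    have "(t, u) \<in> ?S" using t False by (simp add: u_def)
    then have "f p \<le> qf A u + (bil A (ct t) u)\<^sup>2 / 2" using p(2)[of "(t, u)"] by (simp add: f_def)
    then have "f p * (norm x)\<^sup>2 \<le> (qf A u + (bil A (ct t) u)\<^sup>2 / 2) * (norm x)\<^sup>2" by (rule mult_right_mono) simp
    also have "\<dots> = qf A (norm x *\<^sub>R u) + (bil A (ct t) (norm x *\<^sub>R u))\<^sup>2 / 2"
      unfolding qf_bil bil_simps by (simp add: algebra_simps power2_eq_square)
    finally show ?thesis using x by simp
  qed (simp add: qf_bil bil_def)
  then show ?thesis using pos by blast
qed

text \<open>The majorant gives quadratic decay in l uniformly in t; for bounded s and r the linear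
  terms grow at most like L |l| and the correction stays below the constant Q.\<close>

lemma eterm_bound:
  assumes T: "T \<ge> 0" and y: "Im \<tau> > 0" and \<rho>: "\<rho> \<ge> 0"
  shows "\<exists>M. M summable_on UNIV \<and> (\<forall>l. \<forall>t\<in>{0..T}. \<forall>s r. norm s \<le> \<rho> \<longrightarrow> norm r \<le> \<rho> \<longrightarrow> norm (eterm A \<tau> w (ct t) (et t) l s r) \<le> M l)"
proof -
  obtain \<epsilon> where \<epsilon>: "\<epsilon> > 0" "\<And>t x. t \<in> {0..T} \<Longrightarrow> qf A x + (bil A (ct t) x)\<^sup>2 / 2 \<ge> \<epsilon> * (norm x)\<^sup>2"
    using majorant_bound[OF T] by blast
  have "bounded (ct ` {0..T} \<union> et ` {0..T})"
    by (intro compact_imp_bounded compact_Un compact_continuous_image continuous_intros compact_Icc)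
  then obtain C where C: "C > 0" "\<And>t. t \<in> {0..T} \<Longrightarrow> norm (ct t) \<le> C" "\<And>t. t \<in> {0..T} \<Longrightarrow> norm (et t) \<le> C"
    unfolding bounded_pos by blast
  obtain K where K: "K \<ge> 0" "\<And>x. norm (rmat A *v x) \<le> norm x * K"
    using bounded_linear.nonneg_bounded[OF matrix_vector_mul_bounded_linear[of "rmat A"]] by blast
  have B: "\<bar>bil A u x\<bar> \<le> C * (K * norm x)" if "norm u \<le> C" for u x
  proof -
    have "\<bar>bil A u x\<bar> \<le> norm u * norm (rmat A *v x)" unfolding bil_def by (rule Cauchy_Schwarz_ineq2)
    also have "\<dots> \<le> C * (K * norm x)" using that K(2)[of x] C(1) by (intro mult_mono) (auto simp: mult.commute)
    finally show ?thesis .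
  qed
  have wC: "\<bar>w \<bullet> u\<bar> \<le> norm w * C" if "norm u \<le> C" for u
    using Cauchy_Schwarz_ineq2[of w u] mult_left_mono[OF that norm_ge_zero, of w] by linarith
  define L where "L = \<rho> * (norm w + norm w * C * (C * K) / 2) + \<rho> * (C * K)"
  define Q where "Q = (\<rho>\<^sup>2 * (\<bar>inv_form A w\<bar> + (norm w * C)\<^sup>2 / 2) + 2 * \<rho> * \<rho> * (norm w * C) + 2 * \<rho>\<^sup>2) / (8 * pi * Im \<tau>)"
  define M where "M l = exp Q * exp (- (2 * pi * Im \<tau> * \<epsilon>) * (norm (rvec l))\<^sup>2 + L * norm (rvec l))" for l :: "int^'n"
  have "M summable_on UNIV"
    unfolding M_def by (intro summable_on_cmult_right summable_on_gaussian) (use y \<epsilon>(1) in simp)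
  moreover have "norm (eterm A \<tau> w (ct t) (et t) l s r) \<le> M l" if t: "t \<in> {0..T}" and s: "norm s \<le> \<rho>" and r: "norm r \<le> \<rho>" for l t s r
  proof -
    define x where "x = rvec l"
    define p1 where "p1 = complex_of_real (2 * pi) * \<i> * \<tau> * complex_of_real (qf A x)"
    define p2 where "p2 = complex_of_real (pi * Im \<tau> * (bil A (ct t) x)\<^sup>2)"
    define p3 where "p3 = s * complex_of_real (w \<bullet> x + (w \<bullet> ct t) * bil A (ct t) x / 2)"
    define p4 where "p4 = r * complex_of_real (bil A (et t) x)"
    define p5 where "p5 = s\<^sup>2 * complex_of_real (inv_form A w + (w \<bullet> ct t)\<^sup>2 / 2) + 2 * s * r * complex_of_real (w \<bullet> et t) + 2 * r\<^sup>2"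
    note ctC = C(2)[OF t] and etC = C(3)[OF t]
    have e: "norm (eterm A \<tau> w (ct t) (et t) l s r) = exp (Re (p1 - p2 + p3 + p4 - p5 / complex_of_real (8 * pi * Im \<tau>)))"
      unfolding eterm_def p1_def p2_def p3_def p4_def p5_def x_def norm_exp_eq_Re ..
    have r12: "Re p1 - Re p2 = - (2 * pi * Im \<tau>) * (qf A x + (bil A (ct t) x)\<^sup>2 / 2)"
      unfolding p1_def p2_def by (simp add: algebra_simps)
    also have "\<dots> \<le> - (2 * pi * Im \<tau>) * (\<epsilon> * (norm x)\<^sup>2)" using \<epsilon>(2)[OF t, of x] y by (intro mult_left_mono_neg) auto
    finally have b12: "Re p1 - Re p2 \<le> - (2 * pi * Im \<tau> * \<epsilon>) * (norm x)\<^sup>2" by (simp add: mult_ac)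
    have "\<bar>w \<bullet> x + (w \<bullet> ct t) * bil A (ct t) x / 2\<bar> \<le> norm w * norm x + (norm w * C) * (C * (K * norm x)) / 2"
    proof -
      have "\<bar>(w \<bullet> ct t) * bil A (ct t) x\<bar> \<le> (norm w * C) * (C * (K * norm x))"
        unfolding abs_mult using wC[OF ctC] B[OF ctC] C(1) by (intro mult_mono) auto
      then show ?thesis using Cauchy_Schwarz_ineq2[of w x] by linarith
    qed
    then have "norm p3 \<le> \<rho> * (norm w * norm x + (norm w * C) * (C * (K * norm x)) / 2)"
      unfolding p3_def norm_mult norm_of_real using s \<rho> by (intro mult_mono) auto
    then have b3: "Re p3 \<le> \<rho> * (norm w + norm w * C * (C * K) / 2) * norm x"
      using complex_Re_le_cmod[of p3] by (simp add: algebra_simps)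
    have "norm p4 \<le> \<rho> * (C * (K * norm x))"
      unfolding p4_def norm_mult norm_of_real using r B[OF etC, of x] \<rho> by (intro mult_mono) auto
    then have b4: "Re p4 \<le> \<rho> * (C * K) * norm x" using complex_Re_le_cmod[of p4] by (simp add: mult_ac)
    have "norm p5 \<le> \<rho>\<^sup>2 * (\<bar>inv_form A w\<bar> + (norm w * C)\<^sup>2 / 2) + 2 * \<rho> * \<rho> * (norm w * C) + 2 * \<rho>\<^sup>2"
    proof -
      have "(w \<bullet> ct t)\<^sup>2 \<le> (norm w * C)\<^sup>2" using wC[OF ctC] by (metis abs_ge_zero power2_abs power_mono)
      then have "\<bar>inv_form A w + (w \<bullet> ct t)\<^sup>2 / 2\<bar> \<le> \<bar>inv_form A w\<bar> + (norm w * C)\<^sup>2 / 2"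
        using zero_le_power2[of "w \<bullet> ct t"] by linarith
      then have 1: "norm (s\<^sup>2 * complex_of_real (inv_form A w + (w \<bullet> ct t)\<^sup>2 / 2)) \<le> \<rho>\<^sup>2 * (\<bar>inv_form A w\<bar> + (norm w * C)\<^sup>2 / 2)"
        unfolding norm_mult norm_of_real norm_power using s by (intro mult_mono power_mono) auto
      have 2: "norm (2 * s * r * complex_of_real (w \<bullet> et t)) \<le> 2 * \<rho> * \<rho> * (norm w * C)"
        unfolding norm_mult norm_of_real using s r \<rho> wC[OF etC] by (intro mult_mono) auto
      have 3: "norm (2 * r\<^sup>2) \<le> 2 * \<rho>\<^sup>2" unfolding norm_mult norm_power using r by (intro mult_mono power_mono) auto
      show ?thesis unfolding p5_def using 1 2 3 by (intro norm_triangle_mono) auto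
    qed
    then have "norm (p5 / complex_of_real (8 * pi * Im \<tau>)) \<le> Q"
      unfolding Q_def norm_divide norm_of_real using y by (simp add: divide_right_mono)
    then have b5: "- Re (p5 / complex_of_real (8 * pi * Im \<tau>)) \<le> Q"
      using abs_Re_le_cmod[of "p5 / complex_of_real (8 * pi * Im \<tau>)"] by linarith
    have "Re (p1 - p2 + p3 + p4 - p5 / complex_of_real (8 * pi * Im \<tau>)) = (Re p1 - Re p2) + Re p3 + Re p4 + - Re (p5 / complex_of_real (8 * pi * Im \<tau>))"
      by (simp only: minus_complex.simps plus_complex.simps)
    also have "\<dots> \<le> Q + (- (2 * pi * Im \<tau> * \<epsilon>) * (norm x)\<^sup>2 + L * norm x)"
      using b12 b3 b4 b5 unfolding L_def distrib_right by linarith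
    finally show ?thesis unfolding e M_def exp_add[symmetric] x_def exp_le_cancel_iff .
  qed
  ultimately show ?thesis by blast
qed

text \<open>Cauchy's inequality on the unit circle in r transfers the bound of \<open>eterm\<close>
  to its derivative, which explains the radius \<open>max \<rho> 1\<close>.\<close>

lemma dterm_bound:
  assumes T: "T \<ge> 0" and y: "Im \<tau> > 0"
  shows "\<exists>M. M summable_on UNIV \<and> (\<forall>l. \<forall>t\<in>{0..T}. \<forall>s. norm s \<le> \<rho> \<longrightarrow> norm (dterm A \<tau> w (ct t) (et t) l s) \<le> M l)"
proof -
  have m0: "max \<rho> 1 \<ge> 0" by (simp add: le_max_iff_disj)
  obtain M where M: "M summable_on UNIV" "\<And>l t s r. t \<in> {0..T} \<Longrightarrow> norm s \<le> max \<rho> 1 \<Longrightarrow> norm r \<le> max \<rho> 1 \<Longrightarrow> norm (eterm A \<tau> w (ct t) (et t) l s r) \<le> M l"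
    using eterm_bound[OF T y m0, of w] by blast
  have "norm (dterm A \<tau> w (ct t) (et t) l s) \<le> M l" if "t \<in> {0..T}" "norm s \<le> \<rho>" for l t s
  proof -
    let ?f = "\<lambda>r. eterm A \<tau> w (ct t) (et t) l s r"
    have "norm ((deriv ^^ 1) ?f 0) \<le> fact 1 * M l / 1 ^ 1"
    proof (rule Cauchy_inequality)
      show h: "?f holomorphic_on ball 0 1" by (intro holomorphic_intros)
      show "continuous_on (cball 0 1) ?f" by (intro holomorphic_on_imp_continuous_on holomorphic_intros)
      show "norm (?f r) \<le> M l" if "norm (0 - r) = 1" for r using M(2) that \<open>t \<in> _\<close> \<open>norm s \<le> \<rho>\<close> by simp
    qed simp
    moreover have "deriv ?f 0 = dterm A \<tau> w (ct t) (et t) l s" by (rule DERIV_imp_deriv[OF DERIV_eterm[OF y]])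
    ultimately show ?thesis by simp
  qed
  then show ?thesis using M(1) by blast
qed

text \<open>The factors X and j are carried along so that one statement serves both sides of the
  transformation law.\<close>

lemma dterm_has_sum:
  assumes t: "t \<ge> 0" and y: "Im \<tau> > 0"
  shows "((\<lambda>l. X * (j * dterm A \<tau> w (ct t) (et t) l s)) has_sum deriv (\<lambda>r. \<Sum>\<^sub>\<infinity>l. X * eterm A \<tau> w (ct t) (et t) l s (j * r)) 0) UNIV"
proof -
  define \<rho> where "\<rho> = max (norm s) (norm j)"
  have \<rho>: "\<rho> \<ge> 0" "norm s \<le> \<rho>" "norm j \<le> \<rho>" by (auto simp: \<rho>_def le_max_iff_disj)
  obtain M where M: "M summable_on UNIV" "\<And>l r. norm r \<le> \<rho> \<Longrightarrow> norm (eterm A \<tau> w (ct t) (et t) l s r) \<le> M l"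
    using eterm_bound[OF t y \<rho>(1), of w] t \<rho>(2) by auto
  have "((\<lambda>l. (deriv ^^ 1) (\<lambda>r. X * eterm A \<tau> w (ct t) (et t) l s (j * r)) 0) has_sum (deriv ^^ 1) (\<lambda>r. \<Sum>\<^sub>\<infinity>l. X * eterm A \<tau> w (ct t) (et t) l s (j * r)) 0) UNIV"
  proof (rule higher_deriv_has_sum[where S = "ball 0 1" and M = "\<lambda>l. norm X * M l"])
    show "(\<lambda>r. X * eterm A \<tau> w (ct t) (et t) l s (j * r)) holomorphic_on ball 0 1" for l by (intro holomorphic_intros)
    show "(\<lambda>l. norm X * M l) summable_on UNIV" by (intro summable_on_cmult_right M(1))
    fix l and r :: complex assume "r \<in> ball 0 1"
    then have "norm (j * r) \<le> \<rho> * 1" unfolding norm_mult using \<rho> by (intro mult_mono) auto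
    then show "norm (X * eterm A \<tau> w (ct t) (et t) l s (j * r)) \<le> norm X * M l"
      unfolding norm_mult[of X] by (intro mult_left_mono M(2)) auto
  qed auto
  moreover have "deriv (\<lambda>r. X * eterm A \<tau> w (ct t) (et t) l s (j * r)) 0 = X * (j * dterm A \<tau> w (ct t) (et t) l s)" for l
  proof (rule DERIV_imp_deriv)
    have "((\<lambda>r. eterm A \<tau> w (ct t) (et t) l s (j * r)) has_field_derivative dterm A \<tau> w (ct t) (et t) l s * j) (at 0)"
      by (rule DERIV_chain2[where g = "\<lambda>r. j * r"]) (use DERIV_eterm[OF y] in \<open>auto intro!: derivative_eq_intros\<close>)
    then show "((\<lambda>r. X * eterm A \<tau> w (ct t) (et t) l s (j * r)) has_field_derivative X * (j * dterm A \<tau> w (ct t) (et t) l s)) (at 0)"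
      using DERIV_cmult[of _ "dterm A \<tau> w (ct t) (et t) l s * j" 0 UNIV X] by (simp only: mult.commute[of j])
  qed
  ultimately show ?thesis by simp
qed

text \<open>Differentiating the law of \<open>eterm\<close> in r yields a further factor j, which
  cancels the denominator of |j|/j.\<close>

lemma dterm_sum_law:
  assumes t: "t \<ge> 0" and y: "Im \<tau> > 0" and g: "\<gamma> \<in> Gamma0 (level A)"
  defines "j \<equiv> aut_factor \<gamma> \<tau>"
  shows "(\<Sum>\<^sub>\<infinity>l. dterm A (moebius_act \<gamma> \<tau>) w (ct t) (et t) l s) =
    chi A \<gamma> * j powr (of_nat CARD('n) / 2) * of_real (norm j) * (\<Sum>\<^sub>\<infinity>l. dterm A \<tau> w (ct t) (et t) l (j * s))"
proof -
  have det: "det \<gamma> = 1" using g by (simp add: Gamma0_def)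
  note im = Im_moebius[OF det y, folded j_def]
  have y': "Im (moebius_act \<gamma> \<tau>) > 0" using im y by simp
  let ?X = "chi A \<gamma> * j powr (of_nat CARD('n) / 2) * (of_real (norm j) / j)"
  have "(\<Sum>\<^sub>\<infinity>l. dterm A (moebius_act \<gamma> \<tau>) w (ct t) (et t) l s) = deriv (\<lambda>r. \<Sum>\<^sub>\<infinity>l. eterm A (moebius_act \<gamma> \<tau>) w (ct t) (et t) l s r) 0"
    using infsumI[OF dterm_has_sum[OF t y', of 1 1 w s]] by simp
  also have "(\<lambda>r. \<Sum>\<^sub>\<infinity>l. eterm A (moebius_act \<gamma> \<tau>) w (ct t) (et t) l s r) = (\<lambda>r. \<Sum>\<^sub>\<infinity>l. ?X * eterm A \<tau> w (ct t) (et t) l (j * s) (j * r))"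
    unfolding eterm_sum_law[OF ev sig ct_et g y, folded j_def] infsum_cmult_right' ..
  also have "deriv \<dots> 0 = (\<Sum>\<^sub>\<infinity>l. ?X * (j * dterm A \<tau> w (ct t) (et t) l (j * s)))"
    using infsumI[OF dterm_has_sum[OF t y, of ?X j w "j * s"]] by simp
  also have "\<dots> = ?X * (j * (\<Sum>\<^sub>\<infinity>l. dterm A \<tau> w (ct t) (et t) l (j * s)))" by (simp only: infsum_cmult_right')
  finally show ?thesis using im(1) by (simp add: mult_ac)
qed

end

section \<open>Integration along the geodesic and modularity of the difference\<close>

lemma has_sum_sum_finite:
  fixes f :: "'i \<Rightarrow> 'b \<Rightarrow> 'c::topological_comm_monoid_add"
  assumes "\<And>i. i \<in> I \<Longrightarrow> (f i has_sum s i) S"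
  shows "((\<lambda>x. \<Sum>i\<in>I. f i x) has_sum (\<Sum>i\<in>I. s i)) S"
  using assms by (induction I rule: infinite_finite_induct) (auto intro: has_sum_add has_sum_0)

context lorentz_geodesic begin

text \<open>The error function has derivative 2 exp(- pi z^2), and - pi z^2 supplies just what
  separates the exponential part of \<open>gterm\<close> from \<open>eterm\<close> at r = 0: the
  majorant term, the projection of w in the linear term, and (w.c)^2/2 in the quadratic one. The
  inner derivative is sqrt(Im tau) times the linear factor of \<open>dterm\<close>.\<close>

lemma gterm_deriv:
  assumes "Im \<tau> > 0"
  shows "((\<lambda>t. gterm A \<tau> w (ct t) l s) has_vector_derivative 2 * complex_of_real (sqrt (Im \<tau>)) * dterm A \<tau> w (ct t) (et t) l s) (at t)"
proof -
  define y where "y = sqrt (Im \<tau>)"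
  have y: "y > 0" "Im \<tau> = y\<^sup>2" using assms by (auto simp: y_def)
  define x where "x = rvec l"
  define z where "z t = complex_of_real (y * bil A (ct t) x) - s * complex_of_real ((w \<bullet> ct t) / (4 * pi * y))" for t
  define z' where "z' = complex_of_real (y * bil A (et t) x) - s * complex_of_real ((w \<bullet> et t) / (4 * pi * y))"
  define E where "E = exp (complex_of_real (w \<bullet> x) * s - s\<^sup>2 * complex_of_real (inv_form A w / (8 * pi * y\<^sup>2))) *
     exp (2 * complex_of_real pi * \<i> * \<tau> * complex_of_real (qf A x))"
  have d1: "((\<lambda>t. y * bil A (ct t) x) has_real_derivative y * bil A (et t) x) (at t)"
    unfolding ct_def et_def bil_simps by (auto intro!: derivative_eq_intros)
  have d2: "((\<lambda>t. (w \<bullet> ct t) / (4 * pi * y)) has_real_derivative (w \<bullet> et t) / (4 * pi * y)) (at t)"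
    unfolding ct_def et_def inner_add_right inner_scaleR_right divide_inverse by (auto intro!: derivative_eq_intros)
  have "(z has_vector_derivative z') (at t)"
    unfolding z_def z'_def
    by (intro has_vector_derivative_diff has_vector_derivative_mult_right has_vector_derivative_of_real d1 d2)
  from field_vector_diff_chain_at[OF this DERIV_cerr]
  have "((\<lambda>t. cerr (z t)) has_vector_derivative z' * (2 * exp (- complex_of_real pi * (z t)\<^sup>2))) (at t)" by (simp add: o_def)
  then have "((\<lambda>t. cerr (z t) * E) has_vector_derivative z' * (2 * exp (- complex_of_real pi * (z t)\<^sup>2)) * E) (at t)"
    by (rule has_vector_derivative_mult_left)
  moreover have "(\<lambda>t. cerr (z t) * E) = (\<lambda>t. gterm A \<tau> w (ct t) l s)"
    unfolding gterm_def z_def E_def x_def y_def[symmetric] unfolding y(2) by (simp add: mult.assoc)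
  moreover have "z' * (2 * exp (- complex_of_real pi * (z t)\<^sup>2)) * E = 2 * complex_of_real y * dterm A \<tau> w (ct t) (et t) l s"
  proof -
    have y0: "complex_of_real y \<noteq> 0" using y by simp
    have sq: "- p * (v * b - u * (k / (4 * p * v)))\<^sup>2 = - (p * v\<^sup>2 * b\<^sup>2) + u * (k * b / 2) - u\<^sup>2 * (k\<^sup>2 / 2) / (8 * p * v\<^sup>2)"
      if "p \<noteq> 0" "v \<noteq> 0" for p v b u k :: complex
      using that by (simp add: field_simps power2_eq_square)
    have z1: "z' = complex_of_real y * (complex_of_real (bil A (et t) x) - s * complex_of_real ((w \<bullet> et t) / (4 * pi * y\<^sup>2)))"
      unfolding z'_def using y0 by (simp add: field_simps power2_eq_square)
    have zz: "- complex_of_real pi * (z t)\<^sup>2 = - (pi * y\<^sup>2 * (bil A (ct t) x)\<^sup>2) + s * complex_of_real ((w \<bullet> ct t) * bil A (ct t) x / 2) - s\<^sup>2 * complex_of_real ((w \<bullet> ct t)\<^sup>2 / 2) / complex_of_real (8 * pi * y\<^sup>2)"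
      using sq[of "complex_of_real pi" "complex_of_real y" "complex_of_real (bil A (ct t) x)" s "complex_of_real (w \<bullet> ct t)"] y0
      by (simp add: z_def)
    have "exp (- complex_of_real pi * (z t)\<^sup>2) * E = eterm A \<tau> w (ct t) (et t) l s 0"
      unfolding E_def eterm_def exp_add[symmetric] x_def[symmetric] y(2) zz
      by (simp add: algebra_simps add_divide_distrib diff_divide_distrib)
    then show ?thesis unfolding z1 dterm_def x_def[symmetric] y(2) by (simp add: mult_ac)
  qed
  ultimately show ?thesis unfolding y_def by (simp only:)
qed

text \<open>Kept as a single term since only the difference of the end points is summable over
  l.\<close>

definition hterm :: "complex \<Rightarrow> real^'n \<Rightarrow> real \<Rightarrow> int^'n \<Rightarrow> complex \<Rightarrow> complex" where
  "hterm \<tau> w T l s = gterm A \<tau> w (ct T) l s - gterm A \<tau> w (ct 0) l s"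

lemma hterm_integral:
  assumes T: "T \<ge> 0" and y: "Im \<tau> > 0"
  shows "((\<lambda>t. 2 * complex_of_real (sqrt (Im \<tau>)) * dterm A \<tau> w (ct t) (et t) l s) has_integral hterm \<tau> w T l s) {0..T}"
  unfolding hterm_def by (rule fundamental_theorem_of_calculus[OF T]) (rule has_vector_derivative_at_within[OF gterm_deriv[OF y]])

lemma holomorphic_hterm [holomorphic_intros]:
  assumes "f holomorphic_on S"
  shows "(\<lambda>s. hterm \<tau> w T l (f s)) holomorphic_on S"
  unfolding hterm_def by (intro holomorphic_intros assms)

text \<open>As the integral of its t-derivative the difference inherits the bound of
  \<open>dterm\<close>, although its two parts grow separately where Q < 0.\<close>

lemma hterm_bound:
  assumes T: "T \<ge> 0" and y: "Im \<tau> > 0"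
  shows "\<exists>M. M summable_on UNIV \<and> (\<forall>l s. norm s \<le> \<rho> \<longrightarrow> norm (hterm \<tau> w T l s) \<le> M l)"
proof -
  obtain M where M: "M summable_on UNIV" "\<And>l t s. t \<in> {0..T} \<Longrightarrow> norm s \<le> \<rho> \<Longrightarrow> norm (dterm A \<tau> w (ct t) (et t) l s) \<le> M l"
    using dterm_bound[OF T y, of \<rho> w] by blast
  have "norm (hterm \<tau> w T l s) \<le> 2 * sqrt (Im \<tau>) * T * M l" if s: "norm s \<le> \<rho>" for l s
  proof -
    have M0: "M l \<ge> 0" using order_trans[OF norm_ge_zero M(2)[of 0 s l]] T s by simp
    have "norm (hterm \<tau> w T l s) \<le> (2 * sqrt (Im \<tau>) * M l) * measure lborel (cbox 0 T)"
    proof (rule has_integral_bound)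
      show "((\<lambda>t. 2 * complex_of_real (sqrt (Im \<tau>)) * dterm A \<tau> w (ct t) (et t) l s) has_integral hterm \<tau> w T l s) (cbox 0 T)"
        using hterm_integral[OF T y] by simp
      show "0 \<le> 2 * sqrt (Im \<tau>) * M l" using M0 y by simp
      fix t assume "t \<in> cbox 0 T"
      then have "norm (dterm A \<tau> w (ct t) (et t) l s) \<le> M l" using M(2) s by simp
      then show "norm (2 * complex_of_real (sqrt (Im \<tau>)) * dterm A \<tau> w (ct t) (et t) l s) \<le> 2 * sqrt (Im \<tau>) * M l"
        using y by (simp add: norm_mult mult_left_mono)
    qed
    then show ?thesis using T by (simp add: mult_ac)
  qed
  then show ?thesis using summable_on_cmult_right[OF M(1), of "2 * sqrt (Im \<tau>) * T"] by blast
qed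

lemma hterm_sum:
  assumes T: "T \<ge> 0" and y: "Im \<tau> > 0"
  shows "(\<Sum>\<^sub>\<infinity>l. hterm \<tau> w T l s) = integral {0..T} (\<lambda>t. 2 * complex_of_real (sqrt (Im \<tau>)) * (\<Sum>\<^sub>\<infinity>l. dterm A \<tau> w (ct t) (et t) l s))"
proof -
  obtain M where M: "M summable_on UNIV" "\<And>l t. t \<in> {0..T} \<Longrightarrow> norm (dterm A \<tau> w (ct t) (et t) l s) \<le> M l"
    using dterm_bound[OF T y, of "norm s" w] by blast
  have "(\<Sum>\<^sub>\<infinity>l. hterm \<tau> w T l s) = integral {0..T} (\<lambda>t. \<Sum>\<^sub>\<infinity>l. 2 * complex_of_real (sqrt (Im \<tau>)) * dterm A \<tau> w (ct t) (et t) l s)"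
  proof (rule infsum_integral_interchange)
    show "continuous_on {0..T} (\<lambda>t. 2 * complex_of_real (sqrt (Im \<tau>)) * dterm A \<tau> w (ct t) (et t) l s)" for l
      unfolding dterm_def eterm_def ct_def et_def bil_simps inner_add_right inner_scaleR_right divide_inverse
      by (intro continuous_intros)
    show "(\<lambda>l. 2 * sqrt (Im \<tau>) * M l) summable_on UNIV" by (intro summable_on_cmult_right M(1))
    show "norm (2 * complex_of_real (sqrt (Im \<tau>)) * dterm A \<tau> w (ct t) (et t) l s) \<le> 2 * sqrt (Im \<tau>) * M l" if "t \<in> {0..T}" for l t
      using y M(2)[OF that] by (simp add: norm_mult mult_left_mono)
  qed (rule hterm_integral[OF T y])
  then show ?thesis by (simp only: infsum_cmult_right')
qed

text \<open>The factor |j| left by the law of \<open>dterm\<close> is consumed by sqrt(Im(gamma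
  tau)) |j| = sqrt(Im tau).\<close>

lemma hterm_sum_law:
  assumes T: "T \<ge> 0" and y: "Im \<tau> > 0" and g: "\<gamma> \<in> Gamma0 (level A)"
  defines "j \<equiv> aut_factor \<gamma> \<tau>"
  shows "(\<Sum>\<^sub>\<infinity>l. hterm (moebius_act \<gamma> \<tau>) w T l s) = chi A \<gamma> * j powr (of_nat CARD('n) / 2) * (\<Sum>\<^sub>\<infinity>l. hterm \<tau> w T l (j * s))"
proof -
  have det: "det \<gamma> = 1" using g by (simp add: Gamma0_def)
  note im = Im_moebius[OF det y, folded j_def]
  have y': "Im (moebius_act \<gamma> \<tau>) > 0" using im y by simp
  let ?X = "chi A \<gamma> * j powr (of_nat CARD('n) / 2)"
  have sq: "sqrt (Im (moebius_act \<gamma> \<tau>)) * norm j = sqrt (Im \<tau>)" unfolding im(2) using im(1) by (simp add: real_sqrt_divide)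
  have "2 * complex_of_real (sqrt (Im (moebius_act \<gamma> \<tau>))) * (\<Sum>\<^sub>\<infinity>l. dterm A (moebius_act \<gamma> \<tau>) w (ct t) (et t) l s) =
      ?X * (2 * complex_of_real (sqrt (Im \<tau>)) * (\<Sum>\<^sub>\<infinity>l. dterm A \<tau> w (ct t) (et t) l (j * s)))" if "t \<in> {0..T}" for t
  proof -
    have t: "t \<ge> 0" using that by simp
    show ?thesis unfolding dterm_sum_law[OF t y g, folded j_def] sq[symmetric] by (simp add: mult_ac)
  qed
  then have "(\<Sum>\<^sub>\<infinity>l. hterm (moebius_act \<gamma> \<tau>) w T l s) = integral {0..T} (\<lambda>t. ?X * (2 * complex_of_real (sqrt (Im \<tau>)) * (\<Sum>\<^sub>\<infinity>l. dterm A \<tau> w (ct t) (et t) l (j * s))))"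
    unfolding hterm_sum[OF T y'] by (intro integral_cong) auto
  also have "\<dots> = ?X * (\<Sum>\<^sub>\<infinity>l. hterm \<tau> w T l (j * s))" unfolding hterm_sum[OF T y] by (rule integral_mult_right)
  finally show ?thesis .
qed

lemma hterm_higher_deriv_has_sum:
  assumes T: "T \<ge> 0" and y: "Im \<tau> > 0"
  shows "((\<lambda>l. X * (j ^ d * (deriv ^^ d) (hterm \<tau> w T l) 0)) has_sum (deriv ^^ d) (\<lambda>s. \<Sum>\<^sub>\<infinity>l. X * hterm \<tau> w T l (j * s)) 0) UNIV"
proof -
  obtain M where M: "M summable_on UNIV" "\<And>l s. norm s \<le> norm j \<Longrightarrow> norm (hterm \<tau> w T l s) \<le> M l"
    using hterm_bound[OF T y, of "norm j" w] by blast
  have "((\<lambda>l. (deriv ^^ d) (\<lambda>s. X * hterm \<tau> w T l (j * s)) 0) has_sum (deriv ^^ d) (\<lambda>s. \<Sum>\<^sub>\<infinity>l. X * hterm \<tau> w T l (j * s)) 0) UNIV"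
  proof (rule higher_deriv_has_sum[where S = "ball 0 1" and M = "\<lambda>l. norm X * M l"])
    show "(\<lambda>s. X * hterm \<tau> w T l (j * s)) holomorphic_on ball 0 1" for l by (intro holomorphic_intros)
    show "(\<lambda>l. norm X * M l) summable_on UNIV" by (intro summable_on_cmult_right M(1))
    fix l and s :: complex assume "s \<in> ball 0 1"
    then have "norm (j * s) \<le> norm j" unfolding norm_mult by (intro mult_left_le) auto
    then show "norm (X * hterm \<tau> w T l (j * s)) \<le> norm X * M l" unfolding norm_mult[of X] by (intro mult_left_mono M(2)) auto
  qed auto
  moreover have "(deriv ^^ d) (\<lambda>s. X * hterm \<tau> w T l (j * s)) 0 = X * (j ^ d * (deriv ^^ d) (hterm \<tau> w T l) 0)" for l
  proof -
    have h: "hterm \<tau> w T l holomorphic_on UNIV" using holomorphic_hterm[OF holomorphic_on_ident] by simp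
    have "(deriv ^^ d) (\<lambda>s. X * hterm \<tau> w T l (j * s)) 0 = X * (deriv ^^ d) (\<lambda>s. hterm \<tau> w T l (j * s)) 0"
      by (rule higher_deriv_cmult[where A = UNIV]) (auto intro!: holomorphic_intros)
    then show ?thesis using higher_deriv_compose_linear[OF h, of UNIV 0 j d] by simp
  qed
  ultimately show ?thesis by simp
qed

text \<open>The law turns s into j s, so the d-th derivative at 0 acquires j^d; this is the whole
  contribution of the degree to the weight.\<close>

lemma hterm_higher_deriv_law:
  assumes T: "T \<ge> 0" and y: "Im \<tau> > 0" and g: "\<gamma> \<in> Gamma0 (level A)"
  defines "j \<equiv> aut_factor \<gamma> \<tau>"
  shows "(\<Sum>\<^sub>\<infinity>l. (deriv ^^ d) (hterm (moebius_act \<gamma> \<tau>) w T l) 0) =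
    chi A \<gamma> * j powr (of_nat CARD('n) / 2 + of_nat d) * (\<Sum>\<^sub>\<infinity>l. (deriv ^^ d) (hterm \<tau> w T l) 0)"
proof -
  have det: "det \<gamma> = 1" using g by (simp add: Gamma0_def)
  note im = Im_moebius[OF det y, folded j_def]
  have y': "Im (moebius_act \<gamma> \<tau>) > 0" using im y by simp
  let ?X = "chi A \<gamma> * j powr (of_nat CARD('n) / 2)"
  have "(\<Sum>\<^sub>\<infinity>l. (deriv ^^ d) (hterm (moebius_act \<gamma> \<tau>) w T l) 0) = (deriv ^^ d) (\<lambda>s. \<Sum>\<^sub>\<infinity>l. hterm (moebius_act \<gamma> \<tau>) w T l s) 0"
    using infsumI[OF hterm_higher_deriv_has_sum[OF T y', of 1 1 d w]] by simp
  also have "(\<lambda>s. \<Sum>\<^sub>\<infinity>l. hterm (moebius_act \<gamma> \<tau>) w T l s) = (\<lambda>s. \<Sum>\<^sub>\<infinity>l. ?X * hterm \<tau> w T l (j * s))"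
    unfolding hterm_sum_law[OF T y g, folded j_def] infsum_cmult_right' ..
  also have "(deriv ^^ d) \<dots> 0 = (\<Sum>\<^sub>\<infinity>l. ?X * (j ^ d * (deriv ^^ d) (hterm \<tau> w T l) 0))"
    using infsumI[OF hterm_higher_deriv_has_sum[OF T y, of ?X j d w]] by simp
  also have "\<dots> = ?X * (j ^ d * (\<Sum>\<^sub>\<infinity>l. (deriv ^^ d) (hterm \<tau> w T l) 0))" by (simp only: infsum_cmult_right')
  also have "\<dots> = chi A \<gamma> * j powr (of_nat CARD('n) / 2 + of_nat d) * (\<Sum>\<^sub>\<infinity>l. (deriv ^^ d) (hterm \<tau> w T l) 0)"
    using im(1) by (simp add: powr_add powr_nat mult_ac)
  finally show ?thesis .
qed

text \<open>The minus sign appears because the theta function takes start minus end point, while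
  \<open>hterm\<close> takes end minus start.\<close>

lemma theta_geodesic:
  assumes T: "T \<ge> 0" and y: "Im \<tau> > 0" and I: "finite (I :: nat set)"
  shows "theta A d (ct 0) (ct T) (\<lambda>v. \<Sum>i\<in>I. a i * complex_of_real (w i \<bullet> v) ^ d) \<tau> =
    - (\<Sum>i\<in>I. a i * (\<Sum>\<^sub>\<infinity>l. (deriv ^^ d) (hterm \<tau> (w i) T l) 0))"
proof -
  let ?f = "\<lambda>v. \<Sum>i\<in>I. a i * complex_of_real (w i \<bullet> v) ^ d"
  let ?Y = "complex_of_real (Im \<tau> powr (- (real d / 2)))"
  let ?q = "\<lambda>l. exp (2 * complex_of_real pi * \<i> * \<tau> * complex_of_real (qf A (rvec l)))"
  have p: "?Y * (p_fun A d c ?f (sqrt (Im \<tau>) *\<^sub>R rvec l) * ?q l) = (\<Sum>i\<in>I. a i * (deriv ^^ d) (gterm A \<tau> (w i) c l) 0)" for c l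
    unfolding p_fun_generating[OF I] gterm_higher_deriv[OF y, symmetric] sum_distrib_left sum_distrib_right
    by (intro sum.cong refl) (simp only: mult_ac)
  have h: "(deriv ^^ d) (hterm \<tau> u T l) 0 = (deriv ^^ d) (gterm A \<tau> u (ct T) l) 0 - (deriv ^^ d) (gterm A \<tau> u (ct 0) l) 0" for u l
  proof -
    have "gterm A \<tau> u c l holomorphic_on UNIV" for c by (rule holomorphic_gterm[OF holomorphic_on_ident])
    then show ?thesis unfolding hterm_def[abs_def] by (intro higher_deriv_diff[where S = UNIV]) auto
  qed
  have hs: "((\<lambda>l. (deriv ^^ d) (hterm \<tau> u T l) 0) has_sum (\<Sum>\<^sub>\<infinity>l. (deriv ^^ d) (hterm \<tau> u T l) 0)) UNIV" for u
    using has_sum_imp_summable[OF hterm_higher_deriv_has_sum[OF T y, of 1 1 d u]] by (intro has_sum_infsum) simp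
  have "?Y * ((p_fun A d (ct 0) ?f (sqrt (Im \<tau>) *\<^sub>R rvec l) - p_fun A d (ct T) ?f (sqrt (Im \<tau>) *\<^sub>R rvec l)) * ?q l) =
     - (\<Sum>i\<in>I. a i * (deriv ^^ d) (hterm \<tau> (w i) T l) 0)" for l
    unfolding left_diff_distrib right_diff_distrib[of ?Y] p h by (simp add: right_diff_distrib sum_subtractf)
  then have "theta A d (ct 0) (ct T) ?f \<tau> = (\<Sum>\<^sub>\<infinity>l. - (\<Sum>i\<in>I. a i * (deriv ^^ d) (hterm \<tau> (w i) T l) 0))"
    unfolding theta_def infsum_cmult_right'[symmetric] by simp
  also have "\<dots> = - (\<Sum>i\<in>I. a i * (\<Sum>\<^sub>\<infinity>l. (deriv ^^ d) (hterm \<tau> (w i) T l) 0))"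
  proof (rule infsumI)
    show "((\<lambda>l. - (\<Sum>i\<in>I. a i * (deriv ^^ d) (hterm \<tau> (w i) T l) 0)) has_sum - (\<Sum>i\<in>I. a i * (\<Sum>\<^sub>\<infinity>l. (deriv ^^ d) (hterm \<tau> (w i) T l) 0))) UNIV"
      unfolding has_sum_uminus minus_minus by (intro has_sum_sum_finite has_sum_cmult_right hs)
  qed
  finally show ?thesis .
qed

end

text \<open>-B(c1,c2)/2 is to be cosh T. It is at least 1 on one sheet, and equality would make the
  majorant of c1 vanish at c1 - c2. The direction e is the component of c2 orthogonal to c1, scaled
  to Q(e) = 1.\<close>

lemma geodesic_exists:
  fixes A :: "int^'n^'n"
  assumes ev: "even_symmetric A" and sig: "has_signature (rmat A) (CARD('n) - 1) 1" and c0: "qf A c0 < 0"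
    and c1: "c1 \<in> cone_sheet A c0" and c2: "c2 \<in> cone_sheet A c0" and ne: "c1 \<noteq> c2"
  shows "\<exists>T e. T \<ge> 0 \<and> lorentz_geodesic A c1 e \<and> c2 = cosh T *\<^sub>R c1 + sinh T *\<^sub>R e"
proof -
  have q: "qf A c1 = -1" "qf A c2 = -1" using c1 c2 by (auto simp: cone_sheet_def)
  have b: "bil A c1 c1 = -2" "bil A c2 c2 = -2" using q by (auto simp: qf_bil)
  define k where "k = - bil A c1 c2 / 2"
  have bk: "bil A c1 c2 = - 2 * k" "bil A c2 c1 = - 2 * k" using bil_commute[OF ev] by (auto simp: k_def)
  have "k \<ge> 1" using cone_sheet_bil[OF ev sig c0 c1 c2] by (simp add: k_def)
  moreover have "k \<noteq> 1"
  proof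
    assume "k = 1"
    then have "qf A (c1 - c2) + (bil A c1 (c1 - c2))\<^sup>2 / 2 = 0" by (simp add: qf_bil bil_simps b bk)
    then show False using majorant_pos[OF ev sig q(1), of "c1 - c2"] ne by simp
  qed
  ultimately have k: "k > 1" by simp
  define T where "T = arcosh k"
  have ch: "cosh T = k" using k by (simp add: T_def cosh_arcosh_real)
  have T: "T > 0" using k arcosh_real_strict_mono[of 1 k] by (simp add: T_def)
  then have sh: "sinh T > 0" by simp
  define e where "e = (c2 - k *\<^sub>R c1) /\<^sub>R sinh T"
  have s2: "(sinh T)\<^sup>2 = k\<^sup>2 - 1" using cosh_square_eq[of T] ch by simp
  have "bil A c1 e = 0" unfolding e_def bil_simps b bk by simp
  moreover have "qf A e = 1"
  proof -
    have "bil A (c2 - k *\<^sub>R c1) (c2 - k *\<^sub>R c1) = 2 * (sinh T)\<^sup>2"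
      unfolding s2 by (simp add: bil_simps b bk algebra_simps power2_eq_square)
    then show ?thesis unfolding qf_bil e_def bil_scale_left bil_scale_right using sh by (simp add: field_simps power2_eq_square)
  qed
  ultimately have "lorentz_geodesic A c1 e" using ev sig q by unfold_locales auto
  moreover have "c2 = cosh T *\<^sub>R c1 + sinh T *\<^sub>R e" using sh by (simp add: e_def ch)
  ultimately show ?thesis using T by (intro exI[of _ T] exI[of _ e]) auto
qed

theorem theorem1:
  fixes A :: "int^'n^'n" and f :: "real^'n \<Rightarrow> complex" and d :: nat
    and c0 c1 c2 :: "real^'n" and \<gamma> :: "int^2^2" and \<tau> :: complex
  assumes "even_symmetric A"
    and "has_signature (rmat A) (CARD('n) - 1) 1"
    and "homogeneous_polynomial d f"
    and "qf A c0 < 0"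
    and "c1 \<in> cone_sheet A c0" and "c2 \<in> cone_sheet A c0"
    and "\<gamma> \<in> Gamma0 (level A)"
    and "Im \<tau> > 0"
  shows "theta A d c1 c2 f (moebius_act \<gamma> \<tau>) =
    chi A \<gamma> * aut_factor \<gamma> \<tau> powr (of_nat CARD('n) / 2 + of_nat d) * theta A d c1 c2 f \<tau>"
proof (cases "c1 = c2")
  \<comment> \<open>Equal end points determine no direction, but the theta function is then 0 term
    by term.\<close>
  case True
  then show ?thesis by (simp add: theta_def)
next
  case False
  obtain T e where T: "T \<ge> 0" and G: "lorentz_geodesic A c1 e" and c2: "c2 = cosh T *\<^sub>R c1 + sinh T *\<^sub>R e"
    using geodesic_exists[OF assms(1,2,4-6) False] by blast
  interpret lorentz_geodesic A c1 e by (rule G)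
  have ct: "ct 0 = c1" "ct T = c2" by (simp_all add: ct_def c2)
  obtain xs :: "(complex \<times> (real^'n)) list" where xs: "f = (\<lambda>v. \<Sum>(a, w)\<leftarrow>xs. a * complex_of_real (w \<bullet> v) ^ d)"
    using homogeneous_polynomial_power_form[OF assms(3)] unfolding power_form_def by blast
  define I where "I = {0..<length xs}"
  define a where "a i = fst (xs ! i)" for i
  define w where "w i = snd (xs ! i)" for i
  have f: "f = (\<lambda>v. \<Sum>i\<in>I. a i * complex_of_real (w i \<bullet> v) ^ d)"
    unfolding xs sum_list_sum_nth I_def a_def w_def by (simp add: case_prod_beta)
  have I: "finite I" by (simp add: I_def)
  have y': "Im (moebius_act \<gamma> \<tau>) > 0" using Im_moebius[of \<gamma> \<tau>] assms(7,8) by (simp add: Gamma0_def)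
  have "theta A d c1 c2 f z = - (\<Sum>i\<in>I. a i * (\<Sum>\<^sub>\<infinity>l. (deriv ^^ d) (hterm z (w i) T l) 0))" if "Im z > 0" for z
    using theta_geodesic[OF T that I, of d a w] unfolding ct f[symmetric] .
  then show ?thesis using y' assms(8)
    by (simp add: hterm_higher_deriv_law[OF T assms(8,7)] sum_distrib_left mult_ac)
qed

end
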